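(* Let $X$ be a Banach space with $\dim X<\infty$, let $p\in\{0\}\cup[1,\infty]$, and let $A$ be a band-dominated operator on $l^p(\mathbb{Z},X)$. Then the following are equivalent: (i) $A$ is Fredholm. (ii) All limit operators of $A$ are invertible. (iii) All limit operators of $A$ are invertible from the left. (iv) All limit operators of $A$ are invertible from the right. (v) All limit operators of $A$ are bounded below. (vi) All limit operators of $A$ are surjective. Moreover, in this case $$\sup\{\|A_g^{-1}\|:A_g\in\sigma_{\mathrm{op}}(A)\}=\bigl(\inf\{j(A_g):A_g\in\sigma_{\mathrm{op}}(A)\}\bigr)^{-1}<\infty .$$
   Context: For a Banach space $X$ and $1\le p<\infty$, $l^p(\mathbb{Z},X)$ is the Banach space of all $x=(x_n)_{n\in\mathbb{Z}}$ with $x_n\in X$ and $\|x\|_p^p:=\sum_n\|x_n\|_X^p<\infty$; $l^\infty(\mathbb{Z},X)$ is the space of bounded sequences with norm $\|x\|_\infty:=\sup_n\|x_n\|_X$; and $l^0(\mathbb{Z},X)\subset l^\infty(\mathbb{Z},X)$ is the closed subspace (with the sup norm) of all sequences with $\|x_n\|_X\to0$ as $|n|\to\infty$. Write $\mathbf{X}=l^p(\mathbb{Z},X)$ and let $\mathcal{L}(\mathbf{X})$ be the algebra of bounded linear operators on $\mathbf{X}$. Each $a=(a_n)\in l^\infty(\mathbb{Z},\mathcal{L}(X))$ defines a multiplication operator $aI:(x_n)\mapsto(a_nx_n)$, and for $k\in\mathbb{Z}$ the shift $V_k$ is $V_k(x_n):=(x_{n-k})$. A band operator is a finite sum $\sum_\alpha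 a_\alpha V_\alpha$ with $a_\alpha\in l^\infty(\mathbb{Z},\mathcal{L}(X))$; a band-dominated operator is an element of the operator-norm closure in $\mathcal{L}(\mathbf{X})$ of the set of band operators. Let $P_n$ be the operator of multiplication by the characteristic function of $\{-n,\ldots,n\}$, and $Q_n:=I-P_n$. An operator $K\in\mathcal{L}(\mathbf{X})$ is $\mathcal{P}$-compact if $\|KQ_n\|+\|Q_nK\|\to0$ as $n\to\infty$; $\mathcal{K}(\mathbf{X},\mathcal{P})$ is the set of $\mathcal{P}$-compact operators, and $\mathcal{L}(\mathbf{X},\mathcal{P}):=\{B\in\mathcal{L}(\mathbf{X}): BK,KB\in\mathcal{K}(\mathbf{X},\mathcal{P})\text{ for all }K\in\mathcal{K}(\mathbf{X},\mathcal{P})\}$. All band-dominated operators belong to $\mathcal{L}(\mathbf{X},\mathcal{P})$. A bounded sequence $(B_n)\subset\mathcal{L}(\mathbf{X},\mathcal{P})$ converges $\mathcal{P}$-strongly to $B\in\mathcal{L}(\mathbf{X},\mathcal{P})$ if for every $m$, $\|P_m(B_n-B)\|+\|(B_n-B)P_m\|\to0$ as $n\to\infty$. For a sequence $h=(h_n)\subset\mathbb{Z}$ with $|h_n|\to\infty$, the limit operator $A_h$ of $A$ with respect to $h$ is the $\mathcal{P}$-strong limit of $V_{-h_n}AV_{h_n}$ as $n\to\infty$, if it exists. The operator spectrum $\sigma_{\mathrm{op}}(A)$ is the set of all limit operators of $A$. $A$ is Fredholm if its range is closed and $\dim\ker A<\infty$, $\dim\operatorname{coker}A<\infty$. For $B\in\mathcal{L}(\mathbf{X})$,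 $j(B):=\inf\{\|Bx\|:x\in\mathbf{X},\|x\|=1\}$ is its lower norm, and $B$ is bounded below if $j(B)>0$. Invertibility (also one-sided) is meant in $\mathcal{L}(\mathbf{X})$. *)

theory Defs
  imports "HOL-Analysis.Analysis" "HOL-Library.Function_Algebras"
begin

text \<open>
  A type of class \<open>{real_normed_field, euclidean_space}\<close> is, up to isometric isomorphism, the
  real or the complex field; \<open>normed_scale\<close> makes the normed space \<open>'a\<close> a normed space over it.
  For real spaces take \<open>smul = scaleR\<close>.
\<close>

locale normed_scale = vector_space smul
  for smul :: "'k::{real_normed_field, euclidean_space} \<Rightarrow> 'a::real_normed_vector \<Rightarrow> 'a" +
  assumes norm_smul: "norm (smul c x) = norm c * norm x"
    and smul_of_real: "smul (of_real r) x = r *\<^sub>R x"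

definition fin_dim :: "('k::field \<Rightarrow> 'b::ab_group_add \<Rightarrow> 'b) \<Rightarrow> 'b set \<Rightarrow> bool" where
  "fin_dim s S \<longleftrightarrow> (\<exists>B. finite B \<and> module.span s B = S)"

definition seq_scale :: "('k \<Rightarrow> 'a \<Rightarrow> 'a) \<Rightarrow> 'k \<Rightarrow> (int \<Rightarrow> 'a) \<Rightarrow> (int \<Rightarrow> 'a)" where
  "seq_scale smul c x = (\<lambda>n. smul c (x n))"

text \<open>
  The exponent ranges over \<open>{0} \<union> [1, \<infinity>]\<close>, with \<open>0\<close> denoting the null sequences under the
  supremum norm.
\<close>

definition lp :: "ennreal \<Rightarrow> (int \<Rightarrow> 'a::real_normed_vector) set" where
  "lp p = (if p = 0 then {x. bounded (range x) \<and> (x \<longlongrightarrow> 0) (filtercomap abs at_top)}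
     else if p = \<infinity> then {x. bounded (range x)}
     else {x. (\<lambda>n. norm (x n) powr enn2real p) summable_on UNIV})"

definition lp_norm :: "ennreal \<Rightarrow> (int \<Rightarrow> 'a::real_normed_vector) \<Rightarrow> real" where
  "lp_norm p x = (if p = 0 \<or> p = \<infinity> then (SUP n. norm (x n))
     else (\<Sum>\<^sub>\<infinity>n. norm (x n) powr enn2real p) powr (1 / enn2real p))"

text \<open>
  The library's metric spaces want a nonnegative symmetric distance also off the carrier, where
  \<open>lp_norm\<close> has no meaning.
\<close>

definition lp_dist ::
  "ennreal \<Rightarrow> (int \<Rightarrow> 'a::real_normed_vector) \<Rightarrow> (int \<Rightarrow> 'a) \<Rightarrow> real" where
  "lp_dist p x y = (if x \<in> lp p \<and> y \<in> lp p then lp_norm p (x - y) else 0)"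

type_synonym 'a seq_op = "(int \<Rightarrow> 'a) \<Rightarrow> (int \<Rightarrow> 'a)"

text \<open>
  Operators are functions on all sequences; only their values on \<open>lp p\<close> matter, and every notion
  below depends on these values alone. Operator norms, lower norms and their suprema and infima
  are taken in \<open>ennreal\<close>, so that they always exist, with \<open>Inf {} = \<infinity>\<close>.
\<close>

definition op_norm :: "ennreal \<Rightarrow> 'a::real_normed_vector seq_op \<Rightarrow> ennreal" where
  "op_norm p T = (SUP x\<in>{x \<in> lp p. lp_norm p x \<le> 1}. ennreal (lp_norm p (T x)))"

definition lower_norm :: "ennreal \<Rightarrow> 'a::real_normed_vector seq_op \<Rightarrow> ennreal" where
  "lower_norm p T = (INF x\<in>{x \<in> lp p. lp_norm p x = 1}. ennreal (lp_norm p (T x)))"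

definition bounded_ops ::
  "('k \<Rightarrow> 'a::real_normed_vector \<Rightarrow> 'a) \<Rightarrow> ennreal \<Rightarrow> 'a seq_op set" where
  "bounded_ops smul p = {T. T ` lp p \<subseteq> lp p
     \<and> (\<forall>x\<in>lp p. \<forall>y\<in>lp p. T (x + y) = T x + T y)
     \<and> (\<forall>c. \<forall>x\<in>lp p. T (seq_scale smul c x) = seq_scale smul c (T x))
     \<and> op_norm p T < \<infinity>}"

definition mult_op :: "(int \<Rightarrow> 'a \<Rightarrow>\<^sub>L 'a) \<Rightarrow> 'a::real_normed_vector seq_op" where
  "mult_op a x = (\<lambda>n. blinfun_apply (a n) (x n))"

definition shift :: "int \<Rightarrow> 'a seq_op" where
  "shift k x = (\<lambda>n. x (n - k))"

text \<open>
  The bounded operators on \<open>'a\<close> are the \<open>smul\<close>-linear elements of \<open>'a \<Rightarrow>\<^sub>L 'a\<close>, which by itself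
  consists of the real-linear ones.
\<close>

definition band_op ::
  "('k::field \<Rightarrow> 'a::real_normed_vector \<Rightarrow> 'a) \<Rightarrow> ennreal \<Rightarrow> 'a seq_op \<Rightarrow> bool" where
  "band_op smul p T \<longleftrightarrow> (\<exists>(F :: int set) (a :: int \<Rightarrow> int \<Rightarrow> 'a \<Rightarrow>\<^sub>L 'a). finite F
     \<and> (\<forall>\<alpha>\<in>F. a \<alpha> \<in> lp \<infinity> \<and> (\<forall>n. Vector_Spaces.linear smul smul (blinfun_apply (a \<alpha> n))))
     \<and> (\<forall>x\<in>lp p. T x = (\<Sum>\<alpha>\<in>F. mult_op (a \<alpha>) (shift \<alpha> x))))"

definition band_dominated ::
  "('k::field \<Rightarrow> 'a::real_normed_vector \<Rightarrow> 'a) \<Rightarrow> ennreal \<Rightarrow> 'a seq_op \<Rightarrow> bool" where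
  "band_dominated smul p T \<longleftrightarrow> T \<in> bounded_ops smul p
     \<and> (\<forall>\<epsilon>>0. \<exists>B. band_op smul p B \<and> op_norm p (T - B) < \<epsilon>)"

definition trunc_P :: "nat \<Rightarrow> 'a::zero seq_op" where
  "trunc_P n x = (\<lambda>k. if k \<in> {- int n..int n} then x k else 0)"

definition trunc_Q :: "nat \<Rightarrow> 'a::ab_group_add seq_op" where
  "trunc_Q n = id - trunc_P n"

definition P_compact_ops ::
  "('k \<Rightarrow> 'a::real_normed_vector \<Rightarrow> 'a) \<Rightarrow> ennreal \<Rightarrow> 'a seq_op set" where
  "P_compact_ops smul p = {K \<in> bounded_ops smul p.
     (\<lambda>n. op_norm p (K \<circ> trunc_Q n) + op_norm p (trunc_Q n \<circ> K)) \<longlonglongrightarrow> 0}"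

definition LP_ops ::
  "('k \<Rightarrow> 'a::real_normed_vector \<Rightarrow> 'a) \<Rightarrow> ennreal \<Rightarrow> 'a seq_op set" where
  "LP_ops smul p = {B \<in> bounded_ops smul p. \<forall>K\<in>P_compact_ops smul p.
     B \<circ> K \<in> P_compact_ops smul p \<and> K \<circ> B \<in> P_compact_ops smul p}"

definition P_strong_limit ::
  "('k \<Rightarrow> 'a::real_normed_vector \<Rightarrow> 'a) \<Rightarrow> ennreal \<Rightarrow> (nat \<Rightarrow> 'a seq_op) \<Rightarrow> 'a seq_op \<Rightarrow> bool" where
  "P_strong_limit smul p Bs B \<longleftrightarrow>
     range Bs \<subseteq> LP_ops smul p \<and> (SUP n. op_norm p (Bs n)) < \<infinity> \<and> B \<in> LP_ops smul p
     \<and> (\<forall>m. (\<lambda>n. op_norm p (trunc_P m \<circ> (Bs n - B)) + op_norm p ((Bs n - B) \<circ> trunc_P m))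
           \<longlonglongrightarrow> 0)"

definition limit_op ::
  "('k \<Rightarrow> 'a::real_normed_vector \<Rightarrow> 'a) \<Rightarrow> ennreal \<Rightarrow> 'a seq_op \<Rightarrow> (nat \<Rightarrow> int) \<Rightarrow> 'a seq_op \<Rightarrow> bool"
where
  "limit_op smul p A h B \<longleftrightarrow> filterlim (\<lambda>n. \<bar>h n\<bar>) at_top sequentially
     \<and> P_strong_limit smul p (\<lambda>n. shift (- h n) \<circ> A \<circ> shift (h n)) B"

definition op_spectrum ::
  "('k \<Rightarrow> 'a::real_normed_vector \<Rightarrow> 'a) \<Rightarrow> ennreal \<Rightarrow> 'a seq_op \<Rightarrow> 'a seq_op set" where
  "op_spectrum smul p A = {B. \<exists>h. limit_op smul p A h B}"

text \<open>
  The cokernel \<open>lp p / range\<close> is finite-dimensional iff it is spanned by the cosets of finitely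
  many elements \<open>F\<close>.
\<close>

definition fredholm ::
  "('k::field \<Rightarrow> 'a::real_normed_vector \<Rightarrow> 'a) \<Rightarrow> ennreal \<Rightarrow> 'a seq_op \<Rightarrow> bool" where
  "fredholm smul p A \<longleftrightarrow>
     closedin (Metric_space.mtopology (lp p) (lp_dist p)) (A ` lp p)
     \<and> fin_dim (seq_scale smul) {x \<in> lp p. A x = 0}
     \<and> (\<exists>F. finite F \<and> F \<subseteq> lp p
          \<and> (\<forall>y\<in>lp p. \<exists>z\<in>module.span (seq_scale smul) F. y - z \<in> A ` lp p))"

definition left_invertible ::
  "('k \<Rightarrow> 'a::real_normed_vector \<Rightarrow> 'a) \<Rightarrow> ennreal \<Rightarrow> 'a seq_op \<Rightarrow> bool" where
  "left_invertible smul p B \<longleftrightarrow> (\<exists>C\<in>bounded_ops smul p. \<forall>x\<in>lp p. C (B x) = x)"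

definition right_invertible ::
  "('k \<Rightarrow> 'a::real_normed_vector \<Rightarrow> 'a) \<Rightarrow> ennreal \<Rightarrow> 'a seq_op \<Rightarrow> bool" where
  "right_invertible smul p B \<longleftrightarrow> (\<exists>C\<in>bounded_ops smul p. \<forall>x\<in>lp p. B (C x) = x)"

definition op_invertible ::
  "('k \<Rightarrow> 'a::real_normed_vector \<Rightarrow> 'a) \<Rightarrow> ennreal \<Rightarrow> 'a seq_op \<Rightarrow> bool" where
  "op_invertible smul p B \<longleftrightarrow>
     (\<exists>C\<in>bounded_ops smul p. \<forall>x\<in>lp p. C (B x) = x \<and> B (C x) = x)"

definition bounded_below :: "ennreal \<Rightarrow> 'a::real_normed_vector seq_op \<Rightarrow> bool" where
  "bounded_below p B \<longleftrightarrow> lower_norm p B > 0"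

end

theory Submission
  imports Defs "HOL-Library.Diagonal_Subsequence"
begin

text \<open>
  The operator \<open>A\<close> is Fredholm iff it is bounded below on sequences vanishing on a large window and
  uniformly solvable on finite windows far out. Both conditions follow from the corresponding
  pointwise properties of the limit operators. If \<open>A\<close> had ever worse test vectors far out,
  then cutting each of them to a window of prescribed size, then this window to a smaller one, and
  so on, costs little at each scale; a limit operator along the centres of the innermost windows has
  bad test vectors at every scale and is not bounded below. Solvability on windows is treated in the
  same way, with local solutions pasted together in place of test vectors being cutoff.

  Conversely, a lower bound at infinity passes to the limit operators. In one dimension it even makes
  them surjective: a band operator close to \<open>A\<close> maps finite sections injectively into sections whose
  dimension is larger by a bounded number, so among sufficiently many far-apart translates of \<open>y\<close> some
  combination lies in the range, and localizing the preimage near one translate solves \<open>B x = y\<close>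
  approximately. Dually, solvability at infinity makes the limit operators injective.
\<close>

section \<open>Sequence spaces\<close>

text \<open>Lower bounds and solvability are dual to each other, but no adjoint is used: the dual of
  \<open>lp \<infinity>\<close> leaves the scale of spaces, so both halves are proved directly, for
  all exponents at once. Uniformity over the limit operators is not given. A contradiction must come
  from a single limit operator, whose bound is known only after it has been constructed; hence
  badness at all scales around the same centres. Passing from one scale to the next costs a factor
  independent of the scale, 20 for test vectors and 10 for solvability, and the levels are spaced so
  as to absorb it. Uniform constants come out at the end, because a lower bound at infinity is
  inherited by every limit operator unchanged. Finite dimension of the coefficients enters through
  compactness, which produces limit operators, and through counting. The line enters through the
  count: a window has a boundary of fixed size, however long it is. For
  \<open>p = \<infinity>\<close> sequences of finite support are not dense; entrywise limits of
  bounded sequences take the place of norm approximation.\<close>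

definition restr :: "int set \<Rightarrow> (int \<Rightarrow> 'a::zero) \<Rightarrow> int \<Rightarrow> 'a" where
  "restr S x = (\<lambda>k. if k \<in> S then x k else 0)"

abbreviation win :: "nat \<Rightarrow> int set" where
  "win n \<equiv> {- int n..int n}"

lemma restr_win_self: "restr (win (nat \<bar>k\<bar>)) x k = x k"
  by (auto simp: restr_def)

lemma int_div_less_iff: "k div D < m \<longleftrightarrow> k < m * D" if "D > 0" for k D m :: int
proof -
  have k: "k = D * (k div D) + k mod D" "0 \<le> k mod D" "k mod D < D" using that by auto
  show ?thesis
  proof
    assume "k div D < m"
    then have "D * (k div D + 1) \<le> D * m" using that by (intro mult_left_mono) auto
    moreover have "k < D * (k div D + 1)" using k unfolding distrib_left by linarith
    ultimately show "k < m * D" by (simp add: mult.commute)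
  next
    assume "k < m * D"
    show "k div D < m"
    proof (rule ccontr)
      assume "\<not> k div D < m"
      then have "D * m \<le> D * (k div D)" using that by (intro mult_left_mono) auto
      then show False using k \<open>k < m * D\<close> mult.commute[of m D] by linarith
    qed
  qed
qed

definition cutoff :: "(int \<Rightarrow> real) \<Rightarrow> (int \<Rightarrow> 'a::real_vector) \<Rightarrow> int \<Rightarrow> 'a" where
  "cutoff \<phi> x = (\<lambda>k. \<phi> k *\<^sub>R x k)"

lemma sum_apply: "(sum f I) k = (\<Sum>i\<in>I. f i k)" for f :: "'i \<Rightarrow> 'k \<Rightarrow> 'a::comm_monoid_add"
  by (induction I rule: infinite_finite_induct) auto

definition supp :: "(int \<Rightarrow> 'a::zero) \<Rightarrow> int set" where
  "supp x = {k. x k \<noteq> 0}"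

text \<open>The boundary cases \<open>u = 0\<close> and \<open>v = 0\<close> reduce to
  \<open>c powr r \<le> c\<close> on the unit interval; on the open half-line this is convexity of
  the power. It is the analytic input to Minkowski's inequality in
  \<open>lp_add_tri\<close>.\<close>

lemma powr_convex_combination:
  fixes u v s t r :: real
  assumes "r \<ge> 1" "u \<ge> 0" "v \<ge> 0" "s \<ge> 0" "t \<ge> 0" "s + t = 1"
  shows "(s * u + t * v) powr r \<le> s * u powr r + t * v powr r"
proof -
  have small: "c powr r \<le> c" if "0 \<le> c" "c \<le> 1" for c :: real
    using powr_mono'[of 1 r c] that assms(1) by (cases "c = 0") auto
  have zero: "(c * w) powr r \<le> c * w powr r" if "0 \<le> c" "c \<le> 1" "0 \<le> w" for c w :: real
    using small[of c] that by (simp add: powr_mult mult_right_mono)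
  consider "u = 0" | "v = 0" | "u > 0" "v > 0"
    using assms by linarith
  then show ?thesis
  proof cases
    case 1
    then show ?thesis using zero[of t v] assms by simp
  next
    case 2
    then show ?thesis using zero[of s u] assms by simp
  next
    case 3
    have s: "s = 1 - t" "t \<le> 1" using assms by simp_all
    show ?thesis
      using convex_onD[OF powr_convex[OF assms(1)], of t u v] 3 assms(5) s(2) by (simp add: s(1))
  qed
qed

lemma powr_le_imp_le:
  fixes a b r :: real
  assumes "1 \<le> r" "0 \<le> a" "0 \<le> b" "a powr r \<le> b powr r"
  shows "a \<le> b"
  using powr_less_mono2[of r b a] assms by (meson dual_order.strict_trans1 not_le zero_less_one)

lemma finite_int_bound: "finite F \<Longrightarrow> \<exists>n. F \<subseteq> win n"
proof -
  assume "finite F"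
  then obtain C where "\<And>k. k \<in> F \<Longrightarrow> \<bar>k\<bar> \<le> C"
    using bdd_above_finite[of "abs ` F"] by (auto simp: bdd_above_def)
  then have "F \<subseteq> win (nat C)" by force
  then show ?thesis by blast
qed

section \<open>Norms on the sequence spaces: solidity, triangle inequality, windows,
  completeness\<close>

locale lp_exponent =
  fixes p :: ennreal
  assumes p_cases: "p = 0 \<or> 1 \<le> p"
begin

abbreviation r :: real where "r \<equiv> enn2real p"

abbreviation N :: "(int \<Rightarrow> 'b::real_normed_vector) \<Rightarrow> real" where "N \<equiv> lp_norm p"

abbreviation finp :: bool where "finp \<equiv> p \<noteq> 0 \<and> p \<noteq> \<infinity>"

lemma r_ge_1: "finp \<Longrightarrow> 1 \<le> r"
  using p_cases enn2real_mono[of 1 p] by (auto simp: less_top)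

text \<open>Summability and the infinite sum of nonnegative terms are both governed by the finite
  partial sums. Working with these keeps infinite sums out of most later estimates.\<close>

lemma lp_fin_iff:
  fixes x :: "int \<Rightarrow> 'b::real_normed_vector"
  assumes "finp" "0 \<le> C"
  shows "x \<in> lp p \<and> N x \<le> C \<longleftrightarrow> (\<forall>F. finite F \<longrightarrow> (\<Sum>k\<in>F. norm (x k) powr r) \<le> C powr r)"
    (is "?L \<longleftrightarrow> ?R")
proof
  have r: "1 \<le> r" using r_ge_1 assms by blast
  assume ?L
  then have s: "(\<lambda>n. norm (x n) powr r) summable_on UNIV"
    and n: "(\<Sum>\<^sub>\<infinity>n. norm (x n) powr r) powr (1 / r) \<le> C"
    using assms by (auto simp: lp_def lp_norm_def)
  let ?S = "\<Sum>\<^sub>\<infinity>n. norm (x n) powr r"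
  have S0: "0 \<le> ?S" by (rule infsum_nonneg) simp
  have "(?S powr (1 / r)) powr r \<le> C powr r"
    using n r by (intro powr_mono2) auto
  then have le: "?S \<le> C powr r" using r S0 by (simp add: powr_powr)
  show ?R
  proof (intro allI impI)
    fix F :: "int set" assume "finite F"
    then have "(\<Sum>k\<in>F. norm (x k) powr r) \<le> ?S"
      by (intro finite_sum_le_infsum[OF s]) auto
    then show "(\<Sum>k\<in>F. norm (x k) powr r) \<le> C powr r" using le by simp
  qed
next
  have r: "1 \<le> r" using r_ge_1 assms by blast
  assume R: ?R
  have s: "(\<lambda>n. norm (x n) powr r) summable_on UNIV"
    by (rule nonneg_bdd_above_summable_on) (use R in \<open>auto simp: bdd_above_def\<close>)
  have le: "(\<Sum>\<^sub>\<infinity>n. norm (x n) powr r) \<le> C powr r"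
    by (rule infsum_le_finite_sums[OF s]) (use R in auto)
  have S0: "0 \<le> (\<Sum>\<^sub>\<infinity>n. norm (x n) powr r)" by (rule infsum_nonneg) simp
  have "(\<Sum>\<^sub>\<infinity>n. norm (x n) powr r) powr (1 / r) \<le> (C powr r) powr (1 / r)"
    using le r S0 by (intro powr_mono2) auto
  also have "\<dots> = C" using r assms(2) by (simp add: powr_powr)
  finally show ?L using s assms by (auto simp: lp_def lp_norm_def)
qed

lemma lp_inf_iff:
  fixes x :: "int \<Rightarrow> 'b::real_normed_vector"
  assumes "p = \<infinity>"
  shows "x \<in> lp p \<longleftrightarrow> (\<exists>C. \<forall>k. norm (x k) \<le> C)"
  using assms by (auto simp: lp_def bounded_iff)

text \<open>The boundedness demanded by \<open>lp\<close> follows from decay, since only finitely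
  many entries are left over; the limit along the filter becomes a condition on windows.\<close>

lemma lp_0_iff:
  fixes x :: "int \<Rightarrow> 'b::real_normed_vector"
  assumes "p = 0"
  shows "x \<in> lp p \<longleftrightarrow> (\<forall>e>0. \<exists>n. \<forall>k. k \<notin> win n \<longrightarrow> norm (x k) < e)"
proof -
  have lim: "(x \<longlongrightarrow> 0) (filtercomap abs at_top) \<longleftrightarrow>
      (\<forall>e>0. \<exists>n. \<forall>k. k \<notin> win n \<longrightarrow> norm (x k) < e)"
  proof -
    have "(\<exists>m::int. \<forall>k. m \<le> \<bar>k\<bar> \<longrightarrow> norm (x k) < e) \<longleftrightarrow>
        (\<exists>n. \<forall>k. k \<notin> win n \<longrightarrow> norm (x k) < e)" for e
    proof safe
      fix m :: int assume *: "\<forall>k. m \<le> \<bar>k\<bar> \<longrightarrow> norm (x k) < e"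
      show "\<exists>n. \<forall>k. k \<notin> win n \<longrightarrow> norm (x k) < e"
        by (rule exI[of _ "nat m"]) (use * in auto)
    next
      fix n assume *: "\<forall>k. k \<notin> win n \<longrightarrow> norm (x k) < e"
      show "\<exists>m::int. \<forall>k. m \<le> \<bar>k\<bar> \<longrightarrow> norm (x k) < e"
      proof (intro exI[of _ "int n + 1"] allI impI)
        fix k :: int assume "int n + 1 \<le> \<bar>k\<bar>"
        then have "k \<notin> win n" by auto
        then show "norm (x k) < e" using * by blast
      qed
    qed
    then show ?thesis
      by (simp add: tendsto_iff eventually_filtercomap_at_top_linorder)
  qed
  have bdd: "bounded (range x)" if *: "\<forall>e>0. \<exists>n. \<forall>k. k \<notin> win n \<longrightarrow> norm (x k) < e"
  proof -
    obtain n where n: "\<And>k. k \<notin> win n \<Longrightarrow> norm (x k) < 1" using * by (metis zero_less_one)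
    have "bounded (x ` win n)" by (simp add: finite_imp_bounded)
    moreover have "bounded (x ` (- win n))"
      unfolding bounded_iff using n by (intro exI[of _ 1]) (auto intro: less_imp_le)
    moreover have "range x = x ` win n \<union> x ` (- win n)" by auto
    ultimately show ?thesis by simp
  qed
  show ?thesis using lim bdd assms by (auto simp: lp_def)
qed

lemma lp_sup_le_iff:
  fixes x :: "int \<Rightarrow> 'b::real_normed_vector"
  assumes "\<not> finp" "x \<in> lp p"
  shows "N x \<le> C \<longleftrightarrow> (\<forall>k. norm (x k) \<le> C)"
proof -
  have "bounded (range x)" using assms by (auto simp: lp_def)
  then have "bdd_above (range (\<lambda>k. norm (x k)))"
    by (auto simp: bounded_iff bdd_above_def)
  then show ?thesis
    using assms by (simp add: lp_norm_def cSUP_le_iff)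
qed

lemma N_nonneg:
  fixes x :: "int \<Rightarrow> 'b::real_normed_vector"
  assumes "x \<in> lp p" shows "0 \<le> N x"
proof (cases finp)
  case True
  then show ?thesis by (simp add: lp_norm_def)
next
  case False
  then have "norm (x 0) \<le> N x" using lp_sup_le_iff[OF _ assms] by blast
  then show ?thesis using norm_ge_zero[of "x 0"] by linarith
qed

lemma norm_le_N:
  fixes x :: "int \<Rightarrow> 'b::real_normed_vector"
  assumes "x \<in> lp p" shows "norm (x k) \<le> N x"
proof (cases finp)
  case True
  have "(\<Sum>k\<in>{k}. norm (x k) powr r) \<le> N x powr r"
    using lp_fin_iff[of "N x" x] True N_nonneg[OF assms] assms by blast
  then have "norm (x k) powr r \<le> N x powr r" by simp
  then show ?thesis using r_ge_1[OF True] N_nonneg[OF assms] by (auto intro: powr_le_imp_le[of r])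
next
  case False
  then show ?thesis using lp_sup_le_iff[OF _ assms] by blast
qed

text \<open>The norm depends monotonically on the entrywise norms alone. Truncations and cutoffs are
  contractions for this reason.\<close>

lemma lp_solid:
  fixes x :: "int \<Rightarrow> 'b::real_normed_vector" and y :: "int \<Rightarrow> 'c::real_normed_vector"
  assumes "x \<in> lp p" and le: "\<And>k. norm (y k) \<le> norm (x k)"
  shows "y \<in> lp p" "N y \<le> N x"
proof -
  have "y \<in> lp p \<and> N y \<le> N x"
  proof (cases finp)
    case True
    have "(\<Sum>k\<in>F. norm (y k) powr r) \<le> N x powr r" if "finite F" for F
    proof -
      have "(\<Sum>k\<in>F. norm (y k) powr r) \<le> (\<Sum>k\<in>F. norm (x k) powr r)"
        using le r_ge_1[OF True] by (intro sum_mono powr_mono2) auto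
      also have "\<dots> \<le> N x powr r"
        using lp_fin_iff[OF True N_nonneg[OF assms(1)], of x] that assms(1) by blast
      finally show ?thesis .
    qed
    then show ?thesis using lp_fin_iff[OF True N_nonneg[OF assms(1)], of y] by blast
  next
    case False
    have "y \<in> lp p"
    proof (cases "p = 0")
      case True
      then show ?thesis using assms lp_0_iff by (metis order_le_less_trans)
    next
      case False
      then have "p = \<infinity>" using \<open>\<not> finp\<close> by auto
      then show ?thesis using assms lp_inf_iff by (metis order_trans)
    qed
    moreover have "norm (y k) \<le> N x" for k
      using le[of k] norm_le_N[OF assms(1), of k] by linarith
    ultimately show ?thesis using lp_sup_le_iff[OF False] by blast
  qed
  then show "y \<in> lp p" "N y \<le> N x" by auto
qed

lemma lp_zero [simp]: "(\<lambda>k. 0 :: 'b::real_normed_vector) \<in> lp p" "N (\<lambda>k. 0 :: 'b::real_normed_vector) = 0"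
proof -
  have "(\<lambda>k. 0 :: 'b) \<in> lp p \<and> N (\<lambda>k. 0 :: 'b) \<le> 0"
  proof (cases finp)
    case True
    then show ?thesis using lp_fin_iff[of 0 "\<lambda>k. 0::'b"] by auto
  next
    case False
    have "(\<lambda>k. 0::'b) \<in> lp p"
    proof (cases "p = 0")
      case True
      show ?thesis unfolding lp_0_iff[OF True] by simp
    next
      case 2: False
      then have "p = \<infinity>" using False by auto
      then show ?thesis using lp_inf_iff by (metis norm_zero order_refl)
    qed
    then show ?thesis using lp_sup_le_iff[OF False, of "\<lambda>k. 0::'b" 0] by simp
  qed
  then show "(\<lambda>k. 0 :: 'b) \<in> lp p" "N (\<lambda>k. 0 :: 'b) = 0"
    using N_nonneg[of "\<lambda>k. 0::'b"] by auto
qed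

lemma lp_zero' [simp]: "0 \<in> lp p" "N (0 :: int \<Rightarrow> 'b::real_normed_vector) = 0"
  using lp_zero by (simp_all add: zero_fun_def)

lemma N_eq_0:
  fixes x :: "int \<Rightarrow> 'b::real_normed_vector"
  assumes "x \<in> lp p" shows "N x = 0 \<longleftrightarrow> x = 0"
proof
  assume "N x = 0"
  then show "x = 0" using norm_le_N[OF assms] by (auto simp: fun_eq_iff)
qed simp

lemma N_pos:
  fixes x :: "int \<Rightarrow> 'b::real_normed_vector"
  assumes "x \<in> lp p" "x \<noteq> 0" shows "N x > 0"
  using N_eq_0 N_nonneg assms by (metis less_eq_real_def)

lemma lp_scale_le:
  fixes x :: "int \<Rightarrow> 'b::real_normed_vector" and y :: "int \<Rightarrow> 'c::real_normed_vector"
  assumes x: "x \<in> lp p" and c: "c \<ge> 0" and eq: "\<And>k. norm (y k) \<le> c * norm (x k)"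
  shows "y \<in> lp p" "N y \<le> c * N x"
proof -
  have c0: "0 \<le> c * N x" using c N_nonneg[OF x] by simp
  have "y \<in> lp p \<and> N y \<le> c * N x"
  proof (cases finp)
    case True
    have "(\<Sum>k\<in>F. norm (y k) powr r) \<le> (c * N x) powr r" if "finite F" for F
    proof -
      have "(\<Sum>k\<in>F. norm (y k) powr r) \<le> (\<Sum>k\<in>F. (c * norm (x k)) powr r)"
        using eq r_ge_1[OF True] by (intro sum_mono powr_mono2) auto
      also have "\<dots> = (\<Sum>k\<in>F. c powr r * norm (x k) powr r)"
        using c by (simp add: powr_mult)
      also have "\<dots> = c powr r * (\<Sum>k\<in>F. norm (x k) powr r)"
        by (simp add: sum_distrib_left)
      also have "\<dots> \<le> c powr r * N x powr r"
        using lp_fin_iff[OF True N_nonneg[OF x], of x] that x by (intro mult_left_mono) auto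
      finally show ?thesis using c N_nonneg[OF x] by (simp add: powr_mult)
    qed
    then show ?thesis using lp_fin_iff[OF True c0, of y] by blast
  next
    case False
    have le: "norm (y k) \<le> c * N x" for k
      using eq[of k] norm_le_N[OF x, of k] c by (meson mult_left_mono order_trans)
    have "y \<in> lp p"
    proof (cases "p = 0")
      case True
      have "\<exists>n. \<forall>k. k \<notin> win n \<longrightarrow> norm (y k) < e" if "e > 0" for e
      proof -
        \<comment> \<open>The denominator \<open>c + 1\<close> also covers
          \<open>c = 0\<close>.\<close>
        obtain n where n: "\<And>k. k \<notin> win n \<Longrightarrow> norm (x k) < e / (c + 1)"
          using x \<open>e > 0\<close> c unfolding lp_0_iff[OF True] by (metis add_nonneg_pos divide_pos_pos zero_less_one)
        have "norm (y k) < e" if "k \<notin> win n" for k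
        proof -
          have "norm (y k) \<le> c * norm (x k)" by (rule eq)
          also have "\<dots> \<le> (c + 1) * norm (x k)" by (simp add: mult_right_mono)
          also have "\<dots> < (c + 1) * (e / (c + 1))"
            using n[OF that] c by (intro mult_strict_left_mono) auto
          finally show ?thesis using c by simp
        qed
        then show ?thesis by blast
      qed
      then show ?thesis by (simp add: lp_0_iff[OF True])
    next
      case 2: False
      then have "p = \<infinity>" using False by auto
      then show ?thesis using le lp_inf_iff by blast
    qed
    then show ?thesis using lp_sup_le_iff[OF False] le by blast
  qed
  then show "y \<in> lp p" "N y \<le> c * N x" by auto
qed

lemma lp_scale_eq:
  fixes x :: "int \<Rightarrow> 'b::real_normed_vector" and y :: "int \<Rightarrow> 'c::real_normed_vector"
  assumes x: "x \<in> lp p" and c: "c \<ge> 0" and eq: "\<And>k. norm (y k) = c * norm (x k)"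
  shows "N y = c * N x"
proof (cases "c = 0")
  case True
  then have "y = 0" using eq by (auto simp: fun_eq_iff)
  then show ?thesis using True by simp
next
  case False
  have y: "y \<in> lp p" "N y \<le> c * N x"
    using lp_scale_le[OF x c, of y] eq by auto
  have "N x \<le> (1/c) * N y"
    by (rule lp_scale_le(2)[OF y(1)]) (use eq c False in auto)
  then have "c * N x \<le> N y" using c False by (simp add: field_simps)
  then show ?thesis using y by simp
qed

text \<open>Minkowski's inequality by normalization: relative to \<open>N x + N y\<close>, the entry
  norms are convex combinations, with weights \<open>?s\<close> and \<open>?t\<close>, of those of
  \<open>x / N x\<close> and \<open>y / N y\<close>, whose r-th powers have partial sums at most
  one. The zero sequence is split off because it cannot be normalized.\<close>

lemma lp_add_tri:
  fixes x y :: "int \<Rightarrow> 'b::real_normed_vector"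
  assumes x: "x \<in> lp p" and y: "y \<in> lp p"
  shows "x + y \<in> lp p \<and> N (x + y) \<le> N x + N y"
proof (cases "x = 0 \<or> y = 0")
  case True
  then show ?thesis using x y by auto
next
  case ne: False
  let ?a = "N x" and ?b = "N y"
  have a: "?a > 0" and b: "?b > 0" using N_pos ne x y by auto
  show ?thesis
  proof (cases finp)
    case True
    note r1 = r_ge_1[OF True]
    let ?s = "?a / (?a + ?b)" and ?t = "?b / (?a + ?b)"
    have st: "?s \<ge> 0" "?t \<ge> 0" "?s + ?t = 1"
      using a b by (auto simp: add_divide_distrib[symmetric])
    have "(\<Sum>k\<in>F. norm ((x + y) k) powr r) \<le> (?a + ?b) powr r" if "finite F" for F
    proof -
      have 1: "norm ((x + y) k) powr r \<le>
          (?a + ?b) powr r * (?s * (norm (x k) powr r / ?a powr r) + ?t * (norm (y k) powr r / ?b powr r))" for k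
      proof -
        have "norm ((x + y) k) powr r \<le> (norm (x k) + norm (y k)) powr r"
          using r1 by (intro powr_mono2) (auto simp: norm_triangle_ineq)
        also have "norm (x k) + norm (y k)
            = (?a + ?b) * (?s * (norm (x k) / ?a) + ?t * (norm (y k) / ?b))"
          using a b by (simp add: distrib_left)
        also have "(\<dots>) powr r = (?a + ?b) powr r *
            (?s * (norm (x k) / ?a) + ?t * (norm (y k) / ?b)) powr r"
          using a b by (subst powr_mult) auto
        also have "\<dots> \<le> (?a + ?b) powr r *
            (?s * (norm (x k) / ?a) powr r + ?t * (norm (y k) / ?b) powr r)"
          using a b st r1 by (intro mult_left_mono powr_convex_combination) auto
        finally show ?thesis using a b by (simp add: powr_divide)
      qed
      have X: "(\<Sum>k\<in>F. norm (x k) powr r) / ?a powr r \<le> 1"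
        using lp_fin_iff[OF True N_nonneg[OF x], of x] that x a by (simp add: divide_le_eq)
      have Y: "(\<Sum>k\<in>F. norm (y k) powr r) / ?b powr r \<le> 1"
        using lp_fin_iff[OF True N_nonneg[OF y], of y] that y b by (simp add: divide_le_eq)
      have "(\<Sum>k\<in>F. norm ((x + y) k) powr r) \<le> (\<Sum>k\<in>F.
          (?a + ?b) powr r * (?s * (norm (x k) powr r / ?a powr r) + ?t * (norm (y k) powr r / ?b powr r)))"
        by (rule sum_mono) (rule 1)
      also have "\<dots> = (?a + ?b) powr r * (?s * ((\<Sum>k\<in>F. norm (x k) powr r) / ?a powr r)
          + ?t * ((\<Sum>k\<in>F. norm (y k) powr r) / ?b powr r))"
        by (simp only: sum_distrib_left[symmetric] sum.distrib sum_divide_distrib)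
      also have "\<dots> \<le> (?a + ?b) powr r * (?s * 1 + ?t * 1)"
        using X Y st by (intro mult_left_mono add_mono) auto
      finally show ?thesis using st by simp
    qed
    then show ?thesis using lp_fin_iff[OF True, of "?a + ?b" "x + y"] a b by auto
  next
    case False
    have le: "norm ((x + y) k) \<le> ?a + ?b" for k
      using norm_le_N[OF x, of k] norm_le_N[OF y, of k] norm_triangle_ineq[of "x k" "y k"]
      by simp
    have "x + y \<in> lp p"
    proof (cases "p = 0")
      case True
      have "\<exists>n. \<forall>k. k \<notin> win n \<longrightarrow> norm ((x + y) k) < e" if "e > 0" for e
      proof -
        obtain n where n: "\<And>k. k \<notin> win n \<Longrightarrow> norm (x k) < e / 2"
          using x \<open>e > 0\<close> unfolding lp_0_iff[OF True] by (metis half_gt_zero)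
        obtain m where m: "\<And>k. k \<notin> win m \<Longrightarrow> norm (y k) < e / 2"
          using y \<open>e > 0\<close> unfolding lp_0_iff[OF True] by (metis half_gt_zero)
        have "norm ((x + y) k) < e" if "k \<notin> win (max n m)" for k
        proof -
          have "norm (x k) < e / 2" "norm (y k) < e/2" using that n m by auto
          then show ?thesis using norm_triangle_ineq[of "x k" "y k"] by simp
        qed
        then show ?thesis by blast
      qed
      then show ?thesis by (simp add: lp_0_iff[OF True])
    next
      case 2: False
      then have "p = \<infinity>" using False by auto
      then show ?thesis using le lp_inf_iff by blast
    qed
    then show ?thesis using lp_sup_le_iff[OF False] le by blast
  qed
qed

lemma lp_add: "x \<in> lp p \<Longrightarrow> y \<in> lp p \<Longrightarrow> x + y \<in> lp p"
  and N_triangle: "x \<in> lp p \<Longrightarrow> y \<in> lp p \<Longrightarrow> N (x + y) \<le> N x + N y"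
  for x y :: "int \<Rightarrow> 'b::real_normed_vector"
  using lp_add_tri by auto

lemma lp_uminus: "x \<in> lp p \<Longrightarrow> - x \<in> lp p"
  and N_uminus: "x \<in> lp p \<Longrightarrow> N (- x) = N x"
  for x :: "int \<Rightarrow> 'b::real_normed_vector"
  using lp_solid(1)[of x "- x"] lp_scale_eq[of x 1 "- x"] by auto

lemma lp_diff: "x \<in> lp p \<Longrightarrow> y \<in> lp p \<Longrightarrow> x - y \<in> lp p"
  and N_diff: "x \<in> lp p \<Longrightarrow> y \<in> lp p \<Longrightarrow> N (x - y) \<le> N x + N y"
  for x y :: "int \<Rightarrow> 'b::real_normed_vector"
  using lp_add[of x "- y"] N_triangle[of x "- y"] lp_uminus[of y] N_uminus[of y] by auto

lemma N_diff_commute: "x \<in> lp p \<Longrightarrow> y \<in> lp p \<Longrightarrow> N (x - y) = N (y - x)"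
  for x y :: "int \<Rightarrow> 'b::real_normed_vector"
  using N_uminus[OF lp_diff, of x y] by simp

lemma N_le_diff: "x \<in> lp p \<Longrightarrow> y \<in> lp p \<Longrightarrow> N x \<le> N y + N (x - y)"
  for x y :: "int \<Rightarrow> 'b::real_normed_vector"
  using N_triangle[OF _ lp_diff, of y x y] by simp

lemma lp_sum: "(\<And>i. i \<in> I \<Longrightarrow> f i \<in> lp p) \<Longrightarrow> sum f I \<in> lp p"
  for f :: "'i \<Rightarrow> int \<Rightarrow> 'b::real_normed_vector"
  by (induction I rule: infinite_finite_induct) (auto intro: lp_add)

lemma N_sum: "(\<And>i. i \<in> I \<Longrightarrow> f i \<in> lp p) \<Longrightarrow> N (sum f I) \<le> (\<Sum>i\<in>I. N (f i))"
  for f :: "'i \<Rightarrow> int \<Rightarrow> 'b::real_normed_vector"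
proof (induction I rule: infinite_finite_induct)
  case (insert i I)
  have "N (f i + sum f I) \<le> N (f i) + N (sum f I)"
    using insert.prems by (intro N_triangle lp_sum) auto
  moreover have "N (sum f I) \<le> (\<Sum>i\<in>I. N (f i))" using insert by blast
  ultimately show ?case unfolding sum.insert[OF insert(1,2)] by linarith
qed auto

lemma lp_restr: "x \<in> lp p \<Longrightarrow> restr S x \<in> lp p"
  and N_restr: "x \<in> lp p \<Longrightarrow> N (restr S x) \<le> N x"
  for x :: "int \<Rightarrow> 'b::real_normed_vector"
  by (rule lp_solid[of x]; simp add: restr_def)+

lemma lp_cut: "x \<in> lp p \<Longrightarrow> (\<And>k. \<bar>\<phi> k\<bar> \<le> 1) \<Longrightarrow> cutoff \<phi> x \<in> lp p"
  and N_cut: "x \<in> lp p \<Longrightarrow> (\<And>k. \<bar>\<phi> k\<bar> \<le> 1) \<Longrightarrow> N (cutoff \<phi> x) \<le> N x"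
  for x :: "int \<Rightarrow> 'b::real_normed_vector"
  by (rule lp_solid[of x]; simp add: cutoff_def mult_left_le_one_le)+

lemma N_restr_powr:
  fixes x :: "int \<Rightarrow> 'b::real_normed_vector"
  assumes finp "finite F"
  shows "restr F x \<in> lp p" "N (restr F x) powr r = (\<Sum>k\<in>F. norm (x k) powr r)"
proof -
  have z: "norm (restr F x k) powr r = (if k \<in> F then norm (x k) powr r else 0)" for k
    using r_ge_1[OF assms(1)] by (simp add: restr_def)
  have "(\<lambda>k. norm (restr F x k) powr r) summable_on UNIV \<and>
      (\<Sum>\<^sub>\<infinity>k. norm (restr F x k) powr r) = (\<Sum>k\<in>F. norm (x k) powr r)"
  proof -
    have "((\<lambda>k. norm (restr F x k) powr r) has_sum (\<Sum>k\<in>F. norm (x k) powr r)) UNIV"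
      by (rule has_sum_finite_neutralI[OF assms(2)]) (auto simp: z intro!: sum.cong)
    then show ?thesis by (simp add: has_sum_iff)
  qed
  then show "restr F x \<in> lp p" "N (restr F x) powr r = (\<Sum>k\<in>F. norm (x k) powr r)"
    using assms r_ge_1 by (auto simp: lp_def lp_norm_def powr_powr sum_nonneg)
qed

lemma lp_finite_supp:
  fixes x :: "int \<Rightarrow> 'b::real_normed_vector"
  assumes "finite F" shows "restr F x \<in> lp p"
proof (cases finp)
  case True
  then show ?thesis using N_restr_powr assms by blast
next
  case False
  obtain n where n: "F \<subseteq> win n" using finite_int_bound assms by blast
  show ?thesis
  proof (cases "p = 0")
    case True
    show ?thesis unfolding lp_0_iff[OF True]
    proof (intro allI impI)
      fix e :: real assume "e > 0"
      then show "\<exists>n. \<forall>k. k \<notin> win n \<longrightarrow> norm (restr F x k) < e"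
        using n by (intro exI[of _ n]) (auto simp: restr_def)
    qed
  next
    case 2: False
    then have "p = \<infinity>" using False by auto
    obtain C where "\<And>k. k \<in> F \<Longrightarrow> norm (x k) \<le> C"
      using bdd_above_finite[of "(\<lambda>k. norm (x k)) ` F"] assms by (auto simp: bdd_above_def)
    then have "norm (restr F x k) \<le> max C 0" for k by (auto simp: restr_def le_max_iff_disj)
    then show ?thesis using lp_inf_iff[OF \<open>p = \<infinity>\<close>] by blast
  qed
qed

lemma N_restr_sum:
  fixes y :: "int \<Rightarrow> 'b::real_normed_vector"
  assumes F: "finite F" shows "N (restr F y) \<le> (\<Sum>k\<in>F. norm (y k))"
proof -
  have single: "N (restr {k} y) \<le> norm (y k)" for k
  proof (cases finp)
    case True
    then have "N (restr {k} y) powr r = norm (y k) powr r"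
      using N_restr_powr[OF True, of "{k}" y] by simp
    then show ?thesis using r_ge_1[OF True] N_nonneg[OF lp_finite_supp, of "{k}" y]
      by (auto intro: powr_le_imp_le[of r])
  next
    case False
    have "norm (restr {k} y j) \<le> norm (y k)" for j by (simp add: restr_def)
    then show ?thesis using lp_sup_le_iff[OF False lp_finite_supp[of "{k}" y]] by blast
  qed
  have "restr F y = (\<Sum>k\<in>F. restr {k} y)"
    using F by (auto simp: restr_def fun_eq_iff sum_apply sum.delta')
  moreover have "N (\<Sum>k\<in>F. restr {k} y) \<le> (\<Sum>k\<in>F. N (restr {k} y))"
    by (rule N_sum) (simp add: lp_finite_supp)
  moreover have "(\<Sum>k\<in>F. N (restr {k} y)) \<le> (\<Sum>k\<in>F. norm (y k))"
    by (rule sum_mono) (rule single)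
  ultimately show ?thesis by simp
qed

text \<open>A Fatou property: the norm is the supremum of the norms of the windows, which turns
  estimates on windows into global ones. For \<open>p = 0\<close> membership must be known
  beforehand, since a constant sequence has bounded windows without being a null sequence.\<close>

lemma lp_boundI:
  fixes x :: "int \<Rightarrow> 'b::real_normed_vector"
  assumes "p \<noteq> 0 \<or> x \<in> lp p" and C: "\<And>n. N (restr (win n) x) \<le> C"
  shows "x \<in> lp p" "N x \<le> C"
proof -
  have C0: "C \<ge> 0" using C[of 0] N_nonneg[OF lp_finite_supp, of "win 0" x] by simp
  have "x \<in> lp p \<and> N x \<le> C"
  proof (cases finp)
    case True
    have "(\<Sum>k\<in>F. norm (x k) powr r) \<le> C powr r" if F: "finite F" for F
    proof -
      obtain n where n: "F \<subseteq> win n" using finite_int_bound[OF F] by blast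
      have "(\<Sum>k\<in>F. norm (x k) powr r) \<le> (\<Sum>k\<in>win n. norm (x k) powr r)"
        by (rule sum_mono2) (use n in simp_all)
      also have "\<dots> = N (restr (win n) x) powr r"
        by (rule N_restr_powr(2)[OF True, symmetric]) simp
      also have "\<dots> \<le> C powr r"
        using C[of n] r_ge_1[OF True] N_nonneg[OF lp_finite_supp, of "win n" x]
        by (intro powr_mono2) auto
      finally show ?thesis .
    qed
    then show ?thesis using lp_fin_iff[OF True C0] by blast
  next
    case False
    have le: "norm (x k) \<le> C" for k
    proof -
      have "norm (restr (win (nat \<bar>k\<bar>)) x k) \<le> N (restr (win (nat \<bar>k\<bar>)) x)"
        by (intro norm_le_N lp_finite_supp) auto
      then show ?thesis using C[of "nat \<bar>k\<bar>"] unfolding restr_win_self by linarith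
    qed
    have "x \<in> lp p"
    proof (cases "p = 0")
      case True
      then show ?thesis using assms(1) by simp
    next
      case 2: False
      then have "p = \<infinity>" using False by auto
      then show ?thesis using le lp_inf_iff by blast
    qed
    then show ?thesis using lp_sup_le_iff[OF False] le by blast
  qed
  then show "x \<in> lp p" "N x \<le> C" by auto
qed

lemma N_restr_approx:
  fixes x :: "int \<Rightarrow> 'b::real_normed_vector"
  assumes "x \<in> lp p" "e > 0"
  shows "\<exists>n. N x - e < N (restr (win n) x)"
proof (rule ccontr)
  assume "\<not> ?thesis"
  then have "N (restr (win n) x) \<le> N x - e" for n by (simp add: not_less)
  then show False using lp_boundI(2)[of x "N x - e"] assms by auto
qed

text \<open>Sequences of finite support are dense, except for \<open>p = \<infinity>\<close>, where
  a constant sequence has tails of full norm. The later case distinctions on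
  \<open>p = \<infinity>\<close> when solving equations come from here.\<close>

lemma N_tail:
  fixes x :: "int \<Rightarrow> 'b::real_normed_vector"
  assumes x: "x \<in> lp p" and "p \<noteq> \<infinity>" "e > 0"
  shows "\<exists>n. N (restr (- win n) x) \<le> e"
proof (cases "p = 0")
  case True
  obtain n where n: "\<And>k. k \<notin> win n \<Longrightarrow> norm (x k) < e"
    using x \<open>e > 0\<close> unfolding lp_0_iff[OF True] by metis
  have "norm (restr (- win n) x k) \<le> e" for k
    using n[of k] assms(3) by (auto simp: restr_def intro: less_imp_le)
  then have "N (restr (- win n) x) \<le> e"
    using True lp_sup_le_iff[OF _ lp_restr[OF x]] by blast
  then show ?thesis by blast
next
  case False
  then have fp: finp using assms by simp
  note r1 = r_ge_1[OF fp]
  have s: "(\<lambda>n. norm (x n) powr r) summable_on UNIV" using x fp by (auto simp: lp_def)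
  obtain F where F: "finite F" "dist (\<Sum>k\<in>F. norm (x k) powr r) (\<Sum>\<^sub>\<infinity>n. norm (x n) powr r) \<le> e powr r"
    using infsum_finite_approximation[OF s, of "e powr r"] \<open>e > 0\<close> by auto
  obtain n where n: "F \<subseteq> win n" using finite_int_bound F by blast
  have "(\<Sum>k\<in>G. norm (restr (- win n) x k) powr r) \<le> e powr r" if "finite G" for G
  proof -
    have "(\<Sum>k\<in>G. norm (restr (- win n) x k) powr r) = (\<Sum>k\<in>G - win n. norm (x k) powr r)"
      using that r1 by (intro sum.mono_neutral_cong_right) (auto simp: restr_def)
    moreover have "(\<Sum>k\<in>G - win n. norm (x k) powr r) + (\<Sum>k\<in>F. norm (x k) powr r)
        = (\<Sum>k\<in>(G - win n) \<union> F. norm (x k) powr r)"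
      using that n F by (subst sum.union_disjoint) auto
    moreover have "\<dots> \<le> (\<Sum>\<^sub>\<infinity>n. norm (x n) powr r)"
      using that F by (intro finite_sum_le_infsum[OF s]) auto
    ultimately show ?thesis using F(2) by (simp add: dist_real_def)
  qed
  then show ?thesis using lp_fin_iff[OF fp, of e "restr (- win n) x"] assms by auto
qed

lemma lp_shift: "x \<in> lp p \<Longrightarrow> shift h x \<in> lp p"
  and N_shift: "x \<in> lp p \<Longrightarrow> N (shift h x) = N x"
  for x :: "int \<Rightarrow> 'b::real_normed_vector"
proof -
  have le: "shift h x \<in> lp p \<and> N (shift h x) \<le> N x" if x: "x \<in> lp p" for h and x :: "int \<Rightarrow> 'b"
  proof (cases finp)
    case True
    have "(\<Sum>k\<in>F. norm (shift h x k) powr r) \<le> N x powr r" if "finite F" for F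
    proof -
      have "(\<Sum>k\<in>F. norm (shift h x k) powr r) = (\<Sum>k\<in>(\<lambda>k. k - h) ` F. norm (x k) powr r)"
        by (subst sum.reindex) (auto simp: inj_on_def shift_def)
      also have "\<dots> \<le> N x powr r"
        using lp_fin_iff[OF True N_nonneg[OF x], of x] that x by auto
      finally show ?thesis .
    qed
    then show ?thesis using lp_fin_iff[OF True N_nonneg[OF x]] by blast
  next
    case False
    have le: "norm (shift h x k) \<le> N x" for k
      using norm_le_N[OF x] by (simp add: shift_def)
    have "shift h x \<in> lp p"
    proof (cases "p = 0")
      case True
      have "\<exists>n. \<forall>k. k \<notin> win n \<longrightarrow> norm (shift h x k) < e" if "e > 0" for e
      proof -
        obtain n where n: "\<And>k. k \<notin> win n \<Longrightarrow> norm (x k) < e"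
          using x \<open>e > 0\<close> unfolding lp_0_iff[OF True] by metis
        have "norm (shift h x k) < e" if "k \<notin> win (n + nat \<bar>h\<bar>)" for k
        proof -
          have "k - h \<notin> win n" using that by (auto simp: abs_if split: if_splits)
          then show ?thesis using n[of "k - h"] by (simp add: shift_def)
        qed
        then show ?thesis by blast
      qed
      then show ?thesis by (simp add: lp_0_iff[OF True])
    next
      case 2: False
      then have "p = \<infinity>" using False by auto
      then show ?thesis using le lp_inf_iff by blast
    qed
    then show ?thesis using lp_sup_le_iff[OF False] le by blast
  qed
  assume x: "x \<in> lp p"
  show "shift h x \<in> lp p" using le[OF x] by blast
  have "shift (- h) (shift h x) = x" by (simp add: shift_def)
  then have "N x \<le> N (shift h x)" using le[of "shift h x" "- h"] le[OF x] by metis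
  then show "N (shift h x) = N x" using le[OF x, of h] by simp
qed

text \<open>The limit is taken entrywise. On a finite window the norm is bounded by the sum of the
  entry norms, so entrywise convergence suffices there, and \<open>lp_boundI\<close> lifts the
  bounds from windows to whole sequences.\<close>

lemma lp_complete:
  fixes f :: "nat \<Rightarrow> int \<Rightarrow> 'b::banach"
  assumes f: "\<And>n. f n \<in> lp p"
    and cauchy: "\<And>e. e > 0 \<Longrightarrow> \<exists>M. \<forall>m\<ge>M. \<forall>n\<ge>M. N (f m - f n) \<le> e"
  shows "\<exists>x\<in>lp p. \<forall>e>0. \<exists>M. \<forall>m\<ge>M. N (f m - x) \<le> e"
proof -
  have "Cauchy (\<lambda>n. f n k)" for k
  proof (rule metric_CauchyI)
    fix e :: real assume "e > 0"
    then obtain M where M: "\<And>m n. m \<ge> M \<Longrightarrow> n \<ge> M \<Longrightarrow> N (f m - f n) \<le> e / 2"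
      using cauchy[of "e/2"] by auto
    have "dist (f m k) (f n k) < e" if "m \<ge> M" "n \<ge> M" for m n
    proof -
      have "norm ((f m - f n) k) \<le> N (f m - f n)" by (intro norm_le_N lp_diff f)
      then show ?thesis using M[OF that] \<open>e > 0\<close> by (simp add: dist_norm)
    qed
    then show "\<exists>M. \<forall>m\<ge>M. \<forall>n\<ge>M. dist (f m k) (f n k) < e" by blast
  qed
  then have "\<forall>k. \<exists>l. (\<lambda>n. f n k) \<longlonglongrightarrow> l" by (simp add: Cauchy_convergent_iff convergent_def)
  then obtain x where x: "\<And>k. (\<lambda>n. f n k) \<longlonglongrightarrow> x k" by metis
  have win_lim: "(\<lambda>n. N (restr F (f m - f n))) \<longlonglongrightarrow> N (restr F (f m - x))" if "finite F" for m F
  proof -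
    have lim: "(\<lambda>n. \<Sum>k\<in>F. norm (x k - f n k)) \<longlonglongrightarrow> (\<Sum>k\<in>F. norm (x k - x k))"
      by (intro tendsto_intros x)
    have "(\<lambda>n. N (restr F (f m - f n)) - N (restr F (f m - x))) \<longlonglongrightarrow> 0"
    proof (rule Lim_null_comparison[OF always_eventually])
      show "\<forall>n. norm (N (restr F (f m - f n)) - N (restr F (f m - x))) \<le> (\<Sum>k\<in>F. norm (x k - f n k))"
      proof
        fix n
        have L: "restr F y \<in> lp p" for y :: "int \<Rightarrow> 'b" using that by (rule lp_finite_supp)
        have e: "restr F (f m - f n) - restr F (f m - x) = restr F (x - f n)"
          by (auto simp: restr_def)
        have "N (restr F (f m - f n)) \<le> N (restr F (f m - x)) + N (restr F (x - f n))"
          using N_le_diff[OF L L, of "f m - f n" "f m - x"] unfolding e .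
        moreover have "N (restr F (f m - x)) \<le> N (restr F (f m - f n)) + N (restr F (x - f n))"
          using N_le_diff[OF L L, of "f m - x" "f m - f n"] N_diff_commute[OF L L] e by metis
        ultimately show "norm (N (restr F (f m - f n)) - N (restr F (f m - x))) \<le> (\<Sum>k\<in>F. norm (x k - f n k))"
          using N_restr_sum[OF that, of "x - f n"] by (simp add: abs_le_iff)
      qed
      show "(\<lambda>n. \<Sum>k\<in>F. norm (x k - f n k)) \<longlonglongrightarrow> 0" using lim by simp
    qed
    then show ?thesis by (simp add: LIM_zero_iff)
  qed
  have win_le: "N (restr (win j) (f m - x)) \<le> e" if "\<And>n. n \<ge> M \<Longrightarrow> N (f m - f n) \<le> e" for e j m M
  proof (rule LIMSEQ_le_const2[OF win_lim])
    show "\<exists>M. \<forall>n\<ge>M. N (restr (win j) (f m - f n)) \<le> e"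
      using that N_restr[OF lp_diff[OF f f]] by (meson order_trans)
  qed simp
  have mem: "f m - x \<in> lp p \<and> N (f m - x) \<le> e" if "\<And>n. n \<ge> M \<Longrightarrow> N (f m - f n) \<le> e" for e m M
  proof -
    \<comment> \<open>For \<open>p = 0\<close> the entrywise limit must be shown to decay: a fixed
      late \<open>f M'\<close> is uniformly within \<open>e / 2\<close> of it, and
      \<open>f m - f M'\<close> decays.\<close>
    have "p \<noteq> 0 \<or> f m - x \<in> lp p"
    proof (cases "p = 0")
      case True
      have "\<exists>n. \<forall>k. k \<notin> win n \<longrightarrow> norm ((f m - x) k) < e" if "e > 0" for e
      proof -
        obtain M' where M': "\<And>m n. m \<ge> M' \<Longrightarrow> n \<ge> M' \<Longrightarrow> N (f m - f n) \<le> e / 2"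
          using cauchy[of "e/2"] \<open>e > 0\<close> by auto
        have tail: "norm (f M' k - x k) \<le> e / 2" for k
        proof -
          have "norm (restr (win (nat \<bar>k\<bar>)) (f M' - x) k) \<le> N (restr (win (nat \<bar>k\<bar>)) (f M' - x))"
            by (intro norm_le_N lp_finite_supp) auto
          also have "\<dots> \<le> e / 2" by (rule win_le[of M']) (use M' in auto)
          finally show ?thesis unfolding restr_win_self by simp
        qed
        have "f m - f M' \<in> lp p" by (intro lp_diff f)
        then obtain n where n: "\<And>k. k \<notin> win n \<Longrightarrow> norm ((f m - f M') k) < e / 2"
          using \<open>e > 0\<close> unfolding lp_0_iff[OF True] by (metis half_gt_zero)
        have "norm ((f m - x) k) < e" if "k \<notin> win n" for k
          using n[OF that] tail[of k] norm_triangle_ineq[of "f m k - f M' k" "f M' k - x k"] by simp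
        then show ?thesis by blast
      qed
      then show ?thesis by (simp add: lp_0_iff[OF True])
    qed simp
    then show ?thesis using lp_boundI[of "f m - x" e] win_le[OF that] by blast
  qed
  obtain M where "\<forall>m\<ge>M. \<forall>n\<ge>M. N (f m - f n) \<le> 1" using cauchy[of 1] by auto
  then have "f M - x \<in> lp p" using mem[of M M 1] by auto
  then have "f M - (f M - x) \<in> lp p" by (rule lp_diff[OF f])
  moreover have "f M - (f M - x) = x" by (simp add: fun_eq_iff)
  ultimately have "x \<in> lp p" by (simp only:)
  moreover have "\<exists>M. \<forall>m\<ge>M. N (f m - x) \<le> e" if "e > 0" for e
    using cauchy[OF that] mem by meson
  ultimately show ?thesis by blast
qed

section \<open>Blocks of the line and their neighbourhoods\<close>

definition blk :: "int \<Rightarrow> int \<Rightarrow> int set" where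
  "blk D j = {j * D..<(j + 1) * D}"

text \<open>Five blocks: \<open>j\<close> and two on either side. A bump that is one on block
  \<open>j\<close> descends to zero across the adjacent blocks, and an operator whose band width is
  at most one block carries its support one block further. The constant five below counts the
  overlap of these sets.\<close>

definition nbhd :: "int \<Rightarrow> int \<Rightarrow> int set" where
  "nbhd D j = {(j - 2) * D..<(j + 3) * D}"

lemma mem_blk: "D > 0 \<Longrightarrow> k \<in> blk D j \<longleftrightarrow> j = k div D"
  using int_div_less_iff[of D k j] int_div_less_iff[of D k "j + 1"] by (auto simp: blk_def)

lemma mem_nbhd: "D > 0 \<Longrightarrow> k \<in> nbhd D j \<longleftrightarrow> \<bar>k div D - j\<bar> \<le> 2"
  using int_div_less_iff[of D k "j - 2"] int_div_less_iff[of D k "j + 3"] by (auto simp: nbhd_def)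

lemma card_nbhd_le: "D > 0 \<Longrightarrow> finite J \<Longrightarrow> card {j \<in> J. k \<in> nbhd D j} \<le> 5"
proof -
  assume D: "D > 0" and "finite J"
  have "{j \<in> J. k \<in> nbhd D j} \<subseteq> {k div D - 2..k div D + 2}"
    using D by (auto simp: mem_nbhd)
  then have "card {j \<in> J. k \<in> nbhd D j} \<le> card {k div D - 2..k div D + 2}"
    by (rule card_mono[rotated]) simp
  then show ?thesis by simp
qed

lemma finite_blk [simp]: "finite (blk D j)" "finite (nbhd D j)"
  by (simp_all add: blk_def nbhd_def)

text \<open>Double counting: every index lies in at most five of the neighbourhoods.\<close>

lemma sum_nbhd_powr_le:
  fixes x :: "int \<Rightarrow> 'b::real_normed_vector"
  assumes fp: finp and x: "x \<in> lp p" and D: "D > 0" and J: "finite J"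
  shows "(\<Sum>j\<in>J. N (restr (nbhd D j) x) powr r) \<le> 5 * N x powr r"
proof -
  define U where "U = (\<Union>j\<in>J. nbhd D j)"
  have U: "finite U" using J by (simp add: U_def)
  have "(\<Sum>j\<in>J. N (restr (nbhd D j) x) powr r) = (\<Sum>j\<in>J. \<Sum>k\<in>nbhd D j. norm (x k) powr r)"
    by (simp add: N_restr_powr(2)[OF fp])
  also have "\<dots> = (\<Sum>j\<in>J. \<Sum>k\<in>{k\<in>U. k \<in> nbhd D j}. norm (x k) powr r)"
    by (intro sum.cong) (auto simp: U_def)
  also have "\<dots> = (\<Sum>k\<in>U. \<Sum>j\<in>{j\<in>J. k \<in> nbhd D j}. norm (x k) powr r)"
    by (rule sum.swap_restrict[OF J U])
  also have "\<dots> \<le> (\<Sum>k\<in>U. 5 * norm (x k) powr r)"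
  proof (rule sum_mono)
    fix k
    show "(\<Sum>j\<in>{j\<in>J. k \<in> nbhd D j}. norm (x k) powr r) \<le> 5 * norm (x k) powr r"
      using card_nbhd_le[OF D J, of k] by (simp add: mult_right_mono)
  qed
  also have "\<dots> = 5 * (\<Sum>k\<in>U. norm (x k) powr r)" by (simp add: sum_distrib_left)
  also have "\<dots> \<le> 5 * N x powr r"
    using lp_fin_iff[OF fp N_nonneg[OF x], of x] x U by auto
  finally show ?thesis .
qed

text \<open>The block \<open>j\<close> carries a fixed proportion of the mass that \<open>x\<close> has nearby, and there \<open>y\<close> is as
  small relative to \<open>x\<close> as it is globally: summing the opposite inequalities over all blocks would
  contradict \<open>N y \<le> \<kappa> N x\<close>.\<close>

lemma good_block:
  fixes x y :: "int \<Rightarrow> 'b::real_normed_vector"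
  assumes x: "x \<in> lp p" "x \<noteq> 0" and y: "y \<in> lp p" and \<kappa>: "\<kappa> > 0" "N y \<le> \<kappa> * N x" and D: "D > 0"
  shows "\<exists>j. restr (blk D j) x \<noteq> 0 \<and> N (restr (nbhd D j) y) \<le> 20 * \<kappa> * N (restr (blk D j) x)
    \<and> N (restr (nbhd D j) x) \<le> 20 * N (restr (blk D j) x)"
proof (cases finp)
  case True
  note r1 = r_ge_1[OF True]
  have Nx: "N x > 0" using N_pos x by blast
  show ?thesis
  proof (rule ccontr)
    assume neg: "\<not> ?thesis"
    have bad: "N (restr (blk D j) x) powr r \<le>
        (N (restr (nbhd D j) y) / (20 * \<kappa>)) powr r + (N (restr (nbhd D j) x) / 20) powr r" for j
    proof (cases "restr (blk D j) x = 0")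
      case False
      have n0: "0 \<le> N (restr (blk D j) x)" by (intro N_nonneg lp_restr x)
      consider "20 * \<kappa> * N (restr (blk D j) x) \<le> N (restr (nbhd D j) y)"
        | "20 * N (restr (blk D j) x) \<le> N (restr (nbhd D j) x)"
        using neg False by fastforce
      then show ?thesis
      proof cases
        case 1
        then have "N (restr (blk D j) x) \<le> N (restr (nbhd D j) y) / (20 * \<kappa>)"
          using \<kappa> by (simp add: field_simps)
        then have "N (restr (blk D j) x) powr r \<le> (N (restr (nbhd D j) y) / (20 * \<kappa>)) powr r"
          using n0 r1 by (intro powr_mono2) auto
        then show ?thesis by (simp add: add_increasing2)
      next
        case 2
        then have "N (restr (blk D j) x) powr r \<le> (N (restr (nbhd D j) x) / 20) powr r"
          using n0 r1 by (intro powr_mono2) auto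
        then show ?thesis by (simp add: add_increasing)
      qed
    qed simp
    have s: "(\<lambda>n. norm (x n) powr r) summable_on UNIV" using x True by (auto simp: lp_def)
    \<comment> \<open>A finite set carrying more than half of \<open>N x powr r\<close>; only the
      finitely many blocks that meet it have to be summed.\<close>
    obtain F where F: "finite F" "N x powr r / 2 < (\<Sum>k\<in>F. norm (x k) powr r)"
    proof -
      have "\<not> (\<forall>F. finite F \<longrightarrow> (\<Sum>k\<in>F. norm (x k) powr r) \<le> (N x / 2 powr (1/r)) powr r)"
      proof
        assume "\<forall>F. finite F \<longrightarrow> (\<Sum>k\<in>F. norm (x k) powr r) \<le> (N x / 2 powr (1/r)) powr r"
        then have "N x \<le> N x / 2 powr (1/r)"
          using lp_fin_iff[OF True, of "N x / 2 powr (1/r)" x] Nx by simp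
        moreover have "2 powr (1/r) > (1::real)" using r1 by simp
        ultimately show False using Nx by (simp add: pos_le_divide_eq)
      qed
      moreover have "(N x / 2 powr (1/r)) powr r = N x powr r / 2"
        using Nx r1 by (simp add: powr_divide powr_powr)
      ultimately show ?thesis using that by (auto simp: not_le)
    qed
    define J where "J = (\<lambda>k. k div D) ` F"
    have J: "finite J" using F by (simp add: J_def)
    have sub: "F \<subseteq> (\<Union>j\<in>J. blk D j)" using D by (auto simp: J_def mem_blk)
    have "(\<Sum>k\<in>F. norm (x k) powr r) \<le> (\<Sum>k\<in>(\<Union>j\<in>J. blk D j). norm (x k) powr r)"
      by (rule sum_mono2) (use sub J in auto)
    also have "\<dots> = (\<Sum>j\<in>J. \<Sum>k\<in>blk D j. norm (x k) powr r)"
      by (rule sum.UNION_disjoint) (use J D in \<open>auto simp: mem_blk\<close>)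
    also have "\<dots> = (\<Sum>j\<in>J. N (restr (blk D j) x) powr r)"
      by (simp add: N_restr_powr(2)[OF True])
    also have "\<dots> \<le> (\<Sum>j\<in>J. (N (restr (nbhd D j) y) / (20 * \<kappa>)) powr r + (N (restr (nbhd D j) x) / 20) powr r)"
      by (rule sum_mono) (rule bad)
    also have "\<dots> = (\<Sum>j\<in>J. N (restr (nbhd D j) y) powr r) / (20 * \<kappa>) powr r
        + (\<Sum>j\<in>J. N (restr (nbhd D j) x) powr r) / 20 powr r"
      using \<kappa> by (simp add: sum.distrib powr_divide N_nonneg lp_restr x y sum_divide_distrib)
    also have "\<dots> \<le> 5 * N y powr r / (20 * \<kappa>) powr r + 5 * N x powr r / 20 powr r"
      using sum_nbhd_powr_le[OF True _ D J] x y by (intro add_mono divide_right_mono) auto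
    also have "\<dots> \<le> 5 * (\<kappa> * N x) powr r / (20 * \<kappa>) powr r + 5 * N x powr r / 20 powr r"
      using \<kappa> r1 N_nonneg[OF y] Nx
      by (intro add_mono divide_right_mono mult_left_mono powr_mono2) auto
    also have "\<dots> = 10 * N x powr r / 20 powr r"
      using \<kappa> Nx by (simp add: powr_mult)
    \<comment> \<open>The terms for \<open>y\<close> and for \<open>x\<close> contribute five each,
      and \<open>10 / 20 powr r \<le> 1 / 2\<close> because \<open>r \<ge> 1\<close>. This
      contradicts the choice of \<open>F\<close> and is the origin of the constant 20.\<close>
    also have "\<dots> \<le> 10 * N x powr r / 20 powr 1"
      using r1 by (intro divide_left_mono powr_mono) auto
    finally show False using F(2) by simp
  qed
next
  case False
  have Nx: "N x > 0" using N_pos x by blast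
  have "\<not> (\<forall>k. norm (x k) \<le> N x / 2)"
    using lp_sup_le_iff[OF False x(1), of "N x / 2"] Nx by auto
  then obtain k where k: "norm (x k) > N x / 2" by (auto simp: not_le)
  define j where "j = k div D"
  have kj: "k \<in> blk D j" using D by (simp add: mem_blk j_def)
  have "norm (restr (blk D j) x k) \<le> N (restr (blk D j) x)" by (intro norm_le_N lp_restr x)
  then have big: "N x / 2 < N (restr (blk D j) x)" using k kj by (simp add: restr_def)
  have "N (restr (nbhd D j) y) \<le> \<kappa> * N x" using N_restr[OF y] \<kappa> by (meson order_trans)
  also have "\<dots> \<le> \<kappa> * (20 * N (restr (blk D j) x))" using big \<kappa> Nx by (intro mult_left_mono) auto
  finally have 1: "N (restr (nbhd D j) y) \<le> 20 * \<kappa> * N (restr (blk D j) x)" by simp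
  have 2: "N (restr (nbhd D j) x) \<le> 20 * N (restr (blk D j) x)"
    using N_restr[OF x(1), of "nbhd D j"] big Nx by linarith
  have "restr (blk D j) x \<noteq> 0" using big Nx by auto
  then show ?thesis using 1 2 by blast
qed

text \<open>At any index at most five of the pieces are nonzero, so their sum is at most five times
  the largest. For finite exponents the r-th power of the largest is at most the sum of all r-th
  powers; since the sets \<open>blk D j\<close> are disjoint, the bounds on the pieces then add up
  to a single copy of \<open>N y\<close>.\<close>

lemma paste_blocks:
  fixes y :: "int \<Rightarrow> 'b::real_normed_vector" and e :: "int \<Rightarrow> int \<Rightarrow> 'b"
  assumes y: "y \<in> lp p" and D: "D > 0" and J: "finite J" and c: "c \<ge> 0"
    and e: "\<And>j. j \<in> J \<Longrightarrow> e j \<in> lp p" "\<And>j. j \<in> J \<Longrightarrow> supp (e j) \<subseteq> nbhd D j"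
      "\<And>j. j \<in> J \<Longrightarrow> N (e j) \<le> c * N (restr (blk D j) y)"
  shows "N (\<Sum>j\<in>J. e j) \<le> 5 * c * N y"
proof -
  define J' where "J' k = {j \<in> J. k \<in> nbhd D j}" for k
  have J': "finite (J' k)" "card (J' k) \<le> 5" for k
    using J card_nbhd_le[OF D J] by (auto simp: J'_def)
  have loc: "(\<Sum>j\<in>J. e j) k = (\<Sum>j\<in>J' k. e j k)" for k
    unfolding sum_apply by (rule sum.mono_neutral_right) (use J e(2) in \<open>auto simp: J'_def supp_def\<close>)
  have S: "(\<Sum>j\<in>J. e j) \<in> lp p" using e(1) by (rule lp_sum)
  have bound: "norm ((\<Sum>j\<in>J. e j) k) \<le> 5 * M" if M: "M \<ge> 0" "\<And>j. j \<in> J' k \<Longrightarrow> norm (e j k) \<le> M" for k M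
  proof -
    have "norm ((\<Sum>j\<in>J. e j) k) \<le> (\<Sum>j\<in>J' k. norm (e j k))" unfolding loc by (rule norm_sum)
    also have "\<dots> \<le> (\<Sum>j\<in>J' k. M)" using M by (intro sum_mono) auto
    also have "\<dots> \<le> 5 * M" using J'(2)[of k] M(1) by (simp add: mult_right_mono)
    finally show ?thesis .
  qed
  show ?thesis
  proof (cases finp)
    case True
    note r1 = r_ge_1[OF True]
    have pt: "norm ((\<Sum>j\<in>J. e j) k) powr r \<le> 5 powr r * (\<Sum>j\<in>J. norm (e j k) powr r)" for k
    proof (cases "J' k = {}")
      case True
      then show ?thesis using bound[of 0 k] by (simp add: sum_nonneg)
    next
      case False
      obtain i where i: "i \<in> J' k" "\<And>j. j \<in> J' k \<Longrightarrow> norm (e j k) \<le> norm (e i k)"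
        using obtains_MAX[OF J'(1) False, of "\<lambda>j. norm (e j k)"] J'(1) by (metis Max_ge finite_imageI imageI)
      have "norm ((\<Sum>j\<in>J. e j) k) powr r \<le> (5 * norm (e i k)) powr r"
        using bound[of "norm (e i k)" k] i r1 by (intro powr_mono2) auto
      also have "\<dots> = 5 powr r * norm (e i k) powr r" by (simp add: powr_mult)
      also have "\<dots> \<le> 5 powr r * (\<Sum>j\<in>J. norm (e j k) powr r)"
        using i(1) J by (intro mult_left_mono member_le_sum) (auto simp: J'_def)
      finally show ?thesis .
    qed
    have "(\<Sum>k\<in>F. norm ((\<Sum>j\<in>J. e j) k) powr r) \<le> (5 * c * N y) powr r" if F: "finite F" for F
    proof -
      have "(\<Sum>k\<in>F. norm ((\<Sum>j\<in>J. e j) k) powr r) \<le> (\<Sum>k\<in>F. 5 powr r * (\<Sum>j\<in>J. norm (e j k) powr r))"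
        by (rule sum_mono) (rule pt)
      also have "\<dots> = 5 powr r * (\<Sum>j\<in>J. \<Sum>k\<in>F. norm (e j k) powr r)"
        by (subst sum.swap) (simp add: sum_distrib_left)
      also have "\<dots> \<le> 5 powr r * (\<Sum>j\<in>J. (c * N (restr (blk D j) y)) powr r)"
      proof (intro mult_left_mono sum_mono)
        fix j assume j: "j \<in> J"
        have "0 \<le> c * N (restr (blk D j) y)" using c N_nonneg[OF lp_restr[OF y]] by simp
        then show "(\<Sum>k\<in>F. norm (e j k) powr r) \<le> (c * N (restr (blk D j) y)) powr r"
          using lp_fin_iff[OF True, of "c * N (restr (blk D j) y)" "e j"] e(1,3) j F by blast
      qed simp
      also have "\<dots> = (5 * c) powr r * (\<Sum>j\<in>J. N (restr (blk D j) y) powr r)"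
        using c by (simp add: powr_mult N_nonneg lp_restr y sum_distrib_left mult.assoc)
      also have "(\<Sum>j\<in>J. N (restr (blk D j) y) powr r) = (\<Sum>j\<in>J. \<Sum>k\<in>blk D j. norm (y k) powr r)"
        by (simp add: N_restr_powr(2)[OF True])
      also have "\<dots> = (\<Sum>k\<in>(\<Union>j\<in>J. blk D j). norm (y k) powr r)"
        by (rule sum.UNION_disjoint[symmetric]) (use J D in \<open>auto simp: mem_blk\<close>)
      also have "(5 * c) powr r * \<dots> \<le> (5 * c) powr r * N y powr r"
        using lp_fin_iff[OF True N_nonneg[OF y], of y] y J by (intro mult_left_mono) auto
      also have "\<dots> = (5 * c * N y) powr r" using c N_nonneg[OF y] by (simp add: powr_mult)
      finally show ?thesis .
    qed
    then show ?thesis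
      using lp_fin_iff[OF True, of "5 * c * N y"] c N_nonneg[OF y] by auto
  next
    case False
    have "norm (e j k) \<le> c * N y" if "j \<in> J' k" for j k
    proof -
      have j: "j \<in> J" using that by (simp add: J'_def)
      have "norm (e j k) \<le> N (e j)" using e(1)[OF j] by (rule norm_le_N)
      also have "\<dots> \<le> c * N (restr (blk D j) y)" by (rule e(3)[OF j])
      also have "\<dots> \<le> c * N y" using N_restr[OF y] c by (intro mult_left_mono) auto
      finally show ?thesis .
    qed
    then have "norm ((\<Sum>j\<in>J. e j) k) \<le> 5 * (c * N y)" for k
      using bound[of "c * N y" k] c N_nonneg[OF y] by auto
    then show ?thesis using lp_sup_le_iff[OF False S] by (simp add: mult.assoc)
  qed
qed

end

section \<open>Operators on sequence spaces\<close>

text \<open>Resolution eta-expands sequences; these rules undo the effect of simplifying the expanded forms.\<close>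

lemma fold_seq_arith:
  fixes x y :: "int \<Rightarrow> 'a::real_normed_vector"
  shows "(\<lambda>k. x k - y k) = x - y" "(\<lambda>k. x k + y k) = x + y" "(\<lambda>k. - x k) = - x" "(\<lambda>k::int. 0) = (0 :: int \<Rightarrow> 'a)"
  by (auto simp: fun_eq_iff)

locale lp_space = lp_exponent p + normed_scale smul
  for p :: ennreal and smul :: "'k::{real_normed_field, euclidean_space} \<Rightarrow> 'a::banach \<Rightarrow> 'a"
begin

declare fold_seq_arith [simp]

text \<open>\<open>lin\<close> and \<open>bnd\<close> split membership in \<open>bounded_ops\<close>
  into linearity and a real constant, so that estimates stay out of \<open>ennreal\<close>.\<close>

definition lin :: "'a seq_op \<Rightarrow> bool" where
  "lin T \<longleftrightarrow> (\<forall>x\<in>lp p. T x \<in> lp p) \<and> (\<forall>x\<in>lp p. \<forall>y\<in>lp p. T (x + y) = T x + T y)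
    \<and> (\<forall>c. \<forall>x\<in>lp p. T (seq_scale smul c x) = seq_scale smul c (T x))"

definition bnd :: "'a seq_op \<Rightarrow> real \<Rightarrow> bool" where
  "bnd T C \<longleftrightarrow> (\<forall>x\<in>lp p. N (T x) \<le> C * N x)"

lemma linD:
  assumes "lin T"
  shows "x \<in> lp p \<Longrightarrow> T x \<in> lp p" "x \<in> lp p \<Longrightarrow> y \<in> lp p \<Longrightarrow> T (x + y) = T x + T y"
    "x \<in> lp p \<Longrightarrow> T (seq_scale smul c x) = seq_scale smul c (T x)"
  using assms by (auto simp: lin_def)

lemma bndD: "bnd T C \<Longrightarrow> x \<in> lp p \<Longrightarrow> N (T x) \<le> C * N x"
  by (auto simp: bnd_def)

lemma bnd_mono: "bnd T C \<Longrightarrow> C \<le> C' \<Longrightarrow> bnd T C'"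
  unfolding bnd_def using N_nonneg by (meson mult_right_mono order_trans)

lemma lp_seq_scale: "x \<in> lp p \<Longrightarrow> seq_scale smul c x \<in> lp p"
  and N_seq_scale: "x \<in> lp p \<Longrightarrow> N (seq_scale smul c x) = norm c * N x"
  using lp_scale_le(1)[of x "norm c" "seq_scale smul c x"]
    lp_scale_eq[of x "norm c" "seq_scale smul c x"]
  by (auto simp: seq_scale_def norm_smul)

lemma seq_scale_minus_one: "seq_scale smul (- 1) x = - x"
  by (simp add: seq_scale_def fun_eq_iff)

lemma lin_diff: "lin T \<Longrightarrow> x \<in> lp p \<Longrightarrow> y \<in> lp p \<Longrightarrow> T (x - y) = T x - T y"
proof -
  assume T: "lin T" and x: "x \<in> lp p" and y: "y \<in> lp p"
  have "T (x - y) = T (x + seq_scale smul (- 1) y)" by (simp add: seq_scale_minus_one)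
  also have "\<dots> = T x + seq_scale smul (- 1) (T y)"
    using linD(2,3)[OF T] x y lp_seq_scale by metis
  finally show ?thesis by (simp add: seq_scale_minus_one)
qed

lemma lin_zero: "lin T \<Longrightarrow> T 0 = 0"
  using lin_diff[of T 0 0] by simp

lemma lin_sum: "lin T \<Longrightarrow> (\<And>i. i \<in> I \<Longrightarrow> f i \<in> lp p) \<Longrightarrow> T (sum f I) = (\<Sum>i\<in>I. T (f i))"
proof (induction I rule: infinite_finite_induct)
  case (insert i I)
  have "T (f i + sum f I) = T (f i) + T (sum f I)"
    using insert.prems by (intro linD(2) lp_sum) auto
  moreover have "T (sum f I) = (\<Sum>i\<in>I. T (f i))" using insert by blast
  ultimately show ?case unfolding sum.insert[OF insert(1,2)] by (simp only:)
qed (auto simp: lin_zero)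

lemma lin_minus: "lin S \<Longrightarrow> lin T \<Longrightarrow> lin (S - T)"
  by (auto simp: lin_def seq_scale_def fun_eq_iff scale_right_diff_distrib lp_diff)

lemma lin_comp: "lin S \<Longrightarrow> lin T \<Longrightarrow> lin (S \<circ> T)"
  by (auto simp: lin_def)

lemma bnd_comp: "bnd S C \<Longrightarrow> bnd T D \<Longrightarrow> lin T \<Longrightarrow> C \<ge> 0 \<Longrightarrow> bnd (S \<circ> T) (C * D)"
  unfolding bnd_def comp_def using linD(1)
  by (smt (verit, best) mult.assoc mult_left_mono)

lemma lin_restr: "lin (restr S)"
  by (auto simp: lin_def lp_restr) (auto simp: restr_def seq_scale_def fun_eq_iff)

lemma lin_shift: "lin (shift h)"
  by (auto simp: lin_def lp_shift) (auto simp: shift_def seq_scale_def fun_eq_iff)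

lemma op_norm_le_iff:
  assumes T: "lin T" and C: "C \<ge> 0"
  shows "op_norm p T \<le> ennreal C \<longleftrightarrow> bnd T C"
proof
  assume le: "op_norm p T \<le> ennreal C"
  show "bnd T C" unfolding bnd_def
  proof
    fix x :: "int \<Rightarrow> 'a" assume x: "x \<in> lp p"
    show "N (T x) \<le> C * N x"
    proof (cases "x = 0")
      case True
      then show ?thesis by (simp add: lin_zero[OF T])
    next
      case False
      then have n: "N x > 0" using N_pos x by blast
      let ?c = "of_real (1 / N x) :: 'k"
      let ?y = "seq_scale smul ?c x"
      have y: "?y \<in> lp p" "N ?y = 1" using x n by (auto simp: lp_seq_scale N_seq_scale norm_divide)
      then have "ennreal (N (T ?y)) \<le> op_norm p T"
        unfolding op_norm_def by (intro SUP_upper) auto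
      then have "ennreal (N (T ?y)) \<le> ennreal C" using le by simp
      then have "N (T ?y) \<le> C" using C by (simp add: ennreal_le_iff)
      also have "N (T ?y) = N (T x) / N x"
        using linD[OF T] x n by (simp add: N_seq_scale norm_divide)
      finally show ?thesis using n by (simp add: field_simps)
    qed
  qed
next
  assume b: "bnd T C"
  show "op_norm p T \<le> ennreal C" unfolding op_norm_def
  proof (rule SUP_least)
    fix x :: "int \<Rightarrow> 'a" assume "x \<in> {x \<in> lp p. N x \<le> 1}"
    then have "N (T x) \<le> C * N x" "C * N x \<le> C" using b C by (auto simp: bnd_def mult_left_le)
    then show "ennreal (N (T x)) \<le> ennreal C" by (intro ennreal_leI) simp
  qed
qed

lemma bounded_ops_iff: "T \<in> bounded_ops smul p \<longleftrightarrow> lin T \<and> (\<exists>C\<ge>0. bnd T C)"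
proof -
  have "op_norm p T < \<infinity> \<longleftrightarrow> (\<exists>C\<ge>0. bnd T C)" if T: "lin T"
  proof
    assume "op_norm p T < \<infinity>"
    then have "op_norm p T \<le> ennreal (enn2real (op_norm p T))" by (simp add: less_top)
    then show "\<exists>C\<ge>0. bnd T C"
      using op_norm_le_iff[OF T, of "enn2real (op_norm p T)"] enn2real_nonneg by blast
  next
    assume "\<exists>C\<ge>0. bnd T C"
    then show "op_norm p T < \<infinity>"
      using op_norm_le_iff[OF T] by (metis ennreal_less_top infinity_ennreal_def order_le_less_trans)
  qed
  then show ?thesis unfolding bounded_ops_def lin_def by auto
qed

lemma bounded_opsE:
  assumes "T \<in> bounded_ops smul p"
  obtains C where "lin T" "C > 0" "bnd T C"
proof -
  obtain C where "lin T" "C \<ge> 0" "bnd T C" using assms bounded_ops_iff by blast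
  then show ?thesis using that[of "C + 1"] bnd_mono[of T C "C + 1"] by simp
qed

text \<open>\<open>P_compact_ops\<close> and \<open>P_strong_limit\<close> are stated through such
  sums of operator norms; this turns both into estimates with a real error.\<close>

lemma op_norm_pair_lim:
  assumes S: "\<And>n. lin (S n)" and T: "\<And>n. lin (T n)"
  shows "(\<lambda>n::nat. op_norm p (S n) + op_norm p (T n)) \<longlonglongrightarrow> 0 \<longleftrightarrow>
    (\<forall>e>0. \<exists>M. \<forall>n\<ge>M. bnd (S n) e \<and> bnd (T n) e)" (is "?L \<longleftrightarrow> ?R")
proof
  assume ?L
  show ?R
  proof (intro allI impI)
    fix e :: real assume e: "e > 0"
    have "eventually (\<lambda>n. op_norm p (S n) + op_norm p (T n) < ennreal e) sequentially"
      by (rule order_tendstoD(2)[OF \<open>?L\<close>]) (use e in simp)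
    then obtain M where M: "\<And>n. n \<ge> M \<Longrightarrow> op_norm p (S n) + op_norm p (T n) < ennreal e"
      by (auto simp: eventually_sequentially)
    have "bnd (S n) e \<and> bnd (T n) e" if "n \<ge> M" for n
    proof -
      have "op_norm p (S n) \<le> op_norm p (S n) + op_norm p (T n)"
        "op_norm p (T n) \<le> op_norm p (S n) + op_norm p (T n)"
        by (auto intro: add_increasing add_increasing2)
      then have "op_norm p (S n) \<le> ennreal e" "op_norm p (T n) \<le> ennreal e"
        using less_imp_le[OF M[OF that]] by (meson order_trans)+
      then show ?thesis using op_norm_le_iff S T e by auto
    qed
    then show "\<exists>M. \<forall>n\<ge>M. bnd (S n) e \<and> bnd (T n) e" by blast
  qed
next
  assume R: ?R
  show ?L
  proof (rule order_tendstoI)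
    fix a :: ennreal assume "a > 0"
    obtain e where e: "e > 0" "ennreal e + ennreal e < a"
    proof (cases a)
      case (real b)
      then have "ennreal (b/3) + ennreal (b/3) < a" using \<open>a > 0\<close>
        by (simp add: ennreal_plus[symmetric] ennreal_less_iff del: ennreal_plus)
      then show ?thesis using that[of "b/3"] real \<open>a > 0\<close> by auto
    next
      case top
      then show ?thesis using that[of 1] by simp
    qed
    obtain M where M: "\<And>n. n \<ge> M \<Longrightarrow> bnd (S n) e \<and> bnd (T n) e" using R e by blast
    have "op_norm p (S n) + op_norm p (T n) < a" if "n \<ge> M" for n
    proof -
      have "op_norm p (S n) \<le> ennreal e" "op_norm p (T n) \<le> ennreal e"
        using op_norm_le_iff[OF S] op_norm_le_iff[OF T] e M[OF that] by auto
      then show ?thesis using e(2) by (meson add_mono order_le_less_trans)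
    qed
    then show "eventually (\<lambda>n. op_norm p (S n) + op_norm p (T n) < a) sequentially"
      by (auto simp: eventually_sequentially)
  qed simp
qed

lemma trunc_P_restr: "trunc_P n = restr (win n)"
  by (auto simp: trunc_P_def restr_def fun_eq_iff)

lemma trunc_Q_restr: "trunc_Q n = restr (- win n)"
  by (auto simp: trunc_Q_def trunc_P_def restr_def fun_eq_iff)

text \<open>Successive approximation: solving up to half of the right-hand side, and then again for
  the error, produces the solution as a geometric series, whence the factor two. The set
  \<open>E\<close> must contain all residuals. It is the range of the operator in the open mapping
  argument, and the set of sequences supported in a given set when equations are solved on
  windows.\<close>

lemma series_solve:
  assumes R: "lin R" "bnd R C'" and E: "E \<subseteq> lp p" "\<And>x y. y \<in> E \<Longrightarrow> x \<in> lp p \<Longrightarrow> y - R x \<in> E"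
    and C: "C \<ge> 0"
    and half: "\<And>y. y \<in> E \<Longrightarrow> \<exists>x\<in>lp p. N x \<le> C * N y \<and> N (y - R x) \<le> N y / 2"
    and y: "y \<in> E"
  shows "\<exists>x\<in>lp p. N x \<le> 2 * C * N y \<and> R x = y"
proof -
  obtain s where s: "\<And>y. y \<in> E \<Longrightarrow> s y \<in> lp p \<and> N (s y) \<le> C * N y \<and> N (y - R (s y)) \<le> N y / 2"
    using half by metis
  define ys where "ys = rec_nat y (\<lambda>n z. z - R (s z))"
  have ys0: "ys 0 = y" and ysS: "\<And>n. ys (Suc n) = ys n - R (s (ys n))"
    by (simp_all add: ys_def)
  have ysE: "ys n \<in> E" for n
  proof (induction n)
    case (Suc n)
    then show ?case unfolding ysS using s E(2) by blast
  qed (simp add: ys0 y)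
  have ysN: "N (ys n) \<le> N y * (1/2) ^ n" for n
  proof (induction n)
    case (Suc n)
    have "N (ys (Suc n)) \<le> N (ys n) / 2" using s[OF ysE[of n]] by (simp add: ysS)
    then show ?case using Suc by simp
  qed (simp add: ys0)
  define xs where "xs n = (\<Sum>i<n. s (ys i))" for n
  have xs: "xs n \<in> lp p" for n unfolding xs_def using s ysE by (intro lp_sum) auto
  have Rxs: "y - R (xs n) = ys n" for n
  proof (induction n)
    case 0
    have "xs 0 = 0" by (simp add: xs_def)
    then show ?case unfolding ys0 using lin_zero[OF R(1)] by (simp only: diff_zero)
  next
    case (Suc n)
    have "xs (Suc n) = xs n + s (ys n)" by (simp add: xs_def)
    then have "R (xs (Suc n)) = R (xs n) + R (s (ys n))"
      using linD(2)[OF R(1) xs] s[OF ysE] by simp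
    then have "y - R (xs (Suc n)) = (y - R (xs n)) - R (s (ys n))"
      by (simp add: algebra_simps)
    then show ?case using Suc by (simp add: ysS)
  qed
  have y0: "0 \<le> N y" using N_nonneg y E by blast
  \<comment> \<open>The difference of two powers, rather than the first power alone, is what the
    induction on \<open>d\<close> reproduces exactly.\<close>
  have diff: "N (xs (n + d) - xs n) \<le> 2 * C * N y * ((1/2) ^ n - (1/2) ^ (n + d))" for n d
  proof (induction d)
    case (Suc d)
    have e: "xs (n + Suc d) - xs n = (xs (n + d) - xs n) + s (ys (n + d))"
      by (simp add: xs_def algebra_simps)
    have "N (s (ys (n + d))) \<le> C * N (ys (n + d))" using s[OF ysE] by blast
    also have "\<dots> \<le> C * (N y * (1/2) ^ (n + d))" using ysN C by (intro mult_left_mono) auto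
    finally have "N (xs (n + Suc d) - xs n)
        \<le> 2 * C * N y * ((1/2) ^ n - (1/2) ^ (n + d)) + C * (N y * (1/2) ^ (n + d))"
      unfolding e using Suc N_triangle[OF lp_diff[OF xs xs], of "s (ys (n + d))" "n + d" n] s[OF ysE[of "n + d"]]
      by linarith
    also have "\<dots> = 2 * C * N y * ((1/2) ^ n - (1/2) ^ (n + Suc d))"
      by (simp add: algebra_simps)
    finally show ?case .
  qed simp
  have diff': "N (xs m - xs n) \<le> 2 * C * N y * (1/2) ^ n" if "m \<ge> n" for m n
  proof -
    have "N (xs m - xs n) \<le> 2 * C * N y * ((1/2) ^ n - (1/2) ^ m)" using diff[of n "m - n"] that by simp
    also have "\<dots> \<le> 2 * C * N y * (1/2) ^ n" using C y0 by (intro mult_left_mono) auto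
    finally show ?thesis .
  qed
  have "(\<lambda>n. 2 * C * N y * (1/2) ^ n) \<longlonglongrightarrow> 2 * C * N y * 0"
    by (intro tendsto_intros LIMSEQ_power_zero) simp
  then have lim: "\<exists>M. \<forall>n\<ge>M. 2 * C * N y * (1/2) ^ n < e" if "e > 0" for e
    using order_tendstoD(2)[of _ 0 sequentially e] that by (simp add: eventually_sequentially)
  have "\<exists>M. \<forall>m\<ge>M. \<forall>n\<ge>M. N (xs m - xs n) \<le> e" if "e > 0" for e
  proof -
    obtain M where M: "\<And>n. n \<ge> M \<Longrightarrow> 2 * C * N y * (1/2) ^ n < e" using lim[OF \<open>e > 0\<close>] by blast
    have "N (xs m - xs n) \<le> e" if "m \<ge> M" "n \<ge> M" for m n
      using diff'[of m n] diff'[of n m] M[of n] M[of m] that N_diff_commute[OF xs xs, of m n]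
      by (cases "m \<ge> n") auto
    then show ?thesis by blast
  qed
  then obtain x where x: "x \<in> lp p" and xlim: "\<And>e. e > 0 \<Longrightarrow> \<exists>M. \<forall>m\<ge>M. N (xs m - x) \<le> e"
    using lp_complete[of xs] xs by blast
  have C': "bnd R (\<bar>C'\<bar> + 1)" using bnd_mono[OF R(2), of "\<bar>C'\<bar> + 1"] by simp
  have yl: "y \<in> lp p" using y E by blast
  have "N x \<le> 2 * C * N y + e" if "e > 0" for e
  proof -
    obtain M where "N (xs M - x) \<le> e" using xlim[OF \<open>e > 0\<close>] by blast
    moreover have "N (xs M) \<le> 2 * C * N y" using diff'[of 0 M] by (simp add: xs_def)
    ultimately show ?thesis
      using N_le_diff[OF x xs, of M] N_diff_commute[OF x xs, of M] by linarith
  qed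
  then have 1: "N x \<le> 2 * C * N y" by (rule field_le_epsilon)
  have "N (y - R x) \<le> 0 + e" if "e > 0" for e
  proof -
    obtain M where M: "\<And>m. m \<ge> M \<Longrightarrow> N (xs m - x) \<le> e / (2 * (\<bar>C'\<bar> + 1))"
      using xlim[of "e / (2 * (\<bar>C'\<bar> + 1))"] \<open>e > 0\<close> by (auto simp: field_simps)
    have "(\<lambda>n. N y * (1/2) ^ n) \<longlonglongrightarrow> N y * 0" by (intro tendsto_intros LIMSEQ_power_zero) simp
    then obtain M' where M': "\<And>m. m \<ge> M' \<Longrightarrow> N y * (1/2) ^ m < e / 2"
      using order_tendstoD(2)[of _ 0 sequentially "e/2"] \<open>e > 0\<close> by (auto simp: eventually_sequentially)
    let ?m = "max M M'"
    have "y - R x = (y - R (xs ?m)) + R (xs ?m - x)"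
      using lin_diff[OF R(1) xs x] by (simp add: algebra_simps)
    then have "N (y - R x) = N ((y - R (xs ?m)) + R (xs ?m - x))" by (simp only:)
    also have "\<dots> \<le> N (y - R (xs ?m)) + N (R (xs ?m - x))"
      by (intro N_triangle lp_diff linD(1)[OF R(1)] xs x yl)
    also have "N (R (xs ?m - x)) \<le> (\<bar>C'\<bar> + 1) * N (xs ?m - x)"
      by (intro bndD[OF C'] lp_diff xs x)
    also have "\<dots> \<le> (\<bar>C'\<bar> + 1) * (e / (2 * (\<bar>C'\<bar> + 1)))"
      using M[of ?m] by (intro mult_left_mono) auto
    also have "\<dots> = e / 2" by (simp add: field_simps add_nonneg_eq_0_iff)
    also have "N (y - R (xs ?m)) \<le> e / 2" using Rxs[of ?m] ysN[of ?m] M'[of ?m] by simp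
    finally show ?thesis by simp
  qed
  then have "N (y - R x) \<le> 0" by (rule field_le_epsilon)
  moreover have "y - R x \<in> lp p" by (intro lp_diff linD(1)[OF R(1)] x yl)
  ultimately have "y - R x = 0" using N_pos by fastforce
  then have "R x = y" by simp
  then show ?thesis using 1 x by blast
qed

section \<open>The complete metric space and the open mapping principle\<close>

lemma Metric_space_lp: "Metric_space (lp p :: (int \<Rightarrow> 'a) set) (lp_dist p)"
proof
  fix x y :: "int \<Rightarrow> 'a"
  show "0 \<le> lp_dist p x y" by (simp add: lp_dist_def N_nonneg lp_diff)
  show "lp_dist p x y = lp_dist p y x" by (simp add: lp_dist_def N_diff_commute)
next
  fix x y :: "int \<Rightarrow> 'a" assume "x \<in> lp p" "y \<in> lp p"
  then show "lp_dist p x y = 0 \<longleftrightarrow> x = y" using N_eq_0[of "x - y"] by (simp add: lp_dist_def lp_diff)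
next
  fix x y z :: "int \<Rightarrow> 'a" assume a: "x \<in> lp p" "y \<in> lp p" "z \<in> lp p"
  have "N (x - z) \<le> N (x - y) + N (y - z)"
    using N_triangle[of "x - y" "y - z"] a by (simp add: lp_diff)
  then show "lp_dist p x z \<le> lp_dist p x y + lp_dist p y z" using a by (simp add: lp_dist_def)
qed

lemma mcomplete_lp: "Metric_space.mcomplete (lp p :: (int \<Rightarrow> 'a) set) (lp_dist p)"
proof -
  interpret M: Metric_space "lp p :: (int \<Rightarrow> 'a) set" "lp_dist p" by (rule Metric_space_lp)
  show ?thesis unfolding M.mcomplete_def
  proof (intro allI impI)
    fix f :: "nat \<Rightarrow> int \<Rightarrow> 'a" assume f: "M.MCauchy f"
    then have fl: "f n \<in> lp p" for n by (auto simp: M.MCauchy_def)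
    have "\<exists>M. \<forall>m\<ge>M. \<forall>n\<ge>M. N (f m - f n) \<le> e" if "e > 0" for e
    proof -
      obtain M where "\<forall>n n'. M \<le> n \<longrightarrow> M \<le> n' \<longrightarrow> lp_dist p (f n) (f n') < e"
        using f \<open>e > 0\<close> unfolding M.MCauchy_def by blast
      then show ?thesis using fl by (auto simp: lp_dist_def intro!: exI[of _ M] less_imp_le)
    qed
    then obtain x where x: "x \<in> lp p" "\<And>e. e > 0 \<Longrightarrow> \<exists>M. \<forall>m\<ge>M. N (f m - x) \<le> e"
      using lp_complete[of f] fl by blast
    have "\<exists>M. \<forall>m\<ge>M. f m \<in> lp p \<and> lp_dist p (f m) x < e" if "e > 0" for e
    proof -
      obtain M where "\<And>m. m \<ge> M \<Longrightarrow> N (f m - x) \<le> e / 2" using x(2)[of "e/2"] \<open>e > 0\<close> by auto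
      then show ?thesis using fl x(1) \<open>e > 0\<close>
        by (intro exI[of _ M]) (auto simp: lp_dist_def intro: le_less_trans[of _ "e/2"])
    qed
    then show "\<exists>x. limitin M.mtopology f x sequentially"
      using x(1) unfolding M.limit_metric_sequentially by blast
  qed
qed

text \<open>Open mapping onto the range, which is complete because it is closed. By Baire's theorem
  the image of some ball \<open>N x \<le> n\<close> is dense in a ball of the range. Subtracting
  approximants of two points of that ball and rescaling solves every equation up to half its
  right-hand side, and \<open>series_solve\<close> removes the error.\<close>

lemma closed_range_imp_bounded_preimages:
  assumes T: "lin T" "bnd T C0"
    and cl: "closedin (Metric_space.mtopology (lp p) (lp_dist p)) (T ` lp p)"
  shows "\<exists>C>0. \<forall>y\<in>T ` lp p. \<exists>x\<in>lp p. N x \<le> C * N y \<and> T x = y"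
proof -
  interpret M: Metric_space "lp p :: (int \<Rightarrow> 'a) set" "lp_dist p" by (rule Metric_space_lp)
  define S where "S = T ` lp p"
  have SL: "S \<subseteq> lp p" using linD(1)[OF T(1)] by (auto simp: S_def)
  interpret S: Submetric "lp p :: (int \<Rightarrow> 'a) set" "lp_dist p" S by unfold_locales (rule SL)
  have comp: "S.sub.mcomplete"
    using S.closedin_mcomplete_imp_mcomplete cl mcomplete_lp unfolding S_def by blast
  define G where "G n = S.sub.mtopology closure_of (T ` {x \<in> lp p. N x \<le> real n})" for n :: nat
  have sub: "T ` {x \<in> lp p. N x \<le> real n} \<subseteq> S" for n by (auto simp: S_def)
  have G: "T ` {x \<in> lp p. N x \<le> real n} \<subseteq> G n" for n
    unfolding G_def by (rule closure_of_subset) (use sub in simp)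
  have UN: "\<Union> (range G) = S"
  proof
    show "\<Union> (range G) \<subseteq> S"
      unfolding G_def using closure_of_subset_topspace[of S.sub.mtopology] by fastforce
    show "S \<subseteq> \<Union> (range G)"
    proof
      fix y assume "y \<in> S"
      then obtain x where x: "x \<in> lp p" "y = T x" by (auto simp: S_def)
      have "N x \<le> real (nat \<lceil>N x\<rceil>)" by linarith
      then have "y \<in> G (nat \<lceil>N x\<rceil>)" using G x by blast
      then show "y \<in> \<Union> (range G)" by blast
    qed
  qed
  have "0 \<in> S" unfolding S_def using lin_zero[OF T(1)] lp_zero'(1) by (metis imageI)
  have "S.sub.mtopology interior_of (\<Union> (range G)) \<noteq> {}"
    using \<open>0 \<in> S\<close> interior_of_topspace[of S.sub.mtopology] by (auto simp: UN)
  then obtain n where n: "S.sub.mtopology interior_of G n \<noteq> {}"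
  proof -
    have "countable (range G)" "\<And>n. closedin S.sub.mtopology (G n)" by (auto simp: G_def)
    then have "S.sub.mtopology interior_of (\<Union> (range G)) = {}"
      if "\<And>n. S.sub.mtopology interior_of G n = {}"
      using S.sub.metric_Baire_category_alt[OF comp, of "range G"] that by blast
    then show ?thesis using that \<open>S.sub.mtopology interior_of (\<Union> (range G)) \<noteq> {}\<close> by blast
  qed
  then obtain y0 where y0: "y0 \<in> S.sub.mtopology interior_of G n" by blast
  then obtain r0 where r0: "r0 > 0" "S.sub.mball y0 r0 \<subseteq> G n"
    using openin_interior_of[of S.sub.mtopology "G n"] interior_of_subset[of S.sub.mtopology "G n"]
    unfolding S.sub.openin_mtopology by (meson order_trans)
  have y0S: "y0 \<in> S"
    using y0 interior_of_subset_topspace[of S.sub.mtopology "G n"] by auto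
  have appr: "\<exists>x\<in>lp p. N x \<le> real n \<and> N (z - T x) \<le> e" if "z \<in> G n" "e > 0" for z e
  proof -
    have "\<exists>w\<in>T ` {x \<in> lp p. N x \<le> real n}. w \<in> S.sub.mball z e"
      using that unfolding G_def S.sub.metric_closure_of by blast
    then obtain x where x: "x \<in> lp p" "N x \<le> real n" "T x \<in> S.sub.mball z e" by blast
    then have "N (z - T x) \<le> e" using SL by (auto simp: S.sub.in_mball lp_dist_def split: if_splits)
    then show ?thesis using x by blast
  qed
  \<comment> \<open>The difference of two approximants of norm at most \<open>n\<close>, divided by
    \<open>t = r0 / (2 * N y)\<close>, has norm at most \<open>4 * n / r0 * N y\<close>; the added
    one keeps the constant positive for \<open>n = 0\<close>.\<close>
  let ?C = "4 * real n / r0 + 1"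
  have half: "\<exists>x\<in>lp p. N x \<le> ?C * N y \<and> N (y - T x) \<le> N y / 2" if y: "y \<in> S" for y
  proof (cases "y = 0")
    case True
    then show ?thesis using lin_zero[OF T(1)] by (intro bexI[of _ 0]) auto
  next
    case False
    have yl: "y \<in> lp p" using y SL by blast
    have ny: "N y > 0" using N_pos[OF yl False] .
    \<comment> \<open>Scaled by \<open>t\<close>, the sequence \<open>y\<close> has norm
      \<open>r0 / 2\<close>, so \<open>y1\<close> stays in the ball. The two errors
      \<open>r0 / 8\<close>, divided by \<open>t\<close>, add up to \<open>N y / 2\<close>.\<close>
    define t where "t = r0 / (2 * N y)"
    have t: "t > 0" using r0 ny by (simp add: t_def)
    define y1 where "y1 = y0 + seq_scale smul (of_real t) y"
    have sc: "seq_scale smul (of_real t) y \<in> lp p" "N (seq_scale smul (of_real t) y) = r0 / 2"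
      using yl t ny r0 by (auto simp: lp_seq_scale N_seq_scale norm_divide t_def)
    obtain x0 x' where x0: "x0 \<in> lp p" "y0 = T x0" "x' \<in> lp p" "y = T x'" using y y0S by (auto simp: S_def)
    have "y1 = T (x0 + seq_scale smul (of_real t) x')"
      unfolding y1_def using x0 linD[OF T(1)] lp_seq_scale by metis
    then have y1S: "y1 \<in> S" unfolding S_def using x0 lp_add lp_seq_scale by blast
    have "lp_dist p y0 y1 = r0 / 2"
      using y0S y1S SL sc N_diff_commute[of y0 y1] by (auto simp: lp_dist_def y1_def)
    then have y1G: "y1 \<in> G n" and y0G: "y0 \<in> G n"
      using r0 y0S y1S by (auto simp: S.sub.in_mball subset_iff)
    obtain u where u: "u \<in> lp p" "N u \<le> real n" "N (y1 - T u) \<le> r0 / 8"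
      using appr[OF y1G, of "r0/8"] r0 by auto
    obtain v where v: "v \<in> lp p" "N v \<le> real n" "N (y0 - T v) \<le> r0 / 8"
      using appr[OF y0G, of "r0/8"] r0 by auto
    let ?x = "seq_scale smul (of_real (1/t)) (u - v)"
    have uv: "u - v \<in> lp p" using u v lp_diff by blast
    have x: "?x \<in> lp p" using uv lp_seq_scale by blast
    have "N ?x = (1/t) * N (u - v)" using uv t by (simp add: N_seq_scale norm_divide)
    also have "\<dots> \<le> (1/t) * (2 * real n)"
      using N_diff[OF u(1) v(1)] u v t by (intro mult_left_mono) auto
    also have "\<dots> = 4 * real n / r0 * N y" using r0 ny by (simp add: t_def field_simps)
    also have "\<dots> \<le> ?C * N y" using ny by (simp add: distrib_right)
    finally have 1: "N ?x \<le> ?C * N y" .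
    have yy: "y = seq_scale smul (of_real (1/t)) (seq_scale smul (of_real t) y)"
      using t by (simp add: seq_scale_def smul_of_real fun_eq_iff del: of_real_divide)
    have "y - T ?x = seq_scale smul (of_real (1/t)) (seq_scale smul (of_real t) y - T (u - v))"
      using linD(3)[OF T(1) uv] yy by (simp add: seq_scale_def fun_eq_iff scale_right_diff_distrib)
    also have "seq_scale smul (of_real t) y - T (u - v) = (y1 - T u) - (y0 - T v)"
      using lin_diff[OF T(1) u(1) v(1)] by (simp add: y1_def algebra_simps)
    finally have "N (y - T ?x) = (1/t) * N ((y1 - T u) - (y0 - T v))"
      using t y1S y0S SL u v linD(1)[OF T(1)] by (simp add: N_seq_scale norm_divide lp_diff subset_iff)
    also have "\<dots> \<le> (1/t) * (r0/8 + r0/8)"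
    proof -
      have "N ((y1 - T u) - (y0 - T v)) \<le> N (y1 - T u) + N (y0 - T v)"
        using y1S y0S SL u v linD(1)[OF T(1)] by (intro N_diff lp_diff) auto
      then show ?thesis using u v t by (intro mult_left_mono) auto
    qed
    also have "\<dots> = N y / 2" using r0 ny by (simp add: t_def field_simps)
    finally show ?thesis using 1 x by blast
  qed
  have "\<exists>x\<in>lp p. N x \<le> 2 * ?C * N y \<and> T x = y" if "y \<in> S" for y
  proof (rule series_solve[OF T SL _ _ half that])
    fix x y :: "int \<Rightarrow> 'a" assume "y \<in> S" "x \<in> lp p"
    then obtain z where "z \<in> lp p" "y = T z" by (auto simp: S_def)
    then have "y - T x = T (z - x)" using lin_diff[OF T(1)] \<open>x \<in> lp p\<close> by simp
    then show "y - T x \<in> S" unfolding S_def using lp_diff \<open>z \<in> lp p\<close> \<open>x \<in> lp p\<close> by blast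
  qed (use r0 in simp_all)
  moreover have "2 * ?C > 0" using r0 by (intro mult_pos_pos add_nonneg_pos) auto
  ultimately show ?thesis unfolding S_def by blast
qed

lemma surj_imp_bounded_preimages:
  assumes T: "lin T" "bnd T C0" and "T ` lp p = lp p"
  shows "\<exists>C>0. \<forall>y\<in>lp p. \<exists>x\<in>lp p. N x \<le> C * N y \<and> T x = y"
proof -
  interpret M: Metric_space "lp p :: (int \<Rightarrow> 'a) set" "lp_dist p" by (rule Metric_space_lp)
  have "closedin M.mtopology (T ` lp p)"
    using closedin_topspace[of M.mtopology] assms(3) by simp
  then show ?thesis using closed_range_imp_bounded_preimages[OF T] assms(3) by simp
qed

section \<open>Locality: commutators with slowly varying cutoffs\<close>

definition comm_small :: "'a seq_op \<Rightarrow> real \<Rightarrow> real \<Rightarrow> bool" where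
  "comm_small T e D \<longleftrightarrow> (\<forall>\<phi>. (\<forall>k. 0 \<le> \<phi> k \<and> \<phi> k \<le> 1) \<longrightarrow>
     (\<forall>k l. \<bar>\<phi> k - \<phi> l\<bar> \<le> \<bar>real_of_int (k - l)\<bar> / D) \<longrightarrow>
     (\<forall>x\<in>lp p. N (T (cutoff \<phi> x) - cutoff \<phi> (T x)) \<le> e * N x))"

text \<open>Finite band width is lost in norm limits. Small commutators with cutoffs of slope at
  most \<open>1 / D\<close> pass both to norm limits of band operators and to limit
  operators.\<close>

definition quasilocal :: "'a seq_op \<Rightarrow> bool" where
  "quasilocal T \<longleftrightarrow> (\<forall>e>0. \<exists>D>0. comm_small T e D)"

text \<open>Abstracts a band operator to its width \<open>w\<close> and to the rate at which its
  commutators with cutoffs of slope \<open>1 / D\<close> vanish as \<open>D\<close> grows.\<close>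

definition banded :: "'a seq_op \<Rightarrow> nat \<Rightarrow> real \<Rightarrow> bool" where
  "banded T w M \<longleftrightarrow> lin T \<and> (\<exists>C>0. bnd T C) \<and> M \<ge> 0 \<and> (\<forall>D>0. comm_small T (M / D) D)
     \<and> (\<forall>x\<in>lp p. \<forall>y\<in>lp p. \<forall>k. (\<forall>l. \<bar>l - k\<bar> \<le> int w \<longrightarrow> x l = y l) \<longrightarrow> T x k = T y k)"

lemma comm_smallD:
  assumes "comm_small T e D" "\<And>k. 0 \<le> \<phi> k \<and> \<phi> k \<le> 1"
    "\<And>k l. \<bar>\<phi> k - \<phi> l\<bar> \<le> \<bar>real_of_int (k - l)\<bar> / D" "x \<in> lp p"
  shows "N (T (cutoff \<phi> x) - cutoff \<phi> (T x)) \<le> e * N x"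
  using assms unfolding comm_small_def by blast

text \<open>The commutator of the diagonal \<open>\<alpha>\<close> with a cutoff multiplies by
  \<open>\<phi> (k - \<alpha>) - \<phi> k\<close>, which is at most
  \<open>\<bar>\<alpha>\<bar> / D\<close>; summing over the finitely many diagonals gives
  \<open>M / D\<close>.\<close>

lemma band_op_banded:
  assumes "band_op smul p T" shows "\<exists>w M. banded T w M"
proof -
  obtain F and a :: "int \<Rightarrow> int \<Rightarrow> 'a \<Rightarrow>\<^sub>L 'a" where F: "finite F"
    and a: "\<And>\<alpha>. \<alpha> \<in> F \<Longrightarrow> a \<alpha> \<in> lp \<infinity>"
    and al: "\<And>\<alpha> n. \<alpha> \<in> F \<Longrightarrow> Vector_Spaces.linear smul smul (blinfun_apply (a \<alpha> n))"
    and T: "\<And>x. x \<in> lp p \<Longrightarrow> T x = (\<Sum>\<alpha>\<in>F. mult_op (a \<alpha>) (shift \<alpha> x))"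
    using assms unfolding band_op_def by blast
  have "\<exists>c\<ge>0. \<forall>n. norm (a \<alpha> n) \<le> c" if \<alpha>: "\<alpha> \<in> F" for \<alpha>
  proof -
    obtain b where b: "\<And>n. norm (a \<alpha> n) \<le> b" using a[OF \<alpha>] by (auto simp: lp_def bounded_iff)
    then have "0 \<le> b" using norm_ge_zero order_trans by blast
    then show ?thesis using b by blast
  qed
  then obtain c where c: "\<And>\<alpha>. \<alpha> \<in> F \<Longrightarrow> 0 \<le> c \<alpha>" "\<And>\<alpha> n. \<alpha> \<in> F \<Longrightarrow> norm (a \<alpha> n) \<le> c \<alpha>" by metis
  have Tk: "T x k = (\<Sum>\<alpha>\<in>F. a \<alpha> k (x (k - \<alpha>)))" if "x \<in> lp p" for x k
    by (simp add: T[OF that] sum_apply mult_op_def shift_def)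
  have le: "norm (a \<alpha> n v) \<le> c \<alpha> * norm v" if "\<alpha> \<in> F" for \<alpha> n v
    using norm_blinfun[of "a \<alpha> n" v] c(2)[OF that] by (meson mult_right_mono norm_ge_zero order_trans)
  have m: "mult_op (a \<alpha>) (shift \<alpha> x) \<in> lp p" "N (mult_op (a \<alpha>) (shift \<alpha> x)) \<le> c \<alpha> * N x"
    if "\<alpha> \<in> F" "x \<in> lp p" for \<alpha> x
  proof -
    have "norm (mult_op (a \<alpha>) (shift \<alpha> x) k) \<le> c \<alpha> * norm (shift \<alpha> x k)" for k
      using le[OF that(1)] by (simp add: mult_op_def)
    then show "mult_op (a \<alpha>) (shift \<alpha> x) \<in> lp p" "N (mult_op (a \<alpha>) (shift \<alpha> x)) \<le> c \<alpha> * N x"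
      using lp_scale_le[OF lp_shift[OF that(2)] c(1)[OF that(1)], where y = "mult_op (a \<alpha>) (shift \<alpha> x)"]
        N_shift[OF that(2)] by auto
  qed
  have lin: "lin T" unfolding lin_def
  proof (intro conjI ballI allI)
    fix x :: "int \<Rightarrow> 'a" assume "x \<in> lp p"
    then show "T x \<in> lp p" unfolding T[OF \<open>x \<in> lp p\<close>] using m by (intro lp_sum) auto
  next
    fix x y :: "int \<Rightarrow> 'a" assume "x \<in> lp p" "y \<in> lp p"
    then show "T (x + y) = T x + T y"
      by (simp add: fun_eq_iff Tk lp_add blinfun.add_right sum.distrib)
  next
    fix d and x :: "int \<Rightarrow> 'a" assume x: "x \<in> lp p"
    have "a \<alpha> k (smul d v) = smul d (a \<alpha> k v)" if "\<alpha> \<in> F" for \<alpha> k v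
      using al[OF that] by (simp add: Vector_Spaces.linear_iff)
    then show "T (seq_scale smul d x) = seq_scale smul d (T x)"
      using x by (auto simp: fun_eq_iff Tk lp_seq_scale) (simp add: seq_scale_def Tk scale_sum_right)
  qed
  have "bnd T (\<Sum>\<alpha>\<in>F. c \<alpha>)" unfolding bnd_def
  proof
    fix x :: "int \<Rightarrow> 'a" assume x: "x \<in> lp p"
    have "N (T x) \<le> (\<Sum>\<alpha>\<in>F. N (mult_op (a \<alpha>) (shift \<alpha> x)))"
      unfolding T[OF x] using m x by (intro N_sum) auto
    also have "\<dots> \<le> (\<Sum>\<alpha>\<in>F. c \<alpha> * N x)" using m x by (intro sum_mono) auto
    finally show "N (T x) \<le> (\<Sum>\<alpha>\<in>F. c \<alpha>) * N x" by (simp add: sum_distrib_right)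
  qed
  then have bnd: "\<exists>C>0. bnd T C"
    using bnd_mono[of T "\<Sum>\<alpha>\<in>F. c \<alpha>" "\<bar>\<Sum>\<alpha>\<in>F. c \<alpha>\<bar> + 1"] by (intro exI[of _ "\<bar>\<Sum>\<alpha>\<in>F. c \<alpha>\<bar> + 1"]) auto
  define M where "M = (\<Sum>\<alpha>\<in>F. c \<alpha> * \<bar>real_of_int \<alpha>\<bar>)"
  have M: "M \<ge> 0" unfolding M_def using c by (intro sum_nonneg) auto
  have comm: "comm_small T (M / D) D" if D: "D > 0" for D
    unfolding comm_small_def
  proof (intro allI impI ballI)
    fix \<phi> :: "int \<Rightarrow> real" and x :: "int \<Rightarrow> 'a"
    assume \<phi>: "\<forall>k. 0 \<le> \<phi> k \<and> \<phi> k \<le> 1" and sl: "\<forall>k l. \<bar>\<phi> k - \<phi> l\<bar> \<le> \<bar>real_of_int (k - l)\<bar> / D"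
      and x: "x \<in> lp p"
    have cx: "cutoff \<phi> x \<in> lp p" using x \<phi> by (intro lp_cut) auto
    define z where "z \<alpha> = (\<lambda>k. (\<phi> (k - \<alpha>) - \<phi> k) *\<^sub>R a \<alpha> k (x (k - \<alpha>)))" for \<alpha>
    have e: "T (cutoff \<phi> x) - cutoff \<phi> (T x) = (\<Sum>\<alpha>\<in>F. z \<alpha>)"
      using x cx by (simp add: fun_eq_iff Tk sum_apply z_def cutoff_def blinfun.scaleR_right scaleR_sum_right
          sum_subtractf scaleR_left_diff_distrib)
    have z: "z \<alpha> \<in> lp p \<and> N (z \<alpha>) \<le> c \<alpha> * \<bar>real_of_int \<alpha>\<bar> / D * N x" if "\<alpha> \<in> F" for \<alpha>
    proof -
      have "norm (z \<alpha> k) \<le> c \<alpha> * \<bar>real_of_int \<alpha>\<bar> / D * norm (shift \<alpha> x k)" for k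
      proof -
        have "\<bar>\<phi> (k - \<alpha>) - \<phi> k\<bar> \<le> \<bar>real_of_int \<alpha>\<bar> / D" using sl[rule_format, of "k - \<alpha>" k] by simp
        then have "\<bar>\<phi> (k - \<alpha>) - \<phi> k\<bar> * norm (a \<alpha> k (x (k - \<alpha>))) \<le>
            (\<bar>real_of_int \<alpha>\<bar> / D) * (c \<alpha> * norm (x (k - \<alpha>)))"
          using le[OF that] D by (intro mult_mono) auto
        then show ?thesis by (simp add: z_def shift_def mult_ac)
      qed
      then show ?thesis
        using lp_scale_le[OF lp_shift[OF x], of "c \<alpha> * \<bar>real_of_int \<alpha>\<bar> / D" "z \<alpha>" \<alpha>] c(1)[OF that] D
          N_shift[OF x] by auto
    qed
    have "N (\<Sum>\<alpha>\<in>F. z \<alpha>) \<le> (\<Sum>\<alpha>\<in>F. N (z \<alpha>))" using z by (intro N_sum) auto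
    also have "\<dots> \<le> (\<Sum>\<alpha>\<in>F. c \<alpha> * \<bar>real_of_int \<alpha>\<bar> / D * N x)" using z by (intro sum_mono) auto
    also have "\<dots> = M / D * N x" by (simp add: M_def sum_distrib_right sum_divide_distrib)
    finally show "N (T (cutoff \<phi> x) - cutoff \<phi> (T x)) \<le> M / D * N x" by (simp add: e)
  qed
  obtain w where w: "F \<subseteq> win w" using finite_int_bound[OF F] by blast
  have loc: "T x k = T y k" if "x \<in> lp p" "y \<in> lp p" "\<forall>l. \<bar>l - k\<bar> \<le> int w \<longrightarrow> x l = y l" for x y k
  proof -
    have "x (k - \<alpha>) = y (k - \<alpha>)" if "\<alpha> \<in> F" for \<alpha>
    proof -
      have "\<bar>(k - \<alpha>) - k\<bar> \<le> int w" using subsetD[OF w that] by (simp add: abs_le_iff)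
      then show ?thesis using that(1) \<open>\<forall>l. \<bar>l - k\<bar> \<le> int w \<longrightarrow> x l = y l\<close> by blast
    qed
    then show ?thesis using that by (simp add: Tk)
  qed
  show ?thesis unfolding banded_def using lin bnd M comm loc by blast
qed

lemma band_dominated_approx:
  assumes "band_dominated smul p A" "e > 0"
  shows "\<exists>B w M. banded B w M \<and> bnd (A - B) e"
proof -
  obtain B where B: "band_op smul p B" "op_norm p (A - B) < ennreal e"
    using assms unfolding band_dominated_def by (metis ennreal_less_zero_iff)
  obtain w M where w: "banded B w M" using band_op_banded[OF B(1)] by blast
  have "lin A" using assms(1) by (auto simp: band_dominated_def bounded_ops_iff)
  then have "lin (A - B)" using w by (intro lin_minus) (auto simp: banded_def)
  then have "bnd (A - B) e" using op_norm_le_iff[of "A - B" e] B(2) assms(2) by (simp add: less_imp_le)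
  then show ?thesis using w by blast
qed

lemma banded_comm: "banded B w M \<Longrightarrow> e > 0 \<Longrightarrow> \<exists>D>0. comm_small B e D"
proof -
  assume B: "banded B w M" and e: "e > 0"
  have M: "M \<ge> 0" using B by (simp add: banded_def)
  let ?D = "(M + 1) / e"
  have D: "?D > 0" using M e by simp
  have c: "comm_small B (M / ?D) ?D" using B D unfolding banded_def by blast
  have "M / ?D \<le> e" using M e by (simp add: field_simps)
  then have "M / ?D * N x \<le> e * N x" if "x \<in> lp p" for x :: "int \<Rightarrow> 'a"
    using N_nonneg[OF that] by (rule mult_right_mono)
  then have "comm_small B e ?D" using c unfolding comm_small_def by (meson order_trans)
  then show ?thesis using D by blast
qed

text \<open>A cutoff is a contraction, so replacing \<open>A\<close> by a band operator changes the
  commutator by at most twice their distance; hence the thirds.\<close>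

lemma band_dominated_quasilocal:
  assumes A: "band_dominated smul p A" shows "quasilocal A"
  unfolding quasilocal_def
proof (intro allI impI)
  fix e :: real assume e: "e > 0"
  obtain B w M where B: "banded B w M" "bnd (A - B) (e / 3)"
    using band_dominated_approx[OF A, of "e/3"] e by auto
  obtain D where D: "D > 0" "comm_small B (e/3) D" using banded_comm[OF B(1), of "e/3"] e by auto
  have lA: "lin A" using A by (auto simp: band_dominated_def bounded_ops_iff)
  have lB: "lin B" using B by (simp add: banded_def)
  have "comm_small A e D" unfolding comm_small_def
  proof (intro allI impI ballI)
    fix \<phi> :: "int \<Rightarrow> real" and x :: "int \<Rightarrow> 'a"
    assume \<phi>: "\<forall>k. 0 \<le> \<phi> k \<and> \<phi> k \<le> 1" and sl: "\<forall>k l. \<bar>\<phi> k - \<phi> l\<bar> \<le> \<bar>real_of_int (k - l)\<bar> / D"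
      and x: "x \<in> lp p"
    have a1: "\<bar>\<phi> k\<bar> \<le> 1" for k using \<phi>[rule_format, of k] by simp
    have cx: "cutoff \<phi> x \<in> lp p" "N (cutoff \<phi> x) \<le> N x" using x a1 by (auto intro: lp_cut N_cut)
    let ?E = "A - B"
    have lE: "lin ?E" using lin_minus lA lB by blast
    have eq: "A (cutoff \<phi> x) - cutoff \<phi> (A x) =
        ?E (cutoff \<phi> x) + ((B (cutoff \<phi> x) - cutoff \<phi> (B x)) - cutoff \<phi> (?E x))"
      by (simp add: fun_eq_iff cutoff_def scaleR_right_diff_distrib)
    have m: "?E (cutoff \<phi> x) \<in> lp p" "B (cutoff \<phi> x) - cutoff \<phi> (B x) \<in> lp p" "cutoff \<phi> (?E x) \<in> lp p"
      by (rule linD(1)[OF lE cx(1)], rule lp_diff[OF linD(1)[OF lB cx(1)] lp_cut[OF linD(1)[OF lB x] a1]],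
        rule lp_cut[OF linD(1)[OF lE x] a1])
    have "N (?E (cutoff \<phi> x)) \<le> e/3 * N x"
    proof -
      have "e/3 * N (cutoff \<phi> x) \<le> e/3 * N x" using cx(2) e by (intro mult_left_mono) auto
      then show ?thesis using bndD[OF B(2) cx(1)] by (rule order_trans[rotated])
    qed
    moreover have "N (B (cutoff \<phi> x) - cutoff \<phi> (B x)) \<le> e/3 * N x"
      using comm_smallD[OF D(2) _ _ x] \<phi> sl by blast
    moreover have "N (cutoff \<phi> (?E x)) \<le> e/3 * N x"
      using N_cut[OF linD(1)[OF lE x] a1] bndD[OF B(2) x] by (rule order_trans)
    ultimately show "N (A (cutoff \<phi> x) - cutoff \<phi> (A x)) \<le> e * N x"
      unfolding eq using N_triangle[OF m(1) lp_diff[OF m(2,3)]] N_diff[OF m(2,3)] by linarith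
  qed
  then show "\<exists>D>0. comm_small A e D" using D by blast
qed

text \<open>A trapezoid: one up to distance \<open>m\<close> from the centre \<open>c\<close>, zero
  from distance \<open>m + D\<close> on, with slope \<open>1 / D\<close> in between, as
  \<open>comm_small\<close> requires.\<close>

definition tent :: "real \<Rightarrow> real \<Rightarrow> int \<Rightarrow> int \<Rightarrow> real" where
  "tent m D c k = max 0 (min 1 (1 - (\<bar>real_of_int (k - c)\<bar> - m) / D))"

lemma tent_range: "0 \<le> tent m D c k \<and> tent m D c k \<le> 1" by (simp add: tent_def)

lemma tent_abs: "\<bar>tent m D c k\<bar> \<le> 1" using tent_range[of m D c k] by simp

lemma tent_one: "D > 0 \<Longrightarrow> \<bar>real_of_int (k - c)\<bar> \<le> m \<Longrightarrow> tent m D c k = 1"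
proof -
  assume "D > 0" "\<bar>real_of_int (k - c)\<bar> \<le> m"
  then have "(\<bar>real_of_int (k - c)\<bar> - m) / D \<le> 0" by (simp add: divide_nonpos_pos)
  then show ?thesis by (simp add: tent_def)
qed

lemma tent_zero: "D > 0 \<Longrightarrow> m + D \<le> \<bar>real_of_int (k - c)\<bar> \<Longrightarrow> tent m D c k = 0"
proof -
  assume "D > 0" "m + D \<le> \<bar>real_of_int (k - c)\<bar>"
  then have "(\<bar>real_of_int (k - c)\<bar> - m) / D \<ge> 1" by (simp add: le_divide_eq)
  then show ?thesis by (simp add: tent_def)
qed

lemma tent_slope: "D > 0 \<Longrightarrow> \<bar>tent m D c k - tent m D c l\<bar> \<le> \<bar>real_of_int (k - l)\<bar> / D"
proof -
  assume D: "D > 0"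
  have "\<bar>max 0 (min 1 a) - max 0 (min 1 b)\<bar> \<le> \<bar>a - b\<bar>" for a b :: real
    by (auto simp: max_def min_def)
  then have "\<bar>tent m D c k - tent m D c l\<bar> \<le>
      \<bar>(1 - (\<bar>real_of_int (k - c)\<bar> - m) / D) - (1 - (\<bar>real_of_int (l - c)\<bar> - m) / D)\<bar>"
    unfolding tent_def by blast
  also have "\<dots> = \<bar>\<bar>real_of_int (l - c)\<bar> - \<bar>real_of_int (k - c)\<bar>\<bar> / D"
    using D by (simp add: diff_divide_distrib[symmetric] abs_divide)
  also have "\<dots> \<le> \<bar>real_of_int (k - l)\<bar> / D"
    using D by (intro divide_right_mono) auto
  finally show ?thesis .
qed

lemma comm_small_tent:
  assumes "comm_small T e D" "D > 0" "x \<in> lp p"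
  shows "N (T (cutoff (tent m D c) x) - cutoff (tent m D c) (T x)) \<le> e * N x"
  by (rule comm_smallD[OF assms(1) _ _ assms(3)]) (use tent_range tent_slope assms(2) in auto)

text \<open>A tent that is one on \<open>win m\<close> and zero off \<open>win n\<close> separates
  the two sets. It annihilates a sequence living off \<open>win n\<close>, and the commutator is
  then \<open>- T x\<close> on \<open>win m\<close>; it fixes a sequence living on
  \<open>win m\<close>, and the commutator is then \<open>T x\<close> off
  \<open>win n\<close>.\<close>

lemma comm_small_off_diagonal:
  assumes T: "lin T" "comm_small T e D" and D: "D > 0" and x: "x \<in> lp p" and n: "real n \<ge> real m + D"
  shows "N (restr (win m) (T (restr (- win n) x))) \<le> e * N x"
    "N (restr (- win n) (T (restr (win m) x))) \<le> e * N x"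
proof -
  let ?\<phi> = "tent (real m) D 0"
  have out: "k \<notin> win n \<Longrightarrow> ?\<phi> k = 0" for k
    using n by (intro tent_zero[OF D]) auto
  have inn: "k \<in> win m \<Longrightarrow> ?\<phi> k = 1" for k
    by (intro tent_one[OF D]) auto
  \<comment> \<open>The sign of \<open>e\<close> is not given; unless \<open>N x = 0\<close>, the
    commutator estimate itself forces \<open>e \<ge> 0\<close>.\<close>
  have e0: "e * N y \<le> e * N x" if "y \<in> lp p" "N y \<le> N x" for y :: "int \<Rightarrow> 'a"
  proof (cases "N x = 0")
    case True
    then show ?thesis using that N_nonneg[OF that(1)] by simp
  next
    case False
    have "0 \<le> e * N x"
      using N_nonneg[of "T (cutoff ?\<phi> x) - cutoff ?\<phi> (T x)"] comm_small_tent[OF T(2) D x]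
        linD(1)[OF T(1)] x by (meson lp_cut lp_diff order_trans tent_abs)
    then have "e \<ge> 0" using False N_nonneg[OF x] by (simp add: zero_le_mult_iff)
    then show ?thesis using that by (simp add: mult_left_mono)
  qed
  {
    let ?x = "restr (- win n) x"
    have xl: "?x \<in> lp p" using x by (rule lp_restr)
    have z: "cutoff ?\<phi> ?x = 0" using out by (auto simp: cutoff_def restr_def fun_eq_iff)
    have l: "T (cutoff ?\<phi> ?x) - cutoff ?\<phi> (T ?x) \<in> lp p"
      using xl linD(1)[OF T(1)] by (intro lp_diff) (auto intro: lp_cut tent_abs)
    have "norm (restr (win m) (T ?x) k) \<le> norm ((T (cutoff ?\<phi> ?x) - cutoff ?\<phi> (T ?x)) k)" for k
    proof (cases "k \<in> win m")
      case True
      then show ?thesis unfolding z lin_zero[OF T(1)] using inn[OF True] by (simp add: restr_def cutoff_def)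
    qed (auto simp: restr_def)
    then have "N (restr (win m) (T ?x)) \<le> N (T (cutoff ?\<phi> ?x) - cutoff ?\<phi> (T ?x))"
      by (rule lp_solid(2)[OF l])
    also have "\<dots> \<le> e * N ?x" by (rule comm_small_tent[OF T(2) D xl])
    also have "\<dots> \<le> e * N x" using e0[OF xl N_restr[OF x]] .
    finally show "N (restr (win m) (T ?x)) \<le> e * N x" .
  }
  {
    let ?x = "restr (win m) x"
    have xl: "?x \<in> lp p" using x by (rule lp_restr)
    have z: "cutoff ?\<phi> ?x = ?x" using inn by (auto simp: cutoff_def restr_def fun_eq_iff)
    have l: "T (cutoff ?\<phi> ?x) - cutoff ?\<phi> (T ?x) \<in> lp p"
      using xl linD(1)[OF T(1)] by (intro lp_diff) (auto intro: lp_cut tent_abs)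
    have "norm (restr (- win n) (T ?x) k) \<le> norm ((T (cutoff ?\<phi> ?x) - cutoff ?\<phi> (T ?x)) k)" for k
    proof (cases "k \<in> win n")
      case False
      then show ?thesis unfolding z using out[OF False] by (simp add: restr_def cutoff_def)
    qed (auto simp: restr_def)
    then have "N (restr (- win n) (T ?x)) \<le> N (T (cutoff ?\<phi> ?x) - cutoff ?\<phi> (T ?x))"
      by (rule lp_solid(2)[OF l])
    also have "\<dots> \<le> e * N ?x" by (rule comm_small_tent[OF T(2) D xl])
    also have "\<dots> \<le> e * N x" using e0[OF xl N_restr[OF x]] .
    finally show "N (restr (- win n) (T ?x)) \<le> e * N x" .
  }
qed

end

section \<open>Finite-dimensional coefficients\<close>

lemma finite_bolzano_weierstrass:
  fixes t :: "nat \<Rightarrow> 'b \<Rightarrow> 'k::heine_borel"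
  assumes "finite F" "\<And>b. b \<in> F \<Longrightarrow> bounded (range (\<lambda>j. t j b))"
  shows "\<exists>f. strict_mono f \<and> (\<forall>b\<in>F. \<exists>l. (\<lambda>j. t (f j) b) \<longlonglongrightarrow> l)"
  using assms
proof (induction F)
  case empty
  show ?case by (intro exI[of _ id]) (auto simp: strict_mono_def)
next
  case (insert a F)
  then obtain f where f: "strict_mono f" "\<And>b. b \<in> F \<Longrightarrow> \<exists>l. (\<lambda>j. t (f j) b) \<longlonglongrightarrow> l" by auto
  have "bounded (range (\<lambda>j. t (f j) a))"
    by (rule bounded_subset[OF insert.prems[of a]]) auto
  then obtain l g where g: "strict_mono g" "((\<lambda>j. t (f j) a) \<circ> g) \<longlonglongrightarrow> l"
    using bounded_imp_convergent_subsequence by metis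
  have "\<exists>l. (\<lambda>j. t ((f \<circ> g) j) b) \<longlonglongrightarrow> l" if "b \<in> insert a F" for b
  proof (cases "b = a")
    case True
    then show ?thesis using g(2) by (auto simp: comp_def)
  next
    case False
    then have "b \<in> F" using that by simp
    then obtain l' where "(\<lambda>j. t (f j) b) \<longlonglongrightarrow> l'" using f(2) by blast
    then show ?thesis using LIMSEQ_subseq_LIMSEQ[OF _ g(1)] by (auto simp: comp_def)
  qed
  moreover have "strict_mono (f \<circ> g)" using f(1) g(1) by (rule strict_mono_o)
  ultimately show ?case by blast
qed

lemma diagonal_convergent:
  fixes s :: "'i::countable \<Rightarrow> nat \<Rightarrow> 'b::topological_space"
  assumes sub: "\<And>i (f :: nat \<Rightarrow> nat). strict_mono f \<Longrightarrow> \<exists>g l. strict_mono g \<and> (\<lambda>n. s i (f (g n))) \<longlonglongrightarrow> l"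
  shows "\<exists>f. strict_mono f \<and> (\<forall>i. \<exists>l. (\<lambda>n. s i (f n)) \<longlonglongrightarrow> l)"
proof -
  interpret subseqs "\<lambda>m f. \<exists>l. (\<lambda>n. s (from_nat m) (f n)) \<longlonglongrightarrow> l"
  proof
    fix n and f :: "nat \<Rightarrow> nat" assume "strict_mono f"
    then show "\<exists>r. strict_mono r \<and> (\<exists>l. (\<lambda>k. s (from_nat n) ((f \<circ> r) k)) \<longlonglongrightarrow> l)"
      using sub[of f "from_nat n"] by auto
  qed
  have "\<exists>l. (\<lambda>n. s i (diagseq n)) \<longlonglongrightarrow> l" for i
  proof -
    \<comment> \<open>Only a tail of the diagonal sequence is a subsequence of the one selected for
      the index \<open>i\<close>; the offset is removed afterwards.\<close>
    have "\<exists>l. (\<lambda>n. s (from_nat (to_nat i)) ((diagseq \<circ> (+) (Suc (to_nat i))) n)) \<longlonglongrightarrow> l"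
    proof (rule diagseq_holds)
      fix m g :: "nat \<Rightarrow> nat" and n
      assume g: "strict_mono g" and "\<exists>l. (\<lambda>k. s (from_nat n) (m k)) \<longlonglongrightarrow> l"
      then show "\<exists>l. (\<lambda>k. s (from_nat n) ((m \<circ> g) k)) \<longlonglongrightarrow> l"
        using LIMSEQ_subseq_LIMSEQ[OF _ g, of "\<lambda>k. s (from_nat n) (m k)"] by (auto simp: comp_def)
    qed
    then obtain l where "(\<lambda>n. s i (diagseq (n + Suc (to_nat i)))) \<longlonglongrightarrow> l"
      by (auto simp: add.commute)
    then show ?thesis using LIMSEQ_offset[of "\<lambda>n. s i (diagseq n)"] by blast
  qed
  then show ?thesis using subseq_diagseq by blast
qed

text \<open>Equivalence of norms in finite dimension. If every constant failed, coefficient vectors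
  normalized to sum one would have a limit, by compactness, giving a nontrivial combination of norm
  zero. The norm is an arbitrary function on the span because the lemma serves both the coefficient
  space and the kernel of an operator on \<open>lp p\<close>.\<close>

lemma coefficient_bound:
  fixes s :: "'k::{real_normed_field, heine_borel} \<Rightarrow> 'b::ab_group_add \<Rightarrow> 'b" and n :: "'b \<Rightarrow> real"
  assumes vs: "vector_space s" and F: "finite F" "\<not> module.dependent s F"
    and tri: "\<And>x y. x \<in> module.span s F \<Longrightarrow> y \<in> module.span s F \<Longrightarrow> n (x + y) \<le> n x + n y"
    and hom: "\<And>c x. x \<in> module.span s F \<Longrightarrow> n (s c x) = norm c * n x"
    and pos: "\<And>x. x \<in> module.span s F \<Longrightarrow> x \<noteq> 0 \<Longrightarrow> n x > 0"
  shows "\<exists>c>0. \<forall>t. c * (\<Sum>b\<in>F. norm (t b)) \<le> n (\<Sum>b\<in>F. s (t b) b)"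
proof (rule ccontr)
  interpret V: vector_space s by (rule vs)
  have comb: "(\<Sum>b\<in>G. s (t b) b) \<in> V.span F" if "G \<subseteq> F" for t G
    using that by (intro V.span_sum V.span_scale V.span_base) auto
  have n0: "n 0 = 0" using hom[of 0 0] V.span_zero by simp
  have nsum: "n (\<Sum>b\<in>G. s (t b) b) \<le> (\<Sum>b\<in>G. norm (t b) * n b)" if "G \<subseteq> F" for t G
    using finite_subset[OF that F(1)] that
  proof (induction G)
    case (insert b G)
    have "n (s (t b) b + (\<Sum>b\<in>G. s (t b) b)) \<le> n (s (t b) b) + n (\<Sum>b\<in>G. s (t b) b)"
      using insert.prems comb[of G t] by (intro tri V.span_scale[OF V.span_base]) auto
    moreover have "n (s (t b) b) = norm (t b) * n b" using insert.prems by (intro hom V.span_base) auto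
    moreover have "n (\<Sum>b\<in>G. s (t b) b) \<le> (\<Sum>b\<in>G. norm (t b) * n b)" using insert by auto
    ultimately show ?case unfolding sum.insert[OF insert(1,2)] by linarith
  qed (simp add: n0)
  assume "\<not> ?thesis"
  then have neg: "\<exists>t. n (\<Sum>b\<in>F. s (t b) b) < c * (\<Sum>b\<in>F. norm (t b))" if "c > 0" for c
    using that by (auto simp: not_le)
  have "\<exists>t. (\<Sum>b\<in>F. norm (t b)) = 1 \<and> n (\<Sum>b\<in>F. s (t b) b) < 1 / (real j + 1)" for j :: nat
  proof -
    obtain t where t: "n (\<Sum>b\<in>F. s (t b) b) < 1 / (real j + 1) * (\<Sum>b\<in>F. norm (t b))"
      using neg[of "1 / (real j + 1)"] by auto
    define S where "S = (\<Sum>b\<in>F. norm (t b))"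
    note t = t[folded S_def]
    have n: "0 \<le> n (\<Sum>b\<in>F. s (t b) b)"
      using pos[OF comb[OF order_refl]] n0 by (metis less_imp_le order_refl)
    have S: "S > 0"
    proof (rule ccontr)
      assume "\<not> S > 0"
      then have "S = 0" unfolding S_def using sum_nonneg[of F "\<lambda>b. norm (t b)"] by simp
      then show False using t n by simp
    qed
    let ?u = "\<lambda>b. of_real (1 / S) * t b"
    have "(\<Sum>b\<in>F. norm (?u b)) = (1 / S) * S"
      using S by (simp add: norm_mult norm_divide sum_divide_distrib[symmetric] S_def[symmetric])
    moreover have "(\<Sum>b\<in>F. s (?u b) b) = s (of_real (1 / S)) (\<Sum>b\<in>F. s (t b) b)"
      by (simp add: V.scale_sum_right)
    then have "n (\<Sum>b\<in>F. s (?u b) b) = (1 / S) * n (\<Sum>b\<in>F. s (t b) b)"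
      using hom[OF comb[OF order_refl]] S by (simp add: norm_divide)
    moreover have "\<dots> < 1 / (real j + 1)" using t S by (simp add: field_simps)
    ultimately show ?thesis using S by (intro exI[of _ ?u]) simp
  qed
  then obtain t where t: "\<And>j. (\<Sum>b\<in>F. norm (t j b)) = 1"
      "\<And>j. n (\<Sum>b\<in>F. s (t j b) b) < 1 / (real j + 1)" for j :: nat by metis
  have "norm (t j b) \<le> 1" if "b \<in> F" for j b
    using member_le_sum[OF that, of "\<lambda>b. norm (t j b)"] t(1)[of j] F by simp
  then have "bounded (range (\<lambda>j. t j b))" if "b \<in> F" for b using that by (auto simp: bounded_iff)
  then obtain f where f: "strict_mono f" "\<And>b. b \<in> F \<Longrightarrow> \<exists>l. (\<lambda>j. t (f j) b) \<longlonglongrightarrow> l"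
    using finite_bolzano_weierstrass[OF F(1), of t] by blast
  then obtain l where l: "\<And>b. b \<in> F \<Longrightarrow> (\<lambda>j. t (f j) b) \<longlonglongrightarrow> l b" by metis
  have "(\<lambda>j. \<Sum>b\<in>F. norm (t (f j) b)) \<longlonglongrightarrow> (\<Sum>b\<in>F. norm (l b))" by (intro tendsto_intros l)
  then have l1: "(\<Sum>b\<in>F. norm (l b)) = 1" using t(1) by (simp add: LIMSEQ_const_iff)
  let ?y = "\<Sum>b\<in>F. s (l b) b"
  have bound: "n ?y \<le> (\<Sum>b\<in>F. norm (l b - t (f j) b) * n b) + 1 / (real j + 1)" for j
  proof -
    have e: "?y = (\<Sum>b\<in>F. s (l b - t (f j) b) b) + (\<Sum>b\<in>F. s (t (f j) b) b)"
      by (simp add: sum.distrib[symmetric] V.scale_left_distrib[symmetric])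
    have "n ?y \<le> n (\<Sum>b\<in>F. s (l b - t (f j) b) b) + n (\<Sum>b\<in>F. s (t (f j) b) b)"
      unfolding e by (rule tri[OF comb[OF order_refl] comb[OF order_refl]])
    also have "n (\<Sum>b\<in>F. s (l b - t (f j) b) b) \<le> (\<Sum>b\<in>F. norm (l b - t (f j) b) * n b)"
      by (rule nsum) simp
    also have "n (\<Sum>b\<in>F. s (t (f j) b) b) \<le> 1 / (real (f j) + 1)" using t(2)[of "f j"] by simp
    also have "1 / (real (f j) + 1) \<le> 1 / (real j + 1)"
      using seq_suble[OF f(1), of j] by (intro divide_left_mono) auto
    finally show ?thesis by simp
  qed
  have "(\<lambda>j. (\<Sum>b\<in>F. norm (l b - t (f j) b) * n b) + 1 / (real j + 1)) \<longlonglongrightarrow> (\<Sum>b\<in>F. norm (l b - l b) * n b) + 0"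
    by (intro tendsto_add tendsto_sum tendsto_mult tendsto_norm tendsto_diff tendsto_const l)
      (use LIMSEQ_inverse_real_of_nat in \<open>simp_all add: inverse_eq_divide add.commute\<close>)
  then have "n ?y \<le> 0" using bound LIMSEQ_le_const by fastforce
  then have y0: "?y = 0" using pos[OF comb[OF order_refl], of l] by fastforce
  have "\<exists>b\<in>F. l b \<noteq> 0"
  proof (rule ccontr)
    assume "\<not> ?thesis"
    then have "(\<Sum>b\<in>F. norm (l b)) = 0" by simp
    then show False using l1 by simp
  qed
  then have "V.dependent F" using y0 F(1) unfolding V.dependent_finite[OF F(1)] by blast
  then show False using F(2) by simp
qed

definition single :: "int \<Rightarrow> 'a::zero \<Rightarrow> int \<Rightarrow> 'a" where
  "single j v = (\<lambda>k. if k = j then v else 0)"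

locale lp_space_fin = lp_space p smul for p :: ennreal and smul :: "'k::{real_normed_field, euclidean_space} \<Rightarrow> 'a::banach \<Rightarrow> 'a" +
  assumes fin_dim_UNIV: "fin_dim smul UNIV"
begin

lemma basis_exists: "\<exists>F. finite F \<and> independent F \<and> span F = UNIV"
proof -
  obtain G where G: "finite G" "span G = UNIV" using fin_dim_UNIV by (auto simp: fin_dim_def)
  obtain F where "F \<subseteq> G" "independent F" "G \<subseteq> span F"
    using maximal_independent_subset[of G] by blast
  then show ?thesis using G by (metis finite_subset span_mono span_span subset_antisym top_greatest)
qed

definition bas :: "'a set" where
  "bas = (SOME F. finite F \<and> independent F \<and> span F = UNIV)"

lemma bas: "finite bas" "independent bas" "span bas = UNIV"
  using someI_ex[OF basis_exists] by (simp_all add: bas_def)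

definition coef :: "'a \<Rightarrow> 'a \<Rightarrow> 'k" where "coef v = representation bas v"

lemma coef_sum: "(\<Sum>b\<in>bas. smul (coef v b) b) = v"
  unfolding coef_def using sum_representation_eq[of bas v bas] bas by simp

lemma coef_bound: "\<exists>c>0. \<forall>v. (\<Sum>b\<in>bas. norm (coef v b)) \<le> c * norm v"
proof -
  obtain c where c: "c > 0" "\<And>t. c * (\<Sum>b\<in>bas. norm (t b)) \<le> norm (\<Sum>b\<in>bas. smul (t b) b)"
    using coefficient_bound[OF vector_space_axioms bas(1,2), of norm]
    by (auto simp: norm_triangle_ineq norm_smul)
  have "(\<Sum>b\<in>bas. norm (coef v b)) \<le> 1 / c * norm v" for v
    using c(2)[of "coef v"] c(1) unfolding coef_sum by (simp add: field_simps)
  then show ?thesis using c(1) by (intro exI[of _ "1/c"]) auto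
qed

lemma bounded_imp_convergent_subseq:
  fixes s :: "nat \<Rightarrow> 'a"
  assumes "bounded (range s)"
  shows "\<exists>f l. strict_mono f \<and> (\<lambda>n. s (f n)) \<longlonglongrightarrow> l"
proof -
  obtain c where c: "c > 0" "\<And>v. (\<Sum>b\<in>bas. norm (coef v b)) \<le> c * norm v" using coef_bound by blast
  obtain M where M: "\<And>j. norm (s j) \<le> M" using assms by (auto simp: bounded_iff)
  have "norm (coef (s j) b) \<le> c * M" if "b \<in> bas" for j b
  proof -
    have "norm (coef (s j) b) \<le> (\<Sum>b\<in>bas. norm (coef (s j) b))"
      using that bas(1) by (intro member_le_sum) auto
    also have "\<dots> \<le> c * M" using c M[of j] by (meson mult_left_mono order_trans less_imp_le)
    finally show ?thesis .
  qed
  then have "bounded (range (\<lambda>j. coef (s j) b))" if "b \<in> bas" for b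
    using that by (auto simp: bounded_iff)
  then obtain f where f: "strict_mono f" "\<And>b. b \<in> bas \<Longrightarrow> \<exists>l. (\<lambda>j. coef (s (f j)) b) \<longlonglongrightarrow> l"
    using finite_bolzano_weierstrass[OF bas(1), of "\<lambda>j. coef (s j)"] by blast
  then obtain l where l: "\<And>b. b \<in> bas \<Longrightarrow> (\<lambda>j. coef (s (f j)) b) \<longlonglongrightarrow> l b" by metis
  have "(\<lambda>j. smul (coef (s (f j)) b) b) \<longlonglongrightarrow> smul (l b) b" if "b \<in> bas" for b
  proof -
    have "(\<lambda>j. norm (coef (s (f j)) b - l b) * norm b) \<longlonglongrightarrow> norm (l b - l b) * norm b"
      by (intro tendsto_intros l that)
    moreover have "norm (coef (s (f j)) b - l b) * norm b = norm (smul (coef (s (f j)) b) b - smul (l b) b)" for j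
      by (simp add: norm_smul[symmetric] scale_left_diff_distrib)
    ultimately have "(\<lambda>j. norm (smul (coef (s (f j)) b) b - smul (l b) b)) \<longlonglongrightarrow> 0" by simp
    then show ?thesis by (simp add: LIM_zero_iff tendsto_norm_zero_iff)
  qed
  then have "(\<lambda>j. \<Sum>b\<in>bas. smul (coef (s (f j)) b) b) \<longlonglongrightarrow> (\<Sum>b\<in>bas. smul (l b) b)"
    by (rule tendsto_sum)
  then show ?thesis using f(1) unfolding coef_sum by blast
qed

end

section \<open>Translates of operators and membership in \<open>LP_ops\<close>\<close>

context lp_space
begin

lemma shift_add: "shift a (shift b x) = shift (a + b) x"
  by (simp add: shift_def algebra_simps)

lemma shift_0 [simp]: "shift 0 x = x" by (simp add: shift_def)

definition shc :: "int \<Rightarrow> 'a seq_op \<Rightarrow> 'a seq_op" where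
  "shc h A = shift (- h) \<circ> A \<circ> shift h"

lemma lin_shc: "lin A \<Longrightarrow> lin (shc h A)"
  unfolding shc_def by (intro lin_comp lin_shift)

lemma bnd_shc: "lin A \<Longrightarrow> bnd A C \<Longrightarrow> bnd (shc h A) C"
  unfolding bnd_def shc_def
  using linD(1)[of A "shift h x" for x] lp_shift[of x h for x] N_shift[of x h for x] N_shift[of "A (shift h x)" "- h" for x]
  by (metis comp_apply)

lemma shift_cut: "shift h (cutoff \<phi> x) = cutoff (\<lambda>k. \<phi> (k - h)) (shift h x)"
  by (simp add: shift_def cutoff_def)

text \<open>Conjugation by a shift translates the cutoff and preserves its range and slope, so all
  translates of \<open>A\<close> are local with the same \<open>e\<close> and
  \<open>D\<close>.\<close>

lemma comm_small_shc:
  assumes A: "lin A" "comm_small A e D" shows "comm_small (shc h A) e D"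
  unfolding comm_small_def
proof (intro allI impI ballI)
  fix \<phi> :: "int \<Rightarrow> real" and x :: "int \<Rightarrow> 'a"
  assume \<phi>: "\<forall>k. 0 \<le> \<phi> k \<and> \<phi> k \<le> 1" and sl: "\<forall>k l. \<bar>\<phi> k - \<phi> l\<bar> \<le> \<bar>real_of_int (k - l)\<bar> / D"
    and x: "x \<in> lp p"
  let ?\<phi> = "\<lambda>k. \<phi> (k - h)"
  have sx: "shift h x \<in> lp p" using x by (rule lp_shift)
  have "shc h A (cutoff \<phi> x) - cutoff \<phi> (shc h A x)
      = shift (- h) (A (cutoff ?\<phi> (shift h x)) - cutoff ?\<phi> (A (shift h x)))"
    by (simp add: shc_def shift_cut) (simp add: shift_def cutoff_def fun_eq_iff)
  moreover have "A (cutoff ?\<phi> (shift h x)) - cutoff ?\<phi> (A (shift h x)) \<in> lp p"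
  proof -
    have "\<bar>?\<phi> k\<bar> \<le> 1" for k using \<phi> by simp
    then show ?thesis by (intro lp_diff linD(1)[OF A(1)] lp_cut sx)
  qed
  ultimately have "N (shc h A (cutoff \<phi> x) - cutoff \<phi> (shc h A x))
      = N (A (cutoff ?\<phi> (shift h x)) - cutoff ?\<phi> (A (shift h x)))" by (simp only: N_shift)
  also have "\<dots> \<le> e * N (shift h x)"
  proof (rule comm_smallD[OF A(2) _ _ sx])
    fix k l :: int
    show "0 \<le> \<phi> (k - h) \<and> \<phi> (k - h) \<le> 1" using \<phi> by blast
    show "\<bar>\<phi> (k - h) - \<phi> (l - h)\<bar> \<le> \<bar>real_of_int (k - l)\<bar> / D"
      using sl[rule_format, of "k - h" "l - h"] by simp
  qed
  finally show "N (shc h A (cutoff \<phi> x) - cutoff \<phi> (shc h A x)) \<le> e * N x" using x by (simp add: N_shift)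
qed

lemma restr_split: "x = restr S x + restr (- S) x" for x :: "int \<Rightarrow> 'a"
  by (simp add: restr_def fun_eq_iff)

lemma N_split:
  assumes "lin T" "x \<in> lp p"
  shows "N (T x) \<le> N (T (restr S x)) + N (T (restr (- S) x))"
proof -
  have l: "restr S x \<in> lp p" "restr (- S) x \<in> lp p" using assms(2) lp_restr by blast+
  have "T x = T (restr S x) + T (restr (- S) x)"
    using linD(2)[OF assms(1) l] restr_split[of x S] by simp
  then show ?thesis
    using N_triangle[OF linD(1)[OF assms(1) l(1)] linD(1)[OF assms(1) l(2)]] by (simp only:)
qed

text \<open>Limit operators are defined inside \<open>LP_ops\<close>, so translates and their limits
  must be shown to belong to it. A P-compact \<open>K\<close> is concentrated on a window
  \<open>win m\<close> up to a small error, and \<open>T\<close> couples this window only weakly to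
  everything beyond distance \<open>m + D\<close>.\<close>

lemma quasilocal_imp_LP:
  assumes T: "lin T" "bnd T C" "C > 0" and q: "quasilocal T"
  shows "T \<in> LP_ops smul p"
proof -
  have TB: "T \<in> bounded_ops smul p" using T bounded_ops_iff by (meson less_imp_le)
  have "T \<circ> K \<in> P_compact_ops smul p \<and> K \<circ> T \<in> P_compact_ops smul p" if K: "K \<in> P_compact_ops smul p" for K
  proof -
    have "K \<in> bounded_ops smul p" using K by (simp add: P_compact_ops_def)
    then obtain CK where CK: "lin K" "CK > 0" "bnd K CK" by (rule bounded_opsE)
    have Kl: "\<exists>M. \<forall>n\<ge>M. bnd (K \<circ> trunc_Q n) e \<and> bnd (trunc_Q n \<circ> K) e" if "e > 0" for e
    proof -
      have lQ: "lin (trunc_Q n)" for n unfolding trunc_Q_restr by (rule lin_restr)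
      have "(\<lambda>n. op_norm p (K \<circ> trunc_Q n) + op_norm p (trunc_Q n \<circ> K)) \<longlonglongrightarrow> 0"
        using K by (simp add: P_compact_ops_def)
      then show ?thesis
        using op_norm_pair_lim[of "\<lambda>n. K \<circ> trunc_Q n" "\<lambda>n. trunc_Q n \<circ> K"] lin_comp lQ CK(1) that by blast
    qed
    have lTK: "lin (T \<circ> K)" "lin (K \<circ> T)" using T CK lin_comp by blast+
    have bTK: "T \<circ> K \<in> bounded_ops smul p" "K \<circ> T \<in> bounded_ops smul p"
      unfolding bounded_ops_iff using lTK bnd_comp[OF T(2) CK(3,1)] bnd_comp[OF CK(3) T(2,1)] T(3) CK(2)
      by (meson mult_nonneg_nonneg less_imp_le)+
    have "\<exists>M. \<forall>n\<ge>M. bnd ((T \<circ> K) \<circ> trunc_Q n) e \<and> bnd (trunc_Q n \<circ> (T \<circ> K)) e" if e: "e > 0" for e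
    proof -
      obtain m where m: "\<And>n. n \<ge> m \<Longrightarrow> bnd (K \<circ> trunc_Q n) (e / (2 * C)) \<and> bnd (trunc_Q n \<circ> K) (e / (2 * C))"
        using Kl[of "e / (2 * C)"] e T(3) by auto
      obtain D where D: "D > 0" "comm_small T (e / (2 * CK)) D" using q e CK(2) unfolding quasilocal_def
        by (meson divide_pos_pos mult_pos_pos zero_less_numeral)
      have "bnd ((T \<circ> K) \<circ> trunc_Q n) e \<and> bnd (trunc_Q n \<circ> (T \<circ> K)) e" if n: "n \<ge> m + nat \<lceil>D\<rceil>" for n
      proof
        have nD: "real n \<ge> real m + D" using n by linarith
        show "bnd ((T \<circ> K) \<circ> trunc_Q n) e" unfolding bnd_def
        proof
          fix x :: "int \<Rightarrow> 'a" assume x: "x \<in> lp p"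
          have Q: "trunc_Q n x \<in> lp p" unfolding trunc_Q_restr using x by (rule lp_restr)
          have "N (T (K (trunc_Q n x))) \<le> C * N (K (trunc_Q n x))"
            using bndD[OF T(2) linD(1)[OF CK(1) Q]] .
          also have "\<dots> \<le> C * (e / (2 * C) * N x)"
            using m[of n] n T(3) bndD[of "K \<circ> trunc_Q n" "e / (2 * C)" x] x by (intro mult_left_mono) auto
          also have "\<dots> \<le> e * N x" using T(3) e N_nonneg[OF x] by simp
          finally show "N ((T \<circ> K \<circ> trunc_Q n) x) \<le> e * N x" by simp
        qed
        show "bnd (trunc_Q n \<circ> (T \<circ> K)) e" unfolding bnd_def
        proof
          fix x :: "int \<Rightarrow> 'a" assume x: "x \<in> lp p"
          have Kx: "K x \<in> lp p" using linD(1)[OF CK(1) x] .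
          let ?a = "restr (win m) (K x)" and ?b = "restr (- win m) (K x)"
          have ab: "?a \<in> lp p" "?b \<in> lp p" using Kx lp_restr by blast+
          have "T (K x) = T ?a + T ?b"
            using linD(2)[OF T(1) ab] restr_split[of "K x" "win m"] by simp
          then have "restr (- win n) (T (K x)) = restr (- win n) (T ?a) + restr (- win n) (T ?b)"
            by (auto simp: restr_def fun_eq_iff)
          then have "N (restr (- win n) (T (K x))) \<le> N (restr (- win n) (T ?a)) + N (restr (- win n) (T ?b))"
            using N_triangle[OF lp_restr[OF linD(1)[OF T(1) ab(1)]] lp_restr[OF linD(1)[OF T(1) ab(2)]]] by (simp only:)
          also have "N (restr (- win n) (T ?a)) \<le> e / (2 * CK) * N (K x)"
            by (rule comm_small_off_diagonal(2)[OF T(1) D(2,1) Kx nD])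
          also have "\<dots> \<le> e / (2 * CK) * (CK * N x)"
            using bndD[OF CK(3) x] e CK(2) by (intro mult_left_mono) auto
          also have "N (restr (- win n) (T ?b)) \<le> C * N ?b"
            using N_restr[OF linD(1)[OF T(1) ab(2)], of "- win n"] bndD[OF T(2) ab(2)] by simp
          also have "\<dots> \<le> C * (e / (2 * C) * N x)"
            using m[of m] bndD[of "trunc_Q m \<circ> K" "e / (2 * C)" x] x T(3)
            by (intro mult_left_mono) (auto simp: trunc_Q_restr)
          finally have "N (restr (- win n) (T (K x))) \<le> e * N x"
            using CK(2) T(3) by (simp add: algebra_simps)
          then show "N ((trunc_Q n \<circ> (T \<circ> K)) x) \<le> e * N x" by (simp add: trunc_Q_restr)
        qed
      qed
      then show ?thesis by blast
    qed
    moreover have "\<exists>M. \<forall>n\<ge>M. bnd ((K \<circ> T) \<circ> trunc_Q n) e \<and> bnd (trunc_Q n \<circ> (K \<circ> T)) e" if e: "e > 0" for e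
    proof -
      obtain m where m: "\<And>n. n \<ge> m \<Longrightarrow> bnd (K \<circ> trunc_Q n) (e / (2 * C)) \<and> bnd (trunc_Q n \<circ> K) (e / (2 * C))"
        using Kl[of "e / (2 * C)"] e T(3) by auto
      obtain D where D: "D > 0" "comm_small T (e / (2 * CK)) D" using q e CK(2) unfolding quasilocal_def
        by (meson divide_pos_pos mult_pos_pos zero_less_numeral)
      have "bnd ((K \<circ> T) \<circ> trunc_Q n) e \<and> bnd (trunc_Q n \<circ> (K \<circ> T)) e" if n: "n \<ge> m + nat \<lceil>D\<rceil>" for n
      proof
        have nD: "real n \<ge> real m + D" using n by linarith
        show "bnd (trunc_Q n \<circ> (K \<circ> T)) e" unfolding bnd_def
        proof
          fix x :: "int \<Rightarrow> 'a" assume x: "x \<in> lp p"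
          have "N (trunc_Q n (K (T x))) \<le> e / (2 * C) * N (T x)"
            using m[of n] n bndD[of "trunc_Q n \<circ> K" "e / (2 * C)" "T x"] linD(1)[OF T(1) x] by simp
          also have "\<dots> \<le> e / (2 * C) * (C * N x)"
            using bndD[OF T(2) x] e T(3) by (intro mult_left_mono) auto
          also have "\<dots> \<le> e * N x" using T(3) e N_nonneg[OF x] by simp
          finally show "N ((trunc_Q n \<circ> (K \<circ> T)) x) \<le> e * N x" by simp
        qed
        show "bnd ((K \<circ> T) \<circ> trunc_Q n) e" unfolding bnd_def
        proof
          fix x :: "int \<Rightarrow> 'a" assume x: "x \<in> lp p"
          have Q: "restr (- win n) x \<in> lp p" using x by (rule lp_restr)
          have Tx: "T (restr (- win n) x) \<in> lp p" using linD(1)[OF T(1) Q] .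
          let ?a = "restr (win m) (T (restr (- win n) x))" and ?b = "restr (- win m) (T (restr (- win n) x))"
          have ab: "?a \<in> lp p" "?b \<in> lp p" using Tx lp_restr by blast+
          have "K (T (restr (- win n) x)) = K ?a + K ?b"
            using linD(2)[OF CK(1) ab] restr_split[of "T (restr (- win n) x)" "win m"] by simp
          then have "N (K (T (restr (- win n) x))) \<le> N (K ?a) + N (K ?b)"
            using N_triangle[OF linD(1)[OF CK(1) ab(1)] linD(1)[OF CK(1) ab(2)]] by (simp only:)
          also have "N (K ?a) \<le> CK * N ?a" using bndD[OF CK(3) ab(1)] .
          also have "\<dots> \<le> CK * (e / (2 * CK) * N x)"
            using comm_small_off_diagonal(1)[OF T(1) D(2,1) x nD] CK(2) by (intro mult_left_mono) auto
          also have "?b = restr (- win m) ?b" by (auto simp: restr_def)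
          then have "N (K ?b) \<le> e / (2 * C) * N ?b"
            using m[of m] bndD[of "K \<circ> trunc_Q m" "e / (2 * C)" ?b] ab by (auto simp: trunc_Q_restr)
          also have "\<dots> \<le> e / (2 * C) * (C * N x)"
          proof -
            have "N ?b \<le> N (T (restr (- win n) x))" using N_restr[OF Tx] .
            also have "\<dots> \<le> C * N (restr (- win n) x)" using bndD[OF T(2) Q] .
            also have "\<dots> \<le> C * N x" using N_restr[OF x] T(3) by (intro mult_left_mono) auto
            finally show ?thesis using e T(3) by (intro mult_left_mono) auto
          qed
          finally have "N (K (T (restr (- win n) x))) \<le> e * N x"
            using CK(2) T(3) by (simp add: algebra_simps)
          then show "N ((K \<circ> T \<circ> trunc_Q n) x) \<le> e * N x" by (simp add: trunc_Q_restr)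
        qed
      qed
      then show ?thesis by blast
    qed
    ultimately show ?thesis
    proof -
      assume 1: "\<And>e. e > 0 \<Longrightarrow> \<exists>M. \<forall>n\<ge>M. bnd ((T \<circ> K) \<circ> trunc_Q n) e \<and> bnd (trunc_Q n \<circ> (T \<circ> K)) e"
        and 2: "\<And>e. e > 0 \<Longrightarrow> \<exists>M. \<forall>n\<ge>M. bnd ((K \<circ> T) \<circ> trunc_Q n) e \<and> bnd (trunc_Q n \<circ> (K \<circ> T)) e"
      have lQ: "lin (trunc_Q n)" for n unfolding trunc_Q_restr by (rule lin_restr)
      have "(\<lambda>n. op_norm p ((T \<circ> K) \<circ> trunc_Q n) + op_norm p (trunc_Q n \<circ> (T \<circ> K))) \<longlonglongrightarrow> 0"
        by (subst op_norm_pair_lim) (use 1 lin_comp lTK lQ in blast)+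
      moreover have "(\<lambda>n. op_norm p ((K \<circ> T) \<circ> trunc_Q n) + op_norm p (trunc_Q n \<circ> (K \<circ> T))) \<longlonglongrightarrow> 0"
        by (subst op_norm_pair_lim) (use 2 lin_comp lTK lQ in blast)+
      ultimately show ?thesis using bTK by (simp add: P_compact_ops_def)
    qed
  qed
  then show ?thesis using TB by (simp add: LP_ops_def)
qed

end

section \<open>Existence of limit operators\<close>

context lp_space
begin

text \<open>The convergence in \<open>limit_op\<close>, as real estimates. The memberships in
  \<open>LP_ops\<close> that are left out here are supplied by \<open>quasilocal_imp_LP\<close>, and
  the growth of \<open>h\<close> is carried separately.\<close>

definition op_lim :: "'a seq_op \<Rightarrow> (nat \<Rightarrow> int) \<Rightarrow> 'a seq_op \<Rightarrow> bool" where
  "op_lim A h B \<longleftrightarrow> lin B \<and> (\<exists>C>0. bnd B C) \<and> (\<forall>m e. e > 0 \<longrightarrow>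
     (\<exists>M. \<forall>n\<ge>M. bnd (restr (win m) \<circ> (shc (h n) A - B)) e \<and> bnd ((shc (h n) A - B) \<circ> restr (win m)) e))"

lemma op_limD:
  assumes "op_lim A h B" "e > 0"
  shows "\<exists>M. \<forall>n\<ge>M. \<forall>x\<in>lp p. N (restr (win m) (shc (h n) A x - B x)) \<le> e * N x
    \<and> N (shc (h n) A (restr (win m) x) - B (restr (win m) x)) \<le> e * N x"
  using assms unfolding op_lim_def bnd_def comp_apply minus_apply by meson

lemma limit_op_imp_op_lim:
  assumes A: "lin A" and L: "limit_op smul p A h B"
  shows "filterlim (\<lambda>n. \<bar>h n\<bar>) at_top sequentially" "op_lim A h B"
proof -
  show "filterlim (\<lambda>n. \<bar>h n\<bar>) at_top sequentially" using L by (simp add: limit_op_def)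
  have P: "P_strong_limit smul p (\<lambda>n. shc (h n) A) B" using L by (simp add: limit_op_def shc_def)
  then have "B \<in> bounded_ops smul p" by (simp add: P_strong_limit_def LP_ops_def)
  then obtain C where C: "lin B" "C > 0" "bnd B C" by (rule bounded_opsE)
  have "\<exists>M. \<forall>n\<ge>M. bnd (restr (win m) \<circ> (shc (h n) A - B)) e \<and> bnd ((shc (h n) A - B) \<circ> restr (win m)) e"
    if "e > 0" for m e
  proof -
    have "(\<lambda>n. op_norm p (restr (win m) \<circ> (shc (h n) A - B)) + op_norm p ((shc (h n) A - B) \<circ> restr (win m))) \<longlonglongrightarrow> 0"
      using P unfolding P_strong_limit_def trunc_P_restr by blast
    moreover have "lin (restr (win m) \<circ> (shc (h n) A - B))" "lin ((shc (h n) A - B) \<circ> restr (win m))" for n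
      by (intro lin_comp lin_minus lin_restr lin_shc A C)+
    ultimately show ?thesis
      using op_norm_pair_lim[of "\<lambda>n. restr (win m) \<circ> (shc (h n) A - B)" "\<lambda>n. (shc (h n) A - B) \<circ> restr (win m)"] that
      by blast
  qed
  then show "op_lim A h B" using C unfolding op_lim_def by blast
qed

lemma quasilocal_shc: "lin A \<Longrightarrow> quasilocal A \<Longrightarrow> quasilocal (shc h A)"
  unfolding quasilocal_def using comm_small_shc by blast

lemma op_lim_imp_limit_op:
  assumes A: "lin A" "bnd A C" "C > 0" "quasilocal A"
    and h: "filterlim (\<lambda>n. \<bar>h n\<bar>) at_top sequentially"
    and L: "op_lim A h B" and B: "quasilocal B"
  shows "limit_op smul p A h B"
proof -
  obtain C' where C': "lin B" "C' > 0" "bnd B C'" using L unfolding op_lim_def by blast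
  have sl: "lin (shc (h n) A)" "bnd (shc (h n) A) C" for n using A lin_shc bnd_shc by blast+
  have 1: "shc (h n) A \<in> LP_ops smul p" for n
    by (rule quasilocal_imp_LP[OF sl A(3) quasilocal_shc[OF A(1,4)]])
  have 2: "B \<in> LP_ops smul p" by (rule quasilocal_imp_LP[OF C'(1,3,2) B])
  have "op_norm p (shc (h n) A) \<le> ennreal C" for n using op_norm_le_iff sl A(3) by simp
  then have "(SUP n. op_norm p (shc (h n) A)) \<le> ennreal C" by (intro SUP_least)
  then have 3: "(SUP n. op_norm p (shc (h n) A)) < \<infinity>"
    by (metis ennreal_less_top infinity_ennreal_def order_le_less_trans)
  have 4: "(\<lambda>n. op_norm p (trunc_P m \<circ> (shc (h n) A - B)) + op_norm p ((shc (h n) A - B) \<circ> trunc_P m)) \<longlonglongrightarrow> 0" for m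
    unfolding trunc_P_restr
  proof (subst op_norm_pair_lim)
    show "lin (restr (win m) \<circ> (shc (h n) A - B))" "lin ((shc (h n) A - B) \<circ> restr (win m))" for n
      by (intro lin_comp lin_minus lin_restr sl C')+
    show "\<forall>e>0. \<exists>M. \<forall>n\<ge>M. bnd (restr (win m) \<circ> (shc (h n) A - B)) e \<and> bnd ((shc (h n) A - B) \<circ> restr (win m)) e"
      using L unfolding op_lim_def by blast
  qed
  have "P_strong_limit smul p (\<lambda>n. shc (h n) A) B"
    unfolding P_strong_limit_def using 1 2 3 4 by blast
  then show ?thesis using h unfolding limit_op_def shc_def by blast
qed

text \<open>The translates satisfy the commutator bound of \<open>A\<close>, but convergence is
  available only after truncation to a window. The bound is therefore proved on each window with
  arbitrarily small loss, and \<open>lp_boundI\<close> collects the windows; \<open>e\<close> and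
  \<open>D\<close> stay the same.\<close>

lemma op_lim_comm_small:
  assumes A: "lin A" "comm_small A e D" and L: "op_lim A h B"
  shows "comm_small B e D"
  unfolding comm_small_def
proof (intro allI impI ballI)
  fix \<phi> :: "int \<Rightarrow> real" and x :: "int \<Rightarrow> 'a"
  assume \<phi>: "\<forall>k. 0 \<le> \<phi> k \<and> \<phi> k \<le> 1" and sl: "\<forall>k l. \<bar>\<phi> k - \<phi> l\<bar> \<le> \<bar>real_of_int (k - l)\<bar> / D"
    and x: "x \<in> lp p"
  have B: "lin B" using L by (simp add: op_lim_def)
  have a1: "\<bar>\<phi> k\<bar> \<le> 1" for k using \<phi>[rule_format, of k] by simp
  have cx: "cutoff \<phi> x \<in> lp p" using x a1 by (rule lp_cut)
  have zl: "B (cutoff \<phi> x) - cutoff \<phi> (B x) \<in> lp p"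
    by (rule lp_diff[OF linD(1)[OF B cx] lp_cut[OF linD(1)[OF B x] a1]])
  have "N (restr (win m) (B (cutoff \<phi> x) - cutoff \<phi> (B x))) \<le> e * N x + \<eta>" if \<eta>: "\<eta> > 0" for m \<eta>
  proof -
    let ?d = "\<eta> / (2 * (N x + 1))"
    have Nx: "N x \<ge> 0" using N_nonneg x by blast
    have d: "?d > 0" using \<eta> Nx by simp
    obtain n where n: "\<And>y. y \<in> lp p \<Longrightarrow> N (restr (win m) (shc (h n) A y - B y)) \<le> ?d * N y"
      using op_limD[OF L d, of m] by blast
    let ?A = "shc (h n) A"
    have Al: "lin ?A" "comm_small ?A e D" using lin_shc comm_small_shc A by blast+
    let ?u = "restr (win m) (?A (cutoff \<phi> x) - B (cutoff \<phi> x))"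
    let ?v = "restr (win m) (?A (cutoff \<phi> x) - cutoff \<phi> (?A x))"
    let ?w = "restr (win m) (?A x - B x)"
    have m1: "?A (cutoff \<phi> x) - B (cutoff \<phi> x) \<in> lp p" by (rule lp_diff[OF linD(1)[OF Al(1) cx] linD(1)[OF B cx]])
    have m2: "?A (cutoff \<phi> x) - cutoff \<phi> (?A x) \<in> lp p"
      by (rule lp_diff[OF linD(1)[OF Al(1) cx] lp_cut[OF linD(1)[OF Al(1) x] a1]])
    have m3: "?A x - B x \<in> lp p" by (rule lp_diff[OF linD(1)[OF Al(1) x] linD(1)[OF B x]])
    have eq: "restr (win m) (B (cutoff \<phi> x) - cutoff \<phi> (B x)) = (?v - ?u) + cutoff \<phi> ?w"
      by (auto simp: fun_eq_iff restr_def cutoff_def scaleR_right_diff_distrib)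
    have "N (restr (win m) (B (cutoff \<phi> x) - cutoff \<phi> (B x))) \<le> N (?v - ?u) + N (cutoff \<phi> ?w)"
      unfolding eq by (rule N_triangle[OF lp_diff[OF lp_restr[OF m2] lp_restr[OF m1]] lp_cut[OF lp_restr[OF m3] a1]])
    moreover have "N (?v - ?u) \<le> N ?v + N ?u" by (rule N_diff[OF lp_restr[OF m2] lp_restr[OF m1]])
    moreover have "N ?v \<le> e * N x"
      using order_trans[OF N_restr[OF m2, of "win m"] comm_smallD[OF Al(2) _ _ x]] \<phi> sl by blast
    moreover have "N ?u \<le> ?d * N x"
    proof -
      have "?d * N (cutoff \<phi> x) \<le> ?d * N x" using d N_cut[OF x a1] by (intro mult_left_mono) auto
      then show ?thesis using n[OF cx] by linarith
    qed
    moreover have "N (cutoff \<phi> ?w) \<le> ?d * N x"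
      using order_trans[OF N_cut[OF lp_restr[OF m3] a1] n[OF x]] .
    moreover have "?d * N x + ?d * N x \<le> \<eta>"
    proof -
      have "?d * N x \<le> \<eta> / 2" using Nx \<eta> by (simp add: field_simps)
      then show ?thesis by linarith
    qed
    ultimately show ?thesis by linarith
  qed
  then have "N (restr (win m) (B (cutoff \<phi> x) - cutoff \<phi> (B x))) \<le> e * N x" for m
    by (rule field_le_epsilon)
  then show "N (B (cutoff \<phi> x) - cutoff \<phi> (B x)) \<le> e * N x"
    using lp_boundI(2) zl by blast
qed

lemma op_lim_quasilocal: "lin A \<Longrightarrow> quasilocal A \<Longrightarrow> op_lim A h B \<Longrightarrow> quasilocal B"
  unfolding quasilocal_def using op_lim_comm_small by blast

lemma lp_single: "single j v \<in> lp p" "N (single j v) \<le> norm v" for v :: 'a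
proof -
  have e: "single j v = restr {j} (\<lambda>_. v)" by (auto simp: single_def restr_def)
  show "single j v \<in> lp p" unfolding e by (rule lp_finite_supp) simp
  show "N (single j v) \<le> norm v" unfolding e using N_restr_sum[of "{j}" "\<lambda>_. v"] by simp
qed

lemma N_win_tendsto:
  fixes y :: "nat \<Rightarrow> int \<Rightarrow> 'a"
  assumes F: "finite F" and y: "\<And>k. k \<in> F \<Longrightarrow> (\<lambda>n. y n k) \<longlonglongrightarrow> 0" and e: "e > 0"
  shows "\<exists>M. \<forall>n\<ge>M. N (restr F (y n)) \<le> e"
proof -
  have "(\<lambda>n. \<Sum>k\<in>F. norm (y n k)) \<longlonglongrightarrow> (\<Sum>k\<in>F. 0)"
    by (intro tendsto_sum tendsto_norm_zero y)
  then obtain M where "\<And>n. n \<ge> M \<Longrightarrow> (\<Sum>k\<in>F. norm (y n k)) < e"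
    using order_tendstoD(2)[of _ 0 sequentially e] e by (auto simp: eventually_sequentially)
  then have "\<forall>n\<ge>M. N (restr F (y n)) \<le> e"
    using N_restr_sum[OF F, of "y n" for n] by (meson less_imp_le order_trans)
  then show ?thesis by blast
qed

end

context lp_space_fin
begin

lemma win_decomp:
  "restr (win M) x = (\<Sum>j\<in>win M. \<Sum>b\<in>bas. seq_scale smul (coef (x j) b) (single j b))"
proof
  fix k
  have "(\<Sum>j\<in>win M. \<Sum>b\<in>bas. seq_scale smul (coef (x j) b) (single j b)) k
      = (\<Sum>j\<in>win M. if k = j then (\<Sum>b\<in>bas. smul (coef (x j) b) b) else 0)"
    unfolding sum_apply by (intro sum.cong) (auto simp: seq_scale_def single_def)
  also have "\<dots> = restr (win M) x k" unfolding coef_sum by (simp add: restr_def)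
  finally show "restr (win M) x k
      = (\<Sum>j\<in>win M. \<Sum>b\<in>bas. seq_scale smul (coef (x j) b) (single j b)) k" by simp
qed

lemma lin_win_apply:
  assumes T: "lin T"
  shows "T (restr (win M) x) i = (\<Sum>j\<in>win M. \<Sum>b\<in>bas. smul (coef (x j) b) (T (single j b) i))"
proof -
  have l: "seq_scale smul c (single j b) \<in> lp p" for c j b by (rule lp_seq_scale[OF lp_single(1)])
  have "T (restr (win M) x) = (\<Sum>j\<in>win M. T (\<Sum>b\<in>bas. seq_scale smul (coef (x j) b) (single j b)))"
    unfolding win_decomp by (rule lin_sum[OF T]) (intro lp_sum l)
  also have "\<dots> = (\<Sum>j\<in>win M. \<Sum>b\<in>bas. T (seq_scale smul (coef (x j) b) (single j b)))"
    by (intro sum.cong refl lin_sum[OF T] l)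
  also have "\<dots> = (\<Sum>j\<in>win M. \<Sum>b\<in>bas. seq_scale smul (coef (x j) b) (T (single j b)))"
    using linD(3)[OF T lp_single(1)] by simp
  finally show ?thesis by (simp add: sum_apply seq_scale_def)
qed

text \<open>A diagonal argument makes every matrix entry of the translates converge along one
  subsequence, the entries being bounded in a finite-dimensional space. Locality, uniform over the
  translates, reduces truncated operators to finite matrices up to small errors, and for these
  entrywise convergence is norm convergence.\<close>

lemma op_lim_exists:
  fixes h :: "nat \<Rightarrow> int"
  assumes A: "lin A" "bnd A C" "C > 0" "quasilocal A"
  shows "\<exists>f B. strict_mono f \<and> op_lim A (h \<circ> f) B"
proof -
  have Al: "lin (shc l A)" "bnd (shc l A) C" for l using A lin_shc bnd_shc by blast+
  obtain bl where bl: "set bl = bas" using finite_list[OF bas(1)] by blast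
  \<comment> \<open>Numbering the basis by naturals, padded with zeros, gives the diagonal argument
    a countable index type.\<close>
  define e where "e l = (if l < length bl then bl ! l else 0)" for l
  have e: "\<exists>l. e l = b" if "b \<in> bas" for b
    using that unfolding bl[symmetric] in_set_conv_nth e_def by auto
  define s where "s i n = shc (h n) A (single (fst (snd i)) (e (snd (snd i)))) (fst i)" for i :: "int \<times> int \<times> nat" and n
  have "\<exists>f :: nat \<Rightarrow> nat. strict_mono f \<and> (\<forall>i. \<exists>l. (\<lambda>n. s i (f n)) \<longlonglongrightarrow> l)"
  proof (rule diagonal_convergent)
    fix i :: "int \<times> int \<times> nat" and f :: "nat \<Rightarrow> nat"
    obtain k j l where i: "i = (k, j, l)" by (cases i)
    have "norm (shc (h n) A (single j (e l)) k) \<le> C * norm (e l)" for n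
    proof -
      have "norm (shc (h n) A (single j (e l)) k) \<le> N (shc (h n) A (single j (e l)))"
        by (intro norm_le_N linD(1)[OF Al(1)] lp_single)
      also have "\<dots> \<le> C * N (single j (e l))" by (rule bndD[OF Al(2) lp_single(1)])
      also have "\<dots> \<le> C * norm (e l)" using A(3) lp_single(2) by (intro mult_left_mono) auto
      finally show ?thesis .
    qed
    then have "bounded (range (\<lambda>n. shc (h (f n)) A (single j (e l)) k))" by (auto simp: bounded_iff)
    then obtain g l' where "strict_mono g" "(\<lambda>n. shc (h (f (g n))) A (single j (e l)) k) \<longlonglongrightarrow> l'"
      using bounded_imp_convergent_subseq by blast
    then show "\<exists>g l'. strict_mono g \<and> (\<lambda>n. s i (f (g n))) \<longlonglongrightarrow> l'"
      unfolding i s_def by auto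
  qed
  then obtain f where f: "strict_mono f"
    and lim: "\<And>k j l. \<exists>l'. (\<lambda>n. shc (h (f n)) A (single j (e l)) k) \<longlonglongrightarrow> l'"
    unfolding s_def by (metis fst_conv snd_conv)
  define T where "T n = shc (h (f n)) A" for n
  have T: "lin (T n)" "bnd (T n) C" for n using Al by (simp_all add: T_def)
  have Tc: "comm_small (T n) d D" if "comm_small A d D" for n d D
    unfolding T_def using comm_small_shc[OF A(1) that] .
  have lim_b: "\<exists>l'. (\<lambda>n. T n (single j b) k) \<longlonglongrightarrow> l'" if "b \<in> bas" for j b k
    using lim e[OF that] unfolding T_def by metis
  have lim_smul: "(\<lambda>n. smul c (y n)) \<longlonglongrightarrow> smul c l" if "y \<longlonglongrightarrow> l" for c :: 'k and y :: "nat \<Rightarrow> 'a" and l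
  proof -
    have "(\<lambda>n. norm c * norm (y n - l)) \<longlonglongrightarrow> norm c * norm (l - l)" by (intro tendsto_intros that)
    then have "(\<lambda>n. norm (smul c (y n) - smul c l)) \<longlonglongrightarrow> 0"
      by (simp add: norm_smul[symmetric] scale_right_diff_distrib)
    then show ?thesis by (simp add: LIM_zero_iff tendsto_norm_zero_iff)
  qed
  have lim_win: "\<exists>l'. (\<lambda>n. T n (restr (win M) x) k) \<longlonglongrightarrow> l'" for M x k
  proof -
    have "\<forall>j. \<forall>b\<in>bas. \<exists>l'. (\<lambda>n. T n (single j b) k) \<longlonglongrightarrow> l'" using lim_b by blast
    then obtain L where L: "\<And>j b. b \<in> bas \<Longrightarrow> (\<lambda>n. T n (single j b) k) \<longlonglongrightarrow> L j b"
      unfolding bchoice_iff choice_iff by blast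
    have "(\<lambda>n. \<Sum>j\<in>win M. \<Sum>b\<in>bas. smul (coef (x j) b) (T n (single j b) k))
        \<longlonglongrightarrow> (\<Sum>j\<in>win M. \<Sum>b\<in>bas. smul (coef (x j) b) (L j b))"
      by (intro tendsto_sum lim_smul L)
    then show ?thesis unfolding lin_win_apply[OF T(1)] by blast
  qed
  \<comment> \<open>One window \<open>M\<close> serves all translates, because commutator bounds are
    invariant under translation.\<close>
  have approx: "\<exists>M. \<forall>n. N (restr (win m) (T n (restr (- win M) x))) \<le> d * N x
      \<and> N (restr (- win M) (T n (restr (win m) x))) \<le> d * N x"
    if d: "d > 0" and x: "x \<in> lp p" for d m x
  proof -
    obtain D where D: "D > 0" "comm_small A d D" using A(4) d unfolding quasilocal_def by blast
    have M: "real (m + nat \<lceil>D\<rceil>) \<ge> real m + D" by linarith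
    show ?thesis
      by (intro exI[of _ "m + nat \<lceil>D\<rceil>"] allI conjI
          comm_small_off_diagonal[OF T(1) Tc[OF D(2)] D(1) x M])
  qed
  have "\<exists>l. (\<lambda>n. T n x k) \<longlonglongrightarrow> l" if x: "x \<in> lp p" for x k
  proof -
    have "Cauchy (\<lambda>n. T n x k)"
    proof (rule metric_CauchyI)
      fix \<epsilon> :: real assume \<epsilon>: "\<epsilon> > 0"
      have Nx: "N x \<ge> 0" using N_nonneg x by blast
      let ?d = "\<epsilon> / (4 * (N x + 1))"
      have d: "?d > 0" using \<epsilon> Nx by simp
      have dN: "?d * N x \<le> \<epsilon> / 4"
        using \<epsilon> Nx by (simp add: field_simps)
      obtain M where M: "\<And>n. N (restr (win (nat \<bar>k\<bar>)) (T n (restr (- win M) x))) \<le> ?d * N x"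
        using approx[OF d x, of "nat \<bar>k\<bar>"] by blast
      have tail: "norm (T n x k - T n (restr (win M) x) k) \<le> \<epsilon> / 4" for n
      proof -
        have l: "restr (- win M) x \<in> lp p" "restr (win M) x \<in> lp p" using x lp_restr by blast+
        have "T n x = T n (restr (win M) x) + T n (restr (- win M) x)"
          using linD(2)[OF T(1) l(2,1)] restr_split[of x "win M"] by simp
        then have "T n x k - T n (restr (win M) x) k = restr (win (nat \<bar>k\<bar>)) (T n (restr (- win M) x)) k"
          unfolding restr_win_self by simp
        also have "norm \<dots> \<le> N (restr (win (nat \<bar>k\<bar>)) (T n (restr (- win M) x)))"
          by (intro norm_le_N lp_restr linD(1)[OF T(1)] l)
        finally show ?thesis using M[of n] dN by linarith
      qed
      have "Cauchy (\<lambda>n. T n (restr (win M) x) k)"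
        using lim_win[of M x k] LIMSEQ_imp_Cauchy by blast
      then obtain M' where M': "\<And>m n. m \<ge> M' \<Longrightarrow> n \<ge> M' \<Longrightarrow>
          dist (T m (restr (win M) x) k) (T n (restr (win M) x) k) < \<epsilon> / 4"
        using \<epsilon> unfolding Cauchy_def by (metis divide_pos_pos zero_less_numeral)
      have "dist (T m x k) (T n x k) < \<epsilon>" if "m \<ge> M'" "n \<ge> M'" for m n
      proof -
        have "dist (T m x k) (T n x k) \<le> dist (T m x k) (T m (restr (win M) x) k)
          + dist (T m (restr (win M) x) k) (T n (restr (win M) x) k) + dist (T n x k) (T n (restr (win M) x) k)"
          by (metis dist_commute dist_triangle_le dist_triangle2 add_mono order_refl)
        then show ?thesis using M'[OF that] tail[of m] tail[of n] \<epsilon> by (simp add: dist_norm)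
      qed
      then show "\<exists>M. \<forall>m\<ge>M. \<forall>n\<ge>M. dist (T m x k) (T n x k) < \<epsilon>" by blast
    qed
    then show ?thesis by (simp add: Cauchy_convergent_iff convergent_def)
  qed
  then obtain B where B: "\<And>x k. x \<in> lp p \<Longrightarrow> (\<lambda>n. T n x k) \<longlonglongrightarrow> B x k" by metis
  have win_conv: "\<exists>M. \<forall>n\<ge>M. N (restr (win m) (T n x - B x)) \<le> d" if "x \<in> lp p" "d > 0" for x m d
  proof (rule N_win_tendsto[OF _ _ \<open>d > 0\<close>])
    show "(\<lambda>n. (T n x - B x) k) \<longlonglongrightarrow> 0" for k
      using tendsto_diff[OF B[OF that(1), of k] tendsto_const[of "B x k"]] by simp
  qed simp
  have Bwin: "N (restr (win m) (B x)) \<le> C * N x" if x: "x \<in> lp p" for x m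
  proof (rule field_le_epsilon)
    fix d :: real assume "d > 0"
    then obtain n where n: "N (restr (win m) (T n x - B x)) \<le> d" using win_conv[OF x] by blast
    have fl: "restr (win m) y \<in> lp p" for y :: "int \<Rightarrow> 'a" by (rule lp_finite_supp) simp
    have "restr (win m) (B x) = restr (win m) (T n x) - restr (win m) (T n x - B x)"
      by (auto simp: restr_def fun_eq_iff)
    then have "N (restr (win m) (B x)) \<le> N (restr (win m) (T n x)) + N (restr (win m) (T n x - B x))"
      using N_diff[OF fl fl, of "T n x" "T n x - B x"] by (simp only:)
    moreover have "N (restr (win m) (T n x)) \<le> C * N x"
      using N_restr[OF linD(1)[OF T(1)[of n] x]] bndD[OF T(2)[of n] x] by (meson order_trans)
    ultimately show "N (restr (win m) (B x)) \<le> C * N x + d" using n by linarith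
  qed
  \<comment> \<open>Null sequences are not closed under entrywise limits, so for
    \<open>p = 0\<close> the decay of \<open>B x\<close> needs proof: a tail of \<open>x\<close> is
    small in norm, and what remains of \<open>x\<close> is sent by all translates into one common
    window up to a small error.\<close>
  have Bl: "p \<noteq> 0 \<or> B x \<in> lp p" if x: "x \<in> lp p" for x
  proof (cases "p = 0")
    case True
    have "\<exists>n. \<forall>k. k \<notin> win n \<longrightarrow> norm (B x k) < \<epsilon>" if \<epsilon>: "\<epsilon> > 0" for \<epsilon>
    proof -
      have Nx: "N x \<ge> 0" using N_nonneg x by blast
      let ?d = "\<epsilon> / (4 * (N x + 1))"
      have d: "?d > 0" using \<epsilon> Nx by simp
      have dN: "?d * N x \<le> \<epsilon> / 4" using \<epsilon> Nx by (simp add: field_simps)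
      obtain m where m: "N (restr (- win m) x) \<le> \<epsilon> / (4 * C)"
        using N_tail[OF x, of "\<epsilon> / (4 * C)"] True \<epsilon> A(3) by auto
      obtain M where M: "\<And>n. N (restr (- win M) (T n (restr (win m) x))) \<le> ?d * N x"
        using approx[OF d x, of m] by blast
      have "norm (B x k) \<le> \<epsilon> / 2" if k: "k \<notin> win M" for k
      proof (rule LIMSEQ_le_const2[OF tendsto_norm[OF B[OF x]]], intro exI allI impI)
        fix n
        have l: "restr (- win m) x \<in> lp p" "restr (win m) x \<in> lp p" using x lp_restr by blast+
        have "T n x k = T n (restr (win m) x) k + T n (restr (- win m) x) k"
          using linD(2)[OF T(1) l(2,1)] restr_split[of x "win m"] by (metis plus_fun_apply)
        moreover have "norm (T n (restr (win m) x) k) \<le> \<epsilon> / 4"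
        proof -
          have "norm (restr (- win M) (T n (restr (win m) x)) k) \<le> N (restr (- win M) (T n (restr (win m) x)))"
            by (intro norm_le_N lp_restr linD(1)[OF T(1)] l)
          moreover have "restr (- win M) (T n (restr (win m) x)) k = T n (restr (win m) x) k"
            using k by (auto simp: restr_def)
          ultimately have "norm (T n (restr (win m) x) k) \<le> N (restr (- win M) (T n (restr (win m) x)))"
            by (simp only:)
          then show ?thesis using M[of n] dN by (rule order_trans[OF order_trans])
        qed
        moreover have "norm (T n (restr (- win m) x) k) \<le> \<epsilon> / 4"
        proof -
          have "norm (T n (restr (- win m) x) k) \<le> N (T n (restr (- win m) x))"
            by (intro norm_le_N linD(1)[OF T(1)] l)
          also have "\<dots> \<le> C * N (restr (- win m) x)" by (rule bndD[OF T(2) l(1)])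
          also have "\<dots> \<le> C * (\<epsilon> / (4 * C))" using m A(3) by (intro mult_left_mono) auto
          finally show ?thesis using A(3) by simp
        qed
        ultimately show "norm (T n x k) \<le> \<epsilon> / 2"
          using norm_triangle_ineq[of "T n (restr (win m) x) k" "T n (restr (- win m) x) k"] by simp
      qed
      then show ?thesis using \<epsilon> by (intro exI[of _ M]) (auto intro: le_less_trans[of _ "\<epsilon>/2"])
    qed
    then show ?thesis unfolding lp_0_iff[OF True] by blast
  qed simp
  have linB: "lin B" unfolding lin_def
  proof (intro conjI ballI allI)
    fix x :: "int \<Rightarrow> 'a" assume x: "x \<in> lp p"
    show "B x \<in> lp p" using lp_boundI(1)[OF Bl[OF x]] Bwin[OF x] by blast
  next
    fix x y :: "int \<Rightarrow> 'a" assume x: "x \<in> lp p" and y: "y \<in> lp p"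
    show "B (x + y) = B x + B y"
    proof
      fix k
      have "(\<lambda>n. T n (x + y) k) \<longlonglongrightarrow> B x k + B y k"
        using tendsto_add[OF B[OF x, of k] B[OF y, of k]] linD(2)[OF T(1) x y] by simp
      then show "B (x + y) k = (B x + B y) k"
        using LIMSEQ_unique[OF B[OF lp_add[OF x y], of k]] by simp
    qed
  next
    fix c and x :: "int \<Rightarrow> 'a" assume x: "x \<in> lp p"
    show "B (seq_scale smul c x) = seq_scale smul c (B x)"
    proof
      fix k
      have "(\<lambda>n. T n (seq_scale smul c x) k) \<longlonglongrightarrow> smul c (B x k)"
        using lim_smul[OF B[OF x, of k], of c] linD(3)[OF T(1) x] by (simp add: seq_scale_def)
      then show "B (seq_scale smul c x) k = seq_scale smul c (B x) k"
        using LIMSEQ_unique[OF B[OF lp_seq_scale[OF x], of _ k]] by (simp add: seq_scale_def)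
    qed
  qed
  have bndB: "bnd B C" unfolding bnd_def using lp_boundI(2)[OF Bl] Bwin by blast
  have Boff: "N (restr (win m) (B (restr (- win M) x))) \<le> d * N x \<and> N (restr (- win M) (B (restr (win m) x))) \<le> d * N x"
    if D: "D > 0" "comm_small A d D" and M: "real M \<ge> real m + D" and x: "x \<in> lp p" and d0: "d > 0" for m M d D x
  proof
    have l: "restr (- win M) x \<in> lp p" "restr (win m) x \<in> lp p" using x lp_restr by blast+
    have fl: "restr (win j) y \<in> lp p" for y :: "int \<Rightarrow> 'a" and j by (rule lp_finite_supp) simp
    show "N (restr (win m) (B (restr (- win M) x))) \<le> d * N x"
    proof (rule field_le_epsilon)
      fix \<epsilon> :: real assume "\<epsilon> > 0"
      then obtain n where n: "N (restr (win m) (T n (restr (- win M) x) - B (restr (- win M) x))) \<le> \<epsilon>"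
        using win_conv[OF l(1)] by blast
      have e: "restr (win m) (B (restr (- win M) x)) = restr (win m) (T n (restr (- win M) x))
          - restr (win m) (T n (restr (- win M) x) - B (restr (- win M) x))"
        by (auto simp: restr_def fun_eq_iff)
      show "N (restr (win m) (B (restr (- win M) x))) \<le> d * N x + \<epsilon>"
        unfolding e using N_diff[OF fl fl, of m "T n (restr (- win M) x)" m "T n (restr (- win M) x) - B (restr (- win M) x)"]
          n comm_small_off_diagonal(1)[OF T(1) Tc[OF D(2)] D(1) x M, of n] by linarith
    qed
    have Bl: "restr (- win M) (B (restr (win m) x)) \<in> lp p" by (intro lp_restr linD(1)[OF linB] x)
    show "N (restr (- win M) (B (restr (win m) x))) \<le> d * N x"
    proof (rule lp_boundI(2)[OF disjI2[OF Bl]])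
      fix j
      show "N (restr (win j) (restr (- win M) (B (restr (win m) x)))) \<le> d * N x"
      proof (rule field_le_epsilon)
        fix \<epsilon> :: real assume "\<epsilon> > 0"
        then obtain n where n: "N (restr (win j) (T n (restr (win m) x) - B (restr (win m) x))) \<le> \<epsilon>"
          using win_conv[OF l(2)] by blast
        let ?R = "\<lambda>y. restr (win j) (restr (- win M) y)"
        have e: "?R (B (restr (win m) x)) = ?R (T n (restr (win m) x))
            - restr (- win M) (restr (win j) (T n (restr (win m) x) - B (restr (win m) x)))"
          by (auto simp: restr_def fun_eq_iff)
        have "N (?R (B (restr (win m) x))) \<le> N (?R (T n (restr (win m) x)))
            + N (restr (- win M) (restr (win j) (T n (restr (win m) x) - B (restr (win m) x))))"
          unfolding e by (rule N_diff[OF fl lp_restr[OF fl]])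
        moreover have "N (?R (T n (restr (win m) x))) \<le> N (restr (- win M) (T n (restr (win m) x)))"
          by (intro N_restr lp_restr linD(1)[OF T(1)] x)
        moreover have "N (restr (- win M) (restr (win j) (T n (restr (win m) x) - B (restr (win m) x))))
            \<le> N (restr (win j) (T n (restr (win m) x) - B (restr (win m) x)))" by (rule N_restr[OF fl])
        ultimately show "N (?R (B (restr (win m) x))) \<le> d * N x + \<epsilon>"
          using n comm_small_off_diagonal(2)[OF T(1) Tc[OF D(2)] D(1) x M, of n] by linarith
      qed
    qed
  qed
  \<comment> \<open>Only finitely many matrix entries occur, and the coefficients of
    \<open>x\<close> are bounded by a multiple of \<open>N x\<close>; hence the convergence is
    uniform in \<open>x\<close>.\<close>
  have finconv: "\<exists>K. \<forall>n\<ge>K. \<forall>x\<in>lp p. N (restr (win m) (T n (restr (win M) x) - B (restr (win M) x))) \<le> d * N x"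
    if d: "d > 0" for m M d
  proof -
    obtain c where c: "c > 0" "\<And>v. (\<Sum>b\<in>bas. norm (coef v b)) \<le> c * norm v" using coef_bound by blast
    define \<delta> where "\<delta> n = (\<Sum>i\<in>win m. \<Sum>j\<in>win M. \<Sum>b\<in>bas. norm (T n (single j b) i - B (single j b) i))" for n
    have "\<delta> \<longlonglongrightarrow> (\<Sum>i\<in>win m. \<Sum>j\<in>win M. \<Sum>b\<in>bas. norm (B (single j b) i - B (single j b) i))"
      unfolding \<delta>_def by (intro tendsto_intros B lp_single)
    then have "\<delta> \<longlonglongrightarrow> 0" by simp
    then obtain K where K: "\<And>n. n \<ge> K \<Longrightarrow> \<delta> n < d / c"
      using order_tendstoD(2)[of \<delta> 0 sequentially "d / c"] d c(1) by (auto simp: eventually_sequentially)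
    have "N (restr (win m) (T n (restr (win M) x) - B (restr (win M) x))) \<le> d * N x"
      if n: "n \<ge> K" and x: "x \<in> lp p" for n x
    proof -
      have Nx: "N x \<ge> 0" using N_nonneg x by blast
      have cf: "norm (coef (x j) b) \<le> c * N x" if "b \<in> bas" for j b
      proof -
        have "norm (coef (x j) b) \<le> (\<Sum>b\<in>bas. norm (coef (x j) b))"
          using that bas(1) by (intro member_le_sum) auto
        also have "\<dots> \<le> c * norm (x j)" by (rule c(2))
        also have "\<dots> \<le> c * N x" using c(1) norm_le_N[OF x] by (intro mult_left_mono) auto
        finally show ?thesis .
      qed
      have pt: "norm ((T n (restr (win M) x) - B (restr (win M) x)) i) \<le>
          (\<Sum>j\<in>win M. \<Sum>b\<in>bas. (c * N x) * norm (T n (single j b) i - B (single j b) i))" for i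
      proof -
        have "(T n (restr (win M) x) - B (restr (win M) x)) i
            = (\<Sum>j\<in>win M. \<Sum>b\<in>bas. smul (coef (x j) b) (T n (single j b) i - B (single j b) i))"
          by (simp add: lin_win_apply[OF T(1)] lin_win_apply[OF linB] sum_subtractf scale_right_diff_distrib)
        also have "norm \<dots> \<le> (\<Sum>j\<in>win M. \<Sum>b\<in>bas. norm (smul (coef (x j) b) (T n (single j b) i - B (single j b) i)))"
          by (rule order_trans[OF norm_sum]) (intro sum_mono norm_sum)
        also have "\<dots> \<le> (\<Sum>j\<in>win M. \<Sum>b\<in>bas. (c * N x) * norm (T n (single j b) i - B (single j b) i))"
          unfolding norm_smul by (intro sum_mono mult_right_mono cf) auto
        finally show ?thesis .
      qed
      have "N (restr (win m) (T n (restr (win M) x) - B (restr (win M) x)))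
          \<le> (\<Sum>i\<in>win m. norm ((T n (restr (win M) x) - B (restr (win M) x)) i))"
        by (rule N_restr_sum) simp
      also have "\<dots> \<le> (\<Sum>i\<in>win m. \<Sum>j\<in>win M. \<Sum>b\<in>bas. (c * N x) * norm (T n (single j b) i - B (single j b) i))"
        by (intro sum_mono pt)
      also have "\<dots> = (c * N x) * \<delta> n" by (simp add: \<delta>_def sum_distrib_left)
      also have "\<dots> \<le> (c * N x) * (d / c)" using K[OF n] c(1) Nx by (intro mult_left_mono) auto
      finally show ?thesis using c(1) by (simp add: mult.commute)
    qed
    then show ?thesis by blast
  qed
  have "\<exists>M. \<forall>n\<ge>M. bnd (restr (win m) \<circ> (T n - B)) e \<and> bnd ((T n - B) \<circ> restr (win m)) e"
    if \<epsilon>: "e > 0" for m and e :: real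
  proof -
    obtain D where D: "D > 0" "comm_small A (e/4) D"
      using A(4) \<epsilon> unfolding quasilocal_def by (metis divide_pos_pos zero_less_numeral)
    define M where "M = m + nat \<lceil>D\<rceil>"
    have M: "real M \<ge> real m + D" unfolding M_def by linarith
    obtain K1 where K1: "\<And>n x. n \<ge> K1 \<Longrightarrow> x \<in> lp p \<Longrightarrow>
        N (restr (win m) (T n (restr (win M) x) - B (restr (win M) x))) \<le> e/2 * N x"
      using finconv[of "e/2" m M] \<epsilon> by auto
    obtain K2 where K2: "\<And>n x. n \<ge> K2 \<Longrightarrow> x \<in> lp p \<Longrightarrow>
        N (restr (win M) (T n (restr (win m) x) - B (restr (win m) x))) \<le> e/2 * N x"
      using finconv[of "e/2" M m] \<epsilon> by auto
    have "bnd (restr (win m) \<circ> (T n - B)) e \<and> bnd ((T n - B) \<circ> restr (win m)) e" if n: "n \<ge> max K1 K2" for n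
    proof
      have lTB: "lin (T n - B)" using lin_minus T linB by blast
      have e4: "e/4 > 0" using \<epsilon> by simp
      show "bnd (restr (win m) \<circ> (T n - B)) e" unfolding bnd_def
      proof
        fix x :: "int \<Rightarrow> 'a" assume x: "x \<in> lp p"
        have l: "restr (- win M) x \<in> lp p" using x by (rule lp_restr)
        have "N ((restr (win m) \<circ> (T n - B)) x) \<le> N ((restr (win m) \<circ> (T n - B)) (restr (win M) x))
            + N ((restr (win m) \<circ> (T n - B)) (restr (- win M) x))"
          by (rule N_split[OF lin_comp[OF lin_restr lTB] x])
        moreover have "N ((restr (win m) \<circ> (T n - B)) (restr (win M) x)) \<le> e/2 * N x"
          using K1[OF _ x, of n] n by simp
        moreover have "N ((restr (win m) \<circ> (T n - B)) (restr (- win M) x)) \<le> e/4 * N x + e/4 * N x"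
        proof -
          have e: "(restr (win m) \<circ> (T n - B)) (restr (- win M) x)
            = restr (win m) (T n (restr (- win M) x)) - restr (win m) (B (restr (- win M) x))"
            by (auto simp: restr_def fun_eq_iff)
          show ?thesis unfolding e
            using N_diff[OF lp_restr[OF linD(1)[OF T(1)[of n] l]] lp_restr[OF linD(1)[OF linB l]], of "win m" "win m"]
              comm_small_off_diagonal(1)[OF T(1) Tc[OF D(2)] D(1) x M, of n] Boff[OF D M x e4] by linarith
        qed
        ultimately show "N ((restr (win m) \<circ> (T n - B)) x) \<le> e * N x" by linarith
      qed
      show "bnd ((T n - B) \<circ> restr (win m)) e" unfolding bnd_def
      proof
        fix x :: "int \<Rightarrow> 'a" assume x: "x \<in> lp p"
        have l: "restr (win m) x \<in> lp p" using x by (rule lp_restr)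
        let ?y = "(T n - B) (restr (win m) x)"
        have yl: "?y \<in> lp p" by (rule linD(1)[OF lTB l])
        have "?y = restr (win M) ?y + restr (- win M) ?y" by (rule restr_split)
        then have "N ?y \<le> N (restr (win M) ?y) + N (restr (- win M) ?y)"
          using N_triangle[OF lp_restr[OF yl] lp_restr[OF yl], of "win M" "- win M"] by (simp only:)
        moreover have "N (restr (win M) ?y) \<le> e/2 * N x" using K2[OF _ x, of n] n by simp
        moreover have "N (restr (- win M) ?y) \<le> e/4 * N x + e/4 * N x"
        proof -
          have e: "restr (- win M) ?y = restr (- win M) (T n (restr (win m) x)) - restr (- win M) (B (restr (win m) x))"
            by (auto simp: restr_def fun_eq_iff)
          show ?thesis unfolding e
            using N_diff[OF lp_restr[OF linD(1)[OF T(1)[of n] l]] lp_restr[OF linD(1)[OF linB l]], of "- win M" "- win M"]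
              comm_small_off_diagonal(2)[OF T(1) Tc[OF D(2)] D(1) x M, of n] Boff[OF D M x e4] by linarith
        qed
        ultimately show "N (((T n - B) \<circ> restr (win m)) x) \<le> e * N x" by simp
      qed
    qed
    then show ?thesis by blast
  qed
  then have "op_lim A (h \<circ> f) B"
    unfolding op_lim_def using linB bndB A(3) by (auto simp: T_def)
  then show ?thesis using f by blast
qed

end

section \<open>Localization and nested windows\<close>

lemma interval_recenter: "S \<subseteq> {c - D..c + D}" if "S \<subseteq> {j..j + D}" "c \<in> S" for c D j :: int
proof
  fix k assume "k \<in> S"
  then have "k \<in> {j..j + D}" "c \<in> {j..j + D}" using that by blast+
  then show "k \<in> {c - D..c + D}" by auto
qed

text \<open>In the applications a higher level is a stronger form of badness, and each localization,
  to a window of length \<open>D m\<close>, lowers the level by one. A point of the innermost set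
  lies in all sets of the chain, so it can serve as centre for every level at once; recentring
  replaces an interval of length \<open>D m\<close> by one of radius \<open>D m\<close>.\<close>

lemma nested_windows:
  fixes bad :: "nat \<Rightarrow> int set \<Rightarrow> bool" and D :: "nat \<Rightarrow> nat"
  assumes step: "\<And>m S. bad (Suc m) S \<Longrightarrow> \<exists>S'\<subseteq>S. S' \<noteq> {} \<and> (\<exists>j. S' \<subseteq> {j..j + int (D m)}) \<and> bad m S'"
    and start: "\<And>n. \<exists>S. S \<inter> win n = {} \<and> bad (Suc n) S"
  shows "\<exists>h. \<forall>n. \<bar>h n\<bar> > int n \<and> (\<forall>m\<le>n. \<exists>S\<subseteq>{h n - int (D m)..h n + int (D m)}. bad m S)"
proof -
  have chain: "\<exists>c\<in>S. \<forall>m\<le>n. \<exists>S'\<subseteq>{c - int (D m)..c + int (D m)}. bad m S'" if "bad (Suc n) S" for n S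
    using that
  proof (induction n arbitrary: S)
    case 0
    from step[OF 0] obtain S' j where S': "S' \<subseteq> S" "S' \<noteq> {}" "S' \<subseteq> {j..j + int (D 0)}" "bad 0 S'"
      by blast
    then obtain c where c: "c \<in> S'" by blast
    have "S' \<subseteq> {c - int (D 0)..c + int (D 0)}" by (rule interval_recenter[OF S'(3) c])
    then show ?case using S' c by auto
  next
    case (Suc n)
    obtain S' j where S': "S' \<subseteq> S" "S' \<subseteq> {j..j + int (D (Suc n))}" "bad (Suc n) S'"
      using step[OF Suc.prems] by blast
    obtain c where c: "c \<in> S'" "\<And>m. m \<le> n \<Longrightarrow> \<exists>S''\<subseteq>{c - int (D m)..c + int (D m)}. bad m S''"
      using Suc.IH[OF S'(3)] by blast
    have "S' \<subseteq> {c - int (D (Suc n))..c + int (D (Suc n))}" by (rule interval_recenter[OF S'(2) c(1)])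
    then show ?case using S' c by (metis le_Suc_eq subsetD)
  qed
  have "\<exists>c. \<bar>c\<bar> > int n \<and> (\<forall>m\<le>n. \<exists>S\<subseteq>{c - int (D m)..c + int (D m)}. bad m S)" for n
  proof -
    obtain S where S: "S \<inter> win n = {}" "bad (Suc n) S" using start by blast
    obtain c where c: "c \<in> S" "\<forall>m\<le>n. \<exists>S'\<subseteq>{c - int (D m)..c + int (D m)}. bad m S'"
      using chain[OF S(2)] by blast
    have "c \<notin> win n" using S c by blast
    then have "\<bar>c\<bar> > int n" by auto
    then show ?thesis using c by blast
  qed
  then show ?thesis by metis
qed

lemma supp_restr: "supp (restr S x) = supp x \<inter> S"
  by (auto simp: supp_def restr_def)

lemma restr_id: "supp x \<subseteq> S \<Longrightarrow> restr S x = x"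
  by (auto simp: supp_def restr_def fun_eq_iff)

lemma supp_cut: "supp (cutoff \<phi> x) \<subseteq> supp x"
  by (auto simp: supp_def cutoff_def)

lemma supp_shift: "supp (shift h x) = (\<lambda>k. k + h) ` supp x"
  by (force simp: supp_def shift_def image_iff)

context lp_space
begin

definition below_at_infinity :: "'a seq_op \<Rightarrow> nat \<Rightarrow> real \<Rightarrow> bool" where
  "below_at_infinity A n \<nu> \<longleftrightarrow> (\<forall>x\<in>lp p. supp x \<inter> win n = {} \<longrightarrow> \<nu> * N x \<le> N (A x))"

text \<open>The preimage \<open>x\<close> may live anywhere and \<open>A x\<close> is prescribed on
  \<open>W\<close> only. This is the dual form of a lower bound on sequences supported in
  \<open>W\<close>, and it passes to subsets of \<open>W\<close>.\<close>

definition solvable_on :: "'a seq_op \<Rightarrow> int set \<Rightarrow> real \<Rightarrow> bool" where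
  "solvable_on A W C \<longleftrightarrow> (\<forall>y\<in>lp p. supp y \<subseteq> W \<longrightarrow> (\<exists>x\<in>lp p. N x \<le> C * N y \<and> restr W (A x) = y))"

text \<open>Blocks have length \<open>2 * d\<close>, and \<open>(2 * j + 1) * d\<close> is the
  midpoint of block \<open>j\<close>. The plateau covers the block, the slopes cover the two
  adjacent blocks.\<close>

definition bump :: "nat \<Rightarrow> int \<Rightarrow> int \<Rightarrow> real" where
  "bump d j = tent (real d) (2 * real d) ((2 * j + 1) * int d)"

lemma mem_nbhd_bump: "k \<in> nbhd (2 * int d) j \<longleftrightarrow> - 5 * int d \<le> k - (2 * j + 1) * int d \<and> k - (2 * j + 1) * int d < 5 * int d"
  by (auto simp: nbhd_def algebra_simps)

lemma bump_support: "d > 0 \<Longrightarrow> bump d j k \<noteq> 0 \<Longrightarrow> \<bar>k - (2 * j + 1) * int d\<bar> < 3 * int d"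
proof (rule ccontr)
  assume d: "d > 0" and ne: "bump d j k \<noteq> 0" and "\<not> \<bar>k - (2 * j + 1) * int d\<bar> < 3 * int d"
  then have "real_of_int (3 * int d) \<le> real_of_int \<bar>k - (2 * j + 1) * int d\<bar>"
    by (simp only: of_int_le_iff not_less)
  then have "bump d j k = 0" unfolding bump_def using d by (intro tent_zero) simp_all
  then show False using ne by simp
qed

lemma bump_one: "d > 0 \<Longrightarrow> k \<in> blk (2 * int d) j \<Longrightarrow> bump d j k = 1"
proof -
  assume d: "d > 0" and k: "k \<in> blk (2 * int d) j"
  have "\<bar>k - (2 * j + 1) * int d\<bar> \<le> int d" using k by (auto simp: blk_def algebra_simps abs_le_iff)
  then have "real_of_int \<bar>k - (2 * j + 1) * int d\<bar> \<le> real_of_int (int d)" by (simp only: of_int_le_iff)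
  then show ?thesis unfolding bump_def using d
    by (intro tent_one) simp_all
qed

lemma bump_abs: "\<bar>bump d j k\<bar> \<le> 1" unfolding bump_def by (rule tent_abs)

lemma lp_bump: "x \<in> lp p \<Longrightarrow> cutoff (bump d j) x \<in> lp p"
  and N_bump: "x \<in> lp p \<Longrightarrow> N (cutoff (bump d j) x) \<le> N x"
  for x :: "int \<Rightarrow> 'a"
  by (rule lp_cut, assumption, rule bump_abs) (rule N_cut, assumption, rule bump_abs)

lemma blk_subset_nbhd: "d > 0 \<Longrightarrow> blk (2 * int d) j \<subseteq> nbhd (2 * int d) j"
  by (auto simp: mem_blk mem_nbhd)

lemma banded_apply_eq:
  "banded B w M \<Longrightarrow> x \<in> lp p \<Longrightarrow> y \<in> lp p \<Longrightarrow> (\<And>l. \<bar>l - k\<bar> \<le> int w \<Longrightarrow> x l = y l) \<Longrightarrow> B x k = B y k"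
  unfolding banded_def by blast

text \<open>The bump reaches \<open>3 * d\<close> from the midpoint of its block and the band adds
  at most \<open>2 * d\<close>, so everything takes place within distance \<open>5 * d\<close>. The
  gain is a commutator bound by the norm of \<open>x\<close> near block \<open>j\<close> instead of
  its global norm.\<close>

lemma banded_bump:
  fixes j :: int
  assumes B: "banded B w M" and d: "d > 0" "w \<le> 2 * d" and x: "x \<in> lp p"
  defines "\<phi> \<equiv> bump d j" and "U \<equiv> nbhd (2 * int d) j"
  shows "N (B (cutoff \<phi> x) - cutoff \<phi> (B x)) \<le> M / (2 * real d) * N (restr U x)"
    and "supp (B (cutoff \<phi> x)) \<subseteq> U" and "supp (cutoff \<phi> x) \<subseteq> U"
    and "cutoff \<phi> (B x) = cutoff \<phi> (restr U (B x))"
    and "restr (blk (2 * int d) j) (cutoff \<phi> x) = restr (blk (2 * int d) j) x"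
proof -
  have lB: "lin B" using B by (simp add: banded_def)
  let ?c = "(2 * j + 1) * int d"
  have sup: "\<bar>k - ?c\<bar> < 3 * int d" if "\<phi> k \<noteq> 0" for k
    using bump_support[OF d(1)] that unfolding \<phi>_def by blast
  have U: "k \<in> U \<longleftrightarrow> - 5 * int d \<le> k - ?c \<and> k - ?c < 5 * int d" for k
    unfolding U_def by (rule mem_nbhd_bump)
  have supU: "k \<in> U" if "\<phi> k \<noteq> 0" for k using sup[OF that] U[of k] by linarith
  show s: "supp (cutoff \<phi> x) \<subseteq> U" using supU by (auto simp: supp_def cutoff_def)
  show "cutoff \<phi> (B x) = cutoff \<phi> (restr U (B x))" using supU by (auto simp: cutoff_def restr_def fun_eq_iff)
  show "restr (blk (2 * int d) j) (cutoff \<phi> x) = restr (blk (2 * int d) j) x"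
    using bump_one[OF d(1)] by (auto simp: restr_def cutoff_def fun_eq_iff \<phi>_def)
  have a1: "\<bar>\<phi> k\<bar> \<le> 1" for k unfolding \<phi>_def by (rule bump_abs)
  have cx: "cutoff \<phi> x \<in> lp p" using x a1 by (rule lp_cut)
  show "supp (B (cutoff \<phi> x)) \<subseteq> U"
  proof
    fix k assume k: "k \<in> supp (B (cutoff \<phi> x))"
    show "k \<in> U"
    proof (rule ccontr)
      assume "k \<notin> U"
      then have far: "\<bar>k - ?c\<bar> \<ge> 5 * int d" using U[of k] by linarith
      have "cutoff \<phi> x l = (0 :: int \<Rightarrow> 'a) l" if "\<bar>l - k\<bar> \<le> int w" for l
      proof -
        have "\<bar>l - ?c\<bar> \<ge> 3 * int d" using far that d(2) by linarith
        then have "\<phi> l = 0" using sup[of l] by linarith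
        then show ?thesis by (simp add: cutoff_def)
      qed
      then have "B (cutoff \<phi> x) k = B 0 k" by (intro banded_apply_eq[OF B cx]) auto
      then show False using k lin_zero[OF lB] by (simp add: supp_def)
    qed
  qed
  have rx: "restr U x \<in> lp p" using x by (rule lp_restr)
  have e1: "cutoff \<phi> (restr U x) = cutoff \<phi> x" using supU by (auto simp: cutoff_def restr_def fun_eq_iff)
  have e2: "cutoff \<phi> (B x) = cutoff \<phi> (B (restr U x))"
  proof
    fix k
    show "cutoff \<phi> (B x) k = cutoff \<phi> (B (restr U x)) k"
    proof (cases "\<phi> k = 0")
      case False
      have "x l = restr U x l" if "\<bar>l - k\<bar> \<le> int w" for l
      proof -
        have "l \<in> U" using sup[OF False] that d(2) U[of l] by linarith
        then show ?thesis by (simp add: restr_def)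
      qed
      then have "B x k = B (restr U x) k" by (rule banded_apply_eq[OF B x rx])
      then show ?thesis by (simp add: cutoff_def)
    qed (simp add: cutoff_def)
  qed
  have "comm_small B (M / (2 * real d)) (2 * real d)" using B d unfolding banded_def by simp
  then show "N (B (cutoff \<phi> x) - cutoff \<phi> (B x)) \<le> M / (2 * real d) * N (restr U x)"
    unfolding e2 e1[symmetric] unfolding \<phi>_def bump_def using d by (intro comm_small_tent rx) auto
qed

text \<open>A good block for \<open>x\<close> and \<open>B x\<close> is selected and
  \<open>x\<close> is multiplied by its bump: near this block the image is as small as globally, up
  to the factor 20, and the commutator is small relative to the mass on the block. It matters that
  \<open>D\<close> depends only on \<open>A\<close> and \<open>e\<close>, not on
  \<open>\<kappa>\<close> or \<open>x\<close>.\<close>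

lemma localize_small_vector:
  assumes A: "band_dominated smul p A" and e: "e > 0"
  shows "\<exists>D::nat. \<forall>\<kappa>>0. \<forall>x\<in>lp p. x \<noteq> 0 \<longrightarrow> N (A x) \<le> \<kappa> * N x \<longrightarrow>
    (\<exists>z\<in>lp p. z \<noteq> 0 \<and> supp z \<subseteq> supp x \<and> (\<exists>j. supp z \<subseteq> {j..j + int D}) \<and> N (A z) \<le> (20 * \<kappa> + e) * N z)"
proof -
  \<comment> \<open>The distance \<open>e / 42\<close> counts 20 times through the choice of the
    block and once in returning from \<open>B\<close> to \<open>A\<close>, together
    \<open>e / 2\<close>; the commutator takes the other half.\<close>
  obtain B w M where B: "banded B w M" "bnd (A - B) (e / 42)"
    using band_dominated_approx[OF A, of "e/42"] e by auto
  have lA: "lin A" using A by (auto simp: band_dominated_def bounded_ops_iff)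
  have lB: "lin B" and M: "M \<ge> 0" using B by (auto simp: banded_def)
  \<comment> \<open>Blocks at least as long as the band is wide, and so long that the commutator
    \<open>M / (2 * d)\<close>, times the factor 20 of the good block, is at most
    \<open>e / 2\<close>.\<close>
  define d where "d = Suc (max w (nat \<lceil>20 * M / e\<rceil>))"
  have d: "d > 0" "w \<le> 2 * d" by (auto simp: d_def)
  have "20 * M / e \<le> real d" unfolding d_def by linarith
  then have Md: "20 * (M / (2 * real d)) \<le> e / 2" using e d by (simp add: field_simps)
  let ?D = "2 * int d"
  have diff: "N (A x) \<le> N (B x) + e / 42 * N x \<and> N (B x) \<le> N (A x) + e / 42 * N x" if "x \<in> lp p" for x
    using N_le_diff[OF linD(1)[OF lA that] linD(1)[OF lB that]] N_le_diff[OF linD(1)[OF lB that] linD(1)[OF lA that]]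
      N_diff_commute[OF linD(1)[OF lA that] linD(1)[OF lB that]] bndD[OF B(2) that] by simp
  have "\<exists>z\<in>lp p. z \<noteq> 0 \<and> supp z \<subseteq> supp x \<and> (\<exists>j. supp z \<subseteq> {j..j + int (10 * d)}) \<and> N (A z) \<le> (20 * \<kappa> + e) * N z"
    if \<kappa>: "\<kappa> > 0" and x: "x \<in> lp p" "x \<noteq> 0" and le: "N (A x) \<le> \<kappa> * N x" for \<kappa> x
  proof -
    have Bx: "B x \<in> lp p" by (rule linD(1)[OF lB x(1)])
    have "N (B x) \<le> (\<kappa> + e/42) * N x" using diff[OF x(1)] le by (simp add: algebra_simps)
    then obtain j where j: "restr (blk ?D j) x \<noteq> 0"
        "N (restr (nbhd ?D j) (B x)) \<le> 20 * (\<kappa> + e/42) * N (restr (blk ?D j) x)"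
        "N (restr (nbhd ?D j) x) \<le> 20 * N (restr (blk ?D j) x)"
      using good_block[OF x Bx, of "\<kappa> + e/42" ?D] \<kappa> e d by auto
    let ?z = "cutoff (bump d j) x"
    note bb = banded_bump[OF B(1) d x(1), of j]
    have z: "?z \<in> lp p" using x(1) by (rule lp_bump)
    have zN: "N (restr (blk ?D j) x) \<le> N ?z" using N_restr[OF z, of "blk ?D j"] unfolding bb(5) .
    have "?z \<noteq> 0"
    proof
      assume "?z = 0"
      then have "restr (blk ?D j) x = restr (blk ?D j) 0" using bb(5) by simp
      also have "\<dots> = 0" by (auto simp: restr_def)
      finally show False using j(1) by simp
    qed
    moreover have "supp ?z \<subseteq> supp x" by (rule supp_cut)
    moreover have "supp ?z \<subseteq> {(j - 2) * ?D..(j - 2) * ?D + int (10 * d)}"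
      using bb(3) by (force simp: nbhd_def algebra_simps)
    moreover have "N (A ?z) \<le> (20 * \<kappa> + e) * N ?z"
    proof -
      let ?K = "N (restr (blk ?D j) x)"
      have K0: "?K \<ge> 0" by (intro N_nonneg lp_restr x)
      have cB: "cutoff (bump d j) (B x) \<in> lp p" using Bx by (rule lp_bump)
      have "N (B ?z) \<le> N (cutoff (bump d j) (B x)) + N (B ?z - cutoff (bump d j) (B x))"
        by (rule N_le_diff[OF linD(1)[OF lB z] cB])
      also have "N (cutoff (bump d j) (B x)) \<le> N (restr (nbhd ?D j) (B x))"
        unfolding bb(4) by (rule N_bump[OF lp_restr[OF Bx]])
      also have "\<dots> \<le> 20 * (\<kappa> + e/42) * ?K" by (rule j(2))
      also have "N (B ?z - cutoff (bump d j) (B x)) \<le> M / (2 * real d) * N (restr (nbhd ?D j) x)" by (rule bb(1))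
      also have "\<dots> \<le> M / (2 * real d) * (20 * ?K)" using j(3) M by (intro mult_left_mono) auto
      also have "\<dots> = 20 * (M / (2 * real d)) * ?K" by simp
      also have "\<dots> \<le> e / 2 * ?K" using Md K0 by (rule mult_right_mono)
      finally have "N (B ?z) \<le> (20 * (\<kappa> + e/42) + e / 2) * ?K" by (simp add: algebra_simps)
      also have "\<dots> \<le> (20 * (\<kappa> + e/42) + e / 2) * N ?z" using zN \<kappa> e by (intro mult_left_mono) auto
      finally have "N (A ?z) \<le> (20 * (\<kappa> + e/42) + e / 2) * N ?z + e / 42 * N ?z" using diff[OF z] by linarith
      also have "\<dots> = (20 * \<kappa> + e) * N ?z" by (simp add: algebra_simps)
      finally show ?thesis .
    qed
    ultimately show ?thesis using z by blast
  qed
  then show ?thesis by blast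
qed

lemma lin_restr_comp: "lin A \<Longrightarrow> lin (\<lambda>x. restr W (A x))"
  using lin_comp[OF lin_restr, of A W] by (simp add: comp_def)

lemma bnd_restr_comp: "lin A \<Longrightarrow> bnd A C \<Longrightarrow> bnd (\<lambda>x. restr W (A x)) C"
  unfolding bnd_def using N_restr linD(1) by (meson order_trans)

lemma solvable_onI:
  assumes A: "lin A" "bnd A CA" and C: "C \<ge> 0"
    and half: "\<And>y. y \<in> lp p \<Longrightarrow> supp y \<subseteq> W \<Longrightarrow> \<exists>x\<in>lp p. N x \<le> C * N y \<and> N (y - restr W (A x)) \<le> N y / 2"
  shows "solvable_on A W (2 * C)"
  unfolding solvable_on_def
proof (intro ballI impI)
  fix y :: "int \<Rightarrow> 'a" assume y: "y \<in> lp p" "supp y \<subseteq> W"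
  let ?E = "{y \<in> lp p. supp y \<subseteq> W}"
  show "\<exists>x\<in>lp p. N x \<le> 2 * C * N y \<and> restr W (A x) = y"
  proof (rule series_solve[OF lin_restr_comp[OF A(1)] bnd_restr_comp[OF A], of ?E])
    fix x y :: "int \<Rightarrow> 'a" assume "y \<in> ?E" and x: "x \<in> lp p"
    then show "y - restr W (A x) \<in> ?E"
      using lp_diff[OF _ lp_restr[OF linD(1)[OF A(1) x]], of y W]
      by (auto simp: supp_def restr_def split: if_splits)
  qed (use C half y in auto)
qed

lemma solvable_on_mono:
  assumes "solvable_on A W C" "W' \<subseteq> W" shows "solvable_on A W' C"
  unfolding solvable_on_def
proof (intro ballI impI)
  fix y :: "int \<Rightarrow> 'a" assume y: "y \<in> lp p" "supp y \<subseteq> W'"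
  then obtain x where x: "x \<in> lp p" "N x \<le> C * N y" "restr W (A x) = y"
    using assms unfolding solvable_on_def by (meson order_trans)
  have "restr W' (A x) = restr W' (restr W (A x))" using assms(2) by (auto simp: restr_def fun_eq_iff)
  then have "restr W' (A x) = y" using x(3) y(2) by (simp add: restr_id)
  then show "\<exists>x\<in>lp p. N x \<le> C * N y \<and> restr W' (A x) = y" using x by blast
qed

lemma solvable_on_empty: "lin A \<Longrightarrow> solvable_on A {} C"
  unfolding solvable_on_def
proof (intro ballI impI)
  fix y :: "int \<Rightarrow> 'a" assume A: "lin A" and "y \<in> lp p" "supp y \<subseteq> {}"
  then have y0: "y = 0" by (auto simp: supp_def fun_eq_iff)
  have "restr {} (A 0) = 0" by (simp add: restr_def fun_eq_iff)
  then show "\<exists>x\<in>lp p. N x \<le> C * N y \<and> restr {} (A x) = y"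
    unfolding y0 by (intro bexI[of _ 0]) simp_all
qed

text \<open>Local solutions \<open>u j\<close> for the pieces of \<open>y\<close> on blocks are cut
  off by bumps and summed. The fivefold overlap bounds the norm by \<open>5 * C * N y\<close>. The
  error comes from commutators and from \<open>A - B\<close> and is at most half of
  \<open>y\<close>; \<open>solvable_onI\<close> removes it and doubles the constant.\<close>

lemma solvable_from_blocks:
  assumes A: "band_dominated smul p A" and C: "C > 0"
  shows "\<exists>D::nat. \<forall>W. finite W \<longrightarrow> (\<forall>j. solvable_on A (W \<inter> {j..j + int D}) C) \<longrightarrow> solvable_on A W (10 * C)"
proof -
  \<comment> \<open>The difference \<open>A - B\<close> enters the error twice, each time with the
    factor \<open>5 * C\<close>, and contributes \<open>10 * e * C = 1 / 4\<close>; the choice of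
    \<open>d\<close> below leaves at most another \<open>1 / 4\<close> for the commutators.\<close>
  define e where "e = 1 / (40 * C)"
  have e: "e > 0" using C by (simp add: e_def)
  obtain B w M where B: "banded B w M" "bnd (A - B) e" using band_dominated_approx[OF A e] by auto
  obtain CA where lA: "lin A" and CA: "bnd A CA"
    using A by (auto simp: band_dominated_def bounded_ops_iff)
  have lB: "lin B" and M: "M \<ge> 0" using B by (auto simp: banded_def)
  define d where "d = Suc (max w (nat \<lceil>10 * M * C\<rceil>))"
  have d: "d > 0" "w \<le> 2 * d" by (auto simp: d_def)
  have "10 * M * C \<le> real d" unfolding d_def by linarith
  then have Md: "M / (2 * real d) * C \<le> 1 / 20" using d by (simp add: field_simps)
  let ?D = "2 * int d"
  have D0: "?D > 0" using d by simp
  have "solvable_on A W (10 * C)" if W: "finite W" and loc: "\<And>j. solvable_on A (W \<inter> {j..j + int (10 * d)}) C" for W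
  proof -
    have locU: "solvable_on A (W \<inter> nbhd ?D j) C" for j
      by (rule solvable_on_mono[OF loc[of "(j - 2) * ?D"]]) (auto simp: nbhd_def algebra_simps)
    have half: "\<exists>x\<in>lp p. N x \<le> 5 * C * N y \<and> N (y - restr W (A x)) \<le> N y / 2"
      if y: "y \<in> lp p" "supp y \<subseteq> W" for y
    proof -
      define J where "J = (\<lambda>k. k div ?D) ` W"
      have J: "finite J" using W by (simp add: J_def)
      have "\<exists>x\<in>lp p. N x \<le> C * N (restr (blk ?D j) y) \<and> restr (W \<inter> nbhd ?D j) (A x) = restr (blk ?D j) y" for j
      proof -
        have "supp (restr (blk ?D j) y) \<subseteq> W \<inter> nbhd ?D j"
          unfolding supp_restr using y(2) blk_subset_nbhd[OF d(1), of j] by blast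
        then show ?thesis using locU[of j] lp_restr[OF y(1), of "blk ?D j"] unfolding solvable_on_def by blast
      qed
      then obtain u where u: "\<And>j. u j \<in> lp p" "\<And>j. N (u j) \<le> C * N (restr (blk ?D j) y)"
          "\<And>j. restr (W \<inter> nbhd ?D j) (A (u j)) = restr (blk ?D j) y" by metis
      note bb = banded_bump[OF B(1) d u(1)]
      define v where "v j = cutoff (bump d j) (u j)" for j
      have v: "v j \<in> lp p" "N (v j) \<le> N (u j)" for j
        unfolding v_def using lp_bump[OF u(1)] N_bump[OF u(1)] by blast+
      define x where "x = (\<Sum>j\<in>J. v j)"
      have x: "x \<in> lp p" unfolding x_def using v(1) by (rule lp_sum)
      have Nx: "N x \<le> 5 * C * N y" unfolding x_def
      proof (rule paste_blocks[OF y(1) D0 J])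
        show "supp (v j) \<subseteq> nbhd ?D j" for j unfolding v_def by (rule bb(3))
        show "N (v j) \<le> C * N (restr (blk ?D j) y)" for j using v(2) u(2) by (rule order_trans)
      qed (use C v in auto)
      \<comment> \<open>The defect of piece \<open>j\<close>. It is formed with the band operator
        \<open>B\<close>, which keeps the support near the block, as pasting requires.\<close>
      define f where "f j = restr W (B (v j)) - restr (blk ?D j) y" for j
      have fl: "f j \<in> lp p" for j
        unfolding f_def by (rule lp_diff[OF lp_restr[OF linD(1)[OF lB v(1)]] lp_restr[OF y(1)]])
      have fs: "supp (f j) \<subseteq> nbhd ?D j" for j
      proof -
        have "supp (f j) \<subseteq> supp (B (v j)) \<union> blk ?D j" by (auto simp: f_def supp_def restr_def split: if_splits)
        then show ?thesis using bb(2)[of j j] blk_subset_nbhd[OF d(1), of j] unfolding v_def by blast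
      qed
      have fN: "N (f j) \<le> (M / (2 * real d) + e) * C * N (restr (blk ?D j) y)" for j
      proof -
        let ?\<phi> = "bump d j"
        have Bu: "B (u j) \<in> lp p" and Au: "A (u j) \<in> lp p" using u(1) lA lB linD(1) by blast+
        let ?c = "B (v j) - cutoff ?\<phi> (B (u j))"
        let ?g = "cutoff ?\<phi> (A (u j) - B (u j))"
        have cl: "?c \<in> lp p" by (rule lp_diff[OF linD(1)[OF lB v(1)] lp_bump[OF Bu]])
        have gl: "?g \<in> lp p" by (rule lp_bump[OF lp_diff[OF Au Bu]])
        have phi0: "?\<phi> k = 0" if "k \<notin> nbhd ?D j" for k
          using bump_support[OF d(1), of j k] that unfolding mem_nbhd_bump by linarith
        \<comment> \<open>On \<open>W\<close> near the block, \<open>A (u j)\<close> equals the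
          piece of \<open>y\<close>, which the bump leaves unchanged. So \<open>A (u j)\<close>
          times the bump is exactly this piece, and the defect is the commutator of \<open>B\<close>
          minus the cutoff of \<open>A - B\<close>.\<close>
        have "f j = restr W (?c - ?g)"
        proof
          fix k
          have k: "restr (W \<inter> nbhd ?D j) (A (u j)) k = restr (blk ?D j) y k" using u(3) by simp
          have o: "k \<in> blk ?D j \<Longrightarrow> ?\<phi> k = 1" by (rule bump_one[OF d(1)])
          have y0: "k \<notin> W \<Longrightarrow> y k = 0" using y(2) by (auto simp: supp_def)
          have "k \<in> W \<Longrightarrow> ?\<phi> k *\<^sub>R A (u j) k = restr (blk ?D j) y k"
          proof (cases "k \<in> nbhd ?D j")
            case True
            assume "k \<in> W"
            then have "A (u j) k = restr (blk ?D j) y k" using k True by (simp add: restr_def)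
            then show ?thesis using o by (simp add: restr_def)
          next
            case False
            then show ?thesis using phi0[OF False] blk_subset_nbhd[OF d(1), of j] by (auto simp: restr_def)
          qed
          then show "f j k = restr W (?c - ?g) k"
            using y0 by (auto simp: f_def restr_def cutoff_def scaleR_right_diff_distrib)
        qed
        then have "N (f j) \<le> N (?c - ?g)" using N_restr[OF lp_diff[OF cl gl]] by (simp only:)
        also have "\<dots> \<le> N ?c + N ?g" by (rule N_diff[OF cl gl])
        also have "N ?c \<le> M / (2 * real d) * N (u j)"
        proof -
          have "M / (2 * real d) * N (restr (nbhd ?D j) (u j)) \<le> M / (2 * real d) * N (u j)"
            using N_restr[OF u(1)[of j], of "nbhd ?D j"] M by (intro mult_left_mono) auto
          then show ?thesis using bb(1)[of j j] unfolding v_def by linarith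
        qed
        also have "N ?g \<le> e * N (u j)"
          using N_bump[OF lp_diff[OF Au Bu], of d j] bndD[OF B(2) u(1)[of j]] by simp
        finally have "N (f j) \<le> (M / (2 * real d) + e) * N (u j)" by (simp add: algebra_simps)
        also have "\<dots> \<le> (M / (2 * real d) + e) * (C * N (restr (blk ?D j) y))"
          using u(2) M e by (intro mult_left_mono) auto
        finally show ?thesis by (simp add: mult.assoc)
      qed
      have sN: "N (\<Sum>j\<in>J. f j) \<le> 5 * ((M / (2 * real d) + e) * C) * N y"
        by (rule paste_blocks[OF y(1) D0 J _ fl fs]) (use fN M e C in auto)
      have sumy: "(\<Sum>j\<in>J. restr (blk ?D j) y) = y"
      proof
        fix k
        have "(\<Sum>j\<in>J. restr (blk ?D j) y) k = (\<Sum>j\<in>J. if k div ?D = j then y k else 0)"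
          unfolding sum_apply using D0 by (intro sum.cong) (auto simp: restr_def mem_blk)
        also have "\<dots> = (if k div ?D \<in> J then y k else 0)" using J by simp
        also have "\<dots> = y k" using y(2) by (auto simp: J_def supp_def)
        finally show "(\<Sum>j\<in>J. restr (blk ?D j) y) k = y k" .
      qed
      have Bx: "B x = (\<Sum>j\<in>J. B (v j))" unfolding x_def by (rule lin_sum[OF lB v(1)])
      have "restr W (\<Sum>j\<in>J. B (v j)) = (\<Sum>j\<in>J. restr W (B (v j)))"
        by (rule lin_sum[OF lin_restr]) (rule linD(1)[OF lB v(1)])
      then have fx: "(\<Sum>j\<in>J. f j) = restr W (B x) - y"
        unfolding f_def sum_subtractf Bx sumy by simp
      have Fl: "(\<Sum>j\<in>J. f j) \<in> lp p" by (rule lp_sum) (rule fl)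
      have ABl: "A x - B x \<in> lp p" by (rule lp_diff[OF linD(1)[OF lA x] linD(1)[OF lB x]])
      have "y - restr W (A x) = - (\<Sum>j\<in>J. f j) - restr W (A x - B x)"
        unfolding fx by (auto simp: restr_def fun_eq_iff)
      then have "N (y - restr W (A x)) \<le> N (\<Sum>j\<in>J. f j) + N (restr W (A x - B x))"
        using N_diff[OF lp_uminus[OF Fl] lp_restr[OF ABl], of W] N_uminus[OF Fl] by (simp only:)
      also have "N (restr W (A x - B x)) \<le> e * N x"
        using N_restr[OF ABl, of W] bndD[OF B(2) x] by simp
      also have "\<dots> \<le> e * (5 * C * N y)" using Nx e by (intro mult_left_mono) auto
      also note sN
      also have "5 * ((M / (2 * real d) + e) * C) * N y + e * (5 * C * N y)
          = (5 * (M / (2 * real d) * C) + 10 * (e * C)) * N y" by (simp add: algebra_simps)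
      also have "\<dots> \<le> (1/2) * N y"
      proof (rule mult_right_mono)
        have "e * C = 1 / 40" using C by (simp add: e_def)
        then show "5 * (M / (2 * real d) * C) + 10 * (e * C) \<le> 1 / 2" using Md by simp
      qed (rule N_nonneg[OF y(1)])
      finally show ?thesis using x Nx by (intro bexI[of _ x]) auto
    qed
    have "solvable_on A W (2 * (5 * C))" by (rule solvable_onI[OF lA CA _ half]) (use C in auto)
    then show ?thesis by (simp add: mult.assoc)
  qed
  then show ?thesis by blast
qed

lemma supp_shift_subset: "supp x \<subseteq> {c - m..c + m} \<Longrightarrow> supp (shift (- c) x) \<subseteq> {- m..m}"
  unfolding supp_shift by auto

lemma shc_shift: "shc h A (shift (- h) x) = shift (- h) (A x)"
  by (simp add: shc_def shift_add)

end

section \<open>From limit operators to the behaviour of the operator at infinity\<close>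

context lp_space_fin
begin

lemma limit_op_subsequence:
  assumes A: "band_dominated smul p A" and h: "\<And>n. \<bar>h n\<bar> > int n"
  shows "\<exists>f B. strict_mono f \<and> B \<in> op_spectrum smul p A \<and> op_lim A (h \<circ> f) B"
proof -
  obtain C where C: "lin A" "C > 0" "bnd A C"
    using A unfolding band_dominated_def by (auto elim: bounded_opsE)
  note q = band_dominated_quasilocal[OF A]
  obtain f B where f: "strict_mono f" "op_lim A (h \<circ> f) B"
    using op_lim_exists[OF C(1,3,2) q] by blast
  have "filterlim (\<lambda>n. \<bar>(h \<circ> f) n\<bar>) at_top sequentially"
    unfolding filterlim_at_top
  proof
    fix Z :: int
    have "\<bar>(h \<circ> f) n\<bar> \<ge> Z" if "n \<ge> nat Z" for n
      using h[of "f n"] seq_suble[OF f(1), of n] that by simp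
    then show "\<forall>\<^sub>F n in sequentially. Z \<le> \<bar>(h \<circ> f) n\<bar>" by (auto simp: eventually_sequentially)
  qed
  then have "limit_op smul p A (h \<circ> f) B"
    using op_lim_imp_limit_op[OF C(1,3,2) q _ f(2) op_lim_quasilocal[OF C(1) q f(2)]] by blast
  then show ?thesis using f by (auto simp: op_spectrum_def)
qed

text \<open>The lower bounds of the limit operators are not known to be uniform. The bound \<nu> of
  the limit operator constructed here becomes available only after the centres \<open>h\<close> are
  fixed; as all levels are present around the centres, a level that beats this \<nu> can be picked
  afterwards.\<close>

lemma bounded_below_imp_below_at_infinity:
  assumes A: "band_dominated smul p A"
    and below: "\<And>B. B \<in> op_spectrum smul p A \<Longrightarrow> \<exists>\<nu>>0. \<forall>x\<in>lp p. \<nu> * N x \<le> N (B x)"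
  shows "\<exists>n. \<exists>\<nu>>0. below_at_infinity A n \<nu>"
proof (rule ccontr)
  assume neg: "\<not> ?thesis"
  have lA: "lin A" using A by (auto simp: band_dominated_def bounded_ops_iff)
  \<comment> \<open>The levels solve \<open>20 * q (Suc m) + (1/40) ^ m = q m\<close>, the loss in
    one localization with error \<open>(1/40) ^ m\<close>, and tend to zero.\<close>
  define q :: "nat \<Rightarrow> real" where "q m = 2 * (1/40) ^ m" for m
  have q0: "q m > 0" for m by (simp add: q_def)
  define bad where "bad m S \<longleftrightarrow> (\<exists>z\<in>lp p. z \<noteq> 0 \<and> supp z \<subseteq> S \<and> N (A z) \<le> q m * N z)" for m S
  have "\<exists>D::nat. \<forall>\<kappa>>0. \<forall>x\<in>lp p. x \<noteq> 0 \<longrightarrow> N (A x) \<le> \<kappa> * N x \<longrightarrow>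
    (\<exists>z\<in>lp p. z \<noteq> 0 \<and> supp z \<subseteq> supp x \<and> (\<exists>j. supp z \<subseteq> {j..j + int D}) \<and> N (A z) \<le> (20 * \<kappa> + (1/40) ^ m) * N z)" for m
    by (rule localize_small_vector[OF A]) simp
  then obtain D where D: "\<And>m \<kappa> x. \<kappa> > 0 \<Longrightarrow> x \<in> lp p \<Longrightarrow> x \<noteq> 0 \<Longrightarrow> N (A x) \<le> \<kappa> * N x \<Longrightarrow>
    \<exists>z\<in>lp p. z \<noteq> 0 \<and> supp z \<subseteq> supp x \<and> (\<exists>j. supp z \<subseteq> {j..j + int (D m)}) \<and> N (A z) \<le> (20 * \<kappa> + (1/40) ^ m) * N z"
    by metis
  have "\<exists>h. \<forall>n. \<bar>h n\<bar> > int n \<and> (\<forall>m\<le>n. \<exists>S\<subseteq>{h n - int (D m)..h n + int (D m)}. bad m S)"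
  proof (rule nested_windows)
    fix m S assume "bad (Suc m) S"
    then obtain x where x: "x \<in> lp p" "x \<noteq> 0" "supp x \<subseteq> S" "N (A x) \<le> q (Suc m) * N x"
      unfolding bad_def by blast
    obtain z j where z: "z \<in> lp p" "z \<noteq> 0" "supp z \<subseteq> supp x" "supp z \<subseteq> {j..j + int (D m)}"
        "N (A z) \<le> (20 * q (Suc m) + (1/40) ^ m) * N z"
      using D[OF q0 x(1,2,4), of m] by blast
    have "20 * q (Suc m) + (1/40) ^ m = q m" by (simp add: q_def)
    then have "bad m (supp z)" using z unfolding bad_def by auto
    moreover have "supp z \<noteq> {}" using z(2) by (auto simp: supp_def fun_eq_iff)
    ultimately show "\<exists>S'\<subseteq>S. S' \<noteq> {} \<and> (\<exists>j. S' \<subseteq> {j..j + int (D m)}) \<and> bad m S'"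
      using x(3) z(3,4) by (intro exI[of _ "supp z"]) blast
  next
    fix n
    have "\<not> below_at_infinity A n (q (Suc n))" using neg q0 by blast
    then obtain x where x: "x \<in> lp p" "supp x \<inter> win n = {}" "N (A x) < q (Suc n) * N x"
      unfolding below_at_infinity_def by (auto simp: not_le)
    have "x \<noteq> 0" using x(3) lin_zero[OF lA] by auto
    then have "bad (Suc n) (supp x)" using x unfolding bad_def by (intro bexI[of _ x]) auto
    then show "\<exists>S. S \<inter> win n = {} \<and> bad (Suc n) S" using x(2) by blast
  qed
  then obtain h where h: "\<And>n. \<bar>h n\<bar> > int n"
    "\<And>n m. m \<le> n \<Longrightarrow> \<exists>S\<subseteq>{h n - int (D m)..h n + int (D m)}. bad m S" by blast
  obtain f B where f: "strict_mono f" and B: "B \<in> op_spectrum smul p A" and L: "op_lim A (h \<circ> f) B"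
    using limit_op_subsequence[OF A h(1)] by blast
  obtain \<nu> where \<nu>: "\<nu> > 0" "\<And>x. x \<in> lp p \<Longrightarrow> \<nu> * N x \<le> N (B x)" using below[OF B] by blast
  have "(\<lambda>m. q m) \<longlonglongrightarrow> 2 * 0" unfolding q_def by (intro tendsto_intros LIMSEQ_power_zero) simp
  then obtain m where m: "q m < \<nu> / 2"
    using order_tendstoD(2)[of q 0 sequentially "\<nu>/2"] \<nu>(1) by (auto simp: eventually_sequentially)
  obtain M where M: "\<And>n x. n \<ge> M \<Longrightarrow> x \<in> lp p \<Longrightarrow>
      N (shc (h (f n)) A (restr (win (D m)) x) - B (restr (win (D m)) x)) \<le> \<nu> / 2 * N x"
    using op_limD[OF L, of "\<nu>/2" "D m"] \<nu>(1) by auto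
  \<comment> \<open>Since \<open>f n \<ge> n \<ge> m\<close>, the centre \<open>h (f n)\<close> has
    a bad vector of level \<open>m\<close>; and \<open>n \<ge> M\<close> makes the translate close
    to \<open>B\<close> on the window of radius \<open>D m\<close> that contains it after
    shifting.\<close>
  define n where "n = max m M"
  have "m \<le> f n" using seq_suble[OF f, of n] by (simp add: n_def)
  then obtain z where z: "z \<in> lp p" "z \<noteq> 0" "supp z \<subseteq> {h (f n) - int (D m)..h (f n) + int (D m)}" "N (A z) \<le> q m * N z"
    using h(2)[of m "f n"] unfolding bad_def by (meson order_trans)
  let ?y = "shift (- h (f n)) z"
  have y: "?y \<in> lp p" "N ?y = N z" using z(1) by (auto simp: lp_shift N_shift)
  have ry: "restr (win (D m)) ?y = ?y" by (rule restr_id[OF supp_shift_subset[OF z(3)]])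
  have lB: "lin B" using L by (simp add: op_lim_def)
  have "N (B ?y) \<le> N (shc (h (f n)) A ?y) + N (B ?y - shc (h (f n)) A ?y)"
    by (rule N_le_diff[OF linD(1)[OF lB y(1)] linD(1)[OF lin_shc[OF lA] y(1)]])
  also have "N (shc (h (f n)) A ?y) = N (A z)" unfolding shc_shift by (rule N_shift[OF linD(1)[OF lA z(1)]])
  also have "N (B ?y - shc (h (f n)) A ?y) \<le> \<nu> / 2 * N ?y"
    using M[OF _ y(1), of n] N_diff_commute[OF linD(1)[OF lB y(1)] linD(1)[OF lin_shc[OF lA] y(1)]]
    unfolding ry by (simp add: n_def)
  finally have "N (B ?y) \<le> q m * N z + \<nu> / 2 * N z" using z(4) y(2) by simp
  then have "\<nu> * N z \<le> (q m + \<nu> / 2) * N z" using \<nu>(2)[OF y(1)] y(2) by (simp add: algebra_simps)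
  moreover have "N z > 0" using N_pos z by blast
  ultimately show False using m by simp
qed

text \<open>Level \<open>m\<close> means failure with the constant \<open>10 ^ m\<close>, ten being
  the loss in \<open>solvable_from_blocks\<close>. The limit operator has preimages bounded by some
  \<open>C\<close>, by the open mapping principle; a window on which a translate is close to it is
  then solvable with \<open>2 * C\<close>, against badness at a level with
  \<open>2 * C < 10 ^ m\<close>.\<close>

lemma surjective_imp_solvable_at_infinity:
  assumes A: "band_dominated smul p A"
    and surj: "\<And>B. B \<in> op_spectrum smul p A \<Longrightarrow> B ` lp p = lp p"
  shows "\<exists>n. \<exists>C>0. \<forall>W. finite W \<longrightarrow> W \<inter> win n = {} \<longrightarrow> solvable_on A W C"
proof (rule ccontr)
  assume neg: "\<not> ?thesis"
  obtain CA where lA: "lin A" and CA: "CA > 0" "bnd A CA"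
    using A unfolding band_dominated_def by (auto elim: bounded_opsE)
  define bad where "bad m S \<longleftrightarrow> finite S \<and> \<not> solvable_on A S (10 ^ m)" for m S
  have "\<exists>D::nat. \<forall>W. finite W \<longrightarrow> (\<forall>j. solvable_on A (W \<inter> {j..j + int D}) (10 ^ m)) \<longrightarrow> solvable_on A W (10 * 10 ^ m)" for m
    by (rule solvable_from_blocks[OF A]) simp
  then obtain D where D: "\<And>m W. finite W \<Longrightarrow> (\<And>j. solvable_on A (W \<inter> {j..j + int (D m)}) (10 ^ m)) \<Longrightarrow>
      solvable_on A W (10 * 10 ^ m)" by metis
  have "\<exists>h. \<forall>n. \<bar>h n\<bar> > int n \<and> (\<forall>m\<le>n. \<exists>S\<subseteq>{h n - int (D m)..h n + int (D m)}. bad m S)"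
  proof (rule nested_windows)
    fix m S assume b: "bad (Suc m) S"
    then obtain j where j: "\<not> solvable_on A (S \<inter> {j..j + int (D m)}) (10 ^ m)"
      using D[of S m] unfolding bad_def by auto
    let ?S = "S \<inter> {j..j + int (D m)}"
    have "?S \<noteq> {}" using j solvable_on_empty[OF lA] by metis
    moreover have "bad m ?S" using j b by (simp add: bad_def)
    ultimately show "\<exists>S'\<subseteq>S. S' \<noteq> {} \<and> (\<exists>j. S' \<subseteq> {j..j + int (D m)}) \<and> bad m S'"
      by (intro exI[of _ ?S]) auto
  next
    fix n
    have "\<not> (\<forall>W. finite W \<longrightarrow> W \<inter> win n = {} \<longrightarrow> solvable_on A W (10 ^ Suc n))"
      using neg by (metis zero_less_numeral zero_less_power)
    then show "\<exists>S. S \<inter> win n = {} \<and> bad (Suc n) S" unfolding bad_def by blast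
  qed
  then obtain h where h: "\<And>n. \<bar>h n\<bar> > int n"
    "\<And>n m. m \<le> n \<Longrightarrow> \<exists>S\<subseteq>{h n - int (D m)..h n + int (D m)}. bad m S" by blast
  obtain f B where f: "strict_mono f" and B: "B \<in> op_spectrum smul p A" and L: "op_lim A (h \<circ> f) B"
    using limit_op_subsequence[OF A h(1)] by blast
  obtain CB where lB: "lin B" and CB: "bnd B CB" using L unfolding op_lim_def by blast
  obtain C where C: "C > 0" "\<And>y. y \<in> lp p \<Longrightarrow> \<exists>x\<in>lp p. N x \<le> C * N y \<and> B x = y"
    using surj_imp_bounded_preimages[OF lB CB surj[OF B]] by blast
  obtain m where m: "2 * C < 10 ^ m" using real_arch_pow[of 10 "2 * C"] by auto
  let ?e = "1 / (2 * C)"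
  obtain M where M: "\<And>n x. n \<ge> M \<Longrightarrow> x \<in> lp p \<Longrightarrow>
      N (restr (win (D m)) (shc (h (f n)) A x - B x)) \<le> ?e * N x"
    using op_limD[OF L, of ?e "D m"] C(1) by auto
  define n where "n = max m M"
  have "m \<le> f n" using seq_suble[OF f, of n] by (simp add: n_def)
  then obtain S where S: "S \<subseteq> {h (f n) - int (D m)..h (f n) + int (D m)}" "bad m S"
    using h(2)[of m "f n"] by blast
  let ?h = "h (f n)"
  have "solvable_on A S (2 * C)"
  proof (rule solvable_onI[OF lA CA(2)])
    fix y :: "int \<Rightarrow> 'a" assume y: "y \<in> lp p" "supp y \<subseteq> S"
    let ?y = "shift (- ?h) y"
    have y': "?y \<in> lp p" "N ?y = N y" using y(1) by (auto simp: lp_shift N_shift)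
    obtain x where x: "x \<in> lp p" "N x \<le> C * N ?y" "B x = ?y" using C(2)[OF y'(1)] by blast
    let ?x = "shift ?h x"
    have x': "?x \<in> lp p" "N ?x = N x" using x(1) by (auto simp: lp_shift N_shift)
    let ?d = "restr (win (D m)) (shc ?h A x - B x)"
    have dl: "?d \<in> lp p" by (rule lp_restr[OF lp_diff[OF linD(1)[OF lin_shc[OF lA] x(1)] linD(1)[OF lB x(1)]]])
    have "y - restr S (A ?x) = restr S (shift ?h (- ?d))"
    proof
      fix k
      show "(y - restr S (A ?x)) k = restr S (shift ?h (- ?d)) k"
      proof (cases "k \<in> S")
        case True
        then have "k - ?h \<in> win (D m)" using S(1) by auto
        moreover have "shc ?h A x (k - ?h) = A ?x k" by (simp add: shc_def shift_def)
        moreover have "B x (k - ?h) = y k" unfolding x(3) by (simp add: shift_def)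
        ultimately show ?thesis using True by (simp add: restr_def shift_def)
      next
        case False
        then have "y k = 0" using y(2) by (auto simp: supp_def)
        then show ?thesis using False by (simp add: restr_def)
      qed
    qed
    then have "N (y - restr S (A ?x)) \<le> N ?d"
      using N_restr[OF lp_shift[OF lp_uminus[OF dl]], of S ?h] N_shift[OF lp_uminus[OF dl], of ?h] N_uminus[OF dl]
      by simp
    also have "\<dots> \<le> ?e * N x" using M[OF _ x(1), of n] by (simp add: n_def)
    also have "\<dots> \<le> ?e * (C * N y)" using x(2) y'(2) C(1) by (intro mult_left_mono) auto
    also have "\<dots> = N y / 2" using C(1) by simp
    finally show "\<exists>x\<in>lp p. N x \<le> C * N y \<and> N (y - restr S (A x)) \<le> N y / 2"
      using x x' y' by (intro bexI[of _ ?x]) auto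
  qed (use C(1) in simp)
  then have "solvable_on A S (10 ^ m)"
    unfolding solvable_on_def using m N_nonneg by (meson less_imp_le mult_right_mono order_trans)
  then show False using S(2) by (simp add: bad_def)
qed

end

section \<open>Dimension counting\<close>

text \<open>Gaussian elimination: a row with a nonzero entry at \<open>j0\<close> expresses the
  unknown \<open>j0\<close> by the others, and substitution leaves a system with one row and one
  unknown fewer.\<close>

lemma underdetermined_system:
  fixes M :: "'i \<Rightarrow> 'j \<Rightarrow> 'k::field"
  assumes "finite I" "finite J" "card I < card J"
  shows "\<exists>v. (\<exists>j\<in>J. v j \<noteq> 0) \<and> (\<forall>i\<in>I. (\<Sum>j\<in>J. M i j * v j) = 0)"
  using assms
proof (induction I arbitrary: J M)
  case empty
  then obtain j where "j \<in> J" by fastforce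
  then show ?case by (intro exI[of _ "\<lambda>_. 1"]) auto
next
  case (insert i I)
  show ?case
  proof (cases "\<forall>j\<in>J. M i j = 0")
    case True
    have "card I < card J" using insert by simp
    then obtain v where "\<exists>j\<in>J. v j \<noteq> 0" "\<forall>i\<in>I. (\<Sum>j\<in>J. M i j * v j) = 0"
      using insert.IH[OF insert.prems(1), of M] by blast
    then show ?thesis using True by (intro exI[of _ v]) auto
  next
    case False
    then obtain j0 where j0: "j0 \<in> J" "M i j0 \<noteq> 0" by blast
    let ?J = "J - {j0}"
    have "card I < card ?J" using insert j0 by simp
    then obtain v where v: "\<exists>j\<in>?J. v j \<noteq> 0"
        "\<And>l. l \<in> I \<Longrightarrow> (\<Sum>j\<in>?J. (M l j - M l j0 * M i j / M i j0) * v j) = 0"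
      using insert.IH[of ?J "\<lambda>l j. M l j - M l j0 * M i j / M i j0"] insert.prems(1) by auto
    define s where "s = (\<Sum>j\<in>?J. M i j * v j)"
    define u where "u = v(j0 := - s / M i j0)"
    have sum: "(\<Sum>j\<in>J. M l j * u j) = M l j0 * (- s / M i j0) + (\<Sum>j\<in>?J. M l j * v j)" for l
    proof -
      have "(\<Sum>j\<in>J. M l j * u j) = M l j0 * u j0 + (\<Sum>j\<in>?J. M l j * u j)"
        using insert.prems(1) j0(1) by (rule sum.remove)
      also have "(\<Sum>j\<in>?J. M l j * u j) = (\<Sum>j\<in>?J. M l j * v j)" by (intro sum.cong) (auto simp: u_def)
      finally show ?thesis by (simp add: u_def)
    qed
    have "(\<Sum>j\<in>J. M i j * u j) = 0" unfolding sum using j0(2) by (simp add: s_def)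
    moreover have "(\<Sum>j\<in>J. M l j * u j) = 0" if "l \<in> I" for l
    proof -
      have "(\<Sum>j\<in>?J. (M l j - M l j0 * M i j / M i j0) * v j)
          = (\<Sum>j\<in>?J. M l j * v j) - M l j0 / M i j0 * s"
        by (simp add: s_def left_diff_distrib sum_subtractf sum_distrib_left mult.assoc)
      then show ?thesis unfolding sum using v(2)[OF that] by simp
    qed
    moreover have "\<exists>j\<in>J. u j \<noteq> 0" using v(1) by (auto simp: u_def)
    ultimately show ?thesis by (intro exI[of _ u]) auto
  qed
qed

lemma supp_diff: "supp (x - y) \<subseteq> supp x \<union> supp y" for x y :: "int \<Rightarrow> 'a::group_add"
  by (auto simp: supp_def)

text \<open>The absolute values along \<open>g\<close> increase by more than
  \<open>\<bar>Q\<bar>\<close> at every step, so two points are far apart on whichever sides of zero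
  they lie.\<close>

lemma separated_subsequence:
  fixes h :: "nat \<Rightarrow> int"
  assumes h: "filterlim (\<lambda>n. \<bar>h n\<bar>) at_top sequentially"
  shows "\<exists>g :: nat \<Rightarrow> nat. \<forall>i. g i \<ge> n0 \<and> (\<forall>j. i \<noteq> j \<longrightarrow> \<bar>h (g i) - h (g j)\<bar> > Q)"
proof -
  have ex: "\<exists>n\<ge>n0. \<bar>h n\<bar> > Z" for Z
  proof -
    have "\<forall>\<^sub>F n in sequentially. Z + 1 \<le> \<bar>h n\<bar>" using h unfolding filterlim_at_top by blast
    then obtain M where "\<And>n. n \<ge> M \<Longrightarrow> Z + 1 \<le> \<bar>h n\<bar>" by (auto simp: eventually_sequentially)
    then have "Z + 1 \<le> \<bar>h (max M n0)\<bar>" by simp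
    then show ?thesis by (intro exI[of _ "max M n0"]) simp
  qed
  have "\<exists>g. \<forall>i. g i \<ge> n0 \<and> \<bar>h (g (Suc i))\<bar> > \<bar>h (g i)\<bar> + \<bar>Q\<bar>"
    by (rule dependent_nat_choice) (use ex in auto)
  then obtain g where g: "\<And>i. g i \<ge> n0" "\<And>i. \<bar>h (g (Suc i))\<bar> > \<bar>h (g i)\<bar> + \<bar>Q\<bar>" by blast
  have lt: "\<bar>h (g (i + Suc d))\<bar> > \<bar>h (g i)\<bar> + \<bar>Q\<bar>" for i d
  proof (induction d)
    case 0
    then show ?case using g(2)[of i] by simp
  next
    case (Suc d)
    then show ?case using g(2)[of "i + Suc d"] by simp
  qed
  have "\<bar>h (g i) - h (g j)\<bar> > Q" if "i \<noteq> j" for i j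
  proof -
    have "\<exists>d. j = i + Suc d \<or> i = j + Suc d"
      using \<open>i \<noteq> j\<close> by (cases "i < j") (metis add_Suc_right less_iff_Suc_add, metis add_Suc_right less_iff_Suc_add linorder_neqE_nat)
    then obtain d where "j = i + Suc d \<or> i = j + Suc d" by blast
    then have "\<bar>h (g j)\<bar> > \<bar>h (g i)\<bar> + \<bar>Q\<bar> \<or> \<bar>h (g i)\<bar> > \<bar>h (g j)\<bar> + \<bar>Q\<bar>"
      using lt by blast
    then show ?thesis by linarith
  qed
  then show ?thesis using g(1) by blast
qed

context lp_space
begin

abbreviation S :: "'k \<Rightarrow> (int \<Rightarrow> 'a) \<Rightarrow> int \<Rightarrow> 'a" where "S \<equiv> seq_scale smul"

lemma banded_restr:
  assumes B: "banded B w M" and x: "x \<in> lp p" and V: "\<And>k l. k \<in> W \<Longrightarrow> \<bar>l - k\<bar> \<le> int w \<Longrightarrow> l \<in> V"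
  shows "restr W (B (restr V x)) = restr W (B x)"
proof
  fix k
  have "B (restr V x) k = B x k" if "k \<in> W"
    by (rule banded_apply_eq[OF B lp_restr[OF x] x]) (use V that in \<open>auto simp: restr_def\<close>)
  then show "restr W (B (restr V x)) k = restr W (B x) k" by (simp add: restr_def)
qed

lemma banded_supp:
  assumes B: "banded B w M" and x: "x \<in> lp p" "supp x \<subseteq> {c - m..c + m}"
  shows "supp (B x) \<subseteq> {c - m - int w..c + m + int w}"
proof
  fix k assume k: "k \<in> supp (B x)"
  have lB: "lin B" using B by (simp add: banded_def)
  show "k \<in> {c - m - int w..c + m + int w}"
  proof (rule ccontr)
    assume k': "k \<notin> {c - m - int w..c + m + int w}"
    have "x l = (0 :: int \<Rightarrow> 'a) l" if "\<bar>l - k\<bar> \<le> int w" for l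
    proof -
      have "l \<notin> {c - m..c + m}" using k' that by auto
      then show ?thesis using x(2) by (auto simp: supp_def)
    qed
    then have "B x k = B 0 k" by (rule banded_apply_eq[OF B x(1) lp_zero'(1)])
    then show False using k lin_zero[OF lB] by (simp add: supp_def)
  qed
qed

text \<open>The lower bound makes preimages of a convergent sequence Cauchy, and the support
  condition survives the limit. It is applied with \<open>G = UNIV\<close> to limit operators and
  with the complement of a window to \<open>A\<close> itself.\<close>

lemma range_closed_below:
  assumes T: "lin T" "bnd T C" and \<nu>: "\<nu> > 0" "\<And>x. x \<in> lp p \<Longrightarrow> supp x \<subseteq> G \<Longrightarrow> \<nu> * N x \<le> N (T x)"
    and y: "y \<in> lp p" "\<And>e. e > 0 \<Longrightarrow> \<exists>x\<in>lp p. supp x \<subseteq> G \<and> N (T x - y) \<le> e"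
  shows "\<exists>x\<in>lp p. supp x \<subseteq> G \<and> T x = y"
proof -
  have "\<exists>x\<in>lp p. supp x \<subseteq> G \<and> N (T x - y) \<le> 1 / (real n + 1)" for n :: nat by (rule y(2)) simp
  then obtain x where x: "\<And>n. x n \<in> lp p" "\<And>n. supp (x n) \<subseteq> G" "\<And>n. N (T (x n) - y) \<le> 1 / (real n + 1)" for n :: nat
    by metis
  have Tx: "T (x n) \<in> lp p" for n by (rule linD(1)[OF T(1) x(1)])
  have small: "\<exists>M. \<forall>n\<ge>M. 1 / (real n + 1) \<le> e" if e: "e > 0" for e
  proof -
    obtain M where "1 / (real M + 1) < e" using reals_Archimedean[OF e] by (auto simp: inverse_eq_divide add.commute)
    moreover have "1 / (real n + 1) \<le> 1 / (real M + 1)" if "n \<ge> M" for n using that by (intro divide_left_mono) auto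
    ultimately show ?thesis by (meson less_imp_le order_trans)
  qed
  have "\<exists>M. \<forall>m\<ge>M. \<forall>n\<ge>M. N (x m - x n) \<le> e" if e: "e > 0" for e
  proof -
    obtain M where M: "\<And>n. n \<ge> M \<Longrightarrow> 1 / (real n + 1) \<le> \<nu> * e / 2" using small[of "\<nu> * e / 2"] \<nu> e by auto
    have "N (x m - x n) \<le> e" if "m \<ge> M" "n \<ge> M" for m n
    proof -
      have d: "x m - x n \<in> lp p" by (rule lp_diff[OF x(1) x(1)])
      have "supp (x m - x n) \<subseteq> G" using supp_diff[of "x m" "x n"] x(2)[of m] x(2)[of n] by blast
      then have "\<nu> * N (x m - x n) \<le> N (T (x m) - T (x n))" using \<nu>(2)[OF d] lin_diff[OF T(1) x(1) x(1)] by simp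
      also have "T (x m) - T (x n) = (T (x m) - y) - (T (x n) - y)" by simp
      also have "N \<dots> \<le> N (T (x m) - y) + N (T (x n) - y)" by (rule N_diff[OF lp_diff[OF Tx y(1)] lp_diff[OF Tx y(1)]])
      also have "\<dots> \<le> \<nu> * e / 2 + \<nu> * e / 2" using x(3)[of m] x(3)[of n] M that by (intro add_mono order_trans[OF x(3)]) auto
      finally have "\<nu> * N (x m - x n) \<le> \<nu> * e" by simp
      then show ?thesis using \<nu>(1) by simp
    qed
    then show ?thesis by blast
  qed
  then obtain z where z: "z \<in> lp p" "\<And>e. e > 0 \<Longrightarrow> \<exists>M. \<forall>m\<ge>M. N (x m - z) \<le> e"
    using lp_complete[of x] x(1) by blast
  have "N (T z - y) \<le> 0 + e" if e: "e > 0" for e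
  proof -
    have C1: "bnd T (\<bar>C\<bar> + 1)" using bnd_mono[OF T(2), of "\<bar>C\<bar> + 1"] by simp
    obtain M1 where M1: "\<And>m. m \<ge> M1 \<Longrightarrow> N (x m - z) \<le> e / (2 * (\<bar>C\<bar> + 1))"
      using z(2)[of "e / (2 * (\<bar>C\<bar> + 1))"] e by auto
    obtain M2 where M2: "\<And>n. n \<ge> M2 \<Longrightarrow> 1 / (real n + 1) \<le> e / 2" using small[of "e/2"] e by auto
    let ?m = "max M1 M2"
    have d: "x ?m - z \<in> lp p" by (rule lp_diff[OF x(1) z(1)])
    have "T z - y = (T (x ?m) - y) - T (x ?m - z)" unfolding lin_diff[OF T(1) x(1) z(1)] by simp
    then have "N (T z - y) \<le> N (T (x ?m) - y) + N (T (x ?m - z))"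
      using N_diff[OF lp_diff[OF Tx y(1)] linD(1)[OF T(1) d], of ?m] by (simp only:)
    also have "N (T (x ?m - z)) \<le> (\<bar>C\<bar> + 1) * N (x ?m - z)" by (rule bndD[OF C1 d])
    also have "\<dots> \<le> (\<bar>C\<bar> + 1) * (e / (2 * (\<bar>C\<bar> + 1)))" using M1[of ?m] by (intro mult_left_mono) auto
    also have "\<dots> = e / 2" by (simp add: field_simps add_nonneg_eq_0_iff)
    also have "N (T (x ?m) - y) \<le> e / 2" using x(3)[of ?m] M2[of ?m] by simp
    finally show ?thesis by simp
  qed
  then have "N (T z - y) \<le> 0" by (rule field_le_epsilon)
  then have "T z - y = 0" using N_pos[OF lp_diff[OF linD(1)[OF T(1) z(1)] y(1)]] by fastforce
  then have Tz: "T z = y" by simp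
  have "supp z \<subseteq> G"
  proof
    fix k assume k: "k \<in> supp z"
    show "k \<in> G"
    proof (rule ccontr)
      assume "k \<notin> G"
      then have "x n k = 0" for n using x(2)[of n] by (auto simp: supp_def)
      then have "norm (z k) \<le> N (x n - z)" for n using norm_le_N[OF lp_diff[OF x(1) z(1)], of n k] by simp
      then have "norm (z k) \<le> 0 + e" if "e > 0" for e using z(2)[OF that] by (metis add_0 order_refl order_trans)
      then have "norm (z k) \<le> 0" by (rule field_le_epsilon)
      then show False using k by (simp add: supp_def)
    qed
  qed
  then show ?thesis using z(1) Tz by blast
qed

text \<open>Continuity of weak-star type: by locality, the part of \<open>x n - z\<close> outside a
  large window has little influence on \<open>win m\<close>, and inside that window entrywise
  convergence is norm convergence.\<close>

lemma quasilocal_pointwise_continuous: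
  fixes x :: "nat \<Rightarrow> int \<Rightarrow> 'a"
  assumes T: "lin T" "bnd T C" "C > 0" "quasilocal T"
    and x: "\<And>n. x n \<in> lp p" "\<And>n. N (x n) \<le> K" "z \<in> lp p" "N z \<le> K" and lim: "\<And>k. (\<lambda>n. x n k) \<longlonglongrightarrow> z k" and e: "e > 0"
  shows "\<exists>M. \<forall>n\<ge>M. N (restr (win m) (T (x n) - T z)) \<le> e"
proof -
  have K: "K \<ge> 0" using x(3,4) N_nonneg by fastforce
  let ?e = "e / (4 * (K + 1))"
  have e': "?e > 0" using e K by simp
  obtain D where D: "D > 0" "comm_small T ?e D" using T(4) e' unfolding quasilocal_def by blast
  define M where "M = m + nat \<lceil>D\<rceil>"
  have M: "real M \<ge> real m + D" unfolding M_def by linarith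
  obtain M' where M': "\<And>n. n \<ge> M' \<Longrightarrow> N (restr (win M) (x n - z)) \<le> e / (2 * C)"
    using N_win_tendsto[of "win M" "\<lambda>n. x n - z" "e / (2 * C)"] LIM_zero[OF lim] e T(3) by auto
  have "N (restr (win m) (T (x n) - T z)) \<le> e" if n: "n \<ge> M'" for n
  proof -
    have d: "x n - z \<in> lp p" by (rule lp_diff[OF x(1,3)])
    have dK: "N (x n - z) \<le> 2 * K" using N_diff[OF x(1,3), of n] x(2)[of n] x(4) by linarith
    have r: "restr (win M) (x n - z) \<in> lp p" by (rule lp_restr[OF d])
    have "N (restr (win m) (T (x n - z))) \<le> N (restr (win m) (T (restr (win M) (x n - z)))) + N (restr (win m) (T (restr (- win M) (x n - z))))"
      by (rule N_split[OF lin_restr_comp[OF T(1)] d])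
    also have "N (restr (win m) (T (restr (win M) (x n - z)))) \<le> C * N (restr (win M) (x n - z))"
      using N_restr[OF linD(1)[OF T(1) r]] bndD[OF T(2) r] by (rule order_trans)
    also have "\<dots> \<le> C * (e / (2 * C))" using M'[OF n] T(3) by (intro mult_left_mono) auto
    also have "\<dots> = e / 2" using T(3) by simp
    also have "N (restr (win m) (T (restr (- win M) (x n - z)))) \<le> ?e * N (x n - z)"
      by (rule comm_small_off_diagonal(1)[OF T(1) D(2,1) d M])
    also have "\<dots> \<le> ?e * (2 * K)" using dK e' by (intro mult_left_mono) auto
    also have "\<dots> \<le> e / 2" using K e by (simp add: field_simps)
    finally show ?thesis using lin_diff[OF T(1) x(1,3), of n] by simp
  qed
  then show ?thesis by blast
qed

end

context lp_space_fin
begin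

text \<open>Compactness of balls for entrywise convergence, by a diagonal argument in the
  finite-dimensional coefficient space. For \<open>p = 0\<close> the limit need not decay. It is
  meant for \<open>p = \<infinity>\<close>, in place of norm approximation.\<close>

lemma bounded_seq_pointwise_limit:
  fixes x :: "nat \<Rightarrow> int \<Rightarrow> 'a"
  assumes p: "p \<noteq> 0" and x: "\<And>n. x n \<in> lp p" "\<And>n. N (x n) \<le> K"
  shows "\<exists>f z. strict_mono f \<and> z \<in> lp p \<and> N z \<le> K \<and> (\<forall>k. (\<lambda>n. x (f n) k) \<longlonglongrightarrow> z k)"
proof -
  have "\<exists>f :: nat \<Rightarrow> nat. strict_mono f \<and> (\<forall>k. \<exists>l. (\<lambda>n. x (f n) k) \<longlonglongrightarrow> l)"
  proof (rule diagonal_convergent[of "\<lambda>k n. x n k"])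
    fix k and f :: "nat \<Rightarrow> nat"
    have "norm (x (f n) k) \<le> K" for n using norm_le_N[OF x(1), of "f n" k] x(2)[of "f n"] by linarith
    then have "bounded (range (\<lambda>n. x (f n) k))" by (auto simp: bounded_iff)
    then show "\<exists>g l. strict_mono g \<and> (\<lambda>n. x (f (g n)) k) \<longlonglongrightarrow> l" by (rule bounded_imp_convergent_subseq)
  qed
  then obtain f where f: "strict_mono f" "\<forall>k. \<exists>l. (\<lambda>n. x (f n) k) \<longlonglongrightarrow> l" by blast
  then obtain z where z: "\<And>k. (\<lambda>n. x (f n) k) \<longlonglongrightarrow> z k" by metis
  have "N (restr (win m) z) \<le> K" for m
  proof (rule field_le_epsilon)
    fix e :: real assume e: "e > 0"
    obtain n where n: "N (restr (win m) (x (f n) - z)) \<le> e"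
      using N_win_tendsto[of "win m" "\<lambda>n. x (f n) - z" e] LIM_zero[OF z] e by auto
    have fl: "restr (win m) y \<in> lp p" for y :: "int \<Rightarrow> 'a" by (rule lp_finite_supp) simp
    have "restr (win m) z = restr (win m) (x (f n)) - restr (win m) (x (f n) - z)" by (auto simp: restr_def fun_eq_iff)
    then have "N (restr (win m) z) \<le> N (restr (win m) (x (f n))) + N (restr (win m) (x (f n) - z))"
      using N_diff[OF fl fl, of "x (f n)" "x (f n) - z"] by (simp only:)
    also have "N (restr (win m) (x (f n))) \<le> K" using N_restr[OF x(1), of "win m" "f n"] x(2)[of "f n"] by linarith
    finally show "N (restr (win m) z) \<le> K + e" using n by linarith
  qed
  then have "z \<in> lp p" "N z \<le> K" using lp_boundI[of z K] p by blast+
  then show ?thesis using f(1) z by blast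
qed

text \<open>Sequences supported in \<open>W\<close> have \<open>card W * card bas\<close> scalar
  coordinates.\<close>

lemma dependent_family:
  fixes f :: "'j \<Rightarrow> int \<Rightarrow> 'a"
  assumes J: "finite J" and W: "finite W" "\<And>j. j \<in> J \<Longrightarrow> supp (f j) \<subseteq> W" and card: "card W * card bas < card J"
  shows "\<exists>v. (\<exists>j\<in>J. v j \<noteq> 0) \<and> (\<Sum>j\<in>J. S (v j) (f j)) = 0"
proof -
  have "card (W \<times> bas) < card J" using card by (simp add: card_cartesian_product)
  then have "\<exists>v. (\<exists>j\<in>J. v j \<noteq> 0) \<and> (\<forall>i\<in>W \<times> bas. (\<Sum>j\<in>J. coef (f j (fst i)) (snd i) * v j) = 0)"
    by (intro underdetermined_system) (use W(1) bas(1) J in auto)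
  then obtain v where v: "\<exists>j\<in>J. v j \<noteq> 0"
      "\<And>i. i \<in> W \<times> bas \<Longrightarrow> (\<Sum>j\<in>J. coef (f j (fst i)) (snd i) * v j) = 0" by blast
  have "(\<Sum>j\<in>J. S (v j) (f j)) k = 0" for k
  proof (cases "k \<in> W")
    case True
    have "(\<Sum>j\<in>J. S (v j) (f j)) k = (\<Sum>j\<in>J. smul (v j) (\<Sum>b\<in>bas. smul (coef (f j k) b) b))"
      by (simp add: sum_apply seq_scale_def coef_sum)
    also have "\<dots> = (\<Sum>j\<in>J. \<Sum>b\<in>bas. smul (coef (f j k) b * v j) b)"
      by (simp add: scale_sum_right mult.commute)
    also have "\<dots> = (\<Sum>b\<in>bas. \<Sum>j\<in>J. smul (coef (f j k) b * v j) b)" by (rule sum.swap)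
    also have "\<dots> = (\<Sum>b\<in>bas. smul (\<Sum>j\<in>J. coef (f j k) b * v j) b)" by (simp add: scale_sum_left)
    also have "\<dots> = 0" using v(2)[of "(k, b)" for b] True by simp
    finally show ?thesis .
  next
    case False
    have "f j k = 0" if "j \<in> J" for j using W(2)[OF that] False by (auto simp: supp_def)
    then show ?thesis by (simp add: sum_apply seq_scale_def)
  qed
  then show ?thesis using v(1) by (intro exI[of _ v]) (auto simp: fun_eq_iff)
qed

lemma single_sum_zero:
  assumes U: "finite U" and z: "(\<Sum>i\<in>U \<times> bas. S (t i) (single (fst i) (snd i))) = 0" and i: "i \<in> U \<times> bas"
  shows "t i = 0"
proof -
  obtain k b where kb: "i = (k, b)" "k \<in> U" "b \<in> bas" using i by auto
  have "(\<Sum>i\<in>U \<times> bas. S (t i) (single (fst i) (snd i))) k = (\<Sum>j\<in>U. \<Sum>b\<in>bas. if k = j then smul (t (j, b)) b else 0)"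
    unfolding sum_apply sum.cartesian_product by (intro sum.cong) (auto simp: seq_scale_def single_def)
  also have "\<dots> = (\<Sum>j\<in>U. if k = j then (\<Sum>b\<in>bas. smul (t (j, b)) b) else 0)" by (intro sum.cong) auto
  also have "\<dots> = (\<Sum>b\<in>bas. smul (t (k, b)) b)" using U kb(2) by simp
  finally have s0: "(\<Sum>b\<in>bas. smul (t (k, b)) b) = 0" using z by simp
  show ?thesis
  proof (rule ccontr)
    assume "t i \<noteq> 0"
    then have "dependent bas" unfolding dependent_finite[OF bas(1)]
      using s0 kb by (intro exI[of _ "\<lambda>b. t (k, b)"]) auto
    then show False using bas(2) by simp
  qed
qed

lemma single_sum_supp: "supp (\<Sum>i\<in>U \<times> bas. S (t i) (single (fst i) (snd i))) \<subseteq> U"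
proof
  fix k assume "k \<in> supp (\<Sum>i\<in>U \<times> bas. S (t i) (single (fst i) (snd i)))"
  then have "(\<Sum>i\<in>U \<times> bas. smul (t i) (single (fst i) (snd i) k)) \<noteq> 0" by (simp add: supp_def sum_apply seq_scale_def)
  then obtain i where "i \<in> U \<times> bas" "smul (t i) (single (fst i) (snd i) k) \<noteq> 0"
    using sum.neutral[of "U \<times> bas" "\<lambda>i. smul (t i) (single (fst i) (snd i) k)"] by blast
  then show "k \<in> U" by (auto simp: single_def split: if_splits)
qed

text \<open>Division by a coefficient of largest norm. The resulting coefficient one marks the
  translate around which the later arguments localize.\<close>

lemma normalize_coefficients:
  fixes c :: "nat \<Rightarrow> 'k"
  assumes "\<exists>i<K. c i \<noteq> 0"
  shows "\<exists>j<K. c j \<noteq> 0 \<and> (\<forall>i<K. norm (c i / c j) \<le> 1)"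
proof -
  obtain i0 where i0: "i0 < K" "c i0 \<noteq> 0" using assms by blast
  obtain j where j: "j < K" "\<And>i. i < K \<Longrightarrow> norm (c i) \<le> norm (c j)"
    using obtains_MAX[of "{..<K}" "\<lambda>i. norm (c i)"] i0(1)
    by (metis (no_types, lifting) Max_ge empty_iff finite_imageI finite_lessThan imageI lessThan_iff)
  have "c j \<noteq> 0" using j(2)[OF i0(1)] i0(2) by auto
  then show ?thesis using j by (intro exI[of _ j]) (auto simp: norm_divide)
qed

lemma seq_scale_simps:
  "S a (S b x) = S (a * b) x" "S 1 x = x" "S a (\<Sum>i\<in>I. f i) = (\<Sum>i\<in>I. S a (f i))" "S a 0 = 0"
  by (auto simp: seq_scale_def fun_eq_iff sum_apply scale_sum_right)

text \<open>\<open>B\<close> maps sequences on \<open>win R - win n0\<close> to sequences on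
  \<open>win (R + w)\<close>, and the number of coordinates grows by
  \<open>(2 * w + 1 + 2 * n0) * card bas\<close>, whatever \<open>R\<close> is. So the images of the
  basis and the \<open>K\<close> given sequences are linearly dependent; as \<open>B\<close> is
  injective on sequences vanishing on \<open>win n0\<close>, the relation must involve some
  \<open>y i\<close>.\<close>

lemma range_meets_family:
  assumes B: "banded B w M" and low: "below_at_infinity B n0 \<nu>" "\<nu> > 0" and R: "R \<ge> n0"
    and y: "\<And>i. i < K \<Longrightarrow> y i \<in> lp p" "\<And>i. i < K \<Longrightarrow> supp (y i) \<subseteq> win R"
    and K: "K > (2 * w + 1 + 2 * n0) * card bas"
  shows "\<exists>c x j. j < K \<and> c j = 1 \<and> (\<forall>i<K. norm (c i) \<le> 1) \<and> x \<in> lp p \<and> supp x \<inter> win n0 = {}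
    \<and> B x = (\<Sum>i<K. S (c i) (y i))"
proof -
  have lB: "lin B" using B by (simp add: banded_def)
  let ?U = "win R - win n0"
  have sub: "win n0 \<subseteq> win R" using R by auto
  have cU: "card ?U = 2 * R - 2 * n0" using sub by (subst card_Diff_subset) auto
  define f where "f = case_sum y (\<lambda>i. B (single (fst i) (snd i)))"
  let ?J = "Inl ` {..<K} \<union> Inr ` (?U \<times> bas)"
  have fin: "finite ?J" using bas(1) by simp
  have cJ: "card ?J = K + card ?U * card bas"
    using bas(1) by (subst card_Un_disjoint) (auto simp: card_image card_cartesian_product)
  have "card (win (R + w)) * card bas < card ?J"
  proof -
    have "card (win (R + w)) = (2 * w + 1 + 2 * n0) + (2 * R - 2 * n0)" using R by simp
    then have "card (win (R + w)) * card bas = (2 * w + 1 + 2 * n0) * card bas + (2 * R - 2 * n0) * card bas"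
      by (simp only: add_mult_distrib)
    then show ?thesis unfolding cJ cU using K by linarith
  qed
  moreover have "supp (f i) \<subseteq> win (R + w)" if i: "i \<in> ?J" for i
  proof (cases i)
    case (Inl a)
    then have "a < K" using i by auto
    then have "supp (f i) \<subseteq> win R" using y(2) Inl by (simp add: f_def)
    also have "\<dots> \<subseteq> win (R + w)" by auto
    finally show ?thesis .
  next
    case (Inr a)
    then have a: "fst a \<in> win R" using i by auto
    have "supp (single (fst a) (snd a)) \<subseteq> {fst a - 0..fst a + 0}" by (auto simp: supp_def single_def split: if_splits)
    then have "supp (B (single (fst a) (snd a))) \<subseteq> {fst a - 0 - int w..fst a + 0 + int w}"
      by (rule banded_supp[OF B lp_single(1)])
    also have "\<dots> \<subseteq> win (R + w)" using a by auto
    finally show ?thesis by (simp add: f_def Inr)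
  qed
  ultimately obtain v where v: "\<exists>j\<in>?J. v j \<noteq> 0" "(\<Sum>j\<in>?J. S (v j) (f j)) = 0"
    using dependent_family[OF fin, of "win (R + w)" f] by auto
  define x where "x = (\<Sum>i\<in>?U \<times> bas. S (v (Inr i)) (single (fst i) (snd i)))"
  have xs: "supp x \<subseteq> ?U" unfolding x_def by (rule single_sum_supp)
  then have xs0: "supp x \<inter> win n0 = {}" by blast
  have xl: "x \<in> lp p" unfolding x_def by (intro lp_sum lp_seq_scale lp_single)
  have Bx: "B x = (\<Sum>i\<in>?U \<times> bas. S (v (Inr i)) (B (single (fst i) (snd i))))"
    unfolding x_def by (subst lin_sum[OF lB]) (auto intro: lp_seq_scale lp_single simp: linD(3)[OF lB lp_single(1)])
  have "(\<Sum>j\<in>?J. S (v j) (f j)) = (\<Sum>i<K. S (v (Inl i)) (y i)) + B x"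
    unfolding Bx using bas(1) by (subst sum.union_disjoint) (auto simp: sum.reindex f_def)
  then have sum0: "(\<Sum>i<K. S (v (Inl i)) (y i)) + B x = 0" using v(2) by simp
  have "\<exists>i<K. v (Inl i) \<noteq> 0"
  proof (rule ccontr)
    assume neg: "\<not> ?thesis"
    then have "S (v (Inl i)) (y i) = 0" if "i < K" for i using that by (simp add: seq_scale_def fun_eq_iff)
    then have "(\<Sum>i<K. S (v (Inl i)) (y i)) = 0" by (intro sum.neutral) auto
    then have "B x = 0" using sum0 by simp
    then have "\<nu> * N x \<le> 0" using low(1) xl xs0 unfolding below_at_infinity_def by force
    then have "x = 0" using N_pos[OF xl] low(2) by (meson mult_pos_pos not_le)
    then have "v (Inr i) = 0" if "i \<in> ?U \<times> bas" for i
      using single_sum_zero[of ?U "\<lambda>i. v (Inr i)", OF _ _ that] unfolding x_def by simp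
    then show False using v(1) neg by auto
  qed
  then obtain j where j: "j < K" "v (Inl j) \<noteq> 0" "\<And>i. i < K \<Longrightarrow> norm (v (Inl i) / v (Inl j)) \<le> 1"
    using normalize_coefficients[of K "\<lambda>i. v (Inl i)"] by blast
  let ?a = "- (1 / v (Inl j))"
  have sx: "supp (S ?a x) \<subseteq> supp x" by (auto simp: supp_def seq_scale_def)
  have "B (S ?a x) = S ?a (B x)" by (rule linD(3)[OF lB xl])
  also have "B x = - (\<Sum>i<K. S (v (Inl i)) (y i))" using sum0 by (simp add: eq_neg_iff_add_eq_0 add.commute)
  also have "S ?a (- (\<Sum>i<K. S (v (Inl i)) (y i))) = S (1 / v (Inl j)) (\<Sum>i<K. S (v (Inl i)) (y i))"
    by (simp add: seq_scale_def fun_eq_iff)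
  also have "\<dots> = (\<Sum>i<K. S (v (Inl i) / v (Inl j)) (y i))" by (simp add: seq_scale_simps)
  finally show ?thesis using j xl xs0 sx
    by (intro exI[of _ "\<lambda>i. v (Inl i) / v (Inl j)"] exI[of _ "S ?a x"] exI[of _ j]) (auto intro: lp_seq_scale)
qed

text \<open>The dual count. Solutions \<open>q i\<close> for the basis of
  \<open>win R - win n0\<close>, truncated to \<open>win (R + w)\<close>, together with the
  \<open>K\<close> sequences annihilated there outnumber the coordinates of
  \<open>win (R + w)\<close>. Applying \<open>B\<close> to a relation among them removes the
  annihilated sequences and forces the coefficients of the \<open>q i\<close> to vanish.\<close>

lemma kernel_family_dependent:
  assumes B: "banded B w M" and sol: "solvable_on B (win R - win n0) C" and R: "R \<ge> n0"
    and y: "\<And>i. i < K \<Longrightarrow> y i \<in> lp p" "\<And>i. i < K \<Longrightarrow> supp (y i) \<subseteq> win (R + w)"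
      "\<And>i. i < K \<Longrightarrow> restr (win R - win n0) (B (y i)) = 0"
    and K: "K > (2 * w + 1 + 2 * n0) * card bas"
  shows "\<exists>c j. j < K \<and> c j = 1 \<and> (\<forall>i<K. norm (c i) \<le> 1) \<and> (\<Sum>i<K. S (c i) (y i)) = 0"
proof -
  have lB: "lin B" using B by (simp add: banded_def)
  let ?U = "win R - win n0"
  have sub: "win n0 \<subseteq> win R" using R by auto
  have cU: "card ?U = 2 * R - 2 * n0" using sub by (subst card_Diff_subset) auto
  have "\<exists>s\<in>lp p. restr ?U (B s) = single (fst i) (snd i)" if "i \<in> ?U \<times> bas" for i
  proof -
    have "supp (single (fst i) (snd i)) \<subseteq> ?U" using that by (auto simp: supp_def single_def split: if_splits)
    then show ?thesis using sol lp_single(1) unfolding solvable_on_def by blast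
  qed
  then obtain s where s: "\<And>i. i \<in> ?U \<times> bas \<Longrightarrow> s i \<in> lp p"
      "\<And>i. i \<in> ?U \<times> bas \<Longrightarrow> restr ?U (B (s i)) = single (fst i) (snd i)" by metis
  \<comment> \<open>The margin \<open>w\<close> is the band width, so the truncation does not change
    the image on \<open>?U\<close>.\<close>
  define q where "q i = restr (win (R + w)) (s i)" for i
  have ql: "q i \<in> lp p" if "i \<in> ?U \<times> bas" for i unfolding q_def by (rule lp_restr[OF s(1)[OF that]])
  have qs: "restr ?U (B (q i)) = single (fst i) (snd i)" if "i \<in> ?U \<times> bas" for i
    unfolding q_def s(2)[OF that, symmetric] by (rule banded_restr[OF B s(1)[OF that]]) auto
  define f where "f = case_sum y q"
  let ?J = "Inl ` {..<K} \<union> Inr ` (?U \<times> bas)"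
  have fin: "finite ?J" using bas(1) by simp
  have cJ: "card ?J = K + card ?U * card bas"
    using bas(1) by (subst card_Un_disjoint) (auto simp: card_image card_cartesian_product)
  have "card (win (R + w)) * card bas < card ?J"
  proof -
    have "card (win (R + w)) = (2 * w + 1 + 2 * n0) + (2 * R - 2 * n0)" using R by simp
    then have "card (win (R + w)) * card bas = (2 * w + 1 + 2 * n0) * card bas + (2 * R - 2 * n0) * card bas"
      by (simp only: add_mult_distrib)
    then show ?thesis unfolding cJ cU using K by linarith
  qed
  moreover have "supp (f i) \<subseteq> win (R + w)" if i: "i \<in> ?J" for i
    using i y(2) by (auto simp: f_def q_def supp_restr simp del: atLeastAtMost_iff) blast
  ultimately obtain v where v: "\<exists>j\<in>?J. v j \<noteq> 0" "(\<Sum>j\<in>?J. S (v j) (f j)) = 0"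
    using dependent_family[OF fin, of "win (R + w)" f] by auto
  define c where "c i = v (Inl i)" for i
  define t where "t i = v (Inr i)" for i
  have "(\<Sum>j\<in>?J. S (v j) (f j)) = (\<Sum>i<K. S (c i) (y i)) + (\<Sum>i\<in>?U \<times> bas. S (t i) (q i))"
    using bas(1) by (subst sum.union_disjoint) (auto simp: sum.reindex f_def c_def t_def)
  then have sum0: "(\<Sum>i<K. S (c i) (y i)) + (\<Sum>i\<in>?U \<times> bas. S (t i) (q i)) = 0" using v(2) by simp
  let ?R = "\<lambda>x. restr ?U (B x)"
  have lR: "lin ?R" by (rule lin_restr_comp[OF lB])
  have 1: "?R (\<Sum>i<K. S (c i) (y i)) = 0"
  proof -
    have "?R (\<Sum>i<K. S (c i) (y i)) = (\<Sum>i<K. ?R (S (c i) (y i)))"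
      by (rule lin_sum[OF lR]) (use y(1) lp_seq_scale in auto)
    also have "\<dots> = (\<Sum>i<K. S (c i) (?R (y i)))"
      by (rule sum.cong[OF refl], rule linD(3)[OF lR]) (use y(1) in auto)
    also have "\<dots> = 0" using y(3) by (intro sum.neutral) (auto simp: seq_scale_simps)
    finally show ?thesis .
  qed
  have 2: "?R (\<Sum>i\<in>?U \<times> bas. S (t i) (q i)) = (\<Sum>i\<in>?U \<times> bas. S (t i) (single (fst i) (snd i)))"
  proof -
    have "?R (\<Sum>i\<in>?U \<times> bas. S (t i) (q i)) = (\<Sum>i\<in>?U \<times> bas. ?R (S (t i) (q i)))"
      by (rule lin_sum[OF lR]) (use ql lp_seq_scale in blast)
    also have "\<dots> = (\<Sum>i\<in>?U \<times> bas. S (t i) (?R (q i)))"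
      by (rule sum.cong[OF refl], rule linD(3)[OF lR]) (rule ql)
    also have "\<dots> = (\<Sum>i\<in>?U \<times> bas. S (t i) (single (fst i) (snd i)))"
      by (rule sum.cong[OF refl]) (simp only: qs)
    finally show ?thesis .
  qed
  have "?R ((\<Sum>i<K. S (c i) (y i)) + (\<Sum>i\<in>?U \<times> bas. S (t i) (q i)))
      = ?R (\<Sum>i<K. S (c i) (y i)) + ?R (\<Sum>i\<in>?U \<times> bas. S (t i) (q i))"
    by (rule linD(2)[OF lR]) (use y(1) ql in \<open>auto intro!: lp_sum lp_seq_scale\<close>)
  then have "(\<Sum>i\<in>?U \<times> bas. S (t i) (single (fst i) (snd i))) = 0"
    unfolding sum0 1 2 using lin_zero[OF lR] by simp
  then have t0: "t i = 0" if "i \<in> ?U \<times> bas" for i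
    using single_sum_zero[of ?U t, OF _ _ that] by simp
  then have "(\<Sum>i\<in>?U \<times> bas. S (t i) (q i)) = 0"
    by (intro sum.neutral) (auto simp: seq_scale_def fun_eq_iff)
  then have c0: "(\<Sum>i<K. S (c i) (y i)) = 0" using sum0 by simp
  have "\<exists>i<K. c i \<noteq> 0" using v(1) t0 by (auto simp: c_def t_def)
  then obtain j where j: "j < K" "c j \<noteq> 0" "\<And>i. i < K \<Longrightarrow> norm (c i / c j) \<le> 1"
    using normalize_coefficients[of K c] by blast
  have "(\<Sum>i<K. S (c i / c j) (y i)) = S (1 / c j) (\<Sum>i<K. S (c i) (y i))" by (simp add: seq_scale_simps)
  then show ?thesis using c0 j by (intro exI[of _ "\<lambda>i. c i / c j"] exI[of _ j]) (simp add: seq_scale_simps)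
qed

end

section \<open>Limit operators of operators bounded below or solvable at infinity\<close>

lemma eq_add_of_zero_eq_diff: "0 = z - a - b \<Longrightarrow> z = a + b" for z a b :: "'g::ab_group_add"
  by (simp add: algebra_simps)

context lp_space
begin

lemma cut_seq_scale: "cutoff \<phi> (S c x) = S c (cutoff \<phi> x)"
  by (simp add: cutoff_def seq_scale_def smul_of_real[symmetric] mult.commute)

lemma cut_sum: "cutoff \<phi> (\<Sum>i\<in>I. f i) = (\<Sum>i\<in>I. cutoff \<phi> (f i))" for f :: "'i \<Rightarrow> int \<Rightarrow> 'a"
  by (auto simp: cutoff_def fun_eq_iff sum_apply scaleR_sum_right)

lemma cut_one: "(\<And>k. k \<in> supp x \<Longrightarrow> \<phi> k = 1) \<Longrightarrow> cutoff \<phi> x = x"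
  by (auto simp: cutoff_def supp_def fun_eq_iff) (metis scaleR_one scaleR_zero_right)

lemma cut_zero: "(\<And>k. k \<in> supp x \<Longrightarrow> \<phi> k = 0) \<Longrightarrow> cutoff \<phi> x = 0"
  by (auto simp: cutoff_def supp_def fun_eq_iff)

lemma lp_tent: "x \<in> lp p \<Longrightarrow> cutoff (tent m D c) x \<in> lp p"
  and N_tent: "x \<in> lp p \<Longrightarrow> N (cutoff (tent m D c) x) \<le> N x"
  for x :: "int \<Rightarrow> 'a"
  by (rule lp_cut, assumption, rule tent_abs) (rule N_cut, assumption, rule tent_abs)

lemma supp_shift_win: "supp x \<subseteq> win m \<Longrightarrow> supp (shift h x) \<subseteq> {h - int m..h + int m}"
  unfolding supp_shift by auto

lemma tent_on_interval: "D > 0 \<Longrightarrow> k \<in> {c - int m..c + int m} \<Longrightarrow> tent (real m) D c k = 1"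
proof -
  assume D: "D > 0" and k: "k \<in> {c - int m..c + int m}"
  have "\<bar>k - c\<bar> \<le> int m" using k by auto
  then have "real_of_int \<bar>k - c\<bar> \<le> real_of_int (int m)" by (simp only: of_int_le_iff)
  then show ?thesis by (intro tent_one[OF D]) simp
qed

lemma tent_off_interval: "D > 0 \<Longrightarrow> k \<notin> {c - int (m + nat \<lceil>D\<rceil>)..c + int (m + nat \<lceil>D\<rceil>)} \<Longrightarrow> tent (real m) D c k = 0"
proof -
  assume D: "D > 0" and k: "k \<notin> {c - int (m + nat \<lceil>D\<rceil>)..c + int (m + nat \<lceil>D\<rceil>)}"
  have "int (m + nat \<lceil>D\<rceil>) \<le> \<bar>k - c\<bar>" using k by auto
  then have "real_of_int (int (m + nat \<lceil>D\<rceil>)) \<le> real_of_int \<bar>k - c\<bar>" by (simp only: of_int_le_iff)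
  then have "real m + real (nat \<lceil>D\<rceil>) \<le> \<bar>real_of_int (k - c)\<bar>"
    by (simp only: of_int_of_nat_eq of_nat_add of_int_abs)
  moreover have "D \<le> real (nat \<lceil>D\<rceil>)" by linarith
  ultimately have "real m + D \<le> \<bar>real_of_int (k - c)\<bar>" by linarith
  then show ?thesis by (rule tent_zero[OF D])
qed

lemma supp_cut_tent: "D > 0 \<Longrightarrow> supp (cutoff (tent (real m) D c) x) \<subseteq> {c - int (m + nat \<lceil>D\<rceil>)..c + int (m + nat \<lceil>D\<rceil>)}"
  using tent_off_interval[of D _ c m] by (auto simp: supp_def cutoff_def simp del: atLeastAtMost_iff)

text \<open>A tent, unlike a sharp truncation, almost commutes with \<open>B\<close> and so keeps
  the image small. Only norms are compared: for \<open>p = \<infinity>\<close> no sequence of finite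
  support need be close to \<open>x\<close>.\<close>

lemma truncate_almost_same_image:
  assumes B: "lin B" "quasilocal B" and x: "x \<in> lp p" and e: "e > 0"
  shows "\<exists>m. \<exists>z\<in>lp p. supp z \<subseteq> win m \<and> N x - e \<le> N z \<and> N (B z) \<le> N (B x) + e * N x"
proof -
  obtain D where D: "D > 0" "comm_small B e D" using B(2) e unfolding quasilocal_def by blast
  obtain R where R: "N x - e < N (restr (win R) x)" using N_restr_approx[OF x e] by blast
  let ?\<phi> = "tent (real R) D 0"
  let ?z = "cutoff ?\<phi> x"
  have z: "?z \<in> lp p" by (rule lp_tent[OF x])
  have "restr (win R) ?z = restr (win R) x"
    using tent_on_interval[OF D(1), of _ 0 R] by (auto simp: restr_def cutoff_def fun_eq_iff)
  then have "N x - e \<le> N ?z" using R N_restr[OF z, of "win R"] by simp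
  moreover have "N (B ?z) \<le> N (B x) + e * N x"
    using N_le_diff[OF linD(1)[OF B(1) z] lp_tent[OF linD(1)[OF B(1) x]], of "real R" D 0]
      comm_small_tent[OF D(2,1) x, of "real R" 0] N_tent[OF linD(1)[OF B(1) x], of "real R" D 0] by linarith
  moreover have "supp ?z \<subseteq> win (R + nat \<lceil>D\<rceil>)" using supp_cut_tent[OF D(1), of R 0 x] by simp
  ultimately show ?thesis using z by blast
qed

text \<open>A sequence of finite support is moved by \<open>h n\<close> beyond
  \<open>win n0\<close>, where the bound for \<open>A\<close> applies. The constant \<nu> survives
  unchanged, which gives one lower bound for all limit operators.\<close>

lemma below_at_infinity_imp_limit_below:
  assumes A: "lin A" "quasilocal A" and low: "below_at_infinity A n0 \<nu>" "\<nu> > 0"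
    and h: "filterlim (\<lambda>n. \<bar>h n\<bar>) at_top sequentially" and L: "op_lim A h B" and x: "x \<in> lp p"
  shows "\<nu> * N x \<le> N (B x)"
proof -
  have lB: "lin B" using L by (simp add: op_lim_def)
  have fin: "\<nu> * N z \<le> N (B z)" if z: "z \<in> lp p" "supp z \<subseteq> win m" for z m
  proof (rule field_le_epsilon)
    fix \<eta> :: real assume \<eta>: "\<eta> > 0"
    have Nz: "N z \<ge> 0" using N_nonneg z by blast
    define e where "e = \<eta> / (N z + 1)"
    have e: "e > 0" using \<eta> Nz by (simp add: e_def)
    obtain M where M: "\<And>n. n \<ge> M \<Longrightarrow> N (shc (h n) A (restr (win m) z) - B (restr (win m) z)) \<le> e * N z"
      using op_limD[OF L e, of m] z(1) by blast
    have "\<forall>\<^sub>F n in sequentially. int (m + n0 + 1) \<le> \<bar>h n\<bar>" using h unfolding filterlim_at_top by blast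
    then obtain M' where M': "\<And>n. n \<ge> M' \<Longrightarrow> int (m + n0 + 1) \<le> \<bar>h n\<bar>" by (auto simp: eventually_sequentially)
    define n where "n = max M M'"
    have hn: "int (m + n0 + 1) \<le> \<bar>h n\<bar>" using M' by (simp add: n_def)
    have "supp (shift (h n) z) \<inter> win n0 = {}" using supp_shift_win[OF z(2), of "h n"] hn by fastforce
    then have "\<nu> * N (shift (h n) z) \<le> N (A (shift (h n) z))"
      using low(1) lp_shift[OF z(1)] unfolding below_at_infinity_def by blast
    then have "\<nu> * N z \<le> N (A (shift (h n) z))" unfolding N_shift[OF z(1)] .
    moreover have "N (shc (h n) A z) = N (A (shift (h n) z))"
      unfolding shc_def comp_apply by (rule N_shift[OF linD(1)[OF A(1) lp_shift[OF z(1)]]])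
    moreover have "N (shc (h n) A z) \<le> N (B z) + N (shc (h n) A z - B z)"
      by (rule N_le_diff[OF linD(1)[OF lin_shc[OF A(1)] z(1)] linD(1)[OF lB z(1)]])
    moreover have "N (shc (h n) A z - B z) \<le> e * N z" using M[of n] unfolding restr_id[OF z(2)] by (simp add: n_def)
    moreover have "e * N z \<le> \<eta>" using Nz \<eta> by (simp add: e_def field_simps)
    ultimately show "\<nu> * N z \<le> N (B z) + \<eta>" by linarith
  qed
  show ?thesis
  proof (rule field_le_epsilon)
    fix \<eta> :: real assume \<eta>: "\<eta> > 0"
    have Nx: "N x \<ge> 0" using N_nonneg x by blast
    \<comment> \<open>Losing \<open>e\<close> in the norm of \<open>x\<close> costs
      \<open>\<nu> * e\<close>, and the image costs \<open>e * N x\<close>; together this is exactly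
      \<open>\<eta>\<close>.\<close>
    define e where "e = \<eta> / (N x + \<nu>)"
    have e: "e > 0" using \<eta> Nx low(2) by (simp add: e_def)
    obtain m z where z: "z \<in> lp p" "supp z \<subseteq> win m" "N x - e \<le> N z" "N (B z) \<le> N (B x) + e * N x"
      using truncate_almost_same_image[OF lB op_lim_quasilocal[OF A L] x e] by blast
    have "\<nu> * (N x - e) \<le> \<nu> * N z" using z(3) low(2) by (intro mult_left_mono) auto
    also have "\<dots> \<le> N (B x) + e * N x" using fin[OF z(1,2)] z(4) by linarith
    finally have "\<nu> * N x \<le> N (B x) + e * (N x + \<nu>)" by (simp add: algebra_simps)
    also have "e * (N x + \<nu>) = \<eta>" using Nx low(2) by (simp add: e_def)
    finally show "\<nu> * N x \<le> N (B x) + \<eta>" .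
  qed
qed

end

context lp_space_fin
begin

text \<open>Many far-apart translates of \<open>y\<close> cannot all miss the range of the band operator \<open>A'\<close> close to
  \<open>A\<close>, because \<open>A'\<close> maps finite sections injectively into sections of almost the same dimension.
  Near the translate with the largest coefficient, a preimage of the combination solves the equation
  for \<open>y\<close> up to commutators.\<close>

lemma approximate_preimage:
  assumes A: "band_dominated smul p A" and low: "below_at_infinity A n0 \<nu>" "\<nu> > 0"
    and h: "filterlim (\<lambda>n. \<bar>h n\<bar>) at_top sequentially" and L: "op_lim A h B"
    and y: "y \<in> lp p" "supp y \<subseteq> win m" and \<delta>: "\<delta> > 0"
  shows "\<exists>z\<in>lp p. N (B z - y) \<le> \<delta>"
proof -
  have lA: "lin A" using A by (auto simp: band_dominated_def bounded_ops_iff)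
  have lB: "lin B" using L by (simp add: op_lim_def)
  have Ny: "N y \<ge> 0" using N_nonneg y by blast
  \<comment> \<open>A bound for the localized preimage \<open>?u\<close>, obtained below from
    \<open>\<nu> / 2 * N ?u \<le> N y + 1\<close>. It does not depend on the number \<open>K\<close>
    of translates.\<close>
  define X where "X = 2 / \<nu> * (N y + 1)"
  have X: "X > 0" using Ny low(2) by (simp add: X_def)
  \<comment> \<open>This error must be fixed before the band width \<open>w\<close> is known, hence
    before \<open>K\<close> and the bound \<open>Y\<close> on the whole preimage \<open>x\<close>.
    So \<open>A - A'\<close> is only ever applied to \<open>?u\<close>, which is bounded by
    \<open>X\<close>; what is charged to \<open>x\<close> is the commutator, whose size
    \<open>\<tau>\<close> is chosen after \<open>Y\<close>.\<close>
  define \<epsilon> where "\<epsilon> = min (\<nu> / 2) (\<delta> / (4 * X))"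
  have \<epsilon>: "\<epsilon> > 0" "\<epsilon> \<le> \<nu> / 2" "\<epsilon> * X \<le> \<delta> / 4"
    using X \<delta> low(2) by (auto simp: \<epsilon>_def min_def field_simps)
  obtain A' w M where A': "banded A' w M" "bnd (A - A') \<epsilon>" using band_dominated_approx[OF A \<epsilon>(1)] by blast
  have lA': "lin A'" using A' by (simp add: banded_def)
  have low': "below_at_infinity A' n0 (\<nu> / 2)"
    unfolding below_at_infinity_def
  proof (intro ballI impI)
    fix x :: "int \<Rightarrow> 'a" assume x: "x \<in> lp p" "supp x \<inter> win n0 = {}"
    have "\<nu> * N x \<le> N (A x)" using low(1) x unfolding below_at_infinity_def by blast
    moreover have "N (A x) \<le> N (A' x) + N (A x - A' x)" by (rule N_le_diff[OF linD(1)[OF lA x(1)] linD(1)[OF lA' x(1)]])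
    moreover have "N (A x - A' x) \<le> \<epsilon> * N x" using bndD[OF A'(2) x(1)] by simp
    moreover have "\<epsilon> * N x \<le> \<nu> / 2 * N x" using \<epsilon>(2) N_nonneg[OF x(1)] by (rule mult_right_mono)
    ultimately show "\<nu> / 2 * N x \<le> N (A' x)" by linarith
  qed
  define K where "K = Suc ((2 * w + 1 + 2 * n0) * card bas)"
  define Y where "Y = 2 / \<nu> * (real K * N y)"
  have Y: "Y \<ge> 0" using Ny low(2) by (simp add: Y_def)
  define \<tau> where "\<tau> = min 1 (\<delta> / 2) / (Y + 1)"
  have \<tau>: "\<tau> > 0" "\<tau> * Y \<le> min 1 (\<delta> / 2)"
    using Y \<delta> by (auto simp: \<tau>_def min_def field_simps)
  obtain D where D: "D > 0" "comm_small A' \<tau> D" using banded_comm[OF A'(1) \<tau>(1)] by blast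
  define l where "l = m + nat \<lceil>D\<rceil>"
  obtain n1 where n1: "\<And>n x. n \<ge> n1 \<Longrightarrow> x \<in> lp p \<Longrightarrow> N (shc (h n) A (restr (win l) x) - B (restr (win l) x)) \<le> \<epsilon> * N x"
    using op_limD[OF L \<epsilon>(1), of l] by blast
  \<comment> \<open>A distance beyond \<open>2 * l\<close> keeps the tent around one translate, of
    reach \<open>l\<close>, off the supports of the others, of radius
    \<open>m \<le> l\<close>.\<close>
  obtain g :: "nat \<Rightarrow> nat" where g: "\<And>i. g i \<ge> n1" "\<And>i j. i \<noteq> j \<Longrightarrow> \<bar>h (g i) - h (g j)\<bar> > int (2 * l)"
    using separated_subsequence[OF h, of n1 "int (2 * l)"] by blast
  define c where "c i = h (g i)" for i
  define ys where "ys i = shift (c i) y" for i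
  have ys: "ys i \<in> lp p" "N (ys i) = N y" "supp (ys i) \<subseteq> {c i - int m..c i + int m}" for i
    using lp_shift[OF y(1)] N_shift[OF y(1)] supp_shift_win[OF y(2)] by (auto simp: ys_def)
  obtain R0 where R0: "(\<Union>i<K. {c i - int m..c i + int m}) \<subseteq> win R0"
    using finite_int_bound[of "\<Union>i<K. {c i - int m..c i + int m}"] by auto
  define R where "R = max R0 n0"
  have "win R0 \<subseteq> win R" by (auto simp: R_def)
  then have ysR: "supp (ys i) \<subseteq> win R" if "i < K" for i using ys(3)[of i] R0 that by blast
  have side: "\<nu> / 2 > 0" "R \<ge> n0" "K > (2 * w + 1 + 2 * n0) * card bas" using low(2) by (simp_all add: R_def K_def)
  obtain d x j where j: "j < K" "d j = 1" "\<And>i. i < K \<Longrightarrow> norm (d i) \<le> 1" and x: "x \<in> lp p" "supp x \<inter> win n0 = {}"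
      and A'x: "A' x = (\<Sum>i<K. S (d i) (ys i))"
    using range_meets_family[where y = ys and K = K, OF A'(1) low' side(1,2) ys(1) ysR side(3)] by blast
  have "N (A' x) \<le> (\<Sum>i<K. N (S (d i) (ys i)))" unfolding A'x by (rule N_sum) (rule lp_seq_scale[OF ys(1)])
  also have "\<dots> \<le> (\<Sum>i<K. N y)"
  proof (rule sum_mono)
    fix i assume "i \<in> {..<K}"
    then have "norm (d i) * N y \<le> 1 * N y" using j(3) Ny by (intro mult_right_mono) auto
    then show "N (S (d i) (ys i)) \<le> N y" by (simp add: N_seq_scale[OF ys(1)] ys(2))
  qed
  finally have "\<nu> / 2 * N x \<le> real K * N y" using low' x unfolding below_at_infinity_def by fastforce
  then have NxY: "N x \<le> Y" using low(2) by (simp add: Y_def field_simps)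
  let ?\<phi> = "tent (real m) D (c j)"
  let ?u = "cutoff ?\<phi> x"
  have u: "?u \<in> lp p" by (rule lp_tent[OF x(1)])
  have us: "supp ?u \<subseteq> {c j - int l..c j + int l}" unfolding l_def by (rule supp_cut_tent[OF D(1)])
  \<comment> \<open>The tent fixes the \<open>j\<close>-th translate, whose coefficient is one, and
    annihilates all the others.\<close>
  have "cutoff ?\<phi> (A' x) = (\<Sum>i<K. S (d i) (cutoff ?\<phi> (ys i)))" unfolding A'x by (simp add: cut_sum cut_seq_scale)
  also have "\<dots> = (\<Sum>i<K. if i = j then ys j else 0)"
  proof (rule sum.cong[OF refl])
    fix i
    show "S (d i) (cutoff ?\<phi> (ys i)) = (if i = j then ys j else 0)"
    proof (cases "i = j")
      case True
      have "cutoff ?\<phi> (ys j) = ys j" using ys(3) tent_on_interval[OF D(1)] by (intro cut_one) blast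
      then show ?thesis using True j(2) by (simp add: seq_scale_simps)
    next
      case False
      have "?\<phi> k = 0" if "k \<in> supp (ys i)" for k
      proof (rule tent_off_interval[OF D(1)])
        have "k \<in> {c i - int m..c i + int m}" using that ys(3) by blast
        moreover have "\<bar>c i - c j\<bar> > 2 * int l" using g(2)[OF False] by (simp add: c_def)
        moreover have "int m \<le> int l" by (simp add: l_def)
        ultimately show "k \<notin> {c j - int (m + nat \<lceil>D\<rceil>)..c j + int (m + nat \<lceil>D\<rceil>)}"
          unfolding l_def[symmetric] atLeastAtMost_iff by linarith
      qed
      then have "cutoff ?\<phi> (ys i) = 0" by (rule cut_zero)
      then show ?thesis using False by (simp add: seq_scale_simps)
    qed
  qed
  also have "\<dots> = ys j" using j(1) by (simp add: sum.delta)
  finally have cy: "cutoff ?\<phi> (A' x) = ys j" .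
  have A'u: "A' ?u \<in> lp p" "A ?u \<in> lp p" using u linD(1) lA lA' by blast+
  have "N (A' ?u - ys j) \<le> \<tau> * N x" using comm_small_tent[OF D(2,1) x(1), of "real m" "c j"] unfolding cy .
  also have "\<dots> \<le> \<tau> * Y" using NxY \<tau>(1) by (intro mult_left_mono) auto
  finally have r: "N (A' ?u - ys j) \<le> min 1 (\<delta> / 2)" using \<tau>(2) by linarith
  have "supp ?u \<inter> win n0 = {}" using supp_cut[of ?\<phi> x] x(2) by blast
  then have "\<nu> / 2 * N ?u \<le> N (A' ?u)" using low' u unfolding below_at_infinity_def by blast
  also have "\<dots> \<le> N (ys j) + N (A' ?u - ys j)" by (rule N_le_diff[OF A'u(1) ys(1)])
  also have "\<dots> \<le> N y + 1" using r ys(2) by simp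
  finally have NuX: "N ?u \<le> X" using low(2) by (simp add: X_def field_simps)
  let ?z = "shift (- c j) ?u"
  have z: "?z \<in> lp p" "N ?z = N ?u" using lp_shift[OF u] N_shift[OF u] by auto
  have zr: "restr (win l) ?z = ?z" by (rule restr_id[OF supp_shift_subset[OF us]])
  have "N (A ?u - ys j) \<le> N (A' ?u - ys j) + N (A ?u - A' ?u)"
    using N_triangle[OF lp_diff[OF A'u(1) ys(1)] lp_diff[OF A'u(2,1)], of j] by simp
  also have "N (A ?u - A' ?u) \<le> \<epsilon> * N ?u" using bndD[OF A'(2) u] by simp
  finally have 1: "N (A ?u - ys j) \<le> \<delta> / 2 + \<epsilon> * N ?u" using r by simp
  have "shc (c j) A ?z - y = shift (- c j) (A ?u - ys j)"
    unfolding shc_shift by (simp add: ys_def shift_def fun_eq_iff)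
  then have 2: "N (shc (c j) A ?z - y) = N (A ?u - ys j)" using N_shift[OF lp_diff[OF A'u(2) ys(1)]] by (simp only:)
  have 3: "N (shc (c j) A ?z - B ?z) \<le> \<epsilon> * N ?u" using n1[OF g(1) z(1), of j] unfolding zr c_def[symmetric] z(2) .
  have sz: "shc (c j) A ?z \<in> lp p" by (rule linD(1)[OF lin_shc[OF lA] z(1)])
  have "B ?z - y = (shc (c j) A ?z - y) - (shc (c j) A ?z - B ?z)" by simp
  then have "N (B ?z - y) \<le> N (shc (c j) A ?z - y) + N (shc (c j) A ?z - B ?z)"
    using N_diff[OF lp_diff[OF sz y(1)] lp_diff[OF sz linD(1)[OF lB z(1)]]] by (simp only:)
  also have "\<dots> \<le> \<delta> / 2 + \<epsilon> * N ?u + \<epsilon> * N ?u" using 1 2 3 by linarith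
  also have "\<epsilon> * N ?u \<le> \<epsilon> * X" using NuX \<epsilon>(1) by (intro mult_left_mono) auto
  finally have "N (B ?z - y) \<le> \<delta>" using \<epsilon>(3) by linarith
  then show ?thesis using z(1) by blast
qed

text \<open>The range is closed by the lower bound and contains all sequences of finite support, for
  which approximate preimages exist. For \<open>p \<noteq> \<infinity>\<close> these are dense. For
  \<open>p = \<infinity>\<close> the preimages of the windows of \<open>y\<close> are bounded, again
  by the lower bound, and an entrywise limit of them is a preimage of \<open>y\<close>.\<close>

lemma below_at_infinity_imp_limit_surjective:
  assumes A: "band_dominated smul p A" and low: "below_at_infinity A n0 \<nu>" "\<nu> > 0"
    and h: "filterlim (\<lambda>n. \<bar>h n\<bar>) at_top sequentially" and L: "op_lim A h B"
  shows "B ` lp p = lp p"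
proof
  have lA: "lin A" using A by (auto simp: band_dominated_def bounded_ops_iff)
  note q = band_dominated_quasilocal[OF A]
  obtain C where lB: "lin B" and C: "C > 0" "bnd B C" using L unfolding op_lim_def by blast
  note below = below_at_infinity_imp_limit_below[OF lA q low h L]
  show "B ` lp p \<subseteq> lp p" using linD(1)[OF lB] by blast
  have dense: "\<exists>x\<in>lp p. B x = y" if y: "y \<in> lp p" "\<And>e. e > 0 \<Longrightarrow> \<exists>x\<in>lp p. N (B x - y) \<le> e" for y
    using range_closed_below[OF lB C(2) low(2), of UNIV y] below y by auto
  have fin: "\<exists>x\<in>lp p. B x = y" if y: "y \<in> lp p" "supp y \<subseteq> win m" for y m
    using dense[OF y(1)] approximate_preimage[OF A low h L y] by blast
  show "lp p \<subseteq> B ` lp p"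
  proof
    fix y :: "int \<Rightarrow> 'a" assume y: "y \<in> lp p"
    have "\<exists>x\<in>lp p. B x = restr (win n) y" for n
      by (rule fin[OF lp_restr[OF y], of _ n]) (simp add: supp_restr)
    then obtain x where x: "\<And>n. x n \<in> lp p" "\<And>n. B (x n) = restr (win n) y" by metis
    have "\<exists>z\<in>lp p. B z = y"
    proof (cases "p = \<infinity>")
      case False
      have "\<exists>x\<in>lp p. N (B x - y) \<le> e" if e: "e > 0" for e
      proof -
        obtain n where n: "N (restr (- win n) y) \<le> e" using N_tail[OF y False e] by blast
        have "B (x n) - y = - restr (- win n) y" unfolding x(2) by (auto simp: restr_def fun_eq_iff)
        then have "N (B (x n) - y) = N (restr (- win n) y)" using N_uminus[OF lp_restr[OF y]] by (simp only:)
        then show ?thesis using n x(1) by (intro bexI[of _ "x n"]) simp_all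
      qed
      then show ?thesis by (rule dense[OF y])
    next
      case True
      have "N (x n) \<le> N y / \<nu>" for n
        using below[OF x(1)[of n]] N_restr[OF y, of "win n"] low(2) unfolding x(2) by (simp add: field_simps)
      then obtain f z where f: "strict_mono f" and z: "z \<in> lp p" "N z \<le> N y / \<nu>" and lim: "\<And>k. (\<lambda>n. x (f n) k) \<longlonglongrightarrow> z k"
        using bounded_seq_pointwise_limit[of x "N y / \<nu>"] x(1) True by auto
      have "B z k = y k" for k
      proof -
        let ?m = "nat \<bar>k\<bar>"
        have "norm (B z k - y k) \<le> 0 + e" if e: "e > 0" for e
        proof -
          obtain M where M: "\<And>n. n \<ge> M \<Longrightarrow> N (restr (win ?m) (B (x (f n)) - B z)) \<le> e"
            using quasilocal_pointwise_continuous[OF lB C(2,1) op_lim_quasilocal[OF lA q L], of "\<lambda>n. x (f n)" "N y / \<nu>" z e ?m]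
              x(1) \<open>\<And>n. N (x n) \<le> N y / \<nu>\<close> z lim e by blast
          define n where "n = max M ?m"
          have "f n \<ge> ?m" using seq_suble[OF f, of n] by (simp add: n_def)
          then have "k \<in> win (f n)" by auto
          then have "B (x (f n)) k = y k" unfolding x(2) by (simp add: restr_def)
          then have "norm (B z k - y k) = norm (restr (win ?m) (B (x (f n)) - B z) k)"
            unfolding restr_win_self by (simp add: norm_minus_commute)
          also have "\<dots> \<le> N (restr (win ?m) (B (x (f n)) - B z))" by (intro norm_le_N lp_finite_supp) simp
          also have "\<dots> \<le> e" using M[of n] by (simp add: n_def)
          finally show ?thesis by simp
        qed
        then have "norm (B z k - y k) \<le> 0" by (rule field_le_epsilon)
        then show ?thesis by simp
      qed
      then show ?thesis using z(1) by (intro bexI[of _ z]) auto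
    qed
    then show "y \<in> B ` lp p" by blast
  qed
qed

text \<open>Dually, many far-apart translates of an approximate kernel vector of \<open>B\<close> can be corrected, by
  little, to kernel vectors of finite sections of the band operator \<open>A'\<close>; there are too many of
  these to be independent, but they are almost disjointly supported.\<close>

lemma solvable_at_infinity_imp_limit_injective:
  assumes A: "band_dominated smul p A" and C: "C > 0"
    and sol: "\<And>W. finite W \<Longrightarrow> W \<inter> win n0 = {} \<Longrightarrow> solvable_on A W C"
    and h: "filterlim (\<lambda>n. \<bar>h n\<bar>) at_top sequentially" and L: "op_lim A h B"
    and x: "x \<in> lp p" "B x = 0"
  shows "x = 0"
proof (rule ccontr)
  assume x0: "x \<noteq> 0"
  have lA: "lin A" using A by (auto simp: band_dominated_def bounded_ops_iff)
  note q = band_dominated_quasilocal[OF A]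
  have lB: "lin B" using L by (simp add: op_lim_def)
  have Nx: "N x > 0" using N_pos x x0 by blast
  \<comment> \<open>The images \<open>A' (zs i)\<close> will have norm at most
    \<open>4 * \<epsilon> * N z\<close>, and solving on the window costs \<open>2 * C\<close>; this
    choice makes the correction \<open>u i\<close> at most \<open>N z / 4\<close>.\<close>
  define \<epsilon> where "\<epsilon> = 1 / (32 * C)"
  have \<epsilon>: "\<epsilon> > 0" "\<epsilon> * C = 1 / 32" using C by (auto simp: \<epsilon>_def)
  \<comment> \<open>The second term ensures \<open>N z \<ge> N x / 2\<close>, which converts a bound
    relative to \<open>N x\<close> into one relative to \<open>N z\<close>.\<close>
  let ?e = "min \<epsilon> (N x / 2)"
  have "?e > 0" using \<epsilon> Nx by simp
  then obtain m z where z: "z \<in> lp p" "supp z \<subseteq> win m" "N x - ?e \<le> N z" "N (B z) \<le> N (B x) + ?e * N x"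
    using truncate_almost_same_image[OF lB op_lim_quasilocal[OF lA q L] x(1)] by blast
  have zx: "N x / 2 \<le> N z" using z(3) by linarith
  then have Nz: "N z > 0" using Nx by linarith
  have "?e * N x \<le> \<epsilon> * (2 * N z)" using zx Nx \<epsilon>(1) by (intro mult_mono) auto
  then have Bz: "N (B z) \<le> 2 * \<epsilon> * N z" using z(4) x(2) by simp
  obtain A' w M where A': "banded A' w M" "bnd (A - A') \<epsilon>" using band_dominated_approx[OF A \<epsilon>(1)] by blast
  obtain CA' where lA': "lin A'" and CA': "bnd A' CA'" using A' by (auto simp: banded_def)
  have sol': "solvable_on A' W (2 * C)" if W: "finite W" "W \<inter> win n0 = {}" for W
  proof (rule solvable_onI[OF lA' CA'])
    fix y :: "int \<Rightarrow> 'a" assume y: "y \<in> lp p" "supp y \<subseteq> W"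
    then obtain s where s: "s \<in> lp p" "N s \<le> C * N y" "restr W (A s) = y"
      using sol[OF W] unfolding solvable_on_def by blast
    have d: "A s - A' s \<in> lp p" by (rule lp_diff[OF linD(1)[OF lA s(1)] linD(1)[OF lA' s(1)]])
    have "y - restr W (A' s) = restr W (A s - A' s)" unfolding s(3)[symmetric] by (auto simp: restr_def fun_eq_iff)
    then have "N (y - restr W (A' s)) \<le> N (A s - A' s)" using N_restr[OF d] by (simp only:)
    also have "\<dots> \<le> \<epsilon> * N s" using bndD[OF A'(2) s(1)] by simp
    also have "\<dots> \<le> \<epsilon> * (C * N y)" using s(2) \<epsilon>(1) by (intro mult_left_mono) auto
    also have "\<dots> = \<epsilon> * C * N y" by simp
    also have "\<dots> \<le> N y / 2" unfolding \<epsilon>(2) using N_nonneg[OF y(1)] by simp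
    finally show "\<exists>s\<in>lp p. N s \<le> C * N y \<and> N (y - restr W (A' s)) \<le> N y / 2" using s by blast
  qed (use C in simp)
  define K where "K = Suc ((2 * w + 1 + 2 * n0) * card bas)"
  \<comment> \<open>After the factor \<open>2 * C\<close> of solving and the sum over
    \<open>K\<close> translates, the second corrections \<open>v i\<close> still amount to at most
    \<open>N z / 4\<close>.\<close>
  define \<tau> where "\<tau> = 1 / (2 * C * (real K + 1))"
  have \<tau>: "\<tau> > 0" using C by (simp add: \<tau>_def)
  obtain D where D: "D > 0" "comm_small A' \<tau> D" using banded_comm[OF A'(1) \<tau>] by blast
  define l where "l = m + w + nat \<lceil>D\<rceil>"
  obtain n1 where n1: "\<And>n x. n \<ge> n1 \<Longrightarrow> x \<in> lp p \<Longrightarrow> N (shc (h n) A (restr (win m) x) - B (restr (win m) x)) \<le> \<epsilon> * N x"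
    using op_limD[OF L \<epsilon>(1), of m] by blast
  obtain g :: "nat \<Rightarrow> nat" where g: "\<And>i. g i \<ge> n1" "\<And>i j. i \<noteq> j \<Longrightarrow> \<bar>h (g i) - h (g j)\<bar> > int (2 * l)"
    using separated_subsequence[OF h, of n1 "int (2 * l)"] by blast
  define c where "c i = h (g i)" for i
  define zs where "zs i = shift (c i) z" for i
  have zs: "zs i \<in> lp p" "N (zs i) = N z" "supp (zs i) \<subseteq> {c i - int m..c i + int m}" for i
    using lp_shift[OF z(1)] N_shift[OF z(1)] supp_shift_win[OF z(2)] by (auto simp: zs_def)
  obtain R0 where R0: "(\<Union>i<K. {c i - int m..c i + int m}) \<subseteq> win R0"
    using finite_int_bound[of "\<Union>i<K. {c i - int m..c i + int m}"] by auto
  define R where "R = max R0 n0"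
  have "win R0 \<subseteq> win R" "win R \<subseteq> win (R + w)" by (auto simp: R_def)
  then have zsR: "{c i - int m..c i + int m} \<subseteq> win (R + w)" if "i < K" for i using R0 that by blast
  let ?W = "win R - win n0"
  have solW: "solvable_on A' ?W (2 * C)" by (rule sol') auto
  have A'z: "A' (zs i) \<in> lp p" "N (A' (zs i)) \<le> 4 * \<epsilon> * N z" for i
  proof -
    show l1: "A' (zs i) \<in> lp p" by (rule linD(1)[OF lA' zs(1)])
    have l2: "A (zs i) \<in> lp p" by (rule linD(1)[OF lA zs(1)])
    have "N (shc (c i) A z - B z) \<le> \<epsilon> * N z" using n1[OF g(1) z(1), of i] unfolding restr_id[OF z(2)] c_def[symmetric] .
    moreover have "N (shc (c i) A z) \<le> N (B z) + N (shc (c i) A z - B z)"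
      by (rule N_le_diff[OF linD(1)[OF lin_shc[OF lA] z(1)] linD(1)[OF lB z(1)]])
    moreover have "N (shc (c i) A z) = N (A (zs i))" unfolding shc_def comp_apply zs_def[symmetric] by (rule N_shift[OF l2])
    moreover have "N (A' (zs i)) \<le> N (A (zs i)) + N (A (zs i) - A' (zs i))"
      using N_le_diff[OF l1 l2] N_diff_commute[OF l1 l2] by simp
    moreover have "N (A (zs i) - A' (zs i)) \<le> \<epsilon> * N z" using bndD[OF A'(2) zs(1)[of i]] zs(2) by simp
    ultimately show "N (A' (zs i)) \<le> 4 * \<epsilon> * N z" using Bz by linarith
  qed
  define \<phi> where "\<phi> i = tent (real (m + w)) D (c i)" for i
  have "\<exists>u\<in>lp p. N u \<le> 2 * C * N (restr ?W (A' (zs i))) \<and> restr ?W (A' u) = restr ?W (A' (zs i))" for i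
    using solW lp_restr[OF A'z(1)[of i], of ?W] unfolding solvable_on_def by (simp add: supp_restr)
  then obtain u where u: "\<And>i. u i \<in> lp p" "\<And>i. N (u i) \<le> 2 * C * N (restr ?W (A' (zs i)))"
      "\<And>i. restr ?W (A' (u i)) = restr ?W (A' (zs i))" by metis
  have Nu: "N (u i) \<le> N z / 4" for i
  proof -
    have "N (restr ?W (A' (zs i))) \<le> 4 * \<epsilon> * N z" using N_restr[OF A'z(1), of ?W i] A'z(2)[of i] by linarith
    then have "2 * C * N (restr ?W (A' (zs i))) \<le> 2 * C * (4 * \<epsilon> * N z)" using C by (intro mult_left_mono) auto
    also have "\<dots> = 8 * (\<epsilon> * C) * N z" by simp
    finally show ?thesis using u(2)[of i] \<epsilon>(2) by simp
  qed
  \<comment> \<open>The correction \<open>u i\<close> may spread over the other translates, so it is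
    cut off near \<open>c i\<close>. The resulting commutator defect \<open>rr i\<close> is repaired
    by \<open>v i\<close>, which need not be localized: it is small enough to be summed over all
    translates.\<close>
  define u' where "u' i = cutoff (\<phi> i) (u i)" for i
  have u': "u' i \<in> lp p" "N (u' i) \<le> N z / 4" "supp (u' i) \<subseteq> {c i - int l..c i + int l}" for i
  proof -
    show "u' i \<in> lp p" unfolding u'_def \<phi>_def by (rule lp_tent[OF u(1)])
    show "N (u' i) \<le> N z / 4"
      unfolding u'_def \<phi>_def using N_tent[OF u(1), of "real (m + w)" D "c i" i] Nu[of i] by linarith
    show "supp (u' i) \<subseteq> {c i - int l..c i + int l}"
      unfolding u'_def \<phi>_def l_def by (rule supp_cut_tent[OF D(1)])
  qed
  define rr where "rr i = A' (u' i) - cutoff (\<phi> i) (A' (u i))" for i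
  have rl: "rr i \<in> lp p" for i
    unfolding rr_def \<phi>_def by (rule lp_diff[OF linD(1)[OF lA' u'(1)] lp_tent[OF linD(1)[OF lA' u(1)]]])
  have rN: "N (rr i) \<le> \<tau> * (N z / 4)" for i
  proof -
    have "N (rr i) \<le> \<tau> * N (u i)" unfolding rr_def u'_def \<phi>_def by (rule comm_small_tent[OF D(2,1) u(1)])
    also have "\<dots> \<le> \<tau> * (N z / 4)" using Nu \<tau> by (intro mult_left_mono) auto
    finally show ?thesis .
  qed
  have rv: "restr ?W (A' (u' i)) = restr ?W (A' (zs i)) + restr ?W (rr i)" for i
  proof -
    have "supp (A' (zs i)) \<subseteq> {c i - int (m + w)..c i + int (m + w)}"
      using banded_supp[OF A'(1) zs(1,3)] by (simp add: algebra_simps)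
    then have "cutoff (\<phi> i) (A' (zs i)) = A' (zs i)"
      unfolding \<phi>_def using tent_on_interval[OF D(1), of _ "c i" "m + w"] by (intro cut_one) blast
    then have "restr ?W (A' (zs i)) = cutoff (\<phi> i) (restr ?W (A' (u i)))"
      unfolding u(3) by (auto simp: restr_def cutoff_def fun_eq_iff)
    then show ?thesis by (auto simp: rr_def restr_def cutoff_def fun_eq_iff)
  qed
  have "\<exists>v\<in>lp p. N v \<le> 2 * C * N (- restr ?W (rr i)) \<and> restr ?W (A' v) = - restr ?W (rr i)" for i
  proof -
    have "supp (- restr ?W (rr i)) \<subseteq> ?W" by (auto simp: supp_def restr_def)
    then show ?thesis using solW lp_uminus[OF lp_restr[OF rl[of i], of ?W]] unfolding solvable_on_def by blast
  qed
  then obtain v where v: "\<And>i. v i \<in> lp p" "\<And>i. N (v i) \<le> 2 * C * N (- restr ?W (rr i))"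
      "\<And>i. restr ?W (A' (v i)) = - restr ?W (rr i)" by metis
  have Nv: "N (v i) \<le> N z / (4 * (real K + 1))" for i
  proof -
    have "N (- restr ?W (rr i)) \<le> \<tau> * (N z / 4)"
      using N_uminus[OF lp_restr[OF rl], of ?W i] N_restr[OF rl, of ?W i] rN[of i] by linarith
    then have "2 * C * N (- restr ?W (rr i)) \<le> 2 * C * (\<tau> * (N z / 4))" using C by (intro mult_left_mono) auto
    also have "\<dots> = (2 * C * \<tau>) * (N z / 4)" by simp
    also have "2 * C * \<tau> = 1 / (real K + 1)" using C by (simp add: \<tau>_def)
    also have "1 / (real K + 1) * (N z / 4) = N z / (4 * (real K + 1))" by (simp add: mult.commute)
    finally show ?thesis using v(2)[of i] by linarith
  qed
  \<comment> \<open>Restriction to \<open>win (R + w)\<close> puts the corrected sequences into the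
    space of the dimension count; the margin \<open>w\<close> leaves their images on
    \<open>?W\<close> intact.\<close>
  define \<zeta> where "\<zeta> i = restr (win (R + w)) (zs i - u' i - v i)" for i
  have tl: "zs i - u' i - v i \<in> lp p" for i by (intro lp_diff zs u' v)
  have "restr ?W (A' (\<zeta> i)) = 0" for i
  proof -
    have "restr ?W (A' (\<zeta> i)) = restr ?W (A' (zs i - u' i - v i))"
      unfolding \<zeta>_def by (rule banded_restr[OF A'(1) tl]) auto
    also have "A' (zs i - u' i - v i) = A' (zs i) - A' (u' i) - A' (v i)"
      using lin_diff[OF lA' lp_diff[OF zs(1) u'(1)] v(1)] lin_diff[OF lA' zs(1) u'(1)] by simp
    also have "restr ?W \<dots> = restr ?W (A' (zs i)) - restr ?W (A' (u' i)) - restr ?W (A' (v i))"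
      by (auto simp: restr_def fun_eq_iff)
    also have "\<dots> = 0" unfolding rv v(3) by simp
    finally show ?thesis .
  qed
  then obtain d j where j: "j < K" "d j = 1" "\<And>i. i < K \<Longrightarrow> norm (d i) \<le> 1" "(\<Sum>i<K. S (d i) (\<zeta> i)) = 0"
    using kernel_family_dependent[OF A'(1) solW, of K \<zeta>] lp_restr[OF tl]
    by (auto simp: K_def R_def \<zeta>_def supp_restr simp del: atLeastAtMost_iff)
  let ?I = "{c j - int m..c j + int m}"
  have Isub: "?I \<subseteq> win (R + w)" by (rule zsR[OF j(1)])
  have other: "restr ?I (zs i - u' i) = 0" if "i \<noteq> j" for i
  proof
    fix k
    have "zs i k = 0 \<and> u' i k = 0" if "k \<in> ?I"
    proof -
      have "\<bar>c i - c j\<bar> > 2 * int l" using g(2)[OF \<open>i \<noteq> j\<close>] by (simp add: c_def)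
      moreover have "int m \<le> int l" by (simp add: l_def)
      ultimately have "k \<notin> {c i - int l..c i + int l}" using that unfolding atLeastAtMost_iff by linarith
      moreover have "{c i - int m..c i + int m} \<subseteq> {c i - int l..c i + int l}"
      proof -
        have "int m \<le> int l" by (simp add: l_def)
        then show ?thesis by auto
      qed
      ultimately have "k \<notin> supp (zs i)" "k \<notin> supp (u' i)" using zs(3)[of i] u'(3)[of i] by blast+
      then show ?thesis by (simp add: supp_def)
    qed
    then show "restr ?I (zs i - u' i) k = 0 k" by (simp add: restr_def)
  qed
  have "restr ?I (S (d i) (\<zeta> i)) = (if i = j then zs j - restr ?I (u' j) else 0) - S (d i) (restr ?I (v i))" for i
  proof -
    have "restr ?I (S (d i) (\<zeta> i)) = S (d i) (restr ?I (zs i - u' i)) - S (d i) (restr ?I (v i))"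
    proof
      fix k
      have "k \<in> ?I \<Longrightarrow> k \<in> win (R + w)" using Isub by blast
      then show "restr ?I (S (d i) (\<zeta> i)) k = (S (d i) (restr ?I (zs i - u' i)) - S (d i) (restr ?I (v i))) k"
        by (simp add: restr_def \<zeta>_def seq_scale_def scale_right_diff_distrib del: atLeastAtMost_iff)
    qed
    moreover have "S (d j) (restr ?I (zs j - u' j)) = zs j - restr ?I (u' j)"
    proof -
      have "restr ?I (zs j - u' j) = restr ?I (zs j) - restr ?I (u' j)" by (auto simp: restr_def fun_eq_iff)
      then show ?thesis unfolding j(2) seq_scale_simps(2) restr_id[OF zs(3)] .
    qed
    ultimately show ?thesis using other by (auto simp: seq_scale_simps)
  qed
  then have "(\<Sum>i<K. restr ?I (S (d i) (\<zeta> i)))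
      = (\<Sum>i<K. if i = j then zs j - restr ?I (u' j) else 0) - (\<Sum>i<K. S (d i) (restr ?I (v i)))"
    by (simp add: sum_subtractf)
  also have "(\<Sum>i<K. if i = j then zs j - restr ?I (u' j) else 0) = zs j - restr ?I (u' j)"
    using j(1) by (simp add: sum.delta)
  also have "(\<Sum>i<K. restr ?I (S (d i) (\<zeta> i))) = restr ?I (\<Sum>i<K. S (d i) (\<zeta> i))"
    by (rule lin_sum[OF lin_restr, symmetric]) (auto simp: \<zeta>_def intro: lp_seq_scale lp_restr tl)
  also have "\<dots> = 0" unfolding j(4) by (auto simp: restr_def fun_eq_iff)
  finally have "0 = zs j - restr ?I (u' j) - (\<Sum>i<K. S (d i) (restr ?I (v i)))" .
  \<comment> \<open>On the interval of the translate \<open>j\<close> the dependence relation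
    expresses \<open>zs j\<close> by its own correction and by the small terms \<open>v i\<close>,
    each group of norm at most \<open>N z / 4\<close>, which is impossible for
    \<open>N z > 0\<close>.\<close>
  then have "zs j = restr ?I (u' j) + (\<Sum>i<K. S (d i) (restr ?I (v i)))" by (rule eq_add_of_zero_eq_diff)
  then have "N z \<le> N (restr ?I (u' j)) + N (\<Sum>i<K. S (d i) (restr ?I (v i)))"
    using N_triangle[OF lp_restr[OF u'(1)] lp_sum[of "{..<K}" "\<lambda>i. S (d i) (restr ?I (v i))"], of ?I j] zs(2)[of j]
      lp_seq_scale[OF lp_restr[OF v(1)]] by simp
  also have "N (restr ?I (u' j)) \<le> N z / 4" using N_restr[OF u'(1), of ?I j] u'(2)[of j] by linarith
  also have "N (\<Sum>i<K. S (d i) (restr ?I (v i))) \<le> (\<Sum>i<K. N (S (d i) (restr ?I (v i))))"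
    by (rule N_sum) (intro lp_seq_scale lp_restr v)
  also have "\<dots> \<le> (\<Sum>i<K. N z / (4 * (real K + 1)))"
  proof (rule sum_mono)
    fix i assume i: "i \<in> {..<K}"
    have "N (S (d i) (restr ?I (v i))) = norm (d i) * N (restr ?I (v i))" by (rule N_seq_scale[OF lp_restr[OF v(1)]])
    also have "\<dots> \<le> 1 * N (v i)" using j(3) i N_restr[OF v(1)] N_nonneg[OF lp_restr[OF v(1)]] by (intro mult_mono) auto
    finally show "N (S (d i) (restr ?I (v i))) \<le> N z / (4 * (real K + 1))" using Nv[of i] by simp
  qed
  also have "\<dots> = real K / (real K + 1) * (N z / 4)" by simp
  also have "\<dots> \<le> 1 * (N z / 4)" using Nz by (intro mult_right_mono) auto
  finally show False using Nz by simp
qed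

end

section \<open>Fredholm operators\<close>

context lp_space
begin

lemma vector_space_seq: "vector_space S"
  by unfold_locales (auto simp: seq_scale_def fun_eq_iff scale_right_distrib scale_left_distrib)

lemma linear_restr: "Vector_Spaces.linear S S (restr W :: (int \<Rightarrow> 'a) \<Rightarrow> int \<Rightarrow> 'a)"
proof -
  interpret V: vector_space S by (rule vector_space_seq)
  show ?thesis
    unfolding Vector_Spaces.linear_iff
    using V.vector_space_axioms by (auto simp: restr_def seq_scale_def fun_eq_iff)
qed

definition norm_closed :: "(int \<Rightarrow> 'a) set \<Rightarrow> bool" where
  "norm_closed M \<longleftrightarrow> M \<subseteq> lp p \<and> (\<forall>y\<in>lp p. (\<forall>e>0. \<exists>s\<in>M. N (s - y) \<le> e) \<longrightarrow> y \<in> M)"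

lemma norm_closed_imp_closedin:
  assumes M: "norm_closed M"
  shows "closedin (Metric_space.mtopology (lp p) (lp_dist p)) M"
proof -
  interpret M: Metric_space "lp p :: (int \<Rightarrow> 'a) set" "lp_dist p" by (rule Metric_space_lp)
  show ?thesis unfolding M.metric_closedin_iff_sequentially_closed
  proof (intro conjI allI impI)
    show "M \<subseteq> lp p" using M by (simp add: norm_closed_def)
    fix s l assume a: "range s \<subseteq> M \<and> limitin M.mtopology s l sequentially"
    then have l: "l \<in> lp p" and lim: "\<And>e. e > 0 \<Longrightarrow> \<exists>n0. \<forall>n\<ge>n0. s n \<in> lp p \<and> lp_dist p (s n) l < e"
      unfolding M.limit_metric_sequentially by blast+
    have "\<exists>x\<in>M. N (x - l) \<le> e" if e: "e > 0" for e
    proof -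
      obtain n where "s n \<in> lp p" "lp_dist p (s n) l < e" using lim[OF e] by blast
      then have "N (s n - l) \<le> e" using l by (simp add: lp_dist_def)
      then show ?thesis using a by (intro bexI[of _ "s n"]) auto
    qed
    then show "l \<in> M" using M l unfolding norm_closed_def by blast
  qed
qed

definition subsp :: "(int \<Rightarrow> 'a) set \<Rightarrow> bool" where
  "subsp M \<longleftrightarrow> M \<subseteq> lp p \<and> 0 \<in> M \<and> (\<forall>x\<in>M. \<forall>y\<in>M. x + y \<in> M) \<and> (\<forall>c. \<forall>x\<in>M. S c x \<in> M)"

text \<open>If \<open>f\<close> is not in \<open>M\<close>, a positive lower bound \<eta> for its
  distance to \<open>M\<close> controls coefficients:
  \<open>norm c * \<eta> \<le> N (s + S c f)\<close>. Along approximants of a point the coefficients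
  are therefore Cauchy, and the point splits accordingly.\<close>

lemma norm_closed_add_line:
  assumes M: "norm_closed M" "subsp M" and f: "f \<in> lp p"
  shows "norm_closed {s + S c f |s c. s \<in> M} \<and> subsp {s + S c f |s c. s \<in> M}"
proof
  interpret V: vector_space S by (rule vector_space_seq)
  let ?M = "{s + S c f |s c. s \<in> M}"
  have Mlp: "M \<subseteq> lp p" using M by (simp add: norm_closed_def)
  have sub: "?M \<subseteq> lp p" using Mlp f by (auto intro!: lp_add lp_seq_scale)
  show "subsp ?M" unfolding subsp_def
  proof (intro conjI ballI allI)
    show "?M \<subseteq> lp p" by (rule sub)
    show "0 \<in> ?M" using M(2) by (auto simp: subsp_def intro!: exI[of _ 0])
  next
    fix x y assume "x \<in> ?M" "y \<in> ?M"
    then obtain s c s' c' where e: "x = s + S c f" "y = s' + S c' f" "s \<in> M" "s' \<in> M" by blast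
    have "x + y = (s + s') + S (c + c') f" unfolding e V.scale_left_distrib by (simp only: ac_simps)
    moreover have "s + s' \<in> M" using M(2) e by (simp add: subsp_def)
    ultimately show "x + y \<in> ?M" by blast
  next
    fix a x assume "x \<in> ?M"
    then obtain s c where e: "x = s + S c f" "s \<in> M" by blast
    have "S a x = S a s + S (a * c) f" unfolding e V.scale_right_distrib by simp
    moreover have "S a s \<in> M" using M(2) e by (simp add: subsp_def)
    ultimately show "S a x \<in> ?M" by blast
  qed
  show "norm_closed ?M"
  proof (cases "f \<in> M")
    case True
    have "?M = M"
    proof
      show "?M \<subseteq> M" using M(2) True by (auto simp: subsp_def)
      show "M \<subseteq> ?M"
      proof
        fix x assume "x \<in> M"
        moreover have "x = x + S 0 f" by simp
        ultimately show "x \<in> ?M" by blast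
      qed
    qed
    then show ?thesis using M(1) by simp
  next
    case False
    then obtain \<eta> where \<eta>: "\<eta> > 0" "\<And>s. s \<in> M \<Longrightarrow> \<eta> < N (s - f)"
      using M(1) f unfolding norm_closed_def by (meson not_le)
    have dist: "norm c * \<eta> \<le> N (s + S c f)" if s: "s \<in> M" for s c
    proof (cases "c = 0")
      case True
      have "s \<in> lp p" using s Mlp by blast
      then have "0 \<le> N s" by (rule N_nonneg)
      then show ?thesis unfolding True V.scale_zero_left by simp
    next
      case c: False
      have m: "S (- (1 / c)) s \<in> M" using M(2) s unfolding subsp_def by blast
      have d: "S (- (1 / c)) s - f \<in> lp p" using m Mlp f by (intro lp_diff) auto
      have "s + S c f = S (- c) (S (- (1 / c)) s - f)"
        using c by (simp add: V.scale_right_diff_distrib)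
      then have "N (s + S c f) = norm c * N (S (- (1 / c)) s - f)"
        by (simp only: N_seq_scale[OF d] norm_minus_cancel)
      then show ?thesis using \<eta>(2)[OF m] by (simp add: mult_left_mono)
    qed
    show ?thesis unfolding norm_closed_def
    proof (intro conjI ballI impI)
      show "?M \<subseteq> lp p" by (rule sub)
      fix y :: "int \<Rightarrow> 'a" assume y: "y \<in> lp p" and ap: "\<forall>e>0. \<exists>s\<in>?M. N (s - y) \<le> e"
      have "\<exists>s c. s \<in> M \<and> N (s + S c f - y) \<le> 1 / (real n + 1)" for n :: nat
        using ap[rule_format, of "1 / (real n + 1)"] by auto
      then obtain s c where sc: "\<And>n. s n \<in> M" "\<And>n. N (s n + S (c n) f - y) \<le> 1 / (real n + 1)" for n :: nat by metis
      have sl: "s n \<in> lp p" for n using sc(1) Mlp by blast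
      have scl: "s n + S (c n) f \<in> lp p" for n by (intro lp_add lp_seq_scale sl f)
      have Cdiff: "norm (c m - c n) * \<eta> \<le> 1 / (real m + 1) + 1 / (real n + 1)" for m n
      proof -
        have "s m - s n = s m + S (- 1) (s n)" by (simp add: seq_scale_minus_one)
        moreover have "s m + S (- 1) (s n) \<in> M" using M(2) sc(1) unfolding subsp_def by blast
        ultimately have "s m - s n \<in> M" by (simp only:)
        then have "norm (c m - c n) * \<eta> \<le> N ((s m - s n) + S (c m - c n) f)" by (rule dist)
        also have "(s m - s n) + S (c m - c n) f = (s m + S (c m) f - y) - (s n + S (c n) f - y)"
          unfolding V.scale_left_diff_distrib by (simp add: algebra_simps)
        also have "N \<dots> \<le> N (s m + S (c m) f - y) + N (s n + S (c n) f - y)"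
          by (rule N_diff[OF lp_diff[OF scl y] lp_diff[OF scl y]])
        finally show ?thesis using sc(2)[of m] sc(2)[of n] by linarith
      qed
      have lim0: "(\<lambda>n. 1 / (real n + 1)) \<longlonglongrightarrow> 0"
        using LIMSEQ_inverse_real_of_nat by (simp add: inverse_eq_divide add.commute)
      have "Cauchy c"
      proof (rule metric_CauchyI)
        fix e :: real assume e: "e > 0"
        obtain n0 where n0: "\<And>n. n \<ge> n0 \<Longrightarrow> 1 / (real n + 1) < e * \<eta> / 2"
          using order_tendstoD(2)[OF lim0, of "e * \<eta> / 2"] e \<eta>(1) by (auto simp: eventually_sequentially)
        have "dist (c m) (c n) < e" if "m \<ge> n0" "n \<ge> n0" for m n
        proof -
          have "norm (c m - c n) * \<eta> < e * \<eta>" using Cdiff[of m n] n0[OF that(1)] n0[OF that(2)] by linarith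
          then show ?thesis using \<eta>(1) by (simp add: dist_norm)
        qed
        then show "\<exists>M. \<forall>m\<ge>M. \<forall>n\<ge>M. dist (c m) (c n) < e" by blast
      qed
      then obtain l where l: "c \<longlonglongrightarrow> l" by (auto simp: Cauchy_convergent_iff convergent_def)
      have yl: "y - S l f \<in> lp p" by (intro lp_diff lp_seq_scale y f)
      have "\<exists>x\<in>M. N (x - (y - S l f)) \<le> e" if e: "e > 0" for e
      proof -
        have "(\<lambda>n. 1 / (real n + 1) + norm (c n - l) * N f) \<longlonglongrightarrow> 0 + norm (l - l) * N f"
          by (intro tendsto_intros lim0 l)
        then obtain n where n: "1 / (real n + 1) + norm (c n - l) * N f < e"
          using order_tendstoD(2)[of _ "0::real" sequentially e] e by (force simp: eventually_sequentially)
        have "s n - (y - S l f) = (s n + S (c n) f - y) - S (c n - l) f"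
          unfolding V.scale_left_diff_distrib by (simp add: algebra_simps)
        then have "N (s n - (y - S l f)) \<le> N (s n + S (c n) f - y) + N (S (c n - l) f)"
          using N_diff[OF lp_diff[OF scl y] lp_seq_scale[OF f]] by (simp only:)
        then have "N (s n - (y - S l f)) \<le> e" using sc(2)[of n] n N_seq_scale[OF f] by simp
        then show ?thesis using sc(1) by blast
      qed
      then have "y - S l f \<in> M" using M(1) yl unfolding norm_closed_def by blast
      moreover have "y = (y - S l f) + S l f" by simp
      ultimately show "y \<in> ?M" by blast
    qed
  qed
qed

lemma norm_closed_add_span:
  assumes M: "norm_closed M" "subsp M" and F: "finite F" "\<And>i. i \<in> F \<Longrightarrow> f i \<in> lp p"
  shows "norm_closed {s + (\<Sum>i\<in>F. S (c i) (f i)) |s c. s \<in> M} \<and> subsp {s + (\<Sum>i\<in>F. S (c i) (f i)) |s c. s \<in> M}"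
  using F
proof (induction F)
  case empty
  then show ?case using M by simp
next
  case (insert a F)
  let ?M = "{s + (\<Sum>i\<in>F. S (c i) (f i)) |s c. s \<in> M}"
  let ?M' = "{s + (\<Sum>i\<in>insert a F. S (c i) (f i)) |s c. s \<in> M}"
  have IH: "norm_closed ?M" "subsp ?M" using insert by auto
  have "?M' = {s + S d (f a) |s d. s \<in> ?M}"
  proof
    show "?M' \<subseteq> {s + S d (f a) |s d. s \<in> ?M}"
    proof
      fix x assume "x \<in> ?M'"
      then obtain s c where x: "x = s + (\<Sum>i\<in>insert a F. S (c i) (f i))" "s \<in> M" by blast
      have "x = (s + (\<Sum>i\<in>F. S (c i) (f i))) + S (c a) (f a)"
        unfolding x sum.insert[OF insert(1,2)] by (simp only: ac_simps)
      then show "x \<in> {s + S d (f a) |s d. s \<in> ?M}" using x(2) by blast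
    qed
    show "{s + S d (f a) |s d. s \<in> ?M} \<subseteq> ?M'"
    proof
      fix x assume "x \<in> {s + S d (f a) |s d. s \<in> ?M}"
      then obtain s c d where x: "x = (s + (\<Sum>i\<in>F. S (c i) (f i))) + S d (f a)" "s \<in> M" by blast
      have "(\<Sum>i\<in>F. S ((c(a := d)) i) (f i)) = (\<Sum>i\<in>F. S (c i) (f i))"
        using insert(2) by (intro sum.cong) auto
      then have "x = s + (\<Sum>i\<in>insert a F. S ((c(a := d)) i) (f i))"
        unfolding x sum.insert[OF insert(1,2)] by (simp add: ac_simps)
      then show "x \<in> ?M'" using x(2) by blast
    qed
  qed
  then show ?case using norm_closed_add_line[OF IH, of "f a"] insert.prems by simp
qed

end

context lp_space_fin
begin

definition singles :: "nat \<Rightarrow> (int \<Rightarrow> 'a) set" where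
  "singles n = (\<lambda>i. single (fst i) (snd i)) ` (win n \<times> bas)"

lemma finite_singles: "finite (singles n)" using bas(1) by (simp add: singles_def)

lemma singles_lp: "singles n \<subseteq> lp p" by (auto simp: singles_def lp_single)

lemma singles_mem: "j \<in> win n \<Longrightarrow> b \<in> bas \<Longrightarrow> single j b \<in> singles n"
  unfolding singles_def by (rule image_eqI[of _ _ "(j, b)"]) auto

lemma restr_win_in_span: "restr (win n) x \<in> module.span S (singles n)"
proof -
  interpret V: vector_space S by (rule vector_space_seq)
  show ?thesis unfolding win_decomp
    by (intro V.span_sum V.span_scale V.span_base singles_mem)
qed

text \<open>A kernel element vanishing on \<open>win n\<close> is zero by the lower bound, so
  restriction embeds the kernel into the finite-dimensional space of sequences on the
  window.\<close>

lemma below_at_infinity_imp_fin_dim_kernel: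
  assumes A: "lin A" and low: "below_at_infinity A n \<nu>" "\<nu> > 0"
  shows "fin_dim S {x \<in> lp p. A x = 0}"
proof -
  interpret V: vector_space S by (rule vector_space_seq)
  interpret R: Vector_Spaces.linear S S "restr (win n) :: (int \<Rightarrow> 'a) \<Rightarrow> int \<Rightarrow> 'a" by (rule linear_restr)
  let ?K = "{x \<in> lp p. A x = 0}"
  have sub: "V.subspace ?K"
    unfolding V.subspace_def using linD[OF A] lin_zero[OF A] by (auto intro: lp_add lp_seq_scale)
  obtain F where F: "F \<subseteq> ?K" "V.independent F" "?K \<subseteq> V.span F"
    using V.maximal_independent_subset[of ?K] by blast
  have span: "V.span F = ?K" using F(3) V.span_minimal[OF F(1) sub] by blast
  have inj: "inj_on (restr (win n)) ?K"
  proof (rule inj_onI)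
    fix x y assume x: "x \<in> ?K" and y: "y \<in> ?K" and e: "restr (win n) x = restr (win n) y"
    have d: "x - y \<in> lp p" using x y lp_diff by blast
    have "supp (x - y) \<inter> win n = {}"
    proof -
      have "x k = y k" if "k \<in> win n" for k using fun_cong[OF e, of k] that by (simp add: restr_def)
      then show ?thesis by (auto simp: supp_def)
    qed
    then have "\<nu> * N (x - y) \<le> N (A (x - y))" using low(1) d unfolding below_at_infinity_def by blast
    also have "A (x - y) = 0" using lin_diff[OF A, of x y] x y by simp
    finally have "N (x - y) \<le> 0" using low(2) by (simp add: mult_le_0_iff)
    then have "x - y = 0" using N_pos[OF d] by fastforce
    then show "x = y" by simp
  qed
  have "V.independent (restr (win n) ` F)"
    by (rule R.independent_injective_image[OF F(2)]) (use inj span in simp)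
  moreover have "restr (win n) ` F \<subseteq> V.span (singles n)" using restr_win_in_span by blast
  ultimately have "finite (restr (win n) ` F)" using V.independent_span_bound[OF finite_singles] by blast
  moreover have "inj_on (restr (win n)) F" using inj_on_subset[OF inj F(1)] .
  ultimately have "finite F" by (rule finite_imageD)
  then show ?thesis unfolding fin_dim_def using span by blast
qed

text \<open>The images of sequences supported off \<open>win n\<close> form a closed subspace by the
  lower bound. The full range exceeds it by finitely many directions, the images of the unit vectors
  on the window.\<close>

lemma below_at_infinity_imp_closed_range:
  assumes A: "lin A" "bnd A C" and low: "below_at_infinity A n \<nu>" "\<nu> > 0"
  shows "norm_closed (A ` lp p)"
proof -
  let ?M = "A ` {x \<in> lp p. supp x \<subseteq> - win n}"
  have cl: "norm_closed ?M" unfolding norm_closed_def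
  proof (intro conjI ballI impI)
    show "?M \<subseteq> lp p" using linD(1)[OF A(1)] by blast
    fix y :: "int \<Rightarrow> 'a" assume y: "y \<in> lp p" "\<forall>e>0. \<exists>s\<in>?M. N (s - y) \<le> e"
    have "\<exists>x\<in>lp p. supp x \<subseteq> - win n \<and> A x = y"
    proof (rule range_closed_below[OF A low(2) _ y(1)])
      show "\<nu> * N x \<le> N (A x)" if "x \<in> lp p" "supp x \<subseteq> - win n" for x
        using low(1) that unfolding below_at_infinity_def by blast
      show "\<exists>x\<in>lp p. supp x \<subseteq> - win n \<and> N (A x - y) \<le> e" if "e > 0" for e
        using y(2) that by blast
    qed
    then show "y \<in> ?M" by blast
  qed
  have sub: "subsp ?M" unfolding subsp_def
  proof (intro conjI ballI allI)
    show "?M \<subseteq> lp p" using linD(1)[OF A(1)] by blast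
    have "(0 :: int \<Rightarrow> 'a) \<in> {x \<in> lp p. supp x \<subseteq> - win n}" by (simp add: supp_def)
    then have "A 0 \<in> ?M" by (rule imageI)
    then show "0 \<in> ?M" unfolding lin_zero[OF A(1)] .
  next
    fix x y assume "x \<in> ?M" "y \<in> ?M"
    then obtain u v where uv: "x = A u" "y = A v" "u \<in> lp p" "v \<in> lp p" "supp u \<subseteq> - win n" "supp v \<subseteq> - win n" by blast
    have "supp (u + v) \<subseteq> supp u \<union> supp v" by (auto simp: supp_def)
    then have "u + v \<in> {x \<in> lp p. supp x \<subseteq> - win n}" using uv lp_add by blast
    then show "x + y \<in> ?M" unfolding uv(1,2) linD(2)[OF A(1) uv(3,4), symmetric] by (rule imageI)
  next
    fix c x assume "x \<in> ?M"
    then obtain u where u: "x = A u" "u \<in> lp p" "supp u \<subseteq> - win n" by blast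
    have "supp (S c u) \<subseteq> supp u" by (auto simp: supp_def seq_scale_def)
    then have "S c u \<in> {x \<in> lp p. supp x \<subseteq> - win n}" using u lp_seq_scale by blast
    then show "S c x \<in> ?M" unfolding u(1) linD(3)[OF A(1) u(2), symmetric] by (rule imageI)
  qed
  let ?f = "\<lambda>i. A (single (fst i) (snd i))"
  have "A ` lp p = {s + (\<Sum>i\<in>win n \<times> bas. S (c i) (?f i)) |s c. s \<in> ?M}"
  proof
    show "A ` lp p \<subseteq> {s + (\<Sum>i\<in>win n \<times> bas. S (c i) (?f i)) |s c. s \<in> ?M}"
    proof
      fix y assume "y \<in> A ` lp p"
      then obtain x where x: "x \<in> lp p" "y = A x" by blast
      have l: "restr (win n) x \<in> lp p" "restr (- win n) x \<in> lp p" using x lp_restr by blast+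
      have "A (restr (win n) x) = (\<Sum>i\<in>win n \<times> bas. S (coef (x (fst i)) (snd i)) (?f i))"
        by (rule ext) (simp add: lin_win_apply[OF A(1)] sum_apply seq_scale_def sum.cartesian_product case_prod_unfold)
      then have "y = A (restr (- win n) x) + (\<Sum>i\<in>win n \<times> bas. S (coef (x (fst i)) (snd i)) (?f i))"
        using x linD(2)[OF A(1) l(2,1)] restr_split[of x "win n"] by (simp add: add.commute)
      moreover have "A (restr (- win n) x) \<in> ?M" using l(2) by (auto simp: supp_restr)
      ultimately show "y \<in> {s + (\<Sum>i\<in>win n \<times> bas. S (c i) (?f i)) |s c. s \<in> ?M}"
        unfolding mem_Collect_eq
        by (intro exI[of _ "A (restr (- win n) x)"] exI[of _ "\<lambda>i. coef (x (fst i)) (snd i)"] conjI)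
    qed
    show "{s + (\<Sum>i\<in>win n \<times> bas. S (c i) (?f i)) |s c. s \<in> ?M} \<subseteq> A ` lp p"
    proof
      fix y assume "y \<in> {s + (\<Sum>i\<in>win n \<times> bas. S (c i) (?f i)) |s c. s \<in> ?M}"
      then obtain u c where u: "u \<in> lp p" and y: "y = A u + (\<Sum>i\<in>win n \<times> bas. S (c i) (?f i))" by blast
      let ?v = "\<Sum>i\<in>win n \<times> bas. S (c i) (single (fst i) (snd i))"
      have v: "?v \<in> lp p" by (intro lp_sum lp_seq_scale lp_single)
      have "A ?v = (\<Sum>i\<in>win n \<times> bas. A (S (c i) (single (fst i) (snd i))))"
        by (rule lin_sum[OF A(1)]) (intro lp_seq_scale lp_single)
      also have "\<dots> = (\<Sum>i\<in>win n \<times> bas. S (c i) (?f i))" by (simp add: linD(3)[OF A(1) lp_single(1)])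
      finally have "y = A (u + ?v)" using y linD(2)[OF A(1) u v] by simp
      then show "y \<in> A ` lp p" using lp_add[OF u v] by blast
    qed
  qed
  moreover have "norm_closed {s + (\<Sum>i\<in>win n \<times> bas. S (c i) (?f i)) |s c. s \<in> ?M}"
    by (rule conjunct1[OF norm_closed_add_span[OF cl sub]]) (use bas(1) linD(1)[OF A(1) lp_single(1)] in auto)
  ultimately show ?thesis by simp
qed

text \<open>\<open>solvable_on\<close> leaves \<open>A x\<close> free off \<open>?W\<close>. A
  cutoff supported in \<open>?W\<close> and equal to one on the support of \<open>y\<close> turns
  \<open>x\<close> into an approximate solution on the whole line; gaps of at least \<open>D\<close>
  between that support and the boundary of \<open>?W\<close> make room for its slopes.\<close>

lemma solve_finite_support:
  assumes A: "lin A" "comm_small A e D" and D: "D > 0"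
    and sol: "\<And>W. finite W \<Longrightarrow> W \<inter> win n = {} \<Longrightarrow> solvable_on A W C" and C: "C > 0" "e * C \<le> 1/4" "e \<ge> 0"
    and y: "y \<in> lp p" "supp y \<subseteq> win m - win (n + nat \<lceil>D\<rceil>)"
  shows "\<exists>x\<in>lp p. N x \<le> C * N y \<and> N (y - A x) \<le> N y / 4"
proof -
  let ?R = "m + nat \<lceil>D\<rceil>"
  let ?W = "win ?R - win n"
  have "solvable_on A ?W C" by (rule sol) auto
  moreover have "supp y \<subseteq> ?W"
  proof -
    have "win m \<subseteq> win ?R" "win n \<subseteq> win (n + nat \<lceil>D\<rceil>)" by auto
    then show ?thesis using y(2) by blast
  qed
  ultimately obtain x where x: "x \<in> lp p" "N x \<le> C * N y" "restr ?W (A x) = y"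
    using y(1) unfolding solvable_on_def by blast
  \<comment> \<open>Zero on \<open>win n\<close>, rising to one on the support of \<open>y\<close>,
    and zero again beyond \<open>m + D\<close>; a minimum of functions of slope at most
    \<open>1 / D\<close> has slope at most \<open>1 / D\<close>.\<close>
  define \<phi> where "\<phi> k = min (tent (real m) D 0 k) (1 - tent (real n) D 0 k)" for k
  have range: "0 \<le> \<phi> k \<and> \<phi> k \<le> 1" for k
    using tent_range[of "real m" D 0 k] tent_range[of "real n" D 0 k] unfolding \<phi>_def by (simp add: min_def)
  then have a1: "\<bar>\<phi> k\<bar> \<le> 1" for k by (simp add: abs_le_iff)
  have slope: "\<bar>\<phi> k - \<phi> l\<bar> \<le> \<bar>real_of_int (k - l)\<bar> / D" for k l
    using tent_slope[OF D, of "real m" 0 k l] tent_slope[OF D, of "real n" 0 k l] unfolding \<phi>_def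
    by (auto simp: min_def abs_le_iff)
  have supphi: "k \<in> ?W" if "\<phi> k \<noteq> 0" for k
  proof -
    have "k \<in> win ?R"
    proof (rule ccontr)
      assume "k \<notin> win ?R"
      then have "tent (real m) D 0 k = 0" by (intro tent_off_interval[OF D]) simp
      then show False using that tent_range[of "real n" D 0 k] unfolding \<phi>_def by simp
    qed
    moreover have "k \<notin> win n"
    proof
      assume "k \<in> win n"
      then have "tent (real n) D 0 k = 1" by (intro tent_on_interval[OF D]) simp
      then show False using that tent_range[of "real m" D 0 k] unfolding \<phi>_def by simp
    qed
    ultimately show ?thesis by blast
  qed
  have one: "\<phi> k = 1" if "k \<in> supp y" for k
  proof -
    have k: "k \<in> win m" "k \<notin> win (n + nat \<lceil>D\<rceil>)" using that y(2) by blast+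
    have "tent (real m) D 0 k = 1" using tent_on_interval[OF D, of k 0 m] k(1) by simp
    moreover have "tent (real n) D 0 k = 0" by (rule tent_off_interval[OF D]) (use k(2) in simp)
    ultimately show ?thesis by (simp add: \<phi>_def)
  qed
  have "cutoff \<phi> (A x) = cutoff \<phi> (restr ?W (A x))" using supphi by (auto simp: cutoff_def restr_def fun_eq_iff simp del: atLeastAtMost_iff)
  also have "\<dots> = y" unfolding x(3) by (rule cut_one[OF one])
  finally have c: "cutoff \<phi> (A x) = y" .
  have u: "cutoff \<phi> x \<in> lp p" "N (cutoff \<phi> x) \<le> N x"
    by (rule lp_cut[OF x(1) a1]) (rule N_cut[OF x(1) a1])
  have "N (A (cutoff \<phi> x) - y) \<le> e * N x" using comm_smallD[OF A(2) range slope x(1)] unfolding c .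
  also have "\<dots> \<le> e * (C * N y)" using x(2) C(3) by (intro mult_left_mono) auto
  also have "\<dots> = (e * C) * N y" by simp
  also have "\<dots> \<le> 1/4 * N y" using C(2) N_nonneg[OF y(1)] by (rule mult_right_mono)
  finally have "N (y - A (cutoff \<phi> x)) \<le> N y / 4" using N_diff_commute[OF y(1) linD(1)[OF A(1) u(1)]] by simp
  then show ?thesis using u x(2) by (intro bexI[of _ "cutoff \<phi> x"]) auto
qed

text \<open>The constants of \<open>solve_finite_support\<close> do not depend on the size of the
  support, so arbitrary right-hand sides off \<open>win m\<close> can be reached: by truncation for
  \<open>p \<noteq> \<infinity>\<close>, by entrywise limits of solutions for
  \<open>p = \<infinity>\<close>. Ignoring the window costs only finitely many dimensions of the
  cokernel.\<close>

lemma solvable_at_infinity_imp_cofinite_range: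
  assumes A: "lin A" "bnd A CA" "CA > 0" "quasilocal A"
    and sol: "\<And>W. finite W \<Longrightarrow> W \<inter> win n = {} \<Longrightarrow> solvable_on A W C" and C: "C > 0"
  shows "\<exists>m. \<forall>y\<in>lp p. \<exists>x\<in>lp p. restr (- win m) (A x) = restr (- win m) y"
proof -
  define e where "e = 1 / (4 * C)"
  have e: "e > 0" "e * C \<le> 1/4" using C by (auto simp: e_def)
  obtain D where D: "D > 0" "comm_small A e D" using A(4) e(1) unfolding quasilocal_def by blast
  define m where "m = n + nat \<lceil>D\<rceil>"
  let ?E = "{y \<in> lp p. supp y \<subseteq> - win m}"
  let ?R = "\<lambda>x. restr (- win m) (A x)"
  have Rl: "?R x \<in> lp p" if "x \<in> lp p" for x by (rule lp_restr[OF linD(1)[OF A(1) that]])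
  have fin: "\<exists>x\<in>lp p. N x \<le> C * N y \<and> N (restr (win j) y - ?R x) \<le> N y / 4" if y: "y \<in> ?E" for y j
  proof -
    have yl: "y \<in> lp p" using y by simp
    let ?y = "restr (win j) y"
    have "supp ?y \<subseteq> win j - win (n + nat \<lceil>D\<rceil>)" using y unfolding supp_restr m_def[symmetric] by blast
    then obtain x where x: "x \<in> lp p" "N x \<le> C * N ?y" "N (?y - A x) \<le> N ?y / 4"
      using solve_finite_support[OF A(1) D(2,1) sol C e(2) less_imp_le[OF e(1)] lp_restr[OF yl]] by blast
    have ry: "restr (- win m) ?y = ?y" by (rule restr_id) (use y in \<open>auto simp: supp_restr\<close>)
    have "?y - ?R x = restr (- win m) (?y - A x)"
      by (subst ry[symmetric]) (simp add: restr_def fun_eq_iff)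
    then have "N (?y - ?R x) \<le> N (?y - A x)"
      using N_restr[OF lp_diff[OF lp_restr[OF yl] linD(1)[OF A(1) x(1)]]] by (simp only:)
    moreover have "C * N ?y \<le> C * N y" using N_restr[OF yl] C by (intro mult_left_mono) auto
    ultimately show ?thesis using x N_restr[OF yl, of "win j"] by (intro bexI[of _ x]) auto
  qed
  \<comment> \<open>A quarter of \<open>N y\<close> is the error of the finite problem; for
    \<open>p \<noteq> \<infinity>\<close> the other quarter is used for the tail of
    \<open>y\<close>.\<close>
  have half: "\<exists>x\<in>lp p. N x \<le> C * N y \<and> N (y - ?R x) \<le> N y / 2" if y: "y \<in> ?E" for y
  proof (cases "p = \<infinity>")
    case False
    have yl: "y \<in> lp p" using y by simp
    show ?thesis
    proof (cases "y = 0")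
      case True
      have "A 0 = 0" by (rule lin_zero[OF A(1)])
      moreover have "restr (- win m) 0 = (0 :: int \<Rightarrow> 'a)" by (auto simp: restr_def)
      ultimately show ?thesis unfolding True by (intro bexI[of _ 0]) simp_all
    next
      case y0: False
      then have "N y / 4 > 0" using N_pos[OF yl] by simp
      then obtain j where j: "N (restr (- win j) y) \<le> N y / 4" using N_tail[OF yl False] by blast
      obtain x where x: "x \<in> lp p" "N x \<le> C * N y" "N (restr (win j) y - ?R x) \<le> N y / 4" using fin[OF y] by blast
      have "y - ?R x = (restr (win j) y - ?R x) + restr (- win j) y"
        using restr_split[of y "win j"] by (auto simp: restr_def fun_eq_iff)
      then have "N (y - ?R x) \<le> N (restr (win j) y - ?R x) + N (restr (- win j) y)"
        using N_triangle[OF lp_diff[OF lp_restr[OF yl] Rl[OF x(1)]] lp_restr[OF yl]] by (simp only:)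
      then show ?thesis using x j by (intro bexI[of _ x]) auto
    qed
  next
    case True
    have yl: "y \<in> lp p" using y by simp
    obtain x where x: "\<And>j. x j \<in> lp p" "\<And>j. N (x j) \<le> C * N y" "\<And>j. N (restr (win j) y - ?R (x j)) \<le> N y / 4"
      using fin[OF y] by metis
    obtain f z where f: "strict_mono f" and z: "z \<in> lp p" "N z \<le> C * N y" and lim: "\<And>k. (\<lambda>j. x (f j) k) \<longlonglongrightarrow> z k"
      using bounded_seq_pointwise_limit[of x "C * N y"] x True by auto
    have d: "y - ?R z \<in> lp p" by (rule lp_diff[OF yl Rl[OF z(1)]])
    have "N (y - ?R z) \<le> N y / 4"
    proof (rule lp_boundI(2)[OF disjI2[OF d]], rule field_le_epsilon)
      fix i and \<eta> :: real assume \<eta>: "\<eta> > 0"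
      obtain M where M: "\<And>j. j \<ge> M \<Longrightarrow> N (restr (win i) (A (x (f j)) - A z)) \<le> \<eta>"
        using quasilocal_pointwise_continuous[OF A, of "\<lambda>j. x (f j)" "C * N y" z \<eta> i] x z lim \<eta> by blast
      define j where "j = max M i"
      have fj: "f j \<ge> i" using seq_suble[OF f, of j] by (simp add: j_def)
      have fl: "restr (win i) v \<in> lp p" for v :: "int \<Rightarrow> 'a" by (rule lp_finite_supp) simp
      let ?a = "restr (win i) (restr (win (f j)) y - ?R (x (f j)))"
      let ?b = "restr (- win m) (restr (win i) (A (x (f j)) - A z))"
      have "restr (win i) (y - ?R z) = ?a + ?b" using fj by (auto simp: restr_def fun_eq_iff)
      then have "N (restr (win i) (y - ?R z)) \<le> N ?a + N ?b"
        using N_triangle[OF fl lp_restr[OF fl]] by (simp only:)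
      moreover have "N ?a \<le> N y / 4"
        using N_restr[OF lp_diff[OF lp_restr[OF yl] Rl[OF x(1)]]] x(3)[of "f j"] by (rule order_trans)
      moreover have "N ?b \<le> \<eta>"
        by (rule order_trans[OF N_restr[OF fl]]) (use M[of j] in \<open>simp add: j_def\<close>)
      ultimately show "N (restr (win i) (y - ?R z)) \<le> N y / 4 + \<eta>" by linarith
    qed
    moreover have "N y / 4 \<le> N y / 2" using N_nonneg[OF yl] by simp
    ultimately show ?thesis using z by (intro bexI[of _ z]) auto
  qed
  have "\<exists>x\<in>lp p. restr (- win m) (A x) = restr (- win m) y" if y: "y \<in> lp p" for y
  proof -
    have "\<exists>x\<in>lp p. N x \<le> 2 * C * N (restr (- win m) y) \<and> ?R x = restr (- win m) y"
    proof (rule series_solve[OF lin_restr_comp[OF A(1)] bnd_restr_comp[OF A(1,2)], of ?E, OF _ _ less_imp_le[OF C] half])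
      fix x y :: "int \<Rightarrow> 'a" assume y: "y \<in> ?E" and x: "x \<in> lp p"
      have "supp (y - ?R x) \<subseteq> supp y \<union> supp (?R x)" by (rule supp_diff)
      then have "supp (y - ?R x) \<subseteq> - win m" using y unfolding supp_restr by blast
      then show "y - ?R x \<in> ?E" using y lp_diff[OF _ Rl[OF x]] by simp
    qed (use lp_restr[OF y] in \<open>auto simp: supp_restr\<close>)
    then show ?thesis by blast
  qed
  then show ?thesis by blast
qed

lemma fredholmI:
  assumes A: "lin A" "bnd A CA" "CA > 0" "quasilocal A"
    and low: "below_at_infinity A n0 \<nu>" "\<nu> > 0"
    and sol: "\<And>W. finite W \<Longrightarrow> W \<inter> win n = {} \<Longrightarrow> solvable_on A W C" and C: "C > 0"
  shows "fredholm smul p A"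
proof -
  interpret V: vector_space S by (rule vector_space_seq)
  obtain m where m: "\<And>y. y \<in> lp p \<Longrightarrow> \<exists>x\<in>lp p. restr (- win m) (A x) = restr (- win m) y"
    using solvable_at_infinity_imp_cofinite_range[OF A sol C] by blast
  have "\<exists>z\<in>V.span (singles m). y - z \<in> A ` lp p" if y: "y \<in> lp p" for y
  proof -
    obtain x where x: "x \<in> lp p" "restr (- win m) (A x) = restr (- win m) y" using m[OF y] by blast
    let ?z = "restr (win m) (y - A x)"
    have "y - ?z = A x"
    proof
      fix k
      show "(y - ?z) k = A x k"
      proof (cases "k \<in> win m")
        case False
        then have "A x k = y k" using fun_cong[OF x(2), of k] unfolding restr_def by simp
        then show ?thesis using False by (simp add: restr_def)
      qed (simp add: restr_def)
    qed
    then show ?thesis using restr_win_in_span x(1) by (intro bexI[of _ ?z]) auto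
  qed
  note coker = this
  show ?thesis unfolding fredholm_def
  proof (intro conjI exI[of _ "singles m"] ballI)
    show "closedin (Metric_space.mtopology (lp p) (lp_dist p)) (A ` lp p)"
      by (rule norm_closed_imp_closedin[OF below_at_infinity_imp_closed_range[OF A(1,2) low]])
    show "fin_dim S {x \<in> lp p. A x = 0}" by (rule below_at_infinity_imp_fin_dim_kernel[OF A(1) low])
  qed (use finite_singles singles_lp coker in simp_all)
qed

text \<open>Otherwise there are unit vectors \<open>x n\<close> vanishing on \<open>win n\<close>
  with \<open>A (x n)\<close> tending to zero. Bounded preimages for the closed range put them
  within \<open>C / (n + 1)\<close> of the kernel, whose finite dimension gives a subsequence
  converging in norm. The limit would have norm one although all its entries vanish.\<close>

lemma fredholm_imp_below_at_infinity:
  assumes A: "lin A" "bnd A CA" and F: "fredholm smul p A"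
  shows "\<exists>n. \<exists>\<nu>>0. below_at_infinity A n \<nu>"
proof (rule ccontr)
  interpret V: vector_space S by (rule vector_space_seq)
  assume neg: "\<not> ?thesis"
  obtain C where C: "C > 0" "\<And>y. y \<in> A ` lp p \<Longrightarrow> \<exists>x\<in>lp p. N x \<le> C * N y \<and> A x = y"
    using closed_range_imp_bounded_preimages[OF A] F unfolding fredholm_def by blast
  let ?K = "{x \<in> lp p. A x = 0}"
  obtain G where G: "finite G" "V.span G = ?K" using F unfolding fredholm_def fin_dim_def by blast
  obtain F where F: "F \<subseteq> G" "V.independent F" "G \<subseteq> V.span F" using V.maximal_independent_subset[of G] by blast
  have fF: "finite F" using F(1) G(1) finite_subset by blast
  have span: "V.span F = ?K" using F G V.span_mono V.span_span by (metis subset_antisym)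
  have FL: "b \<in> lp p" if "b \<in> F" for b using V.span_base[OF that] span by blast
  have "\<exists>c>0. \<forall>t. c * (\<Sum>b\<in>F. norm (t b)) \<le> N (\<Sum>b\<in>F. S (t b) b)"
  proof (rule coefficient_bound[OF vector_space_seq fF])
    show "\<not> V.dependent F" using F(2) .
  qed (use span in \<open>auto intro: N_triangle N_seq_scale N_pos\<close>)
  then obtain c where c: "c > 0" "\<And>t. c * (\<Sum>b\<in>F. norm (t b)) \<le> N (\<Sum>b\<in>F. S (t b) b)" by blast
  define P where "P n x z t \<longleftrightarrow> x \<in> lp p \<and> N x = 1 \<and> supp x \<inter> win n = {} \<and> z = (\<Sum>b\<in>F. S (t b) b)
    \<and> z \<in> lp p \<and> N (x - z) \<le> C / (real n + 1)" for n x z t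
  have "\<exists>x z t. P n x z t" for n
  proof -
    have "\<not> below_at_infinity A n (1 / (real n + 1))" using neg by (metis divide_pos_pos of_nat_0_le_iff add_nonneg_pos zero_less_one)
    then obtain x where x: "x \<in> lp p" "supp x \<inter> win n = {}" "N (A x) < 1 / (real n + 1) * N x"
      unfolding below_at_infinity_def by (auto simp: not_le)
    have Ax: "A x \<in> lp p" by (rule linD(1)[OF A(1) x(1)])
    have Nx: "N x > 0"
    proof (rule ccontr)
      assume "\<not> N x > 0"
      then have "N x = 0" using N_nonneg[OF x(1)] by simp
      then show False using x(3) N_nonneg[OF Ax] by simp
    qed
    let ?c = "of_real (1 / N x) :: 'k"
    let ?x = "S ?c x"
    have nc: "norm ?c = 1 / N x" using Nx by (simp add: norm_divide)
    have l: "?x \<in> lp p" by (rule lp_seq_scale[OF x(1)])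
    have n1: "N ?x = 1" using Nx unfolding N_seq_scale[OF x(1)] nc by simp
    have s: "supp ?x \<inter> win n = {}" using x(2) by (auto simp: supp_def seq_scale_def)
    have "N (A ?x) = 1 / N x * N (A x)" unfolding linD(3)[OF A(1) x(1)] N_seq_scale[OF Ax] nc ..
    also have "\<dots> \<le> 1 / N x * (1 / (real n + 1) * N x)" using x(3) Nx by (intro mult_left_mono) auto
    also have "\<dots> = 1 / (real n + 1)" using Nx by simp
    finally have le: "N (A ?x) \<le> 1 / (real n + 1)" .
    obtain v where v: "v \<in> lp p" "N v \<le> C * N (A ?x)" "A v = A ?x" using C(2)[of "A ?x"] l by blast
    have "?x - v \<in> ?K" using lp_diff[OF l v(1)] lin_diff[OF A(1) l v(1)] v(3) by simp
    then have "?x - v \<in> V.span F" using span by simp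
    then obtain t where t: "?x - v = (\<Sum>b\<in>F. S (t b) b)" unfolding V.span_finite[OF fF] by auto
    have "N v \<le> C * (1 / (real n + 1))" using v(2) le C(1) by (meson less_imp_le mult_left_mono order_trans)
    moreover have "?x - (?x - v) = v" by simp
    ultimately have "N (?x - (?x - v)) \<le> C / (real n + 1)" by simp
    then show ?thesis using l n1 s t lp_diff[OF l v(1)] unfolding P_def by blast
  qed
  then obtain x z t where "\<And>n. P n (x n) (z n) (t n)" by metis
  then have xz: "\<And>n. x n \<in> lp p" "\<And>n. N (x n) = 1" "\<And>n. supp (x n) \<inter> win n = {}"
      "\<And>n. z n = (\<Sum>b\<in>F. S (t n b) b)" "\<And>n. z n \<in> lp p" "\<And>n. N (x n - z n) \<le> C / (real n + 1)"
    unfolding P_def by blast+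
  have lim0: "(\<lambda>n. C / (real n + 1)) \<longlonglongrightarrow> 0"
    using tendsto_mult_right[OF LIMSEQ_inverse_real_of_nat, of C] by (simp add: inverse_eq_divide add.commute)
  have Nz: "N (z n) \<le> 1 + C" for n
  proof -
    have "N (z n) \<le> N (x n) + N (z n - x n)" by (rule N_le_diff[OF xz(5,1)])
    also have "N (z n - x n) \<le> C / (real n + 1)" using xz(6) N_diff_commute[OF xz(5,1)] by simp
    also have "C / (real n + 1) \<le> C / 1" using C(1) by (intro divide_left_mono) auto
    finally show ?thesis using xz(2) by simp
  qed
  have "norm (t n b) \<le> (1 + C) / c" if "b \<in> F" for n b
  proof -
    have "norm (t n b) \<le> (\<Sum>b\<in>F. norm (t n b))" using that fF by (intro member_le_sum) auto
    also have "\<dots> \<le> (1 + C) / c" using c(2)[of "t n"] Nz[of n] c(1) unfolding xz(4)[symmetric] by (simp add: field_simps)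
    finally show ?thesis .
  qed
  then have "bounded (range (\<lambda>n. t n b))" if "b \<in> F" for b using that by (auto simp: bounded_iff)
  then obtain f where f: "strict_mono f" "\<And>b. b \<in> F \<Longrightarrow> \<exists>l. (\<lambda>n. t (f n) b) \<longlonglongrightarrow> l"
    using finite_bolzano_weierstrass[OF fF, of t] by blast
  then obtain l where l: "\<And>b. b \<in> F \<Longrightarrow> (\<lambda>n. t (f n) b) \<longlonglongrightarrow> l b" by metis
  define y where "y = (\<Sum>b\<in>F. S (l b) b)"
  have yl: "y \<in> lp p" unfolding y_def by (intro lp_sum lp_seq_scale FL)
  have zy: "N (z (f n) - y) \<le> (\<Sum>b\<in>F. norm (t (f n) b - l b) * N b)" for n
  proof -
    have "z (f n) - y = (\<Sum>b\<in>F. S (t (f n) b - l b) b)"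
      unfolding xz(4) y_def by (simp add: V.scale_left_diff_distrib sum_subtractf)
    then have "N (z (f n) - y) \<le> (\<Sum>b\<in>F. N (S (t (f n) b - l b) b))"
      using N_sum[of F "\<lambda>b. S (t (f n) b - l b) b"] lp_seq_scale[OF FL] by simp
    also have "\<dots> = (\<Sum>b\<in>F. norm (t (f n) b - l b) * N b)"
      by (intro sum.cong refl N_seq_scale FL)
    finally show ?thesis .
  qed
  have "(\<lambda>n. \<Sum>b\<in>F. norm (t (f n) b - l b) * N b) \<longlonglongrightarrow> (\<Sum>b\<in>F. norm (l b - l b) * N b)"
    by (intro tendsto_intros l)
  then have zlim: "(\<lambda>n. \<Sum>b\<in>F. norm (t (f n) b - l b) * N b) \<longlonglongrightarrow> 0" by simp
  have f_lim: "(\<lambda>n. C / (real (f n) + 1)) \<longlonglongrightarrow> 0" using LIMSEQ_subseq_LIMSEQ[OF lim0 f(1)] by (simp add: comp_def)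
  have sum_lim: "(\<lambda>n. C / (real (f n) + 1) + (\<Sum>b\<in>F. norm (t (f n) b - l b) * N b)) \<longlonglongrightarrow> 0"
    using tendsto_add[OF f_lim zlim] by simp
  have xy: "N (x (f n) - y) \<le> C / (real (f n) + 1) + (\<Sum>b\<in>F. norm (t (f n) b - l b) * N b)" for n
  proof -
    have "x (f n) - y = (x (f n) - z (f n)) + (z (f n) - y)" by simp
    then have "N (x (f n) - y) \<le> N (x (f n) - z (f n)) + N (z (f n) - y)"
      using N_triangle[OF lp_diff[OF xz(1,5)] lp_diff[OF xz(5) yl]] by (simp only:)
    then show ?thesis using xz(6)[of "f n"] zy[of n] by linarith
  qed
  have "y k = 0" for k
  proof -
    have "norm (y k) \<le> C / (real (f n) + 1) + (\<Sum>b\<in>F. norm (t (f n) b - l b) * N b)" if n: "n \<ge> nat \<bar>k\<bar>" for n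
    proof -
      have "f n \<ge> nat \<bar>k\<bar>" using seq_suble[OF f(1), of n] n by linarith
      then have "k \<in> win (f n)" by auto
      then have "x (f n) k = 0" using xz(3)[of "f n"] unfolding supp_def by blast
      then have "norm (y k) = norm ((x (f n) - y) k)" by simp
      also have "\<dots> \<le> N (x (f n) - y)" by (rule norm_le_N[OF lp_diff[OF xz(1) yl]])
      finally show ?thesis using xy[of n] by linarith
    qed
    then have "norm (y k) \<le> 0" using LIMSEQ_le_const[OF sum_lim] by blast
    then show ?thesis by simp
  qed
  then have y0: "y = 0" by (auto simp: fun_eq_iff)
  have "1 \<le> C / (real (f n) + 1) + (\<Sum>b\<in>F. norm (t (f n) b - l b) * N b)" for n
    using xy[of n] xz(2)[of "f n"] unfolding y0 by simp
  then have "1 \<le> (0::real)" using LIMSEQ_le_const[OF sum_lim] by blast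
  then show False by simp
qed

end

section \<open>Norms of inverses\<close>

context lp_space
begin

lemma bounded_below_iff:
  assumes B: "lin B"
  shows "bounded_below p B \<longleftrightarrow> (\<exists>\<nu>>0. \<forall>x\<in>lp p. \<nu> * N x \<le> N (B x))"
proof
  assume "bounded_below p B"
  \<comment> \<open>A value strictly below \<open>lower_norm\<close> is finite even when the latter
    is infinite, which happens if there is no unit vector.\<close>
  then obtain v where v: "v > 0" "v < lower_norm p B" unfolding bounded_below_def using dense by blast
  then have "v < top" using less_top by (metis order_less_le_trans top_greatest)
  define \<nu> where "\<nu> = enn2real v"
  have \<nu>: "\<nu> > 0" "ennreal \<nu> = v" using v(1) \<open>v < top\<close> by (auto simp: \<nu>_def enn2real_positive_iff)
  have "\<nu> * N x \<le> N (B x)" if x: "x \<in> lp p" for x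
  proof (cases "x = 0")
    case True
    then show ?thesis by (simp add: lin_zero[OF B])
  next
    case False
    then have n: "N x > 0" using N_pos x by blast
    let ?c = "of_real (1 / N x) :: 'k"
    have nc: "norm ?c = 1 / N x" using n by (simp add: norm_divide)
    have Bx: "B x \<in> lp p" by (rule linD(1)[OF B x])
    have u: "S ?c x \<in> lp p" "N (S ?c x) = 1"
      unfolding N_seq_scale[OF x] nc using n by (auto intro: lp_seq_scale[OF x])
    have "ennreal \<nu> \<le> lower_norm p B" using v(2) \<nu>(2) by simp
    also have "\<dots> \<le> ennreal (N (B (S ?c x)))"
      unfolding lower_norm_def by (rule INF_lower) (use u in simp)
    finally have "\<nu> \<le> N (B (S ?c x))"
      using N_nonneg[OF linD(1)[OF B u(1)]] by (simp add: ennreal_le_iff)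
    also have "\<dots> = N (B x) / N x" unfolding linD(3)[OF B x] N_seq_scale[OF Bx] nc by simp
    finally show ?thesis using n by (simp add: field_simps)
  qed
  then show "\<exists>\<nu>>0. \<forall>x\<in>lp p. \<nu> * N x \<le> N (B x)" using \<nu>(1) by blast
next
  assume "\<exists>\<nu>>0. \<forall>x\<in>lp p. \<nu> * N x \<le> N (B x)"
  then obtain \<nu> where \<nu>: "\<nu> > 0" "\<And>x. x \<in> lp p \<Longrightarrow> \<nu> * N x \<le> N (B x)" by blast
  have "ennreal \<nu> \<le> lower_norm p B" unfolding lower_norm_def
    by (rule INF_greatest) (use \<nu> in \<open>force intro: ennreal_leI\<close>)
  then show "bounded_below p B" unfolding bounded_below_def using \<nu>(1)
    by (meson ennreal_less_zero_iff order_less_le_trans)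
qed

lemma ennreal_inverse_inverse: "inverse (inverse a) = (a :: ennreal)"
proof (cases a)
  case (real x)
  then show ?thesis by (cases "x = 0") (simp_all add: inverse_ennreal)
qed simp

lemma ennreal_inverse_antimono:
  fixes a b :: ennreal
  assumes "a \<le> b" shows "inverse b \<le> inverse a"
proof (cases "a = 0 \<or> b = top")
  case False
  then obtain x y where xy: "a = ennreal x" "b = ennreal y" "x > 0" "y > 0"
    using assms by (cases a; cases b) (auto simp: top_unique less_le)
  then have "x \<le> y" using assms by (simp add: ennreal_le_iff)
  then show ?thesis using xy by (simp add: inverse_ennreal ennreal_le_iff le_imp_inverse_le)
qed auto

text \<open>Inversion is an order-reversing involution of \<open>ennreal\<close>, so it exchanges
  infima and suprema, empty ones included.\<close>

lemma inverse_INF_ennreal: "inverse (INF i\<in>I. f i) = (SUP i\<in>I. inverse (f i :: ennreal))"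
proof (rule antisym)
  have inv: "inverse (inverse a) = a" for a :: ennreal by (rule ennreal_inverse_inverse)
  have anti: "a \<le> b \<Longrightarrow> inverse b \<le> inverse a" for a b :: ennreal by (rule ennreal_inverse_antimono)
  have "inverse (SUP i\<in>I. inverse (f i)) \<le> (INF i\<in>I. f i)"
    by (rule INF_greatest) (metis SUP_upper anti inv)
  then show "inverse (INF i\<in>I. f i) \<le> (SUP i\<in>I. inverse (f i))" using anti inv by metis
  show "(SUP i\<in>I. inverse (f i)) \<le> inverse (INF i\<in>I. f i)"
    by (rule SUP_least) (intro anti INF_lower)
qed

section \<open>The inverse of a surjective operator with a lower bound\<close>

context
  fixes B :: "'a seq_op" and \<nu> :: real
  assumes B: "lin B" "B ` lp p = lp p" and \<nu>: "\<nu> > 0" "\<And>x. x \<in> lp p \<Longrightarrow> \<nu> * N x \<le> N (B x)"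
begin

lemma inj_on_below: "inj_on B (lp p)"
proof (rule inj_onI)
  fix x y assume x: "x \<in> lp p" and y: "y \<in> lp p" and e: "B x = B y"
  have d: "x - y \<in> lp p" by (rule lp_diff[OF x y])
  have "\<nu> * N (x - y) \<le> 0" using \<nu>(2)[OF d] lin_diff[OF B(1) x y] e by simp
  then have "N (x - y) \<le> 0" using \<nu>(1) by (simp add: mult_le_0_iff)
  then have "x - y = 0" using N_pos[OF d] by fastforce
  then show "x = y" by simp
qed

lemma inv_lp: "y \<in> lp p \<Longrightarrow> inv_into (lp p) B y \<in> lp p" "y \<in> lp p \<Longrightarrow> B (inv_into (lp p) B y) = y"
  using inv_into_into[of y B "lp p"] f_inv_into_f[of y B "lp p"] B(2) by auto

lemma inv_lp_left: "x \<in> lp p \<Longrightarrow> inv_into (lp p) B (B x) = x"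
  by (rule inv_into_f_f[OF inj_on_below])

lemma lin_inv: "lin (inv_into (lp p) B)"
  unfolding lin_def
proof (intro conjI ballI allI)
  fix x :: "int \<Rightarrow> 'a" assume "x \<in> lp p"
  then show "inv_into (lp p) B x \<in> lp p" by (rule inv_lp(1))
next
  fix x y :: "int \<Rightarrow> 'a" assume x: "x \<in> lp p" and y: "y \<in> lp p"
  let ?u = "inv_into (lp p) B x" and ?v = "inv_into (lp p) B y"
  have "B (?u + ?v) = x + y" using linD(2)[OF B(1) inv_lp(1)[OF x] inv_lp(1)[OF y]] inv_lp(2) x y by simp
  then show "inv_into (lp p) B (x + y) = ?u + ?v"
    using inv_lp_left[OF lp_add[OF inv_lp(1)[OF x] inv_lp(1)[OF y]]] by simp
next
  fix c and x :: "int \<Rightarrow> 'a" assume x: "x \<in> lp p"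
  let ?u = "inv_into (lp p) B x"
  have "B (S c ?u) = S c x" using linD(3)[OF B(1) inv_lp(1)[OF x]] inv_lp(2)[OF x] by simp
  then show "inv_into (lp p) B (S c x) = S c ?u" using inv_lp_left[OF lp_seq_scale[OF inv_lp(1)[OF x]]] by metis
qed

lemma bnd_inv: "bnd (inv_into (lp p) B) (1 / \<nu>)"
  unfolding bnd_def
proof
  fix y :: "int \<Rightarrow> 'a" assume y: "y \<in> lp p"
  show "N (inv_into (lp p) B y) \<le> 1 / \<nu> * N y"
    using \<nu>(2)[OF inv_lp(1)[OF y]] \<nu>(1) unfolding inv_lp(2)[OF y] by (simp add: field_simps)
qed

lemma op_invertible_below: "op_invertible smul p B"
  unfolding op_invertible_def
proof (intro bexI[of _ "inv_into (lp p) B"] ballI conjI)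
  show "inv_into (lp p) B \<in> bounded_ops smul p"
    unfolding bounded_ops_iff using lin_inv bnd_inv \<nu>(1) by (meson divide_nonneg_pos zero_le_one)
qed (simp_all add: inv_lp inv_lp_left)

text \<open>Homogeneity, in both directions: if \<open>B x\<close> has norm at most one, the
  normalized \<open>x\<close> has an image of norm at most \<open>1 / N x\<close>; and the
  normalized image of a unit vector \<open>x\<close> has a preimage of norm
  \<open>1 / N (B x)\<close>. Without nonzero vectors both sides are zero.\<close>

lemma op_norm_inv: "op_norm p (inv_into (lp p) B) = inverse (lower_norm p B)"
proof (rule antisym)
  have anti: "a \<le> b \<Longrightarrow> inverse b \<le> inverse a" for a b :: ennreal by (rule ennreal_inverse_antimono)
  let ?C = "inv_into (lp p) B"
  have unit: "ennreal (N x) \<le> inverse (lower_norm p B)" if x: "x \<in> lp p" "N (B x) \<le> 1" for x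
  proof (cases "x = 0")
    case True
    then show ?thesis by simp
  next
    case False
    then have n: "N x > 0" using N_pos x by blast
    let ?c = "of_real (1 / N x) :: 'k"
    have nc: "norm ?c = 1 / N x" using n by (simp add: norm_divide)
    have u: "S ?c x \<in> lp p" "N (S ?c x) = 1"
      unfolding N_seq_scale[OF x(1)] nc using n by (auto intro: lp_seq_scale[OF x(1)])
    have "lower_norm p B \<le> ennreal (N (B (S ?c x)))"
      unfolding lower_norm_def by (rule INF_lower) (use u in simp)
    also have "N (B (S ?c x)) = 1 / N x * N (B x)"
      unfolding linD(3)[OF B(1) x(1)] N_seq_scale[OF linD(1)[OF B(1) x(1)]] nc ..
    also have "ennreal (1 / N x * N (B x)) \<le> ennreal (1 / N x)"
      using x(2) n by (intro ennreal_leI) (simp add: divide_right_mono)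
    finally have "inverse (ennreal (1 / N x)) \<le> inverse (lower_norm p B)" by (rule anti)
    then show ?thesis using n by (simp add: inverse_ennreal)
  qed
  show "op_norm p ?C \<le> inverse (lower_norm p B)"
    unfolding op_norm_def by (rule SUP_least) (use inv_lp unit in auto)
  have "inverse (ennreal (N (B x))) \<le> op_norm p ?C" if x: "x \<in> lp p" "N x = 1" for x
  proof -
    have Bx: "B x \<in> lp p" by (rule linD(1)[OF B(1) x(1)])
    have n: "N (B x) > 0" using \<nu>(2)[OF x(1)] \<nu>(1) x(2) by simp
    let ?c = "of_real (1 / N (B x)) :: 'k"
    have nc: "norm ?c = 1 / N (B x)" using n by (simp add: norm_divide)
    have u: "S ?c (B x) \<in> lp p" "N (S ?c (B x)) = 1"
      unfolding N_seq_scale[OF Bx] nc using n by (auto intro: lp_seq_scale[OF Bx])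
    have "ennreal (N (?C (S ?c (B x)))) \<le> op_norm p ?C"
      unfolding op_norm_def by (rule SUP_upper) (use u in simp)
    also have "?C (S ?c (B x)) = S ?c x" using linD(3)[OF lin_inv Bx] inv_lp_left[OF x(1)] by simp
    also have "N (S ?c x) = 1 / N (B x)" unfolding N_seq_scale[OF x(1)] nc x(2) by simp
    finally show ?thesis using n by (simp add: inverse_ennreal inverse_eq_divide)
  qed
  then have "(SUP x\<in>{x \<in> lp p. N x = 1}. inverse (ennreal (N (B x)))) \<le> op_norm p ?C"
    by (intro SUP_least) auto
  then show "inverse (lower_norm p B) \<le> op_norm p ?C"
    unfolding lower_norm_def inverse_INF_ennreal .
qed

end

end

theorem theorem5p7:
  fixes smul :: "'k::{real_normed_field, euclidean_space} \<Rightarrow> 'a::banach \<Rightarrow> 'a"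
    and p :: ennreal
    and A :: "(int \<Rightarrow> 'a) \<Rightarrow> (int \<Rightarrow> 'a)"
  assumes "normed_scale smul"
    and "fin_dim smul (UNIV :: 'a set)"
    and "p = 0 \<or> 1 \<le> p"
    and "band_dominated smul p A"
  shows "(fredholm smul p A \<longleftrightarrow> (\<forall>B\<in>op_spectrum smul p A. op_invertible smul p B))
    \<and> (fredholm smul p A \<longleftrightarrow> (\<forall>B\<in>op_spectrum smul p A. left_invertible smul p B))
    \<and> (fredholm smul p A \<longleftrightarrow> (\<forall>B\<in>op_spectrum smul p A. right_invertible smul p B))
    \<and> (fredholm smul p A \<longleftrightarrow> (\<forall>B\<in>op_spectrum smul p A. bounded_below p B))
    \<and> (fredholm smul p A \<longleftrightarrow> (\<forall>B\<in>op_spectrum smul p A. B ` lp p = lp p))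
    \<and> (fredholm smul p A \<longrightarrow>
        (SUP B\<in>op_spectrum smul p A. op_norm p (inv_into (lp p) B))
          = inverse (INF B\<in>op_spectrum smul p A. lower_norm p B)
        \<and> inverse (INF B\<in>op_spectrum smul p A. lower_norm p B) < \<infinity>)"
proof -
  interpret normed_scale smul by (rule assms(1))
  interpret lp_space_fin p smul by unfold_locales (use assms(2,3) in auto)
  note A = assms(4)
  obtain CA where lA: "lin A" and CA: "CA > 0" "bnd A CA"
    using A unfolding band_dominated_def by (auto elim: bounded_opsE)
  note q = band_dominated_quasilocal[OF A]
  let ?\<sigma> = "op_spectrum smul p A"
  have limits: "\<exists>h. filterlim (\<lambda>n. \<bar>h n\<bar>) at_top sequentially \<and> op_lim A h B" if "B \<in> ?\<sigma>" for B
    using that limit_op_imp_op_lim[OF lA] unfolding op_spectrum_def by blast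
  have lin_bnd: "lin B \<and> (\<exists>C>0. bnd B C)" if "B \<in> ?\<sigma>" for B
    using limits[OF that] unfolding op_lim_def by blast
  have below_iff: "bounded_below p B \<longleftrightarrow> (\<exists>\<nu>>0. \<forall>x\<in>lp p. \<nu> * N x \<le> N (B x))" if "B \<in> ?\<sigma>" for B
    using bounded_below_iff lin_bnd[OF that] by blast
  \<comment> \<open>One \<nu> for all limit operators; the finiteness in the norm formula rests on
    it.\<close>
  have uniform: "(\<forall>B\<in>?\<sigma>. B ` lp p = lp p \<and> (\<forall>x\<in>lp p. \<nu> * N x \<le> N (B x)))"
    if \<nu>: "below_at_infinity A n \<nu>" "\<nu> > 0" for n \<nu>
    using limits below_at_infinity_imp_limit_below[OF lA q \<nu>] below_at_infinity_imp_limit_surjective[OF A \<nu>] by blast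
  \<comment> \<open>Lower bounds of the limit operators give one at infinity, this makes the limit
    operators surjective, and surjectivity gives solvability at infinity. So the one-sided condition
    yields both ingredients of \<open>fredholmI\<close>.\<close>
  have below_imp: "fredholm smul p A" if below: "\<forall>B\<in>?\<sigma>. bounded_below p B"
  proof -
    obtain n \<nu> where \<nu>: "\<nu> > 0" "below_at_infinity A n \<nu>"
      using bounded_below_imp_below_at_infinity[OF A] below below_iff by blast
    obtain m C where C: "C > 0" "\<And>W. finite W \<Longrightarrow> W \<inter> win m = {} \<Longrightarrow> solvable_on A W C"
      using surjective_imp_solvable_at_infinity[OF A] uniform[OF \<nu>(2,1)] by blast
    show ?thesis by (rule fredholmI[OF lA CA(2,1) q \<nu>(2,1) C(2,1)])
  qed
  \<comment> \<open>Surjectivity gives solvability at infinity, hence injective limit operators. An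
    injective surjection is bounded below by the open mapping principle, and the previous case
    applies.\<close>
  have surj_imp: "fredholm smul p A" if surj: "\<forall>B\<in>?\<sigma>. B ` lp p = lp p"
  proof (rule below_imp, rule ballI)
    fix B assume B: "B \<in> ?\<sigma>"
    obtain m C where C: "C > 0" "\<And>W. finite W \<Longrightarrow> W \<inter> win m = {} \<Longrightarrow> solvable_on A W C"
      using surjective_imp_solvable_at_infinity[OF A] surj by blast
    obtain h where h: "filterlim (\<lambda>n. \<bar>h n\<bar>) at_top sequentially" "op_lim A h B" using limits[OF B] by blast
    obtain CB where lB: "lin B" and CB: "bnd B CB" using lin_bnd[OF B] by blast
    obtain K where K: "K > 0" "\<And>y. y \<in> lp p \<Longrightarrow> \<exists>x\<in>lp p. N x \<le> K * N y \<and> B x = y"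
      using surj_imp_bounded_preimages[OF lB CB] surj B by blast
    have "1 / K * N x \<le> N (B x)" if x: "x \<in> lp p" for x
    proof -
      obtain u where u: "u \<in> lp p" "N u \<le> K * N (B x)" "B u = B x" using K(2)[OF linD(1)[OF lB x]] by blast
      have "x - u \<in> lp p" "B (x - u) = 0" using lp_diff[OF x u(1)] lin_diff[OF lB x u(1)] u(3) by simp_all
      then have "x - u = 0" using solvable_at_infinity_imp_limit_injective[OF A C h] by blast
      then have "x = u" by simp
      then show ?thesis using u(2) K(1) by (simp add: field_simps)
    qed
    then show "bounded_below p B" unfolding below_iff[OF B] using K(1) by (intro exI[of _ "1 / K"]) auto
  qed
  have fred: "\<exists>\<nu>>0. \<forall>B\<in>?\<sigma>. B ` lp p = lp p \<and> (\<forall>x\<in>lp p. \<nu> * N x \<le> N (B x))" if "fredholm smul p A"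
    using fredholm_imp_below_at_infinity[OF lA CA(2) that] uniform by blast
  have left_below: "bounded_below p B" if B: "B \<in> ?\<sigma>" and left: "left_invertible smul p B" for B
  proof -
    obtain C where C: "C \<in> bounded_ops smul p" "\<And>x. x \<in> lp p \<Longrightarrow> C (B x) = x"
      using left unfolding left_invertible_def by blast
    obtain K where K: "K > 0" "bnd C K" using C(1) by (rule bounded_opsE)
    have "1 / K * N x \<le> N (B x)" if x: "x \<in> lp p" for x
    proof -
      have "B x \<in> lp p" using lin_bnd[OF B] linD(1) x by blast
      then have "N x \<le> K * N (B x)" using bndD[OF K(2)] C(2)[OF x] by metis
      then show ?thesis using K(1) by (simp add: field_simps)
    qed
    then show ?thesis unfolding below_iff[OF B] using K(1) by (intro exI[of _ "1 / K"]) auto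
  qed
  have right_surj: "B ` lp p = lp p" if B: "B \<in> ?\<sigma>" and right: "right_invertible smul p B" for B
  proof
    show "B ` lp p \<subseteq> lp p" using lin_bnd[OF B] linD(1) by blast
    obtain C where C: "C \<in> bounded_ops smul p" "\<And>x. x \<in> lp p \<Longrightarrow> B (C x) = x"
      using right unfolding right_invertible_def by blast
    have "C x \<in> lp p" if "x \<in> lp p" for x using C(1) that unfolding bounded_ops_iff lin_def by blast
    then show "lp p \<subseteq> B ` lp p" using C(2) by (metis imageI subsetI)
  qed
  have inv_left: "left_invertible smul p B" and inv_right: "right_invertible smul p B" if "op_invertible smul p B" for B
    using that unfolding op_invertible_def left_invertible_def right_invertible_def by blast+
  have fred_inv: "op_invertible smul p B" if "fredholm smul p A" "B \<in> ?\<sigma>" for B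
    using fred[OF that(1)] op_invertible_below lin_bnd that(2) by blast
  have formula: "(SUP B\<in>?\<sigma>. op_norm p (inv_into (lp p) B)) = inverse (INF B\<in>?\<sigma>. lower_norm p B)
      \<and> inverse (INF B\<in>?\<sigma>. lower_norm p B) < \<infinity>" if F: "fredholm smul p A"
  proof
    obtain \<nu> where \<nu>: "\<nu> > 0" "\<And>B. B \<in> ?\<sigma> \<Longrightarrow> B ` lp p = lp p"
        "\<And>B x. B \<in> ?\<sigma> \<Longrightarrow> x \<in> lp p \<Longrightarrow> \<nu> * N x \<le> N (B x)"
      using fred[OF F] by blast
    have "op_norm p (inv_into (lp p) B) = inverse (lower_norm p B)" if B: "B \<in> ?\<sigma>" for B
      using op_norm_inv[OF _ \<nu>(2)[OF B] \<nu>(1) \<nu>(3)[OF B]] lin_bnd[OF B] by blast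
    then show "(SUP B\<in>?\<sigma>. op_norm p (inv_into (lp p) B)) = inverse (INF B\<in>?\<sigma>. lower_norm p B)"
      unfolding inverse_INF_ennreal by (rule SUP_cong[OF refl])
    have "ennreal \<nu> \<le> (INF B\<in>?\<sigma>. lower_norm p B)" unfolding lower_norm_def
      by (intro INF_greatest) (use \<nu>(3) in \<open>force intro: ennreal_leI\<close>)
    then have "(INF B\<in>?\<sigma>. lower_norm p B) \<noteq> 0" using \<nu>(1) by auto
    then show "inverse (INF B\<in>?\<sigma>. lower_norm p B) < \<infinity>" by (simp add: less_top[symmetric])
  qed
  show ?thesis
    using fred_inv inv_left inv_right left_below right_surj below_imp surj_imp formula by blast
qed

end
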